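(* Let $k$ be a commutative ring and let $A$ be a non-degenerate idempotent $k$-projective algebra. Then there is a bijective correspondence between (a) structures of a multiplier bialgebra on $A$, and (b) structures of monoidal categories on $\mathcal{M}_A$, ${}_A\mathcal{M}$ and $A\text{-}\mathsf{Ext}$ such that all forgetful functors in the diagram of forgetful functors $$A\text{-}\mathsf{Ext}\to {}_A\mathcal{M},\qquad A\text{-}\mathsf{Ext}\to \mathcal{M}_A,\qquad {}_A\mathcal{M}\to\mathcal{M}_k,\qquad \mathcal{M}_A\to\mathcal{M}_k$$ are strict monoidal (where $\mathcal{M}_k$ has its usual monoidal structure $(\otimes,k)$).
   Context: Conventions. $k$ is a commutative ring, all modules are $k$-modules, linear means $k$-linear, $\otimes=\otimes_k$. An algebra is a $k$-module $A$ with an associative linear multiplication (no unit assumed); an algebra map is a linear multiplicative map. $A$ is idempotent if $A=A^2$ (every element is a finite sum of products); non-degenerate if for every $a\in A$: $a=0$ whenever $ab=0$ for all $b\in A$, and $a=0$ whenever $ba=0$ for all $b\in A$; $k$-projective if projective as a $k$-module. A right $A$-module $M$ (a $k$-module with associative linear action) is idempotent if $M=MA$ (finite sums), non-degenerate if $m=0$ whenever $ma=0$ for all $a\in A$; similarly for left modules; a bimodule has such a property if it has it on both sides. $\mathcal{M}_A$ (resp. ${}_A\mathcal{M}$) is the category of non-degenerate idempotent $k$-projective right (resp. left) $A$-modules and $A$-linear maps; $\mathcal{M}_k$ is the category of $k$-modules. $A\otimes B$ is an algebra via $(a\otimes b)(a'\otimes b')=aa'\otimes bb'$. Extensions. An algebra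 $R$ is an extension of an algebra $B$ if $R$ is a $B$-bimodule whose multiplication is $B$-bilinear and $B$-balanced, i.e. $(r\cdot b)r'=r(b\cdot r')$. It is a non-degenerate (idempotent, $k$-projective) extension if $R$ is so as a $B$-bimodule. $B\text{-}\mathsf{Ext}$ is the category of non-degenerate idempotent $k$-projective extensions of $B$, with $B$-bilinear algebra maps as morphisms. Multiplier algebra. $\mathbb{M}(A)$ is the set of pairs $x=(\lambda,\rho)$ with $\lambda:A\to A$ right $A$-linear, $\rho:A\to A$ left $A$-linear and $a\lambda(b)=\rho(a)b$ for all $a,b\in A$. It is a unital algebra with product $(\lambda_x\circ\lambda_y,\rho_y\circ\rho_x)$. Write $x\rhd a=\lambda(a)$, $a\lhd x=\rho(a)$, and $\iota_A:A\to\mathbb{M}(A)$ for $\iota_A(a)=(b\mapsto ab,\ b\mapsto ba)$. The category $\mathsf{NdI}_k$. Objects: non-degenerate idempotent $k$-projective algebras. A morphism $f$ from $B$ to $A$ is a structure of non-degenerate idempotent ($k$-projective) $B$-extension on $A$; equivalently an algebra map $\widetilde f:B\to\mathbb{M}(A)$ such that the actions $b\cdot a=\widetilde f(b)\rhd a$, $a\cdot b=a\lhd\widetilde f(b)$ make $A$ a non-degenerate idempotent $B$-bimodule. $\widetilde f$ extends uniquely to a unital algebra map $\overline f:\mathbb{M}(B)\to\mathbb{M}(A)$ with $\overline f\circ\iota_B=\widetilde f$. Composition: $\widetilde{g\circ f}=\overline g\circ\widetilde f$; the identity of $A$ corresponds to $\iota_A$. The tensor product of objects is the tensor product algebra; $f\otimes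 f'$ is the extension $A\otimes A'$ of $B\otimes B'$ given by the componentwise bimodule structure on $A\otimes A'$. With unit object $k$ this is a monoidal category. A multiplier bialgebra is a comonoid $(A,\Delta,\varepsilon)$ in $\mathsf{NdI}_k$: morphisms $\Delta$ from $A$ to $A\otimes A$ and $\varepsilon$ from $A$ to $k$ in $\mathsf{NdI}_k$ with $(\Delta\otimes A)\circ\Delta=(A\otimes\Delta)\circ\Delta$ and $(\varepsilon\otimes A)\circ\Delta=A=(A\otimes\varepsilon)\circ\Delta$ (an object also denotes its identity morphism).
   Formalization: In (b) the tensor product of two extensions in A-Ext must also carry the tensor product algebra structure, and the unit object the algebra k; without this the claim fails for k = A = Q. Modules are taken with carriers in a fixed, arbitrarily large universe. *)

theory Defs
  imports "HOL-Algebra.Module"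
begin

section \<open>Monoidal categories\<close>

record ('o, 'f) arrow =
  src :: 'o
  tgt :: 'o
  fn :: 'f

record ('o, 'f) precategory =
  obj :: "'o set"
  arr :: "('o, 'f) arrow set"
  idn :: "'o \<Rightarrow> ('o, 'f) arrow"
  cmp :: "('o, 'f) arrow \<Rightarrow> ('o, 'f) arrow \<Rightarrow> ('o, 'f) arrow"  \<comment> \<open>\<open>cmp C g f\<close> is ``g after f''\<close>

definition in_hom :: "('o, 'f) precategory \<Rightarrow> ('o, 'f) arrow \<Rightarrow> 'o \<Rightarrow> 'o \<Rightarrow> bool" where
  "in_hom C f X Y \<longleftrightarrow> f \<in> arr C \<and> src f = X \<and> tgt f = Y"

definition iso_in :: "('o, 'f) precategory \<Rightarrow> ('o, 'f) arrow \<Rightarrow> 'o \<Rightarrow> 'o \<Rightarrow> bool" where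
  "iso_in C f X Y \<longleftrightarrow> in_hom C f X Y \<and>
     (\<exists>g. in_hom C g Y X \<and> cmp C g f = idn C X \<and> cmp C f g = idn C Y)"

locale category =
  fixes C :: "('o, 'f) precategory"
  assumes src_obj: "f \<in> arr C \<Longrightarrow> src f \<in> obj C"
    and tgt_obj: "f \<in> arr C \<Longrightarrow> tgt f \<in> obj C"
    and idn_hom: "X \<in> obj C \<Longrightarrow> in_hom C (idn C X) X X"
    and cmp_hom: "in_hom C f X Y \<Longrightarrow> in_hom C g Y Z \<Longrightarrow> in_hom C (cmp C g f) X Z"
    and cmp_idn: "in_hom C f X Y \<Longrightarrow> cmp C f (idn C X) = f"
    and idn_cmp: "in_hom C f X Y \<Longrightarrow> cmp C (idn C Y) f = f"
    and cmp_assoc: "in_hom C f W X \<Longrightarrow> in_hom C g X Y \<Longrightarrow> in_hom C h Y Z \<Longrightarrow>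
      cmp C h (cmp C g f) = cmp C (cmp C h g) f"

locale cat_functor = source: category C + target: category D
  for C :: "('o, 'f) precategory" and D :: "('p, 'g) precategory" +
  fixes Fo :: "'o \<Rightarrow> 'p" and Fa :: "('o, 'f) arrow \<Rightarrow> ('p, 'g) arrow"
  assumes Fo_obj: "X \<in> obj C \<Longrightarrow> Fo X \<in> obj D"
    and Fa_hom: "in_hom C f X Y \<Longrightarrow> in_hom D (Fa f) (Fo X) (Fo Y)"
    and Fa_idn: "X \<in> obj C \<Longrightarrow> Fa (idn C X) = idn D (Fo X)"
    and Fa_cmp: "in_hom C f X Y \<Longrightarrow> in_hom C g Y Z \<Longrightarrow>
      Fa (cmp C g f) = cmp D (Fa g) (Fa f)"

record ('o, 'f) monoidal_data =
  tob :: "'o \<Rightarrow> 'o \<Rightarrow> 'o"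
  tar :: "('o, 'f) arrow \<Rightarrow> ('o, 'f) arrow \<Rightarrow> ('o, 'f) arrow"
  unit_ob :: 'o
  asc :: "'o \<Rightarrow> 'o \<Rightarrow> 'o \<Rightarrow> ('o, 'f) arrow"
  lun :: "'o \<Rightarrow> ('o, 'f) arrow"
  run :: "'o \<Rightarrow> ('o, 'f) arrow"

locale monoidal_category = category C
  for C :: "('o, 'f) precategory" +
  fixes T :: "('o, 'f) monoidal_data"
  assumes tob_obj: "X \<in> obj C \<Longrightarrow> Y \<in> obj C \<Longrightarrow> tob T X Y \<in> obj C"
    and tar_hom: "in_hom C f X X' \<Longrightarrow> in_hom C g Y Y' \<Longrightarrow>
      in_hom C (tar T f g) (tob T X Y) (tob T X' Y')"
    and tar_idn: "X \<in> obj C \<Longrightarrow> Y \<in> obj C \<Longrightarrow>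
      tar T (idn C X) (idn C Y) = idn C (tob T X Y)"
    and tar_cmp: "in_hom C f X X' \<Longrightarrow> in_hom C f' X' X'' \<Longrightarrow>
      in_hom C g Y Y' \<Longrightarrow> in_hom C g' Y' Y'' \<Longrightarrow>
      tar T (cmp C f' f) (cmp C g' g) = cmp C (tar T f' g') (tar T f g)"
    and unit_obj: "unit_ob T \<in> obj C"
    and asc_iso: "X \<in> obj C \<Longrightarrow> Y \<in> obj C \<Longrightarrow> Z \<in> obj C \<Longrightarrow>
      iso_in C (asc T X Y Z) (tob T (tob T X Y) Z) (tob T X (tob T Y Z))"
    and asc_natural: "in_hom C f X X' \<Longrightarrow> in_hom C g Y Y' \<Longrightarrow> in_hom C h Z Z' \<Longrightarrow>
      cmp C (asc T X' Y' Z') (tar T (tar T f g) h) = cmp C (tar T f (tar T g h)) (asc T X Y Z)"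
    and lun_iso: "X \<in> obj C \<Longrightarrow> iso_in C (lun T X) (tob T (unit_ob T) X) X"
    and lun_natural: "in_hom C f X Y \<Longrightarrow>
      cmp C (lun T Y) (tar T (idn C (unit_ob T)) f) = cmp C f (lun T X)"
    and run_iso: "X \<in> obj C \<Longrightarrow> iso_in C (run T X) (tob T X (unit_ob T)) X"
    and run_natural: "in_hom C f X Y \<Longrightarrow>
      cmp C (run T Y) (tar T f (idn C (unit_ob T))) = cmp C f (run T X)"
    and pentagon: "W \<in> obj C \<Longrightarrow> X \<in> obj C \<Longrightarrow> Y \<in> obj C \<Longrightarrow> Z \<in> obj C \<Longrightarrow>
      cmp C (asc T W X (tob T Y Z)) (asc T (tob T W X) Y Z) =
      cmp C (tar T (idn C W) (asc T X Y Z))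
        (cmp C (asc T W (tob T X Y) Z) (tar T (asc T W X Y) (idn C Z)))"
    and triangle: "X \<in> obj C \<Longrightarrow> Y \<in> obj C \<Longrightarrow>
      cmp C (tar T (idn C X) (lun T Y)) (asc T X (unit_ob T) Y) = tar T (run T X) (idn C Y)"

locale strict_monoidal_functor =
  cat_functor C D Fo Fa + source: monoidal_category C S + target: monoidal_category D T
  for C :: "('o, 'f) precategory" and S :: "('o, 'f) monoidal_data"
    and D :: "('p, 'g) precategory" and T :: "('p, 'g) monoidal_data"
    and Fo :: "'o \<Rightarrow> 'p" and Fa :: "('o, 'f) arrow \<Rightarrow> ('p, 'g) arrow" +
  assumes strict_tob: "X \<in> obj C \<Longrightarrow> Y \<in> obj C \<Longrightarrow> Fo (tob S X Y) = tob T (Fo X) (Fo Y)"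
    and strict_tar: "f \<in> arr C \<Longrightarrow> g \<in> arr C \<Longrightarrow> Fa (tar S f g) = tar T (Fa f) (Fa g)"
    and strict_unit: "Fo (unit_ob S) = unit_ob T"
    and strict_asc: "X \<in> obj C \<Longrightarrow> Y \<in> obj C \<Longrightarrow> Z \<in> obj C \<Longrightarrow>
      Fa (asc S X Y Z) = asc T (Fo X) (Fo Y) (Fo Z)"
    and strict_lun: "X \<in> obj C \<Longrightarrow> Fa (lun S X) = lun T (Fo X)"
    and strict_run: "X \<in> obj C \<Longrightarrow> Fa (run S X) = run T (Fo X)"

text \<open>The values of the structure maps outside of the category carry no information; they are
  fixed to be \<^const>\<open>undefined\<close>, so that equality in this set is equality of monoidal structures.\<close>

definition monoidal_structures :: "('o, 'f) precategory \<Rightarrow> ('o, 'f) monoidal_data set" where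
  "monoidal_structures C = {T. monoidal_category C T \<and>
     (\<forall>X Y. \<not> (X \<in> obj C \<and> Y \<in> obj C) \<longrightarrow> tob T X Y = undefined) \<and>
     (\<forall>f g. \<not> (f \<in> arr C \<and> g \<in> arr C) \<longrightarrow> tar T f g = undefined) \<and>
     (\<forall>X Y Z. \<not> (X \<in> obj C \<and> Y \<in> obj C \<and> Z \<in> obj C) \<longrightarrow> asc T X Y Z = undefined) \<and>
     (\<forall>X. X \<notin> obj C \<longrightarrow> lun T X = undefined \<and> run T X = undefined)}"

definition comonoid :: "('o, 'f) precategory \<Rightarrow> ('o, 'f) monoidal_data \<Rightarrow>
    'o \<Rightarrow> ('o, 'f) arrow \<Rightarrow> ('o, 'f) arrow \<Rightarrow> bool" where
  "comonoid C T A \<Delta> \<epsilon> \<longleftrightarrow> A \<in> obj C \<and>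
     in_hom C \<Delta> A (tob T A A) \<and> in_hom C \<epsilon> A (unit_ob T) \<and>
     cmp C (asc T A A A) (cmp C (tar T \<Delta> (idn C A)) \<Delta>) = cmp C (tar T (idn C A) \<Delta>) \<Delta> \<and>
     cmp C (lun T A) (cmp C (tar T \<epsilon> (idn C A)) \<Delta>) = idn C A \<and>
     cmp C (run T A) (cmp C (tar T (idn C A) \<epsilon>) \<Delta>) = idn C A"


section \<open>The monoidal category of modules\<close>

text \<open>All modules have their carrier in the following type, where \<^typ>\<open>'k\<close> is the type of
  scalars and \<^typ>\<open>'a\<close> is arbitrary. The type contains the ring of scalars and is closed under the
  tensor product constructed below: an element of a tensor product is a chosen list
  \<open>[(m\<^sub>1, n\<^sub>1), \<dots>, (m\<^sub>r, n\<^sub>r)]\<close> of pairs that represents \<open>m\<^sub>1 \<otimes> n\<^sub>1 + \<dots> + m\<^sub>r \<otimes> n\<^sub>r\<close>.\<close>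

datatype ('k, 'a) univ =
    Scalar (the_scalar: 'k)
  | Atom 'a
  | Tensor (terms: "(('k, 'a) univ \<times> ('k, 'a) univ) list")

type_synonym ('k, 'a) kmod = "('k, ('k, 'a) univ) module"

definition linear_maps ::
    "'k ring \<Rightarrow> ('k, 'u) module \<Rightarrow> ('k, 'v) module \<Rightarrow> ('u \<Rightarrow> 'v) set" where
  "linear_maps k M N = {f \<in> carrier M \<rightarrow>\<^sub>E carrier N.
     (\<forall>x \<in> carrier M. \<forall>y \<in> carrier M. f (x \<oplus>\<^bsub>M\<^esub> y) = f x \<oplus>\<^bsub>N\<^esub> f y) \<and>
     (\<forall>r \<in> carrier k. \<forall>x \<in> carrier M. f (r \<odot>\<^bsub>M\<^esub> x) = r \<odot>\<^bsub>N\<^esub> f x)}"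

definition bilinear :: "'k ring \<Rightarrow> ('k, 'u) module \<Rightarrow> ('k, 'v) module \<Rightarrow> ('k, 'w) module \<Rightarrow>
    ('u \<Rightarrow> 'v \<Rightarrow> 'w) \<Rightarrow> bool" where
  "bilinear k M N P \<beta> \<longleftrightarrow>
     (\<forall>x \<in> carrier M. (\<lambda>y \<in> carrier N. \<beta> x y) \<in> linear_maps k N P) \<and>
     (\<forall>y \<in> carrier N. (\<lambda>x \<in> carrier M. \<beta> x y) \<in> linear_maps k M P)"

text \<open>Quantifying over the modules in \<^typ>\<open>('k, 'a) univ\<close> is sufficient in the lifting property,
  because the free module on the carrier of \<open>P\<close> has an isomorphic copy there, its elements being
  represented by lists of pairs (\<open>Scalar r\<close>, \<open>p\<close>).\<close>

definition projective :: "'k ring \<Rightarrow> ('k, 'a) kmod \<Rightarrow> bool" where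
  "projective k P \<longleftrightarrow> module k P \<and>
     (\<forall>(M :: ('k, 'a) kmod) (N :: ('k, 'a) kmod) g f.
        module k M \<longrightarrow> module k N \<longrightarrow>
        g \<in> linear_maps k M N \<longrightarrow> g ` carrier M = carrier N \<longrightarrow> f \<in> linear_maps k P N \<longrightarrow>
        (\<exists>h \<in> linear_maps k P M. \<forall>x \<in> carrier P. g (h x) = f x))"

text \<open>Equality of formal sums of pure tensors. Scalars can be absorbed into either factor, so it
  is enough to divide the free commutative monoid on pairs by the bilinearity relations.\<close>

inductive tensor_eq :: "'k ring \<Rightarrow> ('k, 'a) kmod \<Rightarrow> ('k, 'a) kmod \<Rightarrow>
    (('k, 'a) univ \<times> ('k, 'a) univ) list \<Rightarrow> (('k, 'a) univ \<times> ('k, 'a) univ) list \<Rightarrow> bool"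
  for k :: "'k ring" and M :: "('k, 'a) kmod" and N :: "('k, 'a) kmod" where
    refl: "xs \<in> lists (carrier M \<times> carrier N) \<Longrightarrow> tensor_eq k M N xs xs"
  | sym: "tensor_eq k M N xs ys \<Longrightarrow> tensor_eq k M N ys xs"
  | trans: "tensor_eq k M N xs ys \<Longrightarrow> tensor_eq k M N ys zs \<Longrightarrow> tensor_eq k M N xs zs"
  | append: "tensor_eq k M N xs xs' \<Longrightarrow> tensor_eq k M N ys ys' \<Longrightarrow>
      tensor_eq k M N (xs @ ys) (xs' @ ys')"
  | commute: "xs \<in> lists (carrier M \<times> carrier N) \<Longrightarrow> ys \<in> lists (carrier M \<times> carrier N) \<Longrightarrow>
      tensor_eq k M N (xs @ ys) (ys @ xs)"
  | zero: "n \<in> carrier N \<Longrightarrow> tensor_eq k M N [(\<zero>\<^bsub>M\<^esub>, n)] []"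
  | add_left: "m \<in> carrier M \<Longrightarrow> m' \<in> carrier M \<Longrightarrow> n \<in> carrier N \<Longrightarrow>
      tensor_eq k M N [(m \<oplus>\<^bsub>M\<^esub> m', n)] [(m, n), (m', n)]"
  | add_right: "m \<in> carrier M \<Longrightarrow> n \<in> carrier N \<Longrightarrow> n' \<in> carrier N \<Longrightarrow>
      tensor_eq k M N [(m, n \<oplus>\<^bsub>N\<^esub> n')] [(m, n), (m, n')]"
  | scalar: "r \<in> carrier k \<Longrightarrow> m \<in> carrier M \<Longrightarrow> n \<in> carrier N \<Longrightarrow>
      tensor_eq k M N [(r \<odot>\<^bsub>M\<^esub> m, n)] [(m, r \<odot>\<^bsub>N\<^esub> n)]"

definition tensor_class :: "'k ring \<Rightarrow> ('k, 'a) kmod \<Rightarrow> ('k, 'a) kmod \<Rightarrow>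
    (('k, 'a) univ \<times> ('k, 'a) univ) list \<Rightarrow> ('k, 'a) univ" where
  "tensor_class k M N xs = Tensor (SOME ys. tensor_eq k M N xs ys)"

definition tensor :: "'k ring \<Rightarrow> ('k, 'a) kmod \<Rightarrow> ('k, 'a) kmod \<Rightarrow> ('k, 'a) kmod" where
  "tensor k M N =
     \<lparr>carrier = tensor_class k M N ` lists (carrier M \<times> carrier N),
      mult = undefined, one = undefined,
      zero = tensor_class k M N [],
      add = (\<lambda>x y. tensor_class k M N (terms x @ terms y)),
      smult = (\<lambda>r x. tensor_class k M N (map (\<lambda>(m, n). (r \<odot>\<^bsub>M\<^esub> m, n)) (terms x)))\<rparr>"

definition pure_tensor :: "'k ring \<Rightarrow> ('k, 'a) kmod \<Rightarrow> ('k, 'a) kmod \<Rightarrow>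
    ('k, 'a) univ \<Rightarrow> ('k, 'a) univ \<Rightarrow> ('k, 'a) univ" where
  "pure_tensor k M N m n = tensor_class k M N [(m, n)]"

text \<open>\<open>tensor_lift P \<beta>\<close> is the map \<open>M \<otimes> N \<rightarrow> P\<close> induced by a bilinear map
  \<open>\<beta> : M \<times> N \<rightarrow> P\<close>.\<close>

definition tensor_lift :: "('k, 'u) module \<Rightarrow> (('k, 'a) univ \<Rightarrow> ('k, 'a) univ \<Rightarrow> 'u) \<Rightarrow>
    ('k, 'a) univ \<Rightarrow> 'u" where
  "tensor_lift P \<beta> x = foldr (\<lambda>(m, n) s. \<beta> m n \<oplus>\<^bsub>P\<^esub> s) (terms x) \<zero>\<^bsub>P\<^esub>"

text \<open>The operation \<open>(m \<otimes> m') \<cdot> (n \<otimes> n') = (m \<cdot> n) \<otimes> (m' \<cdot> n')\<close> with values in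
  \<open>P \<otimes> P'\<close>.\<close>

definition componentwise :: "'k ring \<Rightarrow> ('k, 'a) kmod \<Rightarrow> ('k, 'a) kmod \<Rightarrow>
    (('k, 'a) univ \<Rightarrow> ('k, 'a) univ \<Rightarrow> ('k, 'a) univ) \<Rightarrow>
    (('k, 'a) univ \<Rightarrow> ('k, 'a) univ \<Rightarrow> ('k, 'a) univ) \<Rightarrow>
    ('k, 'a) univ \<Rightarrow> ('k, 'a) univ \<Rightarrow> ('k, 'a) univ" where
  "componentwise k P P' op op' x y =
     tensor_lift (tensor k P P')
       (\<lambda>m m'. tensor_lift (tensor k P P')
          (\<lambda>n n'. pure_tensor k P P' (op m n) (op' m' n')) y) x"

text \<open>The ring of scalars, as an algebra over itself.\<close>

definition scalar_algebra :: "'k ring \<Rightarrow> ('k, 'a) kmod" where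
  "scalar_algebra k =
     \<lparr>carrier = Scalar ` carrier k,
      mult = (\<lambda>x y. Scalar (the_scalar x \<otimes>\<^bsub>k\<^esub> the_scalar y)),
      one = Scalar \<one>\<^bsub>k\<^esub>,
      zero = Scalar \<zero>\<^bsub>k\<^esub>,
      add = (\<lambda>x y. Scalar (the_scalar x \<oplus>\<^bsub>k\<^esub> the_scalar y)),
      smult = (\<lambda>r x. Scalar (r \<otimes>\<^bsub>k\<^esub> the_scalar x))\<rparr>"

text \<open>The record \<^typ>\<open>('k, 'u) module\<close> has fields for a multiplication and for a unit that the
  predicate \<^const>\<open>module\<close> ignores.\<close>

definition underlying :: "('k, 'u) module \<Rightarrow> ('k, 'u) module" where
  "underlying A = A\<lparr>mult := undefined, one := undefined\<rparr>"

type_synonym ('k, 'a) kmap = "(('k, 'a) kmod, ('k, 'a) univ \<Rightarrow> ('k, 'a) univ) arrow"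

definition mod_cat ::
    "'k ring \<Rightarrow> (('k, 'a) kmod, ('k, 'a) univ \<Rightarrow> ('k, 'a) univ) precategory" where
  "mod_cat k =
     \<lparr>obj = {M. module k M},
      arr = {f. module k (src f) \<and> module k (tgt f) \<and> fn f \<in> linear_maps k (src f) (tgt f)},
      idn = (\<lambda>M. \<lparr>src = M, tgt = M, fn = (\<lambda>x \<in> carrier M. x)\<rparr>),
      cmp = (\<lambda>g f. \<lparr>src = src f, tgt = tgt g, fn = compose (carrier (src f)) (fn g) (fn f)\<rparr>)\<rparr>"

definition tensor_map :: "'k ring \<Rightarrow> ('k, 'a) kmap \<Rightarrow> ('k, 'a) kmap \<Rightarrow>
    ('k, 'a) univ \<Rightarrow> ('k, 'a) univ" where
  "tensor_map k f g =
     (\<lambda>x \<in> carrier (tensor k (src f) (src g)).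
        tensor_lift (tensor k (tgt f) (tgt g))
          (\<lambda>m n. pure_tensor k (tgt f) (tgt g) (fn f m) (fn g n)) x)"

definition assoc_map :: "'k ring \<Rightarrow> ('k, 'a) kmod \<Rightarrow> ('k, 'a) kmod \<Rightarrow> ('k, 'a) kmod \<Rightarrow>
    ('k, 'a) univ \<Rightarrow> ('k, 'a) univ" where
  "assoc_map k M N P =
     (\<lambda>x \<in> carrier (tensor k (tensor k M N) P).
        tensor_lift (tensor k M (tensor k N P))
          (\<lambda>y p. tensor_lift (tensor k M (tensor k N P))
             (\<lambda>m n. pure_tensor k M (tensor k N P) m (pure_tensor k N P n p)) y) x)"

definition lunit_map :: "'k ring \<Rightarrow> ('k, 'a) kmod \<Rightarrow> ('k, 'a) univ \<Rightarrow> ('k, 'a) univ" where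
  "lunit_map k M =
     (\<lambda>x \<in> carrier (tensor k (scalar_algebra k) M).
        tensor_lift M (\<lambda>r m. the_scalar r \<odot>\<^bsub>M\<^esub> m) x)"

definition runit_map :: "'k ring \<Rightarrow> ('k, 'a) kmod \<Rightarrow> ('k, 'a) univ \<Rightarrow> ('k, 'a) univ" where
  "runit_map k M =
     (\<lambda>x \<in> carrier (tensor k M (scalar_algebra k)).
        tensor_lift M (\<lambda>m r. the_scalar r \<odot>\<^bsub>M\<^esub> m) x)"

definition mod_tensor ::
    "'k ring \<Rightarrow> (('k, 'a) kmod, ('k, 'a) univ \<Rightarrow> ('k, 'a) univ) monoidal_data" where
  "mod_tensor k =
     \<lparr>tob = tensor k,
      tar = (\<lambda>f g. \<lparr>src = tensor k (src f) (src g), tgt = tensor k (tgt f) (tgt g),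
                    fn = tensor_map k f g\<rparr>),
      unit_ob = underlying (scalar_algebra k),
      asc = (\<lambda>M N P. \<lparr>src = tensor k (tensor k M N) P, tgt = tensor k M (tensor k N P),
                      fn = assoc_map k M N P\<rparr>),
      lun = (\<lambda>M. \<lparr>src = tensor k (underlying (scalar_algebra k)) M, tgt = M,
                  fn = lunit_map k M\<rparr>),
      run = (\<lambda>M. \<lparr>src = tensor k M (underlying (scalar_algebra k)), tgt = M,
                  fn = runit_map k M\<rparr>)\<rparr>"


section \<open>Algebras, modules over an algebra and extensions\<close>

text \<open>An algebra is a module record whose \<^const>\<open>one\<close> field is ignored: algebras need not be
  unital or commutative, in contrast to the locale \<^locale>\<open>algebra\<close>.\<close>

definition nonunital_algebra :: "'k ring \<Rightarrow> ('k, 'u) module \<Rightarrow> bool" where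
  "nonunital_algebra k A \<longleftrightarrow> module k A \<and> bilinear k A A A (\<lambda>a b. a \<otimes>\<^bsub>A\<^esub> b) \<and>
     (\<forall>a \<in> carrier A. \<forall>b \<in> carrier A. \<forall>c \<in> carrier A.
        (a \<otimes>\<^bsub>A\<^esub> b) \<otimes>\<^bsub>A\<^esub> c = a \<otimes>\<^bsub>A\<^esub> (b \<otimes>\<^bsub>A\<^esub> c))"

definition algebra_maps ::
    "'k ring \<Rightarrow> ('k, 'u) module \<Rightarrow> ('k, 'v) module \<Rightarrow> ('u \<Rightarrow> 'v) set" where
  "algebra_maps k A B = {f \<in> linear_maps k A B.
     \<forall>a \<in> carrier A. \<forall>b \<in> carrier A. f (a \<otimes>\<^bsub>A\<^esub> b) = f a \<otimes>\<^bsub>B\<^esub> f b}"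

definition finite_sums :: "('k, 'u) module \<Rightarrow> 'u set \<Rightarrow> 'u set" where
  "finite_sums M S = {finsum M x {..<n} | x (n :: nat). \<forall>i < n. x i \<in> S}"

definition idempotent_algebra :: "('k, 'u) module \<Rightarrow> bool" where
  "idempotent_algebra A \<longleftrightarrow>
     carrier A = finite_sums A {a \<otimes>\<^bsub>A\<^esub> b | a b. a \<in> carrier A \<and> b \<in> carrier A}"

definition nondegenerate_algebra :: "('k, 'u) module \<Rightarrow> bool" where
  "nondegenerate_algebra A \<longleftrightarrow> (\<forall>a \<in> carrier A.
     ((\<forall>b \<in> carrier A. a \<otimes>\<^bsub>A\<^esub> b = \<zero>\<^bsub>A\<^esub>) \<longrightarrow> a = \<zero>\<^bsub>A\<^esub>) \<and>
     ((\<forall>b \<in> carrier A. b \<otimes>\<^bsub>A\<^esub> a = \<zero>\<^bsub>A\<^esub>) \<longrightarrow> a = \<zero>\<^bsub>A\<^esub>))"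

definition algebra_tensor :: "'k ring \<Rightarrow> ('k, 'a) kmod \<Rightarrow> ('k, 'a) kmod \<Rightarrow> ('k, 'a) kmod" where
  "algebra_tensor k A B =
     (tensor k A B)\<lparr>mult := componentwise k A B (\<lambda>a a'. a \<otimes>\<^bsub>A\<^esub> a') (\<lambda>b b'. b \<otimes>\<^bsub>B\<^esub> b')\<rparr>"

text \<open>Modules over an algebra. The value of \<open>act M\<close> at a module element \<open>m\<close> and an algebra
  element \<open>a\<close> is \<open>act M m a\<close> in a right module and \<open>act M a m\<close> in a left module. Actions are
  extensional functions, so that equality of records is equality of actions.\<close>

record ('k, 'u) action_module =
  base :: "('k, 'u) module"
  act :: "'u \<Rightarrow> 'u \<Rightarrow> 'u"

definition right_module :: "'k ring \<Rightarrow> ('k, 'u) module \<Rightarrow> ('k, 'u) action_module \<Rightarrow> bool" where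
  "right_module k A M \<longleftrightarrow> module k (base M) \<and>
     act M \<in> carrier (base M) \<rightarrow>\<^sub>E carrier A \<rightarrow>\<^sub>E carrier (base M) \<and>
     bilinear k (base M) A (base M) (act M) \<and>
     (\<forall>m \<in> carrier (base M). \<forall>a \<in> carrier A. \<forall>b \<in> carrier A.
        act M (act M m a) b = act M m (a \<otimes>\<^bsub>A\<^esub> b))"

definition left_module :: "'k ring \<Rightarrow> ('k, 'u) module \<Rightarrow> ('k, 'u) action_module \<Rightarrow> bool" where
  "left_module k A M \<longleftrightarrow> module k (base M) \<and>
     act M \<in> carrier A \<rightarrow>\<^sub>E carrier (base M) \<rightarrow>\<^sub>E carrier (base M) \<and>
     bilinear k A (base M) (base M) (act M) \<and>
     (\<forall>m \<in> carrier (base M). \<forall>a \<in> carrier A. \<forall>b \<in> carrier A.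
        act M a (act M b m) = act M (a \<otimes>\<^bsub>A\<^esub> b) m)"

definition right_idempotent :: "('k, 'u) module \<Rightarrow> ('k, 'u) action_module \<Rightarrow> bool" where
  "right_idempotent A M \<longleftrightarrow> carrier (base M) =
     finite_sums (base M) {act M m a | m a. m \<in> carrier (base M) \<and> a \<in> carrier A}"

definition left_idempotent :: "('k, 'u) module \<Rightarrow> ('k, 'u) action_module \<Rightarrow> bool" where
  "left_idempotent A M \<longleftrightarrow> carrier (base M) =
     finite_sums (base M) {act M a m | a m. a \<in> carrier A \<and> m \<in> carrier (base M)}"

definition right_nondegenerate :: "('k, 'u) module \<Rightarrow> ('k, 'u) action_module \<Rightarrow> bool" where
  "right_nondegenerate A M \<longleftrightarrow> (\<forall>m \<in> carrier (base M).
     (\<forall>a \<in> carrier A. act M m a = \<zero>\<^bsub>base M\<^esub>) \<longrightarrow> m = \<zero>\<^bsub>base M\<^esub>)"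

definition left_nondegenerate :: "('k, 'u) module \<Rightarrow> ('k, 'u) action_module \<Rightarrow> bool" where
  "left_nondegenerate A M \<longleftrightarrow> (\<forall>m \<in> carrier (base M).
     (\<forall>a \<in> carrier A. act M a m = \<zero>\<^bsub>base M\<^esub>) \<longrightarrow> m = \<zero>\<^bsub>base M\<^esub>)"

type_synonym ('k, 'a) action_cat =
  "(('k, ('k, 'a) univ) action_module, ('k, 'a) univ \<Rightarrow> ('k, 'a) univ) precategory"

text \<open>The categories \<open>\<M>\<^sub>A\<close> and \<open>\<^sub>A\<M>\<close>.\<close>

definition right_mod_cat :: "'k ring \<Rightarrow> ('k, 'a) kmod \<Rightarrow> ('k, 'a) action_cat" where
  "right_mod_cat k A =
     (let Ob = {M. right_module k A M \<and> right_nondegenerate A M \<and> right_idempotent A M \<and>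
                   projective k (base M)}
      in \<lparr>obj = Ob,
          arr = {f. src f \<in> Ob \<and> tgt f \<in> Ob \<and>
                    fn f \<in> linear_maps k (base (src f)) (base (tgt f)) \<and>
                    (\<forall>m \<in> carrier (base (src f)). \<forall>a \<in> carrier A.
                       fn f (act (src f) m a) = act (tgt f) (fn f m) a)},
          idn = (\<lambda>M. \<lparr>src = M, tgt = M, fn = (\<lambda>x \<in> carrier (base M). x)\<rparr>),
          cmp = (\<lambda>g f. \<lparr>src = src f, tgt = tgt g,
                        fn = compose (carrier (base (src f))) (fn g) (fn f)\<rparr>)\<rparr>)"

definition left_mod_cat :: "'k ring \<Rightarrow> ('k, 'a) kmod \<Rightarrow> ('k, 'a) action_cat" where
  "left_mod_cat k A =
     (let Ob = {M. left_module k A M \<and> left_nondegenerate A M \<and> left_idempotent A M \<and>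
                   projective k (base M)}
      in \<lparr>obj = Ob,
          arr = {f. src f \<in> Ob \<and> tgt f \<in> Ob \<and>
                    fn f \<in> linear_maps k (base (src f)) (base (tgt f)) \<and>
                    (\<forall>m \<in> carrier (base (src f)). \<forall>a \<in> carrier A.
                       fn f (act (src f) a m) = act (tgt f) a (fn f m))},
          idn = (\<lambda>M. \<lparr>src = M, tgt = M, fn = (\<lambda>x \<in> carrier (base M). x)\<rparr>),
          cmp = (\<lambda>g f. \<lparr>src = src f, tgt = tgt g,
                        fn = compose (carrier (base (src f))) (fn g) (fn f)\<rparr>)\<rparr>)"

record ('k, 'u) extension =
  alg :: "('k, 'u) module"
  lact :: "'u \<Rightarrow> 'u \<Rightarrow> 'u"   \<comment> \<open>\<open>lact R b r = b \<cdot> r\<close>\<close>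
  ract :: "'u \<Rightarrow> 'u \<Rightarrow> 'u"   \<comment> \<open>\<open>ract R r b = r \<cdot> b\<close>\<close>

definition left_part :: "('k, 'u) extension \<Rightarrow> ('k, 'u) action_module" where
  "left_part R = \<lparr>base = underlying (alg R), act = lact R\<rparr>"

definition right_part :: "('k, 'u) extension \<Rightarrow> ('k, 'u) action_module" where
  "right_part R = \<lparr>base = underlying (alg R), act = ract R\<rparr>"

definition is_extension :: "'k ring \<Rightarrow> ('k, 'u) module \<Rightarrow> ('k, 'u) extension \<Rightarrow> bool" where
  "is_extension k B R \<longleftrightarrow> nonunital_algebra k (alg R) \<and>
     left_module k B (left_part R) \<and> right_module k B (right_part R) \<and>
     (\<forall>r \<in> carrier (alg R). \<forall>b \<in> carrier B. \<forall>c \<in> carrier B.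
        ract R (lact R b r) c = lact R b (ract R r c)) \<and>
     (\<forall>r \<in> carrier (alg R). \<forall>s \<in> carrier (alg R). \<forall>b \<in> carrier B.
        lact R b (r \<otimes>\<^bsub>alg R\<^esub> s) = lact R b r \<otimes>\<^bsub>alg R\<^esub> s \<and>
        ract R (r \<otimes>\<^bsub>alg R\<^esub> s) b = r \<otimes>\<^bsub>alg R\<^esub> ract R s b \<and>
        ract R r b \<otimes>\<^bsub>alg R\<^esub> s = r \<otimes>\<^bsub>alg R\<^esub> lact R b s)"

definition ext_objects :: "'k ring \<Rightarrow> ('k, 'a) kmod \<Rightarrow> ('k, ('k, 'a) univ) extension set" where
  "ext_objects k B = {R. is_extension k B R \<and>
     left_nondegenerate B (left_part R) \<and> right_nondegenerate B (right_part R) \<and>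
     left_idempotent B (left_part R) \<and> right_idempotent B (right_part R) \<and>
     projective k (alg R)}"

definition ext_cat :: "'k ring \<Rightarrow> ('k, 'a) kmod \<Rightarrow>
    (('k, ('k, 'a) univ) extension, ('k, 'a) univ \<Rightarrow> ('k, 'a) univ) precategory" where
  "ext_cat k B =
     \<lparr>obj = ext_objects k B,
      arr = {f. src f \<in> ext_objects k B \<and> tgt f \<in> ext_objects k B \<and>
                fn f \<in> algebra_maps k (alg (src f)) (alg (tgt f)) \<and>
                (\<forall>r \<in> carrier (alg (src f)). \<forall>b \<in> carrier B.
                   fn f (lact (src f) b r) = lact (tgt f) b (fn f r) \<and>
                   fn f (ract (src f) r b) = ract (tgt f) (fn f r) b)},
      idn = (\<lambda>R. \<lparr>src = R, tgt = R, fn = (\<lambda>x \<in> carrier (alg R). x)\<rparr>),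
      cmp = (\<lambda>g f. \<lparr>src = src f, tgt = tgt g,
                    fn = compose (carrier (alg (src f))) (fn g) (fn f)\<rparr>)\<rparr>"

text \<open>The forgetful functors act on objects by \<^const>\<open>left_part\<close>, \<^const>\<open>right_part\<close> and
  \<^const>\<open>base\<close>, and leave the functions underlying the arrows unchanged.\<close>

definition forget_arrow :: "('o \<Rightarrow> 'p) \<Rightarrow> ('o, 'f) arrow \<Rightarrow> ('p, 'f) arrow" where
  "forget_arrow U f = \<lparr>src = U (src f), tgt = U (tgt f), fn = fn f\<rparr>"


section \<open>The multiplier algebra and the category of non-degenerate idempotent algebras\<close>

type_synonym 'u multiplier = "('u \<Rightarrow> 'u) \<times> ('u \<Rightarrow> 'u)"

definition multiplier_algebra ::
    "'k ring \<Rightarrow> ('k, 'u) module \<Rightarrow> ('k, 'u multiplier) module" where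
  "multiplier_algebra k A =
     \<lparr>carrier = {(l, r). l \<in> linear_maps k A A \<and> r \<in> linear_maps k A A \<and>
        (\<forall>a \<in> carrier A. \<forall>b \<in> carrier A.
           l (a \<otimes>\<^bsub>A\<^esub> b) = l a \<otimes>\<^bsub>A\<^esub> b \<and> r (a \<otimes>\<^bsub>A\<^esub> b) = a \<otimes>\<^bsub>A\<^esub> r b \<and>
           a \<otimes>\<^bsub>A\<^esub> l b = r a \<otimes>\<^bsub>A\<^esub> b)},
      mult = (\<lambda>x y. (compose (carrier A) (fst x) (fst y), compose (carrier A) (snd y) (snd x))),
      one = (\<lambda>a \<in> carrier A. a, \<lambda>a \<in> carrier A. a),
      zero = (\<lambda>a \<in> carrier A. \<zero>\<^bsub>A\<^esub>, \<lambda>a \<in> carrier A. \<zero>\<^bsub>A\<^esub>),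
      add = (\<lambda>x y. (\<lambda>a \<in> carrier A. fst x a \<oplus>\<^bsub>A\<^esub> fst y a,
                    \<lambda>a \<in> carrier A. snd x a \<oplus>\<^bsub>A\<^esub> snd y a)),
      smult = (\<lambda>c x. (\<lambda>a \<in> carrier A. c \<odot>\<^bsub>A\<^esub> fst x a, \<lambda>a \<in> carrier A. c \<odot>\<^bsub>A\<^esub> snd x a))\<rparr>"

definition multiplier_incl :: "('k, 'u) module \<Rightarrow> 'u \<Rightarrow> 'u multiplier" where
  "multiplier_incl A a = (\<lambda>b \<in> carrier A. a \<otimes>\<^bsub>A\<^esub> b, \<lambda>b \<in> carrier A. b \<otimes>\<^bsub>A\<^esub> a)"

text \<open>An arrow \<open>f\<close> from \<open>B\<close> to \<open>A\<close> in \<open>NdI\<^sub>k\<close> is an extension structure on \<open>A\<close>, given by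
  the pair of the left and the right action of \<open>B\<close>.\<close>

type_synonym 'u actions = "('u \<Rightarrow> 'u \<Rightarrow> 'u) \<times> ('u \<Rightarrow> 'u \<Rightarrow> 'u)"

type_synonym ('k, 'a) ndi_arrow = "(('k, 'a) kmod, ('k, 'a) univ actions) arrow"

definition extension_of :: "(('k, 'u) module, 'u actions) arrow \<Rightarrow> ('k, 'u) extension" where
  "extension_of f = \<lparr>alg = tgt f, lact = fst (fn f), ract = snd (fn f)\<rparr>"

definition tilde :: "(('k, 'u) module, 'u actions) arrow \<Rightarrow> 'u \<Rightarrow> 'u multiplier" where
  "tilde f = (\<lambda>b \<in> carrier (src f).
     (\<lambda>a \<in> carrier (tgt f). fst (fn f) b a, \<lambda>a \<in> carrier (tgt f). snd (fn f) a b))"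

definition bar ::
    "'k ring \<Rightarrow> (('k, 'u) module, 'u actions) arrow \<Rightarrow> 'u multiplier \<Rightarrow> 'u multiplier" where
  "bar k f = (THE h.
     h \<in> algebra_maps k (multiplier_algebra k (src f)) (multiplier_algebra k (tgt f)) \<and>
     h \<one>\<^bsub>multiplier_algebra k (src f)\<^esub> = \<one>\<^bsub>multiplier_algebra k (tgt f)\<^esub> \<and>
     (\<forall>b \<in> carrier (src f). h (multiplier_incl (src f) b) = tilde f b))"

text \<open>The arrow from \<open>B\<close> to \<open>A\<close> that corresponds to a map \<open>B \<rightarrow> \<bbbM>(A)\<close>.\<close>

definition arrow_of_tilde :: "('k, 'u) module \<Rightarrow> ('k, 'u) module \<Rightarrow> ('u \<Rightarrow> 'u multiplier) \<Rightarrow>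
    (('k, 'u) module, 'u actions) arrow" where
  "arrow_of_tilde B A h = \<lparr>src = B, tgt = A,
     fn = (\<lambda>b \<in> carrier B. \<lambda>a \<in> carrier A. fst (h b) a,
           \<lambda>a \<in> carrier A. \<lambda>b \<in> carrier B. snd (h b) a)\<rparr>"

definition ndi_cat :: "'k ring \<Rightarrow> (('k, 'a) kmod, ('k, 'a) univ actions) precategory" where
  "ndi_cat k =
     (let Ob = {A. nonunital_algebra k A \<and> nondegenerate_algebra A \<and> idempotent_algebra A \<and>
                   projective k A}
      in \<lparr>obj = Ob,
          arr = {f. src f \<in> Ob \<and> tgt f \<in> Ob \<and> extension_of f \<in> ext_objects k (src f)},
          idn = (\<lambda>A. arrow_of_tilde A A (multiplier_incl A)),
          cmp = (\<lambda>g f. arrow_of_tilde (src f) (tgt g)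
                         (compose (carrier (src f)) (bar k g) (tilde f)))\<rparr>)"

text \<open>An isomorphism of algebras \<open>h : B \<rightarrow> A\<close>, regarded as an arrow of \<open>NdI\<^sub>k\<close>.\<close>

definition arrow_of_map :: "('k, 'a) kmod \<Rightarrow> ('k, 'a) kmod \<Rightarrow>
    (('k, 'a) univ \<Rightarrow> ('k, 'a) univ) \<Rightarrow> ('k, 'a) ndi_arrow" where
  "arrow_of_map B A h = arrow_of_tilde B A (compose (carrier B) (multiplier_incl A) h)"

definition ndi_tensor_arrow ::
    "'k ring \<Rightarrow> ('k, 'a) ndi_arrow \<Rightarrow> ('k, 'a) ndi_arrow \<Rightarrow> ('k, 'a) ndi_arrow" where
  "ndi_tensor_arrow k f g =
     (let B = algebra_tensor k (src f) (src g); A = algebra_tensor k (tgt f) (tgt g)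
      in \<lparr>src = B, tgt = A,
          fn = (\<lambda>b \<in> carrier B. \<lambda>a \<in> carrier A.
                  componentwise k (tgt f) (tgt g) (fst (fn f)) (fst (fn g)) b a,
                \<lambda>a \<in> carrier A. \<lambda>b \<in> carrier B.
                  componentwise k (tgt f) (tgt g) (snd (fn f)) (snd (fn g)) a b)\<rparr>)"

definition ndi_tensor ::
    "'k ring \<Rightarrow> (('k, 'a) kmod, ('k, 'a) univ actions) monoidal_data" where
  "ndi_tensor k =
     \<lparr>tob = algebra_tensor k,
      tar = ndi_tensor_arrow k,
      unit_ob = scalar_algebra k,
      asc = (\<lambda>A B C. arrow_of_map
               (algebra_tensor k (algebra_tensor k A B) C)
               (algebra_tensor k A (algebra_tensor k B C)) (assoc_map k A B C)),
      lun = (\<lambda>A. arrow_of_map (algebra_tensor k (scalar_algebra k) A) A (lunit_map k A)),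
      run = (\<lambda>A. arrow_of_map (algebra_tensor k A (scalar_algebra k)) A (runit_map k A))\<rparr>"


section \<open>The two kinds of structure\<close>

definition multiplier_bialgebra_structures ::
    "'k ring \<Rightarrow> ('k, 'a) kmod \<Rightarrow> (('k, 'a) ndi_arrow \<times> ('k, 'a) ndi_arrow) set" where
  "multiplier_bialgebra_structures k A =
     {(\<Delta>, \<epsilon>). comonoid (ndi_cat k) (ndi_tensor k) A \<Delta> \<epsilon>}"

type_synonym ('k, 'a) action_tensor =
  "(('k, ('k, 'a) univ) action_module, ('k, 'a) univ \<Rightarrow> ('k, 'a) univ) monoidal_data"

type_synonym ('k, 'a) ext_tensor =
  "(('k, ('k, 'a) univ) extension, ('k, 'a) univ \<Rightarrow> ('k, 'a) univ) monoidal_data"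

text \<open>Monoidal structures \<open>(T\<^sub>R, T\<^sub>L, T\<^sub>E)\<close> on \<open>\<M>\<^sub>A\<close>, \<open>\<^sub>A\<M>\<close> and \<open>A-Ext\<close>. The functors from
  \<open>A-Ext\<close> to modules do not see the multiplications on \<open>R \<otimes> S\<close> and on the unit object. The last
  two conditions say that these are the tensor product algebra and the algebra \<open>k\<close>. They cannot
  be omitted: if \<open>c\<close> is an invertible scalar, then the products \<open>c\<^sup>-\<^sup>1 rr' \<otimes> ss'\<close> on \<open>R \<otimes> S\<close> and
  \<open>cxy\<close> on \<open>k\<close> are another lift of the same monoidal structure on modules.\<close>

definition strict_monoidal_structures :: "'k ring \<Rightarrow> ('k, 'a) kmod \<Rightarrow>
    (('k, 'a) action_tensor \<times> ('k, 'a) action_tensor \<times> ('k, 'a) ext_tensor) set" where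
  "strict_monoidal_structures k A =
     {(T\<^sub>R, T\<^sub>L, T\<^sub>E).
        T\<^sub>R \<in> monoidal_structures (right_mod_cat k A) \<and>
        T\<^sub>L \<in> monoidal_structures (left_mod_cat k A) \<and>
        T\<^sub>E \<in> monoidal_structures (ext_cat k A) \<and>
        strict_monoidal_functor (ext_cat k A) T\<^sub>E (left_mod_cat k A) T\<^sub>L
          left_part (forget_arrow left_part) \<and>
        strict_monoidal_functor (ext_cat k A) T\<^sub>E (right_mod_cat k A) T\<^sub>R
          right_part (forget_arrow right_part) \<and>
        strict_monoidal_functor (left_mod_cat k A) T\<^sub>L (mod_cat k) (mod_tensor k)
          base (forget_arrow base) \<and>
        strict_monoidal_functor (right_mod_cat k A) T\<^sub>R (mod_cat k) (mod_tensor k)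
          base (forget_arrow base) \<and>
        (\<forall>R \<in> ext_objects k A. \<forall>S \<in> ext_objects k A.
           alg (tob T\<^sub>E R S) = algebra_tensor k (alg R) (alg S)) \<and>
        alg (unit_ob T\<^sub>E) = scalar_algebra k}"

end

theory Submission
  imports Defs
begin

text \<open>If \<open>B\<close> is an extension of \<open>A\<close>, then every non-degenerate idempotent \<open>B\<close>-module \<open>M\<close> is an
  \<open>A\<close>-module by \<open>(m y) a = m (y a)\<close>, and composition in \<open>NdI\<^sub>k\<close> is this base change. Since modules
  are projective, dual bases show that \<open>M \<otimes> N\<close> is a non-degenerate idempotent \<open>A \<otimes> A\<close>-module; base
  change along \<open>\<Delta>\<close> turns it into an \<open>A\<close>-module, and \<open>\<epsilon>\<close> turns \<open>k\<close> into one. As the module \<open>M\<close> is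
  spanned by the images of the \<open>A\<close>-linear maps \<open>a \<mapsto> m a\<close> on \<open>A\<close>, naturality reduces the linearity
  of the associativity and unit constraints to the case of the modules \<open>A\<close> and \<open>k\<close>, where it says
  that \<open>\<Delta>\<close> is coassociative and counital. For the same reason a monoidal structure over
  \<open>k\<close>-modules is determined by the \<open>A\<close>-extensions \<open>A \<otimes> A\<close> and \<open>k\<close>.\<close>

section \<open>Linear and bilinear maps\<close>

text \<open>The forgetful functors do not change functions, so they are faithful, and strictness
  forces the structure maps: constraints and tensor products of arrows are those of k-modules.
  Coherence is checked once, for k-modules, and what varies is only the action of A on M \<otimes> N
  and on k. The axioms of a comonoid and those of a monoidal category thus become statements of one
  kind: a fixed k-linear map commutes with actions of A. Extensions join the two sides, because one
  extension structure on A \<otimes> A carries a left and a right action that are compatible, and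
  such structures are the arrows from A to A \<otimes> A in \<open>ndi_cat\<close>. Two obstacles
  shape the details. Composition of arrows is given through \<open>bar\<close>, a definite
  description over multiplier algebras, and has to be made explicit. Equality of structures is
  equality of records, so fields that are forgotten, values outside of carriers and values outside
  of the categories have to be controlled. Left modules are treated as right modules over the
  opposite multiplication, so that the arguments about modules are carried out once.\<close>

definition lin :: "'k ring \<Rightarrow> ('k, 'u) module \<Rightarrow> ('k, 'v) module \<Rightarrow> ('u \<Rightarrow> 'v) \<Rightarrow> bool" where
  "lin k M N f \<longleftrightarrow> (\<forall>x \<in> carrier M. f x \<in> carrier N) \<and>
     (\<forall>x \<in> carrier M. \<forall>y \<in> carrier M. f (x \<oplus>\<^bsub>M\<^esub> y) = f x \<oplus>\<^bsub>N\<^esub> f y) \<and>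
     (\<forall>r \<in> carrier k. \<forall>x \<in> carrier M. f (r \<odot>\<^bsub>M\<^esub> x) = r \<odot>\<^bsub>N\<^esub> f x)"

definition bil :: "'k ring \<Rightarrow> ('k, 'u) module \<Rightarrow> ('k, 'v) module \<Rightarrow> ('k, 'w) module \<Rightarrow>
    ('u \<Rightarrow> 'v \<Rightarrow> 'w) \<Rightarrow> bool" where
  "bil k M N P \<beta> \<longleftrightarrow> (\<forall>x \<in> carrier M. lin k N P (\<beta> x)) \<and> (\<forall>y \<in> carrier N. lin k M P (\<lambda>x. \<beta> x y))"

lemma linI:
  assumes "\<And>x. x \<in> carrier M \<Longrightarrow> f x \<in> carrier N"
    and "\<And>x y. x \<in> carrier M \<Longrightarrow> y \<in> carrier M \<Longrightarrow> f (x \<oplus>\<^bsub>M\<^esub> y) = f x \<oplus>\<^bsub>N\<^esub> f y"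
    and "\<And>r x. r \<in> carrier k \<Longrightarrow> x \<in> carrier M \<Longrightarrow> f (r \<odot>\<^bsub>M\<^esub> x) = r \<odot>\<^bsub>N\<^esub> f x"
  shows "lin k M N f"
  using assms by (simp add: lin_def)

lemma lin_closed: "lin k M N f \<Longrightarrow> x \<in> carrier M \<Longrightarrow> f x \<in> carrier N"
  and lin_add: "lin k M N f \<Longrightarrow> x \<in> carrier M \<Longrightarrow> y \<in> carrier M \<Longrightarrow> f (x \<oplus>\<^bsub>M\<^esub> y) = f x \<oplus>\<^bsub>N\<^esub> f y"
  and lin_smult: "lin k M N f \<Longrightarrow> r \<in> carrier k \<Longrightarrow> x \<in> carrier M \<Longrightarrow> f (r \<odot>\<^bsub>M\<^esub> x) = r \<odot>\<^bsub>N\<^esub> f x"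
  by (simp_all add: lin_def)

lemma bilI:
  assumes "\<And>x y. x \<in> carrier M \<Longrightarrow> y \<in> carrier N \<Longrightarrow> \<beta> x y \<in> carrier P"
    and "\<And>x x' y. x \<in> carrier M \<Longrightarrow> x' \<in> carrier M \<Longrightarrow> y \<in> carrier N \<Longrightarrow>
      \<beta> (x \<oplus>\<^bsub>M\<^esub> x') y = \<beta> x y \<oplus>\<^bsub>P\<^esub> \<beta> x' y"
    and "\<And>x y y'. x \<in> carrier M \<Longrightarrow> y \<in> carrier N \<Longrightarrow> y' \<in> carrier N \<Longrightarrow>
      \<beta> x (y \<oplus>\<^bsub>N\<^esub> y') = \<beta> x y \<oplus>\<^bsub>P\<^esub> \<beta> x y'"
    and "\<And>r x y. r \<in> carrier k \<Longrightarrow> x \<in> carrier M \<Longrightarrow> y \<in> carrier N \<Longrightarrow>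
      \<beta> (r \<odot>\<^bsub>M\<^esub> x) y = r \<odot>\<^bsub>P\<^esub> \<beta> x y"
    and "\<And>r x y. r \<in> carrier k \<Longrightarrow> x \<in> carrier M \<Longrightarrow> y \<in> carrier N \<Longrightarrow>
      \<beta> x (r \<odot>\<^bsub>N\<^esub> y) = r \<odot>\<^bsub>P\<^esub> \<beta> x y"
  shows "bil k M N P \<beta>"
  using assms by (simp add: bil_def lin_def)

lemma bil_closed: "bil k M N P \<beta> \<Longrightarrow> x \<in> carrier M \<Longrightarrow> y \<in> carrier N \<Longrightarrow> \<beta> x y \<in> carrier P"
  and bil_addL: "bil k M N P \<beta> \<Longrightarrow> x \<in> carrier M \<Longrightarrow> x' \<in> carrier M \<Longrightarrow> y \<in> carrier N \<Longrightarrow>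
      \<beta> (x \<oplus>\<^bsub>M\<^esub> x') y = \<beta> x y \<oplus>\<^bsub>P\<^esub> \<beta> x' y"
  and bil_addR: "bil k M N P \<beta> \<Longrightarrow> x \<in> carrier M \<Longrightarrow> y \<in> carrier N \<Longrightarrow> y' \<in> carrier N \<Longrightarrow>
      \<beta> x (y \<oplus>\<^bsub>N\<^esub> y') = \<beta> x y \<oplus>\<^bsub>P\<^esub> \<beta> x y'"
  and bil_smultL: "bil k M N P \<beta> \<Longrightarrow> r \<in> carrier k \<Longrightarrow> x \<in> carrier M \<Longrightarrow> y \<in> carrier N \<Longrightarrow>
      \<beta> (r \<odot>\<^bsub>M\<^esub> x) y = r \<odot>\<^bsub>P\<^esub> \<beta> x y"
  and bil_smultR: "bil k M N P \<beta> \<Longrightarrow> r \<in> carrier k \<Longrightarrow> x \<in> carrier M \<Longrightarrow> y \<in> carrier N \<Longrightarrow>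
      \<beta> x (r \<odot>\<^bsub>N\<^esub> y) = r \<odot>\<^bsub>P\<^esub> \<beta> x y"
  and bil_linL: "bil k M N P \<beta> \<Longrightarrow> y \<in> carrier N \<Longrightarrow> lin k M P (\<lambda>x. \<beta> x y)"
  and bil_linR: "bil k M N P \<beta> \<Longrightarrow> x \<in> carrier M \<Longrightarrow> lin k N P (\<beta> x)"
  by (simp_all add: bil_def lin_def)

lemma bil_flip: "bil k M N P \<beta> \<Longrightarrow> bil k N M P (\<lambda>y x. \<beta> x y)"
  by (simp add: bil_def)

lemma lin_comp: "lin k M N f \<Longrightarrow> lin k N P g \<Longrightarrow> lin k M P (\<lambda>x. g (f x))"
  by (simp add: lin_def)

lemma lin_cong: "(\<And>x. x \<in> carrier M \<Longrightarrow> f x = g x) \<Longrightarrow> module k M \<Longrightarrow> lin k M N f \<longleftrightarrow> lin k M N g"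
  by (simp add: lin_def module.smult_closed abelian_groupE(1)[OF module.axioms(2)])

text \<open>The proofs work with \<open>lin\<close>, which ignores values outside of the carrier, so
  that lambda terms and compositions need no restriction. Extensionality is restored only where
  membership in \<open>linear_maps\<close> or an equality of functions is wanted.\<close>

lemma linear_maps_iff: "f \<in> linear_maps k M N \<longleftrightarrow> lin k M N f \<and> f \<in> extensional (carrier M)"
  by (auto simp: linear_maps_def lin_def PiE_def)

lemma linear_maps_restrict:
  assumes "lin k M N f" "module k M"
  shows "(\<lambda>x \<in> carrier M. f x) \<in> linear_maps k M N"
  using assms lin_cong[of M "\<lambda>x \<in> carrier M. f x" f k N] by (simp add: linear_maps_iff)

section \<open>Modules over a commutative ring\<close>

locale scalars =
  fixes k :: "'k ring"
  assumes cring: "cring k"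
begin

sublocale k: cring k by (rule cring)

lemma module_grp: "module k M \<Longrightarrow> abelian_group M"
  by (simp add: module_def)

lemma mod_closed [simp]:
  assumes "module k M"
  shows "\<zero>\<^bsub>M\<^esub> \<in> carrier M"
    and "x \<in> carrier M \<Longrightarrow> y \<in> carrier M \<Longrightarrow> x \<oplus>\<^bsub>M\<^esub> y \<in> carrier M"
    and "x \<in> carrier M \<Longrightarrow> \<ominus>\<^bsub>M\<^esub> x \<in> carrier M"
    and "r \<in> carrier k \<Longrightarrow> x \<in> carrier M \<Longrightarrow> r \<odot>\<^bsub>M\<^esub> x \<in> carrier M"
proof -
  interpret module k M by fact
  show "\<zero>\<^bsub>M\<^esub> \<in> carrier M" "x \<in> carrier M \<Longrightarrow> y \<in> carrier M \<Longrightarrow> x \<oplus>\<^bsub>M\<^esub> y \<in> carrier M"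
    "x \<in> carrier M \<Longrightarrow> \<ominus>\<^bsub>M\<^esub> x \<in> carrier M"
    "r \<in> carrier k \<Longrightarrow> x \<in> carrier M \<Longrightarrow> r \<odot>\<^bsub>M\<^esub> x \<in> carrier M" by auto
qed

lemma mod_simps [simp]:
  assumes "module k M" and "x \<in> carrier M"
  shows "\<zero>\<^bsub>M\<^esub> \<oplus>\<^bsub>M\<^esub> x = x" and "x \<oplus>\<^bsub>M\<^esub> \<zero>\<^bsub>M\<^esub> = x"
    and "\<zero>\<^bsub>k\<^esub> \<odot>\<^bsub>M\<^esub> x = \<zero>\<^bsub>M\<^esub>" and "\<one>\<^bsub>k\<^esub> \<odot>\<^bsub>M\<^esub> x = x"
proof -
  interpret module k M by fact
  show "\<zero>\<^bsub>M\<^esub> \<oplus>\<^bsub>M\<^esub> x = x" "x \<oplus>\<^bsub>M\<^esub> \<zero>\<^bsub>M\<^esub> = x" "\<zero>\<^bsub>k\<^esub> \<odot>\<^bsub>M\<^esub> x = \<zero>\<^bsub>M\<^esub>" "\<one>\<^bsub>k\<^esub> \<odot>\<^bsub>M\<^esub> x = x"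
    using assms(2) by auto
qed

lemma mod_smult_zero [simp]: "module k M \<Longrightarrow> r \<in> carrier k \<Longrightarrow> r \<odot>\<^bsub>M\<^esub> \<zero>\<^bsub>M\<^esub> = \<zero>\<^bsub>M\<^esub>"
  by (rule module.smult_r_null)

lemma mod_assoc: "module k M \<Longrightarrow> x \<in> carrier M \<Longrightarrow> y \<in> carrier M \<Longrightarrow> z \<in> carrier M \<Longrightarrow>
    (x \<oplus>\<^bsub>M\<^esub> y) \<oplus>\<^bsub>M\<^esub> z = x \<oplus>\<^bsub>M\<^esub> (y \<oplus>\<^bsub>M\<^esub> z)"
  and mod_comm: "module k M \<Longrightarrow> x \<in> carrier M \<Longrightarrow> y \<in> carrier M \<Longrightarrow> x \<oplus>\<^bsub>M\<^esub> y = y \<oplus>\<^bsub>M\<^esub> x"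
  and mod_lcomm: "module k M \<Longrightarrow> x \<in> carrier M \<Longrightarrow> y \<in> carrier M \<Longrightarrow> z \<in> carrier M \<Longrightarrow>
    x \<oplus>\<^bsub>M\<^esub> (y \<oplus>\<^bsub>M\<^esub> z) = y \<oplus>\<^bsub>M\<^esub> (x \<oplus>\<^bsub>M\<^esub> z)"
proof -
  assume M: "module k M"
  then interpret module k M .
  show "x \<in> carrier M \<Longrightarrow> y \<in> carrier M \<Longrightarrow> z \<in> carrier M \<Longrightarrow>
    (x \<oplus>\<^bsub>M\<^esub> y) \<oplus>\<^bsub>M\<^esub> z = x \<oplus>\<^bsub>M\<^esub> (y \<oplus>\<^bsub>M\<^esub> z)" "x \<in> carrier M \<Longrightarrow> y \<in> carrier M \<Longrightarrow> x \<oplus>\<^bsub>M\<^esub> y = y \<oplus>\<^bsub>M\<^esub> x"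
    "x \<in> carrier M \<Longrightarrow> y \<in> carrier M \<Longrightarrow> z \<in> carrier M \<Longrightarrow>
    x \<oplus>\<^bsub>M\<^esub> (y \<oplus>\<^bsub>M\<^esub> z) = y \<oplus>\<^bsub>M\<^esub> (x \<oplus>\<^bsub>M\<^esub> z)" by (simp_all add: M.a_ac)
qed

lemmas mod_ac = mod_assoc mod_comm mod_lcomm

text \<open>The difference is written with the scalar -1, so that a bilinear action passes through
  it by additivity and compatibility with scalars; see \<open>nd_eqI\<close>.\<close>

lemma mod_minus_eqD:
  assumes "module k M" "x \<in> carrier M" "y \<in> carrier M" "x \<oplus>\<^bsub>M\<^esub> (\<ominus>\<^bsub>k\<^esub> \<one>\<^bsub>k\<^esub>) \<odot>\<^bsub>M\<^esub> y = \<zero>\<^bsub>M\<^esub>"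
  shows "x = y"
proof -
  interpret module k M by fact
  have "(\<ominus>\<^bsub>k\<^esub> \<one>\<^bsub>k\<^esub>) \<odot>\<^bsub>M\<^esub> y = \<ominus>\<^bsub>M\<^esub> y"
    using assms by (simp add: smult_l_minus)
  then show ?thesis
    using assms M.minus_equality[of x "\<ominus>\<^bsub>M\<^esub> y"] by simp
qed

lemma lin_zero: "lin k M N f \<Longrightarrow> module k M \<Longrightarrow> module k N \<Longrightarrow> f \<zero>\<^bsub>M\<^esub> = \<zero>\<^bsub>N\<^esub>"
  using lin_smult[of k M N f "\<zero>\<^bsub>k\<^esub>" "\<zero>\<^bsub>M\<^esub>"] lin_closed[of k M N f "\<zero>\<^bsub>M\<^esub>"] by simp

lemma bil_zeroL: "bil k M N P \<beta> \<Longrightarrow> module k M \<Longrightarrow> module k P \<Longrightarrow> y \<in> carrier N \<Longrightarrow> \<beta> \<zero>\<^bsub>M\<^esub> y = \<zero>\<^bsub>P\<^esub>"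
  by (rule lin_zero[OF bil_linL])

lemma bil_zeroR: "bil k M N P \<beta> \<Longrightarrow> module k N \<Longrightarrow> module k P \<Longrightarrow> x \<in> carrier M \<Longrightarrow> \<beta> x \<zero>\<^bsub>N\<^esub> = \<zero>\<^bsub>P\<^esub>"
  by (rule lin_zero[OF bil_linR])

lemmas bilD = bil_closed bil_addL bil_addR bil_smultL bil_smultR
lemmas linD = lin_closed lin_add lin_smult

lemma bilinear_iff:
  assumes "module k M" "module k N"
  shows "bilinear k M N P \<beta> \<longleftrightarrow> bil k M N P \<beta>"
proof -
  have "(\<lambda>y \<in> carrier N. \<beta> x y) \<in> linear_maps k N P \<longleftrightarrow> lin k N P (\<beta> x)" for x
    using lin_cong[of N "\<lambda>y \<in> carrier N. \<beta> x y" "\<beta> x" k P] assms by (simp add: linear_maps_iff)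
  moreover have "(\<lambda>x \<in> carrier M. \<beta> x y) \<in> linear_maps k M P \<longleftrightarrow> lin k M P (\<lambda>x. \<beta> x y)" for y
    using lin_cong[of M "\<lambda>x \<in> carrier M. \<beta> x y" "\<lambda>x. \<beta> x y" k P] assms
    by (simp add: linear_maps_iff)
  ultimately show ?thesis by (simp add: bilinear_def bil_def)
qed

end

text \<open>An inductive form of \<open>finite_sums\<close>: idempotence becomes available by rule
  induction, without index sets.\<close>

inductive_set addspan :: "('k, 'u) module \<Rightarrow> 'u set \<Rightarrow> 'u set" for M and S where
  zero: "\<zero>\<^bsub>M\<^esub> \<in> addspan M S"
| step: "x \<in> S \<Longrightarrow> y \<in> addspan M S \<Longrightarrow> x \<oplus>\<^bsub>M\<^esub> y \<in> addspan M S"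

context scalars
begin

lemma addspan_closed:
  assumes "x \<in> addspan M S" "module k M" "S \<subseteq> carrier M"
  shows "x \<in> carrier M"
  using assms(1) by induction (use assms(2,3) in auto)

lemma addspan_gen: "module k M \<Longrightarrow> S \<subseteq> carrier M \<Longrightarrow> x \<in> S \<Longrightarrow> x \<in> addspan M S"
  using addspan.step[OF _ addspan.zero, of x S M] by (auto simp: subset_iff)

lemma addspan_add:
  assumes "x \<in> addspan M S" "y \<in> addspan M S" "module k M" "S \<subseteq> carrier M"
  shows "x \<oplus>\<^bsub>M\<^esub> y \<in> addspan M S"
  using assms(1)
proof induction
  case zero
  then show ?case using assms addspan_closed[OF assms(2)] by simp
next
  case (step x z)
  then have "x \<oplus>\<^bsub>M\<^esub> z \<oplus>\<^bsub>M\<^esub> y = x \<oplus>\<^bsub>M\<^esub> (z \<oplus>\<^bsub>M\<^esub> y)"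
    using assms addspan_closed[where M = M and S = S] by (intro mod_assoc) auto
  then show ?case using step by (auto intro: addspan.step)
qed

lemma finite_sums_eq_addspan:
  assumes M: "module k M" and S: "S \<subseteq> carrier M"
  shows "finite_sums M S = addspan M S"
proof (intro equalityI subsetI)
  interpret module k M by (rule M)
  fix z assume "z \<in> finite_sums M S"
  then obtain x and n :: nat where z: "z = finsum M x {..<n}" "\<forall>i<n. x i \<in> S"
    by (auto simp: finite_sums_def)
  have "finsum M x {..<n} \<in> addspan M S" using z(2)
  proof (induction n)
    case 0
    then show ?case by (simp add: addspan.zero)
  next
    case (Suc n)
    have "finsum M x {..<Suc n} = x n \<oplus>\<^bsub>M\<^esub> finsum M x {..<n}"
      unfolding lessThan_Suc using Suc.prems S by (intro M.finsum_insert) auto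
    then show ?case using Suc by (auto intro: addspan.step)
  qed
  then show "z \<in> addspan M S" using z by simp
next
  interpret module k M by (rule M)
  fix z assume "z \<in> addspan M S"
  then have "\<exists>x (n::nat). z = finsum M x {..<n} \<and> (\<forall>i<n. x i \<in> S)"
  proof induction
    case zero
    show ?case by (intro exI[of _ undefined] exI[of _ 0]) simp
  next
    case (step y z)
    then obtain x and n :: nat where z: "z = finsum M x {..<n}" "\<forall>i<n. x i \<in> S" by blast
    \<comment> \<open>The new summand is put at the fresh index n, which leaves the old sum over
      \<open>{..<n}\<close> unchanged.\<close>
    have "finsum M (x(n := y)) {..<Suc n} = (x(n := y)) n \<oplus>\<^bsub>M\<^esub> finsum M (x(n := y)) {..<n}"
      unfolding lessThan_Suc using z step S by (intro M.finsum_insert) auto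
    also have "finsum M (x(n := y)) {..<n} = z"
      unfolding z using z step S by (intro M.finsum_cong') auto
    finally show ?case using z step
      by (intro exI[of _ "x(n := y)"] exI[of _ "Suc n"]) (auto simp: less_Suc_eq)
  qed
  then show "z \<in> finite_sums M S" by (auto simp: finite_sums_def)
qed

end

section \<open>Tensor products\<close>

context scalars
begin

lemma tensor_eq_lists:
  assumes "tensor_eq k M N xs ys" and M: "module k M" and N: "module k N"
  shows "xs \<in> lists (carrier M \<times> carrier N) \<and> ys \<in> lists (carrier M \<times> carrier N)"
  using assms(1) by induction (use M N in auto)

text \<open>Equivalent lists are equivalent to the same lists, by symmetry and transitivity, and
  \<open>SOME\<close> depends on this predicate only.\<close>

lemma tensor_class_eq:
  assumes "tensor_eq k M N xs ys"
  shows "tensor_class k M N xs = tensor_class k M N ys"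
proof -
  have "tensor_eq k M N xs zs \<longleftrightarrow> tensor_eq k M N ys zs" for zs
    using assms tensor_eq.sym tensor_eq.trans by blast
  then show ?thesis by (simp add: tensor_class_def)
qed

text \<open>The list stored in a tensor need not be the one it was formed from, but it is equivalent
  to it, since \<open>xs\<close> itself was a candidate for the choice. Operations defined on stored
  lists can therefore be computed on any representing list.\<close>

lemma tensor_class_terms:
  assumes "xs \<in> lists (carrier M \<times> carrier N)"
  shows "tensor_eq k M N xs (terms (tensor_class k M N xs))"
  unfolding tensor_class_def using someI[of "tensor_eq k M N xs", OF tensor_eq.refl[OF assms]]
  by simp

lemma tensor_carrierI:
  "xs \<in> lists (carrier M \<times> carrier N) \<Longrightarrow> tensor_class k M N xs \<in> carrier (tensor k M N)"
  by (simp add: tensor_def)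

lemma tensor_carrierE:
  assumes "x \<in> carrier (tensor k M N)"
  obtains xs where "xs \<in> lists (carrier M \<times> carrier N)" "x = tensor_class k M N xs"
  using assms by (auto simp: tensor_def)

lemma tensor_class_append:
  assumes xs: "xs \<in> lists (carrier M \<times> carrier N)" and ys: "ys \<in> lists (carrier M \<times> carrier N)"
  shows "tensor_class k M N xs \<oplus>\<^bsub>tensor k M N\<^esub> tensor_class k M N ys = tensor_class k M N (xs @ ys)"
  using tensor_class_eq[OF tensor_eq.append[OF tensor_class_terms[OF xs] tensor_class_terms[OF ys]]]
  by (simp add: tensor_def)

lemma tensor_eq_scale:
  assumes "tensor_eq k M N xs ys" and r: "r \<in> carrier k" and M: "module k M" and N: "module k N"
  shows "tensor_eq k M N (map (\<lambda>(m, n). (r \<odot>\<^bsub>M\<^esub> m, n)) xs) (map (\<lambda>(m, n). (r \<odot>\<^bsub>M\<^esub> m, n)) ys)"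
  using assms(1)
proof induction
  case (refl xs)
  have "map (\<lambda>(m, n). (r \<odot>\<^bsub>M\<^esub> m, n)) xs \<in> lists (carrier M \<times> carrier N)"
    using refl M r by (force simp: in_lists_conv_set)
  then show ?case by (rule tensor_eq.refl)
next
  case (commute xs ys)
  have *: "map (\<lambda>(m, n). (r \<odot>\<^bsub>M\<^esub> m, n)) xs \<in> lists (carrier M \<times> carrier N)"
    "map (\<lambda>(m, n). (r \<odot>\<^bsub>M\<^esub> m, n)) ys \<in> lists (carrier M \<times> carrier N)"
    using commute M r by (force simp: in_lists_conv_set)+
  show ?case using tensor_eq.commute[OF *] by simp
next
  case (add_left m m' n)
  then show ?case
    using M r by (auto simp: module.smult_r_distr intro: tensor_eq.add_left)
next
  case (add_right m n n')
  then show ?case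
    using M r by (auto intro: tensor_eq.add_right)
next
  case (scalar s m n)
  \<comment> \<open>The factor r is applied on the left while the relation moves s to the right, so
    the two scalars have to be exchanged; this uses that k is commutative.\<close>
  have "r \<odot>\<^bsub>M\<^esub> (s \<odot>\<^bsub>M\<^esub> m) = s \<odot>\<^bsub>M\<^esub> (r \<odot>\<^bsub>M\<^esub> m)"
    using scalar r M by (metis k.m_comm module.smult_assoc1)
  then show ?case
    using scalar M r tensor_eq.scalar[of s k "r \<odot>\<^bsub>M\<^esub> m" M n N] by simp
next
  case (zero n)
  then show ?case using M r by (auto intro: tensor_eq.zero)
next
  case (sym xs ys)
  then show ?case by (blast intro: tensor_eq.sym)
next
  case (trans xs ys zs)
  then show ?case by (meson tensor_eq.trans)
next
  case (append xs xs' ys ys')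
  then show ?case by (auto intro: tensor_eq.append)
qed

lemma tensor_class_scale:
  assumes xs: "xs \<in> lists (carrier M \<times> carrier N)"
    and "r \<in> carrier k" "module k M" "module k N"
  shows "r \<odot>\<^bsub>tensor k M N\<^esub> tensor_class k M N xs =
    tensor_class k M N (map (\<lambda>(m, n). (r \<odot>\<^bsub>M\<^esub> m, n)) xs)"
  using tensor_class_eq[OF tensor_eq_scale[OF tensor_class_terms[OF xs] assms(2-4)]]
  by (simp add: tensor_def)

lemma tensor_zero_class: "\<zero>\<^bsub>tensor k M N\<^esub> = tensor_class k M N []"
  by (simp add: tensor_def)

lemma pure_tensor_closed [simp]:
  "m \<in> carrier M \<Longrightarrow> n \<in> carrier N \<Longrightarrow> pure_tensor k M N m n \<in> carrier (tensor k M N)"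
  by (simp add: pure_tensor_def tensor_carrierI)

lemma tensor_class_Cons:
  "m \<in> carrier M \<Longrightarrow> n \<in> carrier N \<Longrightarrow> xs \<in> lists (carrier M \<times> carrier N) \<Longrightarrow>
   tensor_class k M N ((m, n) # xs) = pure_tensor k M N m n \<oplus>\<^bsub>tensor k M N\<^esub> tensor_class k M N xs"
  using tensor_class_append[of "[(m, n)]" M N xs] by (simp add: pure_tensor_def)

text \<open>Induction along a representing list. It precedes the module laws of the tensor product,
  several of which are proved by it.\<close>

lemma tensor_induct_step [consumes 1, case_names zero step]:
  assumes "z \<in> carrier (tensor k M N)"
    and "Q \<zero>\<^bsub>tensor k M N\<^esub>"
    and "\<And>m n y. m \<in> carrier M \<Longrightarrow> n \<in> carrier N \<Longrightarrow> y \<in> carrier (tensor k M N) \<Longrightarrow> Q y \<Longrightarrow>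
      Q (pure_tensor k M N m n \<oplus>\<^bsub>tensor k M N\<^esub> y)"
  shows "Q z"
proof -
  have "xs \<in> lists (carrier M \<times> carrier N) \<Longrightarrow> Q (tensor_class k M N xs)" for xs
  proof (induction xs)
    case Nil
    then show ?case using assms(2) by (simp add: tensor_zero_class)
  next
    case (Cons x xs)
    then show ?case
      using assms(3) tensor_class_Cons[of "fst x" M "snd x" N xs] tensor_carrierI[of xs M N]
      by (cases x) auto
  qed
  then show ?thesis using assms(1) by (metis tensor_carrierE)
qed

text \<open>Laws that concern concatenation hold on representing lists. Those about sums, products
  and special values of scalars are reduced to pure tensors, where the generating relations and the
  laws of M apply.\<close>

lemma tensor_module [simp]:
  fixes M N :: "('k, 'a) kmod"
  assumes M: "module k M" and N: "module k N"
  shows "module k (tensor k M N)"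
proof -
  let ?T = "tensor k M N"
  let ?L = "lists (carrier M \<times> carrier N)"
  let ?c = "tensor_class k M N"
  have add: "x \<oplus>\<^bsub>?T\<^esub> y \<in> carrier ?T" if "x \<in> carrier ?T" "y \<in> carrier ?T" for x y
    using that by (elim tensor_carrierE) (simp add: tensor_class_append tensor_carrierI del:
        in_lists_conv_set)
  have assoc: "x \<oplus>\<^bsub>?T\<^esub> y \<oplus>\<^bsub>?T\<^esub> z = x \<oplus>\<^bsub>?T\<^esub> (y \<oplus>\<^bsub>?T\<^esub> z)"
    if "x \<in> carrier ?T" "y \<in> carrier ?T" "z \<in> carrier ?T" for x y z
    using that by (elim tensor_carrierE) (simp add: tensor_class_append del: in_lists_conv_set)
  have comm: "x \<oplus>\<^bsub>?T\<^esub> y = y \<oplus>\<^bsub>?T\<^esub> x"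
    if "x \<in> carrier ?T" "y \<in> carrier ?T" for x y
    using that
    by (elim tensor_carrierE) (simp add: tensor_class_append tensor_class_eq tensor_eq.commute
        del: in_lists_conv_set)
  have zc: "\<zero>\<^bsub>?T\<^esub> \<in> carrier ?T" by (simp add: tensor_zero_class tensor_carrierI)
  have l_zero: "\<zero>\<^bsub>?T\<^esub> \<oplus>\<^bsub>?T\<^esub> x = x" if "x \<in> carrier ?T" for x
    using that by (elim tensor_carrierE) (simp add: tensor_class_append tensor_zero_class
        del: in_lists_conv_set)
  have scale_list: "map (\<lambda>(m, n). (r \<odot>\<^bsub>M\<^esub> m, n)) xs \<in> ?L" if "r \<in> carrier k" "xs \<in> ?L" for r xs
    using that M by (force simp: in_lists_conv_set)
  have smult: "r \<odot>\<^bsub>?T\<^esub> x \<in> carrier ?T" if "r \<in> carrier k" "x \<in> carrier ?T" for r x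
    using that scale_list M N by (elim tensor_carrierE) (simp add: tensor_class_scale
        tensor_carrierI
        del: in_lists_conv_set)
  have smult_pure: "r \<odot>\<^bsub>?T\<^esub> pure_tensor k M N m n = pure_tensor k M N (r \<odot>\<^bsub>M\<^esub> m) n"
    if "r \<in> carrier k" "m \<in> carrier M" "n \<in> carrier N" for r m n
    using that M N tensor_class_scale[of "[(m, n)]"] by (simp add: pure_tensor_def)
  have smult_zero: "r \<odot>\<^bsub>?T\<^esub> \<zero>\<^bsub>?T\<^esub> = \<zero>\<^bsub>?T\<^esub>" if "r \<in> carrier k" for r
    using that M N tensor_class_scale[of "[]"] by (simp add: tensor_zero_class)
  have smult_add: "r \<odot>\<^bsub>?T\<^esub> (x \<oplus>\<^bsub>?T\<^esub> y) = r \<odot>\<^bsub>?T\<^esub> x \<oplus>\<^bsub>?T\<^esub> r \<odot>\<^bsub>?T\<^esub> y"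
    if r: "r \<in> carrier k" and x: "x \<in> carrier ?T" and y: "y \<in> carrier ?T" for r x y
  proof -
    obtain xs where "xs \<in> ?L" "x = ?c xs" by (rule tensor_carrierE[OF x])
    moreover obtain ys where "ys \<in> ?L" "y = ?c ys" by (rule tensor_carrierE[OF y])
    ultimately show ?thesis
      using r M N scale_list[of r xs] scale_list[of r ys]
      by (simp add: tensor_class_scale tensor_class_append del: append_in_lists_conv)
        (simp add: tensor_class_scale)
  qed
  have pure_add: "pure_tensor k M N (m \<oplus>\<^bsub>M\<^esub> m') n =
      pure_tensor k M N m n \<oplus>\<^bsub>?T\<^esub> pure_tensor k M N m' n"
    if "m \<in> carrier M" "m' \<in> carrier M" "n \<in> carrier N" for m m' n
    using that tensor_class_eq[OF tensor_eq.add_left[of m M m' n N k]]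
    by (simp add: pure_tensor_def tensor_class_append)
  have lcomm: "x \<oplus>\<^bsub>?T\<^esub> (y \<oplus>\<^bsub>?T\<^esub> z) = y \<oplus>\<^bsub>?T\<^esub> (x \<oplus>\<^bsub>?T\<^esub> z)"
    if "x \<in> carrier ?T" "y \<in> carrier ?T" "z \<in> carrier ?T" for x y z
    by (metis that assoc comm)
  have add_smult: "(r \<oplus>\<^bsub>k\<^esub> s) \<odot>\<^bsub>?T\<^esub> x = r \<odot>\<^bsub>?T\<^esub> x \<oplus>\<^bsub>?T\<^esub> s \<odot>\<^bsub>?T\<^esub> x"
    if "r \<in> carrier k" "s \<in> carrier k" "x \<in> carrier ?T" for r s x
    using that(3)
  proof (induction x rule: tensor_induct_step)
    case zero
    then show ?case using that zc l_zero by (simp add: smult_zero)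
  next
    case (step m n y)
    then show ?case using that M N zc
      by (simp add: smult_add smult_pure smult pure_add module.smult_l_distr assoc lcomm add)
  qed
  have mult_smult: "(r \<otimes>\<^bsub>k\<^esub> s) \<odot>\<^bsub>?T\<^esub> x = r \<odot>\<^bsub>?T\<^esub> (s \<odot>\<^bsub>?T\<^esub> x)"
    if "r \<in> carrier k" "s \<in> carrier k" "x \<in> carrier ?T" for r s x
    using that(3)
  proof (induction x rule: tensor_induct_step)
    case zero
    then show ?case using that by (simp add: smult_zero)
  next
    case (step m n y)
    then show ?case using that M N
      by (simp add: smult_add smult_pure smult module.smult_assoc1)
  qed
  have one_smult: "\<one>\<^bsub>k\<^esub> \<odot>\<^bsub>?T\<^esub> x = x" if "x \<in> carrier ?T" for x
    using that
  proof (induction x rule: tensor_induct_step)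
    case zero
    then show ?case by (simp add: smult_zero)
  next
    case (step m n y)
    then show ?case using M N by (simp add: smult_add smult_pure)
  qed
  have zero_smult: "\<zero>\<^bsub>k\<^esub> \<odot>\<^bsub>?T\<^esub> x = \<zero>\<^bsub>?T\<^esub>" if "x \<in> carrier ?T" for x
    using that
  proof (induction x rule: tensor_induct_step)
    case zero
    then show ?case by (simp add: smult_zero)
  next
    case (step m n y)
    then show ?case using M N zc tensor_class_eq[OF tensor_eq.zero[of n N k M]]
      by (simp add: smult_add smult_pure l_zero)
        (simp add: pure_tensor_def tensor_zero_class[symmetric] l_zero)
  qed
  show ?thesis
  proof (intro moduleI cring abelian_groupI)
    \<comment> \<open>The negative of x is (-1) x, which reduces the existence of inverses to the
      scalar laws.\<close>
    fix x assume x: "x \<in> carrier ?T"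
    have "(\<ominus>\<^bsub>k\<^esub> \<one>\<^bsub>k\<^esub>) \<odot>\<^bsub>?T\<^esub> x \<oplus>\<^bsub>?T\<^esub> x = (\<ominus>\<^bsub>k\<^esub> \<one>\<^bsub>k\<^esub> \<oplus>\<^bsub>k\<^esub> \<one>\<^bsub>k\<^esub>) \<odot>\<^bsub>?T\<^esub> x"
      using x by (simp add: add_smult one_smult)
    then have "(\<ominus>\<^bsub>k\<^esub> \<one>\<^bsub>k\<^esub>) \<odot>\<^bsub>?T\<^esub> x \<oplus>\<^bsub>?T\<^esub> x = \<zero>\<^bsub>?T\<^esub>"
      using x by (simp add: k.l_neg zero_smult)
    then show "\<exists>y \<in> carrier ?T. y \<oplus>\<^bsub>?T\<^esub> x = \<zero>\<^bsub>?T\<^esub>"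
      using x smult[of "\<ominus>\<^bsub>k\<^esub> \<one>\<^bsub>k\<^esub>" x] by auto
  qed ((rule comm; assumption) |
    simp add: add zc assoc l_zero smult add_smult smult_add mult_smult one_smult)+
qed

lemma bil_pure_tensor:
  assumes M: "module k M" and N: "module k N"
  shows "bil k M N (tensor k M N) (pure_tensor k M N)"
proof (rule bilI)
  fix x x' y assume "x \<in> carrier M" "x' \<in> carrier M" "y \<in> carrier N"
  then show "pure_tensor k M N (x \<oplus>\<^bsub>M\<^esub> x') y =
      pure_tensor k M N x y \<oplus>\<^bsub>tensor k M N\<^esub> pure_tensor k M N x' y"
    using tensor_class_eq[OF tensor_eq.add_left[of x M x' y N k]]
    by (simp add: pure_tensor_def tensor_class_append)
next
  fix x y y' assume "x \<in> carrier M" "y \<in> carrier N" "y' \<in> carrier N"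
  then show "pure_tensor k M N x (y \<oplus>\<^bsub>N\<^esub> y') =
      pure_tensor k M N x y \<oplus>\<^bsub>tensor k M N\<^esub> pure_tensor k M N x y'"
    using tensor_class_eq[OF tensor_eq.add_right[of x M y N y' k]]
    by (simp add: pure_tensor_def tensor_class_append)
next
  fix r x y assume *: "r \<in> carrier k" "x \<in> carrier M" "y \<in> carrier N"
  show L: "pure_tensor k M N (r \<odot>\<^bsub>M\<^esub> x) y = r \<odot>\<^bsub>tensor k M N\<^esub> pure_tensor k M N x y"
    using * M N tensor_class_scale[of "[(x, y)]"] by (simp add: pure_tensor_def)
  show "pure_tensor k M N x (r \<odot>\<^bsub>N\<^esub> y) = r \<odot>\<^bsub>tensor k M N\<^esub> pure_tensor k M N x y"
    using * L tensor_class_eq[OF tensor_eq.scalar[of r k x M y N]] by (simp add: pure_tensor_def)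
qed simp

lemma pure_tensor_simps [simp]:
  assumes "module k M" "module k N"
  shows "x \<in> carrier M \<Longrightarrow> x' \<in> carrier M \<Longrightarrow> y \<in> carrier N \<Longrightarrow> pure_tensor k M N (x \<oplus>\<^bsub>M\<^esub> x') y =
      pure_tensor k M N x y \<oplus>\<^bsub>tensor k M N\<^esub> pure_tensor k M N x' y"
    and "x \<in> carrier M \<Longrightarrow> y \<in> carrier N \<Longrightarrow> y' \<in> carrier N \<Longrightarrow> pure_tensor k M N x (y \<oplus>\<^bsub>N\<^esub> y') =
      pure_tensor k M N x y \<oplus>\<^bsub>tensor k M N\<^esub> pure_tensor k M N x y'"
    and "r \<in> carrier k \<Longrightarrow> x \<in> carrier M \<Longrightarrow> y \<in> carrier N \<Longrightarrow>
      pure_tensor k M N (r \<odot>\<^bsub>M\<^esub> x) y = r \<odot>\<^bsub>tensor k M N\<^esub> pure_tensor k M N x y"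
    and "r \<in> carrier k \<Longrightarrow> x \<in> carrier M \<Longrightarrow> y \<in> carrier N \<Longrightarrow>
      pure_tensor k M N x (r \<odot>\<^bsub>N\<^esub> y) = r \<odot>\<^bsub>tensor k M N\<^esub> pure_tensor k M N x y"
    and "y \<in> carrier N \<Longrightarrow> pure_tensor k M N \<zero>\<^bsub>M\<^esub> y = \<zero>\<^bsub>tensor k M N\<^esub>"
    and "x \<in> carrier M \<Longrightarrow> pure_tensor k M N x \<zero>\<^bsub>N\<^esub> = \<zero>\<^bsub>tensor k M N\<^esub>"
  using bilD[OF bil_pure_tensor[OF assms]] bil_zeroL[OF bil_pure_tensor[OF assms]]
    bil_zeroR[OF bil_pure_tensor[OF assms]] assms by simp_all

lemma tensor_induct [consumes 3, case_names zero pure add]: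
  assumes "z \<in> carrier (tensor k M N)" "module k M" "module k N"
    and "Q \<zero>\<^bsub>tensor k M N\<^esub>"
    and "\<And>m n. m \<in> carrier M \<Longrightarrow> n \<in> carrier N \<Longrightarrow> Q (pure_tensor k M N m n)"
    and "\<And>x y. x \<in> carrier (tensor k M N) \<Longrightarrow> y \<in> carrier (tensor k M N) \<Longrightarrow> Q x \<Longrightarrow> Q y \<Longrightarrow>
      Q (x \<oplus>\<^bsub>tensor k M N\<^esub> y)"
  shows "Q z"
  using assms(1) by (induction rule: tensor_induct_step) (use assms in auto)

text \<open>The universal property. The sum of \<beta> over a list respects each generating relation
  of \<open>tensor_eq\<close>, so \<open>tensor_lift\<close>, which is evaluated on the stored list,
  has the same value on every representing list.\<close>

lemma lin_tensor_lift:
  fixes M N :: "('k, 'a) kmod"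
  assumes M: "module k M" and N: "module k N" and P: "module k P" and b: "bil k M N P \<beta>"
  shows "lin k (tensor k M N) P (tensor_lift P \<beta>)"
    and "m \<in> carrier M \<Longrightarrow> n \<in> carrier N \<Longrightarrow> tensor_lift P \<beta> (pure_tensor k M N m n) = \<beta> m n"
proof -
  let ?L = "lists (carrier M \<times> carrier N)"
  define F where "F xs = foldr (\<lambda>(m, n) s. \<beta> m n \<oplus>\<^bsub>P\<^esub> s) xs \<zero>\<^bsub>P\<^esub>" for xs
  have F_closed: "F xs \<in> carrier P" if "xs \<in> ?L" for xs
    using that by (induction xs) (auto simp: F_def P bil_closed[OF b])
  have F_append: "F (xs @ ys) = F xs \<oplus>\<^bsub>P\<^esub> F ys" if "xs \<in> ?L" "ys \<in> ?L" for xs ys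
    using that(1)
  proof (induction xs)
    case Nil
    then show ?case using F_closed[OF that(2)] P by (simp add: F_def)
  next
    case (Cons x xs)
    obtain m n where x: "x = (m, n)" by (cases x)
    have "F ((x # xs) @ ys) = \<beta> m n \<oplus>\<^bsub>P\<^esub> F (xs @ ys)" "F (x # xs) = \<beta> m n \<oplus>\<^bsub>P\<^esub> F xs"
      by (simp_all add: F_def x)
    then show ?case using Cons F_closed[OF that(2)] F_closed[of xs] P
      by (simp add: x mod_assoc bil_closed[OF b])
  qed
  have F_single: "F [(m, n)] = \<beta> m n" if "m \<in> carrier M" "n \<in> carrier N" for m n
    using that P by (simp add: F_def bil_closed[OF b])
  have F_eq: "F xs = F ys" if "tensor_eq k M N xs ys" for xs ys
    using that
  proof induction
    case (append xs xs' ys ys')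
    then show ?case by (metis F_append M N tensor_eq_lists)
  next
    case (commute xs ys)
    then show ?case using P by (simp add: F_append mod_comm F_closed)
  next
    case (zero n)
    then show ?case using M P F_single by (simp add: bil_zeroL[OF b]) (simp add: F_def)
  next
    case (add_left m m' n)
    then have "F ([(m, n)] @ [(m', n)]) = F [(m, n)] \<oplus>\<^bsub>P\<^esub> F [(m', n)]"
      by (intro F_append) auto
    then show ?case using add_left M by (simp add: F_single bilD[OF b])
  next
    case (add_right m n n')
    then have "F ([(m, n)] @ [(m, n')]) = F [(m, n)] \<oplus>\<^bsub>P\<^esub> F [(m, n')]"
      by (intro F_append) auto
    then show ?case using add_right N by (simp add: F_single bilD[OF b])
  next
    case (scalar r m n)
    then show ?case using M N by (simp add: F_single bilD[OF b])
  qed auto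
  have lift_class: "tensor_lift P \<beta> (tensor_class k M N xs) = F xs" if "xs \<in> ?L" for xs
    using F_eq[OF tensor_class_terms[OF that]] by (simp add: tensor_lift_def F_def)
  show "m \<in> carrier M \<Longrightarrow> n \<in> carrier N \<Longrightarrow> tensor_lift P \<beta> (pure_tensor k M N m n) = \<beta> m n"
    by (simp add: pure_tensor_def lift_class F_single)
  show "lin k (tensor k M N) P (tensor_lift P \<beta>)"
  proof (rule linI)
    fix r x assume r: "r \<in> carrier k" and "x \<in> carrier (tensor k M N)"
    then obtain xs where xs: "xs \<in> ?L" "x = tensor_class k M N xs" by (auto elim: tensor_carrierE)
    let ?s = "map (\<lambda>(m, n). (r \<odot>\<^bsub>M\<^esub> m, n))"
    have "?s xs \<in> ?L" using xs M r by (force simp: in_lists_conv_set)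
    moreover have "F (?s xs) = r \<odot>\<^bsub>P\<^esub> F xs" using xs(1)
    proof (induction xs)
      case Nil
      then show ?case using P r by (simp add: F_def)
    next
      case (Cons x xs)
      obtain m n where x: "x = (m, n)" by (cases x)
      have "F (?s (x # xs)) = \<beta> (r \<odot>\<^bsub>M\<^esub> m) n \<oplus>\<^bsub>P\<^esub> F (?s xs)" "F (x # xs) = \<beta> m n \<oplus>\<^bsub>P\<^esub> F xs"
        by (simp_all add: F_def x)
      then show ?case using Cons F_closed[of xs] P r x
        by (simp add: bilD[OF b] module.smult_r_distr)
    qed
    ultimately show "tensor_lift P \<beta> (r \<odot>\<^bsub>tensor k M N\<^esub> x) = r \<odot>\<^bsub>P\<^esub> tensor_lift P \<beta> x"
      using xs r M N by (simp add: tensor_class_scale lift_class)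
  qed (elim tensor_carrierE, simp add: lift_class F_closed F_append tensor_class_append
      del: in_lists_conv_set)+
qed

lemma lin_eq_on_tensor:
  assumes "lin k (tensor k M N) P f" "lin k (tensor k M N) P g"
    and "module k M" "module k N" "module k P"
    and "\<And>m n. m \<in> carrier M \<Longrightarrow> n \<in> carrier N \<Longrightarrow> f (pure_tensor k M N m n) =
        g (pure_tensor k M N m n)"
    and "z \<in> carrier (tensor k M N)"
  shows "f z = g z"
  using assms(7,3,4)
  by (induction rule: tensor_induct)
    (use assms in \<open>simp_all add: lin_add[OF assms(1)] lin_add[OF assms(2)] lin_zero\<close>)

text \<open>A lift that depends linearly on a parameter p is bilinear. Nested lifts such as those in
  \<open>assoc_map\<close> and \<open>componentwise\<close> are treated by repeated use of
  this.\<close>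

lemma bil_tensor_lift:
  fixes M N :: "('k, 'a) kmod"
  assumes M: "module k M" and N: "module k N" and P: "module k P" and Q: "module k Q"
    and b: "\<And>p. p \<in> carrier P \<Longrightarrow> bil k M N Q (\<gamma> p)"
    and l: "\<And>m n. m \<in> carrier M \<Longrightarrow> n \<in> carrier N \<Longrightarrow> lin k P Q (\<lambda>p. \<gamma> p m n)"
  shows "bil k (tensor k M N) P Q (\<lambda>y p. tensor_lift Q (\<gamma> p) y)"
proof -
  note lift = lin_tensor_lift[OF M N Q b]
  have add: "tensor_lift Q (\<gamma> (p \<oplus>\<^bsub>P\<^esub> p')) y = tensor_lift Q (\<gamma> p) y \<oplus>\<^bsub>Q\<^esub> tensor_lift Q (\<gamma> p') y"
    if p: "p \<in> carrier P" "p' \<in> carrier P" and y: "y \<in> carrier (tensor k M N)" for p p' y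
    using y M N
  proof (induction y rule: tensor_induct)
    case (add x y)
    have "module k Q" by (rule Q)
    then show ?case using add p P
      by (simp add: lin_add[OF lift(1)] mod_assoc lin_closed[OF lift(1)])
         (simp add: mod_lcomm lin_closed[OF lift(1)])
  qed (use p P Q in \<open>simp_all add: lift(2) lin_add[OF l] lin_zero[OF lift(1)] M N\<close>)
  have smult: "tensor_lift Q (\<gamma> (r \<odot>\<^bsub>P\<^esub> p)) y = r \<odot>\<^bsub>Q\<^esub> tensor_lift Q (\<gamma> p) y"
    if p: "p \<in> carrier P" "r \<in> carrier k" and y: "y \<in> carrier (tensor k M N)" for p r y
    using y M N
  proof (induction y rule: tensor_induct)
    case (add x y)
    then show ?case using p P
      by (simp add: lin_add[OF lift(1)] module.smult_r_distr[OF Q] lin_closed[OF lift(1)])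
  qed (use p P Q in \<open>simp_all add: lift(2) lin_smult[OF l] lin_zero[OF lift(1)] M N\<close>)
  show ?thesis
    by (rule bilI) (simp_all add: linD[OF lift(1)] add smult)
qed

end

section \<open>Independence of the multiplication and unit fields\<close>

lemma tensor_eq_cong:
  assumes "tensor_eq k M N xs ys"
    and "carrier M' = carrier M" "\<zero>\<^bsub>M'\<^esub> = \<zero>\<^bsub>M\<^esub>" "add M' = add M" "smult M' = smult M"
    and "carrier N' = carrier N" "\<zero>\<^bsub>N'\<^esub> = \<zero>\<^bsub>N\<^esub>" "add N' = add N" "smult N' = smult N"
  shows "tensor_eq k M' N' xs ys"
  using assms(1)
proof induction
  case (add_left m m' n)
  then show ?case using tensor_eq.add_left[of m M' m' n N' k] assms by simp
next
  case (add_right m n n')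
  then show ?case using tensor_eq.add_right[of m M' n N' n' k] assms by simp
next
  case (scalar r m n)
  then show ?case using tensor_eq.scalar[of r k m M' n N'] assms by simp
next
  case (zero n)
  then show ?case using tensor_eq.zero[of n N' k M'] assms by simp
next
  case (refl xs)
  then show ?case using assms by (simp add: tensor_eq.refl del: in_lists_conv_set)
next
  case (commute xs ys)
  then show ?case using assms by (simp add: tensor_eq.commute del: in_lists_conv_set)
qed (blast intro: tensor_eq.intros)+

text \<open>An algebra and its underlying module differ in the fields \<open>mult\<close> and
  \<open>one\<close>, while strictness demands equality of tensor products as records. These rules
  make the tensor product insensitive to the two fields.\<close>

lemma tensor_eq_update [simp]:
  "tensor_eq k (M\<lparr>mult := p\<rparr>) N = tensor_eq k M N" "tensor_eq k (M\<lparr>one := u\<rparr>) N = tensor_eq k M N"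
  "tensor_eq k M (N\<lparr>mult := p\<rparr>) = tensor_eq k M N" "tensor_eq k M (N\<lparr>one := u\<rparr>) = tensor_eq k M N"
  by (intro ext iffI; erule tensor_eq_cong; simp)+

lemma tensor_update [simp]:
  "tensor k (M\<lparr>mult := p\<rparr>) N = tensor k M N" "tensor k (M\<lparr>one := u\<rparr>) N = tensor k M N"
  "tensor k M (N\<lparr>mult := p\<rparr>) = tensor k M N" "tensor k M (N\<lparr>one := u\<rparr>) = tensor k M N"
  "pure_tensor k (M\<lparr>mult := p\<rparr>) N = pure_tensor k M N"
  "pure_tensor k (M\<lparr>one := u\<rparr>) N = pure_tensor k M N"
  "pure_tensor k M (N\<lparr>mult := p\<rparr>) = pure_tensor k M N"
  "pure_tensor k M (N\<lparr>one := u\<rparr>) = pure_tensor k M N"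
  by (simp_all add: fun_eq_iff tensor_def pure_tensor_def tensor_class_def cong: map_cong)

lemma underlying_simps [simp]:
  "carrier (underlying M) = carrier M" "\<zero>\<^bsub>underlying M\<^esub> = \<zero>\<^bsub>M\<^esub>" "add (underlying M) = add M"
  "smult (underlying M) = smult M" "mult (underlying M) = undefined"
  by (simp_all add: underlying_def)

lemma algebra_tensor_simps [simp]:
  "carrier (algebra_tensor k M N) = carrier (tensor k M N)"
  "\<zero>\<^bsub>algebra_tensor k M N\<^esub> = \<zero>\<^bsub>tensor k M N\<^esub>"
  "add (algebra_tensor k M N) = add (tensor k M N)"
  "smult (algebra_tensor k M N) = smult (tensor k M N)"
  "mult (algebra_tensor k M N) = componentwise k M N (mult M) (mult N)"
  by (simp_all add: algebra_tensor_def)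

lemma tensor_lift_update [simp]:
  "tensor_lift (M\<lparr>mult := p\<rparr>) = tensor_lift M" "tensor_lift (M\<lparr>one := u\<rparr>) = tensor_lift M"
  by (simp_all add: fun_eq_iff tensor_lift_def)

lemma componentwise_update [simp]:
  "componentwise k (M\<lparr>mult := p\<rparr>) N = componentwise k M N"
  "componentwise k (M\<lparr>one := u\<rparr>) N = componentwise k M N"
  "componentwise k M (N\<lparr>mult := p\<rparr>) = componentwise k M N"
  "componentwise k M (N\<lparr>one := u\<rparr>) = componentwise k M N"
  by (simp_all add: fun_eq_iff componentwise_def)

lemma underlying_reduct [simp]:
  "tensor k (underlying M) N = tensor k M N" "tensor k M (underlying N) = tensor k M N"
  "pure_tensor k (underlying M) N = pure_tensor k M N"
  "pure_tensor k M (underlying N) = pure_tensor k M N"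
  "componentwise k (underlying M) N = componentwise k M N"
  "componentwise k M (underlying N) = componentwise k M N"
  "tensor_lift (underlying P) = tensor_lift P"
  "assoc_map k (underlying M) N P = assoc_map k M N P"
  "assoc_map k M (underlying N) P = assoc_map k M N P"
  "assoc_map k M N (underlying P) = assoc_map k M N P"
  "lunit_map k (underlying M) = lunit_map k M"
  "runit_map k (underlying M) = runit_map k M"
  by (simp_all add: underlying_def assoc_map_def lunit_map_def runit_map_def tensor_lift_def)

lemma algebra_tensor_reduct [simp]:
  "tensor k (algebra_tensor k M M') N = tensor k (tensor k M M') N"
  "tensor k N (algebra_tensor k M M') = tensor k N (tensor k M M')"
  "pure_tensor k (algebra_tensor k M M') N = pure_tensor k (tensor k M M') N"
  "pure_tensor k N (algebra_tensor k M M') = pure_tensor k N (tensor k M M')"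
  "componentwise k (algebra_tensor k M M') N = componentwise k (tensor k M M') N"
  "componentwise k N (algebra_tensor k M M') = componentwise k N (tensor k M M')"
  "tensor_lift (algebra_tensor k M M') = tensor_lift (tensor k M M')"
  by (simp_all add: algebra_tensor_def)

lemma underlying_algebra_tensor [simp]: "underlying (algebra_tensor k M N) = tensor k M N"
  by (simp add: underlying_def algebra_tensor_def tensor_def)

lemma module_reduct:
  fixes M M' :: "('k, 'u) module"
  assumes "carrier M' = carrier M" "\<zero>\<^bsub>M'\<^esub> = \<zero>\<^bsub>M\<^esub>" "add M' = add M" "smult M' = smult M"
  shows "module k M \<longleftrightarrow> module k M'"
  using assms
  by (simp add: module_def module_axioms_def abelian_group_def abelian_monoid_def
      abelian_group_axioms_def)

lemma lin_reduct [simp]: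
  "lin k (underlying M) N = lin k M N" "lin k M (underlying N) = lin k M N"
  "lin k (algebra_tensor k P Q) N = lin k (tensor k P Q) N"
  "lin k M (algebra_tensor k P Q) = lin k M (tensor k P Q)"
  by (simp_all add: fun_eq_iff lin_def)

lemma bil_reduct [simp]:
  "bil k (underlying M) N P = bil k M N P" "bil k M (underlying N) P = bil k M N P"
  "bil k M N (underlying P) = bil k M N P"
  "bil k (algebra_tensor k A B) N P = bil k (tensor k A B) N P"
  "bil k M (algebra_tensor k A B) P = bil k M (tensor k A B) P"
  "bil k M N (algebra_tensor k A B) = bil k M N (tensor k A B)"
  by (simp_all add: fun_eq_iff bil_def)

lemma linear_maps_reduct [simp]:
  "linear_maps k (underlying M) N = linear_maps k M N"
  "linear_maps k M (underlying N) = linear_maps k M N"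
  "linear_maps k (algebra_tensor k A B) N = linear_maps k (tensor k A B) N"
  "linear_maps k M (algebra_tensor k A B) = linear_maps k M (tensor k A B)"
  by (simp_all add: linear_maps_def)

lemma scalar_algebra_simps [simp]:
  "carrier (scalar_algebra k) = Scalar ` carrier k" "\<zero>\<^bsub>scalar_algebra k\<^esub> = Scalar \<zero>\<^bsub>k\<^esub>"
  "Scalar r \<oplus>\<^bsub>scalar_algebra k\<^esub> Scalar s = Scalar (r \<oplus>\<^bsub>k\<^esub> s)"
  "t \<odot>\<^bsub>scalar_algebra k\<^esub> Scalar r = Scalar (t \<otimes>\<^bsub>k\<^esub> r)"
  "Scalar r \<otimes>\<^bsub>scalar_algebra k\<^esub> Scalar s = Scalar (r \<otimes>\<^bsub>k\<^esub> s)"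
  by (simp_all add: scalar_algebra_def)

context scalars
begin

lemma module_underlying [simp]: "module k (underlying M) \<longleftrightarrow> module k M"
  using module_reduct[of "underlying M" M k] by simp

lemma module_algebra_tensor [simp]: "module k (algebra_tensor k M N) \<longleftrightarrow> module k (tensor k M N)"
  using module_reduct[of "algebra_tensor k M N" "tensor k M N" k] by simp

lemma module_scalar_algebra [simp]: "module k (scalar_algebra k)"
proof (intro moduleI cring abelian_groupI)
  fix x :: "('k, 'a) univ" assume "x \<in> carrier (scalar_algebra k)"
  then show "\<exists>y \<in> carrier (scalar_algebra k). y \<oplus>\<^bsub>scalar_algebra k\<^esub> x = \<zero>\<^bsub>scalar_algebra k\<^esub>"
    by (auto simp: k.l_neg intro!: bexI[of _ "\<ominus>\<^bsub>k\<^esub> _"])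
qed (auto simp: k.a_ac k.m_ac k.l_distr k.r_distr)

text \<open>An arrow of k-modules without the extensionality that \<open>mod_cat\<close> demands.
  Images of arrows under \<open>forget_arrow\<close> qualify, and so does a record with the plain
  identity function.\<close>

definition kmap :: "('k, 'a) kmap \<Rightarrow> bool" where
  "kmap f \<longleftrightarrow> module k (src f) \<and> module k (tgt f) \<and> lin k (src f) (tgt f) (fn f)"

lemma kmapD:
  assumes "kmap f"
  shows "module k (src f)" "module k (tgt f)" "x \<in> carrier (src f) \<Longrightarrow> fn f x \<in> carrier (tgt f)"
    and "fn f \<zero>\<^bsub>src f\<^esub> = \<zero>\<^bsub>tgt f\<^esub>"
    and "x \<in> carrier (src f) \<Longrightarrow> y \<in> carrier (src f) \<Longrightarrow> fn f (x \<oplus>\<^bsub>src f\<^esub> y) = fn f x \<oplus>\<^bsub>tgt f\<^esub> fn f y"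
    and "r \<in> carrier k \<Longrightarrow> x \<in> carrier (src f) \<Longrightarrow> fn f (r \<odot>\<^bsub>src f\<^esub> x) = r \<odot>\<^bsub>tgt f\<^esub> fn f x"
proof -
  have *: "module k (src f)" "module k (tgt f)" "lin k (src f) (tgt f) (fn f)"
    using assms by (simp_all add: kmap_def)
  from * show "module k (src f)" "module k (tgt f)" by simp_all
  from * show "fn f \<zero>\<^bsub>src f\<^esub> = \<zero>\<^bsub>tgt f\<^esub>" by (intro lin_zero)
qed (use assms in \<open>simp_all add: kmap_def lin_def\<close>)

declare kmapD [simp]

lemma kmap_lin: "kmap f \<Longrightarrow> lin k (src f) (tgt f) (fn f)"
  unfolding kmap_def by blast

lemma bil_comp:
  assumes "bil k M N P \<beta>" "lin k M' M f" "lin k N' N g"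
  shows "bil k M' N' P (\<lambda>x y. \<beta> (f x) (g y))"
  by (rule bilI) (simp_all add: bilD[OF assms(1)] linD[OF assms(2)] linD[OF assms(3)])

lemma lin_restrict: "module k M \<Longrightarrow> lin k M N (\<lambda>x \<in> carrier M. f x) \<longleftrightarrow> lin k M N f"
  by (rule lin_cong) simp_all

section \<open>Tensor products of maps and the constraint maps of k-modules\<close>

lemma tensor_map_lin:
  assumes f: "kmap f" and g: "kmap g"
  shows "lin k (tensor k (src f) (src g)) (tensor k (tgt f) (tgt g)) (tensor_map k f g)"
    and "x \<in> carrier (src f) \<Longrightarrow> y \<in> carrier (src g) \<Longrightarrow>
      tensor_map k f g (pure_tensor k (src f) (src g) x y) =
      pure_tensor k (tgt f) (tgt g) (fn f x) (fn g y)"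
proof -
  have "bil k (src f) (src g) (tensor k (tgt f) (tgt g))
      (\<lambda>m n. pure_tensor k (tgt f) (tgt g) (fn f m) (fn g n))"
    by (rule bil_comp[where f = "fn f" and g = "fn g", OF bil_pure_tensor])
      (simp_all add: f g kmap_lin)
  note * = lin_tensor_lift[OF kmapD(1)[OF f] kmapD(1)[OF g] _ this]
  show "lin k (tensor k (src f) (src g)) (tensor k (tgt f) (tgt g)) (tensor_map k f g)"
    unfolding tensor_map_def by (rule iffD2[OF lin_restrict], simp_all add: f g, rule *(1),
        simp add: f g)
  show "x \<in> carrier (src f) \<Longrightarrow> y \<in> carrier (src g) \<Longrightarrow>
      tensor_map k f g (pure_tensor k (src f) (src g) x y) =
      pure_tensor k (tgt f) (tgt g) (fn f x) (fn g y)"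
    using f g by (simp add: tensor_map_def *(2))
qed

lemma tensor_map_simps [simp]:
  assumes f: "kmap f" and g: "kmap g"
  shows "x \<in> carrier (src f) \<Longrightarrow> y \<in> carrier (src g) \<Longrightarrow>
      tensor_map k f g (pure_tensor k (src f) (src g) x y) =
      pure_tensor k (tgt f) (tgt g) (fn f x) (fn g y)"
    and "z \<in> carrier (tensor k (src f) (src g)) \<Longrightarrow>
      tensor_map k f g z \<in> carrier (tensor k (tgt f) (tgt g))"
    and "z \<in> carrier (tensor k (src f) (src g)) \<Longrightarrow> w \<in> carrier (tensor k (src f) (src g)) \<Longrightarrow>
      tensor_map k f g (z \<oplus>\<^bsub>tensor k (src f) (src g)\<^esub> w) =
      tensor_map k f g z \<oplus>\<^bsub>tensor k (tgt f) (tgt g)\<^esub> tensor_map k f g w"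
    and "tensor_map k f g \<zero>\<^bsub>tensor k (src f) (src g)\<^esub> = \<zero>\<^bsub>tensor k (tgt f) (tgt g)\<^esub>"
  using tensor_map_lin[OF f g] lin_zero[OF tensor_map_lin(1)[OF f g]] f g by (simp_all add: linD)

lemma tensor3_induct [consumes 4, case_names zero pure add]:
  assumes z: "z \<in> carrier (tensor k (tensor k M N) P)"
    and M: "module k M" and N: "module k N" and P: "module k P"
    and Q: "Q \<zero>\<^bsub>tensor k (tensor k M N) P\<^esub>"
    "\<And>m n p. m \<in> carrier M \<Longrightarrow> n \<in> carrier N \<Longrightarrow> p \<in> carrier P \<Longrightarrow>
      Q (pure_tensor k (tensor k M N) P (pure_tensor k M N m n) p)"
    "\<And>x y. x \<in> carrier (tensor k (tensor k M N) P) \<Longrightarrow> y \<in> carrier (tensor k (tensor k M N) P) \<Longrightarrow>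
      Q x \<Longrightarrow> Q y \<Longrightarrow> Q (x \<oplus>\<^bsub>tensor k (tensor k M N) P\<^esub> y)"
  shows "Q z"
  using z tensor_module[OF M N] P
proof (induction rule: tensor_induct)
  case (pure t p)
  show ?case using pure(1) M N
    by (induction rule: tensor_induct) (use M N P Q pure in simp_all)
qed (use Q in auto)

lemma tensor4_induct [consumes 5, case_names zero pure add]:
  assumes z: "z \<in> carrier (tensor k (tensor k (tensor k M N) P) R)"
    and M: "module k M" and N: "module k N" and P: "module k P" and R: "module k R"
    and Q: "Q \<zero>\<^bsub>tensor k (tensor k (tensor k M N) P) R\<^esub>"
    "\<And>m n p r. m \<in> carrier M \<Longrightarrow> n \<in> carrier N \<Longrightarrow> p \<in> carrier P \<Longrightarrow> r \<in> carrier R \<Longrightarrow>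
      Q (pure_tensor k (tensor k (tensor k M N) P) R
          (pure_tensor k (tensor k M N) P (pure_tensor k M N m n) p) r)"
    "\<And>x y. x \<in> carrier (tensor k (tensor k (tensor k M N) P) R) \<Longrightarrow>
      y \<in> carrier (tensor k (tensor k (tensor k M N) P) R) \<Longrightarrow>
      Q x \<Longrightarrow> Q y \<Longrightarrow> Q (x \<oplus>\<^bsub>tensor k (tensor k (tensor k M N) P) R\<^esub> y)"
  shows "Q z"
  using z tensor_module[OF tensor_module[OF M N] P] R
proof (induction rule: tensor_induct)
  case (pure t p)
  show ?case using pure(1) M N P
    by (induction rule: tensor3_induct) (use M N P R Q pure in simp_all)
qed (use Q in auto)

definition assoc_inv :: "('k, 'a) kmod \<Rightarrow> ('k, 'a) kmod \<Rightarrow> ('k, 'a) kmod \<Rightarrow>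
    ('k, 'a) univ \<Rightarrow> ('k, 'a) univ" where
  "assoc_inv M N P =
     (\<lambda>x \<in> carrier (tensor k M (tensor k N P)).
        tensor_lift (tensor k (tensor k M N) P)
          (\<lambda>m y. tensor_lift (tensor k (tensor k M N) P)
             (\<lambda>n p. pure_tensor k (tensor k M N) P (pure_tensor k M N m n) p) y) x)"

lemma assoc_map_lin:
  assumes M: "module k M" and N: "module k N" and P: "module k P"
  shows "lin k (tensor k (tensor k M N) P) (tensor k M (tensor k N P)) (assoc_map k M N P)"
    and "m \<in> carrier M \<Longrightarrow> n \<in> carrier N \<Longrightarrow> p \<in> carrier P \<Longrightarrow>
      assoc_map k M N P (pure_tensor k (tensor k M N) P (pure_tensor k M N m n) p) =
      pure_tensor k M (tensor k N P) m (pure_tensor k N P n p)"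
proof -
  let ?T = "tensor k M (tensor k N P)"
  let ?g = "\<lambda>p m n. pure_tensor k M (tensor k N P) m (pure_tensor k N P n p)"
  have b: "bil k M N ?T (?g p)" if "p \<in> carrier P" for p
    by (rule bilI) (use that M N P in simp_all)
  have l: "lin k P ?T (\<lambda>p. ?g p m n)" if "m \<in> carrier M" "n \<in> carrier N" for m n
    by (rule linI) (use that M N P in simp_all)
  have "bil k (tensor k M N) P ?T (\<lambda>y p. tensor_lift ?T (?g p) y)"
    by (rule bil_tensor_lift) (use M N P b l in simp_all)
  note lift = lin_tensor_lift[OF _ _ _ this]
  show "lin k (tensor k (tensor k M N) P) ?T (assoc_map k M N P)"
    using lift(1) M N P by (simp add: assoc_map_def lin_restrict)
  show "m \<in> carrier M \<Longrightarrow> n \<in> carrier N \<Longrightarrow> p \<in> carrier P \<Longrightarrow>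
      assoc_map k M N P (pure_tensor k (tensor k M N) P (pure_tensor k M N m n) p) =
      pure_tensor k M (tensor k N P) m (pure_tensor k N P n p)"
    using lift(2) M N P lin_tensor_lift(2)[OF _ _ _ b] by (simp add: assoc_map_def)
qed

lemma assoc_inv_lin:
  assumes M: "module k M" and N: "module k N" and P: "module k P"
  shows "lin k (tensor k M (tensor k N P)) (tensor k (tensor k M N) P) (assoc_inv M N P)"
    and "m \<in> carrier M \<Longrightarrow> n \<in> carrier N \<Longrightarrow> p \<in> carrier P \<Longrightarrow>
      assoc_inv M N P (pure_tensor k M (tensor k N P) m (pure_tensor k N P n p)) =
      pure_tensor k (tensor k M N) P (pure_tensor k M N m n) p"
proof -
  let ?T = "tensor k (tensor k M N) P"
  let ?g = "\<lambda>m n p. pure_tensor k (tensor k M N) P (pure_tensor k M N m n) p"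
  have b: "bil k N P ?T (?g m)" if "m \<in> carrier M" for m
    by (rule bilI) (use that M N P in simp_all)
  have l: "lin k M ?T (\<lambda>m. ?g m n p)" if "p \<in> carrier P" "n \<in> carrier N" for p n
    by (rule linI) (use that M N P in simp_all)
  have "bil k (tensor k N P) M ?T (\<lambda>y m. tensor_lift ?T (?g m) y)"
    by (rule bil_tensor_lift) (use M N P b l in simp_all)
  from bil_flip[OF this] have "bil k M (tensor k N P) ?T (\<lambda>m y. tensor_lift ?T (?g m) y)" .
  note lift = lin_tensor_lift[OF _ _ _ this]
  show "lin k (tensor k M (tensor k N P)) ?T (assoc_inv M N P)"
    using lift(1) M N P by (simp add: assoc_inv_def lin_restrict)
  show "m \<in> carrier M \<Longrightarrow> n \<in> carrier N \<Longrightarrow> p \<in> carrier P \<Longrightarrow>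
      assoc_inv M N P (pure_tensor k M (tensor k N P) m (pure_tensor k N P n p)) =
      pure_tensor k (tensor k M N) P (pure_tensor k M N m n) p"
    using lift(2) M N P lin_tensor_lift(2)[OF _ _ _ b] by (simp add: assoc_inv_def)
qed

lemma assoc_simps [simp]:
  assumes M: "module k M" and N: "module k N" and P: "module k P"
  defines "S \<equiv> tensor k (tensor k M N) P" and "T \<equiv> tensor k M (tensor k N P)"
  shows "m \<in> carrier M \<Longrightarrow> n \<in> carrier N \<Longrightarrow> p \<in> carrier P \<Longrightarrow>
      assoc_map k M N P (pure_tensor k (tensor k M N) P (pure_tensor k M N m n) p) =
      pure_tensor k M (tensor k N P) m (pure_tensor k N P n p)"
    and "z \<in> carrier S \<Longrightarrow> assoc_map k M N P z \<in> carrier T"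
    and "z \<in> carrier S \<Longrightarrow> w \<in> carrier S \<Longrightarrow>
      assoc_map k M N P (z \<oplus>\<^bsub>S\<^esub> w) = assoc_map k M N P z \<oplus>\<^bsub>T\<^esub> assoc_map k M N P w"
    and "assoc_map k M N P \<zero>\<^bsub>S\<^esub> = \<zero>\<^bsub>T\<^esub>"
    and "m \<in> carrier M \<Longrightarrow> n \<in> carrier N \<Longrightarrow> p \<in> carrier P \<Longrightarrow>
      assoc_inv M N P (pure_tensor k M (tensor k N P) m (pure_tensor k N P n p)) =
      pure_tensor k (tensor k M N) P (pure_tensor k M N m n) p"
    and "z' \<in> carrier T \<Longrightarrow> assoc_inv M N P z' \<in> carrier S"
    and "z' \<in> carrier T \<Longrightarrow> w' \<in> carrier T \<Longrightarrow>
      assoc_inv M N P (z' \<oplus>\<^bsub>T\<^esub> w') = assoc_inv M N P z' \<oplus>\<^bsub>S\<^esub> assoc_inv M N P w'"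
    and "assoc_inv M N P \<zero>\<^bsub>T\<^esub> = \<zero>\<^bsub>S\<^esub>"
  using assoc_map_lin[OF M N P] assoc_inv_lin[OF M N P] lin_zero[OF assoc_map_lin(1)[OF M N P]]
    lin_zero[OF assoc_inv_lin(1)[OF M N P]] M N P
  unfolding S_def T_def by (simp_all add: linD)

lemma assoc_inv_left [simp]:
  assumes M: "module k M" and N: "module k N" and P: "module k P"
    and z: "z \<in> carrier (tensor k (tensor k M N) P)"
  shows "assoc_inv M N P (assoc_map k M N P z) = z"
  using z M N P by (induction rule: tensor3_induct) (use M N P in simp_all)

lemma assoc_inv_right [simp]:
  assumes M: "module k M" and N: "module k N" and P: "module k P"
    and z: "z \<in> carrier (tensor k M (tensor k N P))"
  shows "assoc_map k M N P (assoc_inv M N P z) = z"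
  using z M tensor_module[OF N P]
proof (induction rule: tensor_induct)
  case (pure m y)
  show ?case using pure(2) N P by (induction rule: tensor_induct) (use M N P pure in simp_all)
qed (use M N P in simp_all)

definition lunit_inv :: "('k, 'a) kmod \<Rightarrow> ('k, 'a) univ \<Rightarrow> ('k, 'a) univ" where
  "lunit_inv M = (\<lambda>m \<in> carrier M. pure_tensor k (scalar_algebra k) M (Scalar \<one>\<^bsub>k\<^esub>) m)"

definition runit_inv :: "('k, 'a) kmod \<Rightarrow> ('k, 'a) univ \<Rightarrow> ('k, 'a) univ" where
  "runit_inv M = (\<lambda>m \<in> carrier M. pure_tensor k M (scalar_algebra k) m (Scalar \<one>\<^bsub>k\<^esub>))"

lemma lunit_map_lin:
  assumes M: "module k M"
  shows "lin k (tensor k (scalar_algebra k) M) M (lunit_map k M)"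
    and "r \<in> carrier k \<Longrightarrow> m \<in> carrier M \<Longrightarrow>
      lunit_map k M (pure_tensor k (scalar_algebra k) M (Scalar r) m) = r \<odot>\<^bsub>M\<^esub> m"
    and "lin k M (tensor k (scalar_algebra k) M) (lunit_inv M)"
proof -
  have "bil k (scalar_algebra k) M M (\<lambda>r m. the_scalar r \<odot>\<^bsub>M\<^esub> m)"
    using M by (intro bilI) (auto simp: module.smult_l_distr module.smult_r_distr
        module.smult_assoc1[symmetric] k.m_comm)
  from lin_tensor_lift[OF module_scalar_algebra M M this] M
  show "lin k (tensor k (scalar_algebra k) M) M (lunit_map k M)"
    and "r \<in> carrier k \<Longrightarrow> m \<in> carrier M \<Longrightarrow>
      lunit_map k M (pure_tensor k (scalar_algebra k) M (Scalar r) m) = r \<odot>\<^bsub>M\<^esub> m"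
    by (simp_all add: lunit_map_def lin_restrict)
  show "lin k M (tensor k (scalar_algebra k) M) (lunit_inv M)"
    unfolding lunit_inv_def using M by (simp add: lin_restrict) (rule linI; simp)
qed

lemma runit_map_lin:
  assumes M: "module k M"
  shows "lin k (tensor k M (scalar_algebra k)) M (runit_map k M)"
    and "r \<in> carrier k \<Longrightarrow> m \<in> carrier M \<Longrightarrow>
      runit_map k M (pure_tensor k M (scalar_algebra k) m (Scalar r)) = r \<odot>\<^bsub>M\<^esub> m"
    and "lin k M (tensor k M (scalar_algebra k)) (runit_inv M)"
proof -
  have "bil k (scalar_algebra k) M M (\<lambda>r m. the_scalar r \<odot>\<^bsub>M\<^esub> m)"
    using M by (intro bilI) (auto simp: module.smult_l_distr module.smult_r_distr
        module.smult_assoc1[symmetric] k.m_comm)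
  from lin_tensor_lift[OF M module_scalar_algebra M bil_flip[OF this]] M
  show "lin k (tensor k M (scalar_algebra k)) M (runit_map k M)"
    and "r \<in> carrier k \<Longrightarrow> m \<in> carrier M \<Longrightarrow>
      runit_map k M (pure_tensor k M (scalar_algebra k) m (Scalar r)) = r \<odot>\<^bsub>M\<^esub> m"
    by (simp_all add: runit_map_def lin_restrict)
  show "lin k M (tensor k M (scalar_algebra k)) (runit_inv M)"
    unfolding runit_inv_def using M by (simp add: lin_restrict) (rule linI; simp)
qed

lemma unit_simps [simp]:
  assumes M: "module k M"
  defines "L \<equiv> tensor k (scalar_algebra k) M" and "R \<equiv> tensor k M (scalar_algebra k)"
  shows "r \<in> carrier k \<Longrightarrow> m \<in> carrier M \<Longrightarrow>
      lunit_map k M (pure_tensor k (scalar_algebra k) M (Scalar r) m) = r \<odot>\<^bsub>M\<^esub> m"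
    and "z \<in> carrier L \<Longrightarrow> lunit_map k M z \<in> carrier M"
    and "z \<in> carrier L \<Longrightarrow> w \<in> carrier L \<Longrightarrow>
      lunit_map k M (z \<oplus>\<^bsub>L\<^esub> w) = lunit_map k M z \<oplus>\<^bsub>M\<^esub> lunit_map k M w"
    and "lunit_map k M \<zero>\<^bsub>L\<^esub> = \<zero>\<^bsub>M\<^esub>"
    and "r \<in> carrier k \<Longrightarrow> m \<in> carrier M \<Longrightarrow>
      runit_map k M (pure_tensor k M (scalar_algebra k) m (Scalar r)) = r \<odot>\<^bsub>M\<^esub> m"
    and "z' \<in> carrier R \<Longrightarrow> runit_map k M z' \<in> carrier M"
    and "z' \<in> carrier R \<Longrightarrow> w' \<in> carrier R \<Longrightarrow>
      runit_map k M (z' \<oplus>\<^bsub>R\<^esub> w') = runit_map k M z' \<oplus>\<^bsub>M\<^esub> runit_map k M w'"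
    and "runit_map k M \<zero>\<^bsub>R\<^esub> = \<zero>\<^bsub>M\<^esub>"
  using lunit_map_lin[OF M] runit_map_lin[OF M] lin_zero[OF lunit_map_lin(1)[OF M]]
    lin_zero[OF runit_map_lin(1)[OF M]] M
  unfolding L_def R_def by (simp_all add: linD)

lemma unit_inv [simp]:
  assumes M: "module k M"
  shows "m \<in> carrier M \<Longrightarrow> lunit_map k M (lunit_inv M m) = m"
    and "z \<in> carrier (tensor k (scalar_algebra k) M) \<Longrightarrow> lunit_inv M (lunit_map k M z) = z"
    and "m \<in> carrier M \<Longrightarrow> runit_map k M (runit_inv M m) = m"
    and "z' \<in> carrier (tensor k M (scalar_algebra k)) \<Longrightarrow> runit_inv M (runit_map k M z') = z'"
proof -
  show "m \<in> carrier M \<Longrightarrow> lunit_map k M (lunit_inv M m) = m"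
    "m \<in> carrier M \<Longrightarrow> runit_map k M (runit_inv M m) = m"
    using M by (simp_all add: lunit_inv_def runit_inv_def)
  show "lunit_inv M (lunit_map k M z) = z" if "z \<in> carrier (tensor k (scalar_algebra k) M)"
    using that module_scalar_algebra M
  proof (induction rule: tensor_induct)
    case (pure s m)
    then obtain r where r: "s = Scalar r" "r \<in> carrier k" by auto
    \<comment> \<open>The scalar r is carried across the tensor sign to the element 1 of k, which
      turns 1 into the given left factor.\<close>
    have "pure_tensor k (scalar_algebra k) M (Scalar \<one>\<^bsub>k\<^esub>) (r \<odot>\<^bsub>M\<^esub> m) =
        pure_tensor k (scalar_algebra k) M (r \<odot>\<^bsub>scalar_algebra k\<^esub> Scalar \<one>\<^bsub>k\<^esub>) m"
      using r pure M
      by (subst pure_tensor_simps(3)) (simp_all del: scalar_algebra_simps(4) pure_tensor_simps(3))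
    then show ?case using r pure M by (simp add: lunit_inv_def del: pure_tensor_simps)
  qed (use M in \<open>simp_all add: lunit_inv_def\<close>)
  show "runit_inv M (runit_map k M z) = z" if "z \<in> carrier (tensor k M (scalar_algebra k))" for z
    using that M module_scalar_algebra
  proof (induction rule: tensor_induct)
    case (pure m s)
    then obtain r where r: "s = Scalar r" "r \<in> carrier k" by auto
    have "pure_tensor k M (scalar_algebra k) (r \<odot>\<^bsub>M\<^esub> m) (Scalar \<one>\<^bsub>k\<^esub>) =
        pure_tensor k M (scalar_algebra k) m (r \<odot>\<^bsub>scalar_algebra k\<^esub> Scalar \<one>\<^bsub>k\<^esub>)"
      using r pure M
      by (subst pure_tensor_simps(4)) (simp_all del: scalar_algebra_simps(4) pure_tensor_simps(4))
    then show ?case using r pure M by (simp add: runit_inv_def del: pure_tensor_simps)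
  qed (use M in \<open>simp_all add: runit_inv_def\<close>)
qed

lemma tensor_map_ident:
  assumes f: "kmap f" and g: "kmap g" and "tgt f = src f" "tgt g = src g"
    and "\<And>x. x \<in> carrier (src f) \<Longrightarrow> fn f x = x" "\<And>x. x \<in> carrier (src g) \<Longrightarrow> fn g x = x"
    and z: "z \<in> carrier (tensor k (src f) (src g))"
  shows "tensor_map k f g z = z"
  using z kmapD(1)[OF f] kmapD(1)[OF g]
  by (induction rule: tensor_induct) (use assms tensor_map_simps[OF f g] in simp_all)

lemma tensor_map_comp:
  assumes f: "kmap f" "kmap f'" "kmap f''" and g: "kmap g" "kmap g'" "kmap g''"
    and eqs: "src f' = tgt f" "src g' = tgt g" "src f'' = src f" "tgt f'' = tgt f'"
      "src g'' = src g" "tgt g'' = tgt g'"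
    and comp: "\<And>x. x \<in> carrier (src f) \<Longrightarrow> fn f'' x = fn f' (fn f x)"
      "\<And>x. x \<in> carrier (src g) \<Longrightarrow> fn g'' x = fn g' (fn g x)"
    and z: "z \<in> carrier (tensor k (src f) (src g))"
  shows "tensor_map k f'' g'' z = tensor_map k f' g' (tensor_map k f g z)"
proof -
  note s = tensor_map_simps[OF f(1) g(1)] tensor_map_simps[OF f(2) g(2), unfolded eqs]
    tensor_map_simps[OF f(3) g(3), unfolded eqs] kmapD[OF f(1)] kmapD[OF g(1)]
    kmapD[OF f(2), unfolded eqs] kmapD[OF g(2), unfolded eqs] comp
  show ?thesis using z kmapD(1)[OF f(1)] kmapD(1)[OF g(1)]
    by (induction rule: tensor_induct) (simp_all only: s)
qed

text \<open>The tensor products of maps enter as arrows \<open>fg\<close> and \<open>gh\<close> with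
  prescribed fields, because in the applications they are images under \<open>forget_arrow\<close>
  of arrows of another category.\<close>

lemma assoc_natural:
  assumes f: "kmap f" and g: "kmap g" and h: "kmap h" and fg: "kmap fg" and gh: "kmap gh"
    and fg_eqs: "src fg = tensor k (src f) (src g)" "tgt fg = tensor k (tgt f) (tgt g)"
      "fn fg = tensor_map k f g"
    and gh_eqs: "src gh = tensor k (src g) (src h)" "tgt gh = tensor k (tgt g) (tgt h)"
      "fn gh = tensor_map k g h"
    and z: "z \<in> carrier (tensor k (tensor k (src f) (src g)) (src h))"
  shows "assoc_map k (tgt f) (tgt g) (tgt h) (tensor_map k fg h z) =
    tensor_map k f gh (assoc_map k (src f) (src g) (src h) z)"
proof -
  note s = tensor_map_simps[OF fg h, unfolded fg_eqs] tensor_map_simps[OF f gh, unfolded gh_eqs]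
  show ?thesis using z kmapD(1)[OF f] kmapD(1)[OF g] kmapD(1)[OF h]
    by (induction rule: tensor3_induct) (use f g h in \<open>simp_all add: s\<close>)
qed

lemma lunit_natural:
  assumes f: "kmap f" and e: "kmap e" and eqs: "src e = underlying (scalar_algebra k)"
      "tgt e = underlying (scalar_algebra k)" "\<And>x. x \<in> carrier (src e) \<Longrightarrow> fn e x = x"
    and z: "z \<in> carrier (tensor k (scalar_algebra k) (src f))"
  shows "lunit_map k (tgt f) (tensor_map k e f z) = fn f (lunit_map k (src f) z)"
proof -
  note s = tensor_map_simps[OF e f, unfolded eqs underlying_reduct underlying_simps]
  show ?thesis using z module_scalar_algebra kmapD(1)[OF f]
    by (induction rule: tensor_induct) (use f e eqs in \<open>auto simp: s\<close>)
qed

lemma runit_natural: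
  assumes f: "kmap f" and e: "kmap e" and eqs: "src e = underlying (scalar_algebra k)"
      "tgt e = underlying (scalar_algebra k)" "\<And>x. x \<in> carrier (src e) \<Longrightarrow> fn e x = x"
    and z: "z \<in> carrier (tensor k (src f) (scalar_algebra k))"
  shows "runit_map k (tgt f) (tensor_map k f e z) = fn f (runit_map k (src f) z)"
proof -
  note s = tensor_map_simps[OF f e, unfolded eqs underlying_reduct underlying_simps]
  show ?thesis using z kmapD(1)[OF f] module_scalar_algebra
    by (induction rule: tensor_induct) (use f e eqs in \<open>auto simp: s\<close>)
qed

lemma tensor_pentagon:
  assumes W: "module k W" and X: "module k X" and Y: "module k Y" and Z: "module k Z"
    and f: "kmap f" "src f = W" "tgt f = W" "\<And>x. x \<in> carrier W \<Longrightarrow> fn f x = x"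
    and g: "kmap g" "src g = Z" "tgt g = Z" "\<And>x. x \<in> carrier Z \<Longrightarrow> fn g x = x"
    and a: "kmap a" "src a = tensor k (tensor k X Y) Z" "tgt a = tensor k X (tensor k Y Z)"
      "fn a = assoc_map k X Y Z"
    and b: "kmap b" "src b = tensor k (tensor k W X) Y" "tgt b = tensor k W (tensor k X Y)"
      "fn b = assoc_map k W X Y"
    and z: "z \<in> carrier (tensor k (tensor k (tensor k W X) Y) Z)"
  shows "assoc_map k W X (tensor k Y Z) (assoc_map k (tensor k W X) Y Z z) =
    tensor_map k f a (assoc_map k W (tensor k X Y) Z (tensor_map k b g z))"
proof -
  note s = tensor_map_simps[OF f(1) a(1), unfolded f(2,3) a(2-4)]
    tensor_map_simps[OF b(1) g(1), unfolded b(2-4) g(2,3)]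
  show ?thesis using z W X Y Z
    by (induction rule: tensor4_induct) (use W X Y Z in \<open>simp_all add: s f(4) g(4)\<close>)
qed

lemma tensor_triangle:
  assumes X: "module k X" and Y: "module k Y"
    and f: "kmap f" "src f = X" "tgt f = X" "\<And>x. x \<in> carrier X \<Longrightarrow> fn f x = x"
    and g: "kmap g" "src g = Y" "tgt g = Y" "\<And>x. x \<in> carrier Y \<Longrightarrow> fn g x = x"
    and a: "kmap a" "src a = tensor k (scalar_algebra k) Y" "tgt a = Y" "fn a = lunit_map k Y"
    and b: "kmap b" "src b = tensor k X (scalar_algebra k)" "tgt b = X" "fn b = runit_map k X"
    and z: "z \<in> carrier (tensor k (tensor k X (scalar_algebra k)) Y)"
  shows "tensor_map k f a (assoc_map k X (scalar_algebra k) Y z) = tensor_map k b g z"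
proof -
  note s = tensor_map_simps[OF f(1) a(1), unfolded f(2,3) a(2-4)]
    tensor_map_simps[OF b(1) g(1), unfolded b(2-4) g(2,3)]
  show ?thesis using z X module_scalar_algebra Y
    by (induction rule: tensor3_induct) (use X Y in \<open>auto simp: s f(4) g(4)\<close>)
qed

section \<open>Componentwise operations\<close>

text \<open>Two nested lifts. For fixed m and m' the inner one lifts a bilinear map of n and n';
  \<open>bil_tensor_lift\<close> gives its linearity in m and in m' separately, and a further use
  gives bilinearity of the outer lift.\<close>

lemma bil_componentwise:
  fixes M M' N N' P P' :: "('k, 'a) kmod"
  assumes mods: "module k M" "module k M'" "module k N" "module k N'" "module k P" "module k P'"
    and f: "bil k M N P f" and g: "bil k M' N' P' g"
  shows "bil k (tensor k M M') (tensor k N N') (tensor k P P') (componentwise k P P' f g)"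
    and "m \<in> carrier M \<Longrightarrow> m' \<in> carrier M' \<Longrightarrow> n \<in> carrier N \<Longrightarrow> n' \<in> carrier N' \<Longrightarrow>
      componentwise k P P' f g (pure_tensor k M M' m m') (pure_tensor k N N' n n') =
      pure_tensor k P P' (f m n) (g m' n')"
proof -
  let ?T = "tensor k P P'"
  let ?h = "\<lambda>m m' n n'. pure_tensor k P P' (f m n) (g m' n')"
  have b: "bil k N N' ?T (?h m m')" if "m \<in> carrier M" "m' \<in> carrier M'" for m m'
    by (rule bilI) (use that mods in \<open>simp_all add: bilD[OF f] bilD[OF g]\<close>)
  have b1: "bil k (tensor k N N') M ?T (\<lambda>y m. tensor_lift ?T (?h m m') y)" if "m' \<in> carrier M'"
      for m'
    by (rule bil_tensor_lift) (use that mods b in \<open>auto simp: bilD[OF f] bilD[OF g] intro!: linI\<close>)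
  have b2: "bil k (tensor k N N') M' ?T (\<lambda>y m'. tensor_lift ?T (?h m m') y)" if "m \<in> carrier M"
      for m
    by (rule bil_tensor_lift) (use that mods b in \<open>auto simp: bilD[OF f] bilD[OF g] intro!: linI\<close>)
  have b3: "bil k M M' ?T (\<lambda>m m'. tensor_lift ?T (?h m m') y)" if "y \<in> carrier (tensor k N N')"
      for y
    using b1 b2 that by (simp add: bil_def)
  have "bil k (tensor k M M') (tensor k N N') ?T
      (\<lambda>x y. tensor_lift ?T (\<lambda>m m'. tensor_lift ?T (?h m m') y) x)"
    by (rule bil_tensor_lift)
      (use mods b3 b in \<open>auto intro: lin_tensor_lift(1)\<close>)
  then show "bil k (tensor k M M') (tensor k N N') ?T (componentwise k P P' f g)"
    by (simp add: componentwise_def[abs_def])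
  show "m \<in> carrier M \<Longrightarrow> m' \<in> carrier M' \<Longrightarrow> n \<in> carrier N \<Longrightarrow> n' \<in> carrier N' \<Longrightarrow>
      componentwise k P P' f g (pure_tensor k M M' m m') (pure_tensor k N N' n n') =
      pure_tensor k P P' (f m n) (g m' n')"
    using mods by (simp add: componentwise_def lin_tensor_lift(2)[OF _ _ _ b3]
        lin_tensor_lift(2)[OF _ _ _ b])
qed

text \<open>The two sides nest the lifts in opposite orders, so they are different terms that agree
  on pure tensors. The exchange is needed because left modules are handled as right modules with the
  arguments of the action swapped.\<close>

lemma componentwise_flip:
  fixes M M' N N' P P' :: "('k, 'a) kmod"
  assumes mods: "module k M" "module k M'" "module k N" "module k N'" "module k P" "module k P'"
    and f: "bil k M N P f" and g: "bil k M' N' P' g"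
    and x: "x \<in> carrier (tensor k M M')" and y: "y \<in> carrier (tensor k N N')"
  shows "componentwise k P P' (\<lambda>n m. f m n) (\<lambda>n m. g m n) y x = componentwise k P P' f g x y"
proof -
  note b = bil_componentwise(1)[OF mods f g]
  note b' = bil_componentwise(1)[OF mods(3,4,1,2,5,6) bil_flip[OF f] bil_flip[OF g]]
  note s = bilD[OF b] bilD[OF b'] bil_zeroL[OF b] bil_zeroR[OF b] bil_zeroL[OF b'] bil_zeroR[OF b']
  show ?thesis using x mods(1,2)
  proof (induction rule: tensor_induct)
    case (pure m m')
    show ?case using y mods(3,4)
      by (induction rule: tensor_induct)
        (use pure mods in \<open>simp_all add: s bil_componentwise(2)[OF mods f g]
          bil_componentwise(2)[OF mods(3,4,1,2,5,6) bil_flip[OF f] bil_flip[OF g]]\<close>)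
  qed (use mods y in \<open>simp_all add: s\<close>)
qed

text \<open>A single identity with four pairs of operations covers all laws needed later:
  associativity of a product, the law of a module, commuting left and right actions, and
  balancedness are instances.\<close>

lemma componentwise_assoc:
  fixes X X' Y Y' Z Z' U U' V V' W W' :: "('k, 'a) kmod"
  assumes mods: "module k X" "module k X'" "module k Y" "module k Y'" "module k Z" "module k Z'"
      "module k U" "module k U'" "module k V" "module k V'" "module k W" "module k W'"
    and p: "bil k X Y U p" "bil k X' Y' U' p'" and q: "bil k U Z W q" "bil k U' Z' W' q'"
    and r: "bil k Y Z V r" "bil k Y' Z' V' r'" and s: "bil k X V W s" "bil k X' V' W' s'"
    and eq: "\<And>x y z. x \<in> carrier X \<Longrightarrow> y \<in> carrier Y \<Longrightarrow> z \<in> carrier Z \<Longrightarrow> q (p x y) z = s x (r y z)"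
      "\<And>x y z. x \<in> carrier X' \<Longrightarrow> y \<in> carrier Y' \<Longrightarrow> z \<in> carrier Z' \<Longrightarrow> q' (p' x y) z = s' x (r' y z)"
    and x: "x \<in> carrier (tensor k X X')" and y: "y \<in> carrier (tensor k Y Y')"
    and z: "z \<in> carrier (tensor k Z Z')"
  shows "componentwise k W W' q q' (componentwise k U U' p p' x y) z =
    componentwise k W W' s s' x (componentwise k V V' r r' y z)"
proof -
  note bp = bil_componentwise[OF mods(1-4,7,8) p]
  note bq = bil_componentwise[OF mods(7,8,5,6,11,12) q]
  note br = bil_componentwise[OF mods(3-6,9,10) r]
  note bs = bil_componentwise[OF mods(1,2,9-12) s]
  note t = bilD(1,2,3)[OF bp(1)] bilD(1,2,3)[OF bq(1)] bilD(1,2,3)[OF br(1)] bilD(1,2,3)[OF bs(1)]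
    bil_zeroL[OF bp(1)] bil_zeroL[OF bq(1)] bil_zeroL[OF br(1)] bil_zeroL[OF bs(1)]
    bil_zeroR[OF bp(1)] bil_zeroR[OF bq(1)] bil_zeroR[OF br(1)] bil_zeroR[OF bs(1)]
    bp(2) bq(2) br(2) bs(2) bilD(1)[OF p(1)] bilD(1)[OF p(2)] bilD(1)[OF r(1)] bilD(1)[OF r(2)]
  show ?thesis using x mods(1,2)
  proof (induction rule: tensor_induct)
    case x: (pure m m')
    show ?case using y mods(3,4)
    proof (induction rule: tensor_induct)
      case (pure n n')
      show ?case using z mods(5,6)
        by (induction rule: tensor_induct) (use x pure mods in \<open>simp_all add: t eq\<close>)
    qed (use x z mods in \<open>simp_all add: t\<close>)
  qed (use y z mods in \<open>simp_all add: t\<close>)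
qed

lemma smult_lcomm: "module k M \<Longrightarrow> r \<in> carrier k \<Longrightarrow> s \<in> carrier k \<Longrightarrow> x \<in> carrier M \<Longrightarrow>
    r \<odot>\<^bsub>M\<^esub> (s \<odot>\<^bsub>M\<^esub> x) = s \<odot>\<^bsub>M\<^esub> (r \<odot>\<^bsub>M\<^esub> x)"
  by (simp add: module.smult_assoc1[symmetric] k.m_comm)

text \<open>\<open>componentwise\<close> takes whole functions as arguments, so operations that
  agree only on the carriers, such as a product and its restriction, have to be compared on
  tensors.\<close>

lemma componentwise_cong:
  fixes M M' N N' P P' :: "('k, 'a) kmod"
  assumes mods: "module k M" "module k M'" "module k N" "module k N'" "module k P" "module k P'"
    and f: "bil k M N P f" and g: "bil k M' N' P' g"
    and eq: "\<And>x y. x \<in> carrier M \<Longrightarrow> y \<in> carrier N \<Longrightarrow> f' x y = f x y"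
      "\<And>x y. x \<in> carrier M' \<Longrightarrow> y \<in> carrier N' \<Longrightarrow> g' x y = g x y"
    and x: "x \<in> carrier (tensor k M M')" and y: "y \<in> carrier (tensor k N N')"
  shows "componentwise k P P' f' g' x y = componentwise k P P' f g x y"
proof -
  have f': "bil k M N P f'" by (rule bilI) (use mods in \<open>simp_all add: eq bilD[OF f]\<close>)
  have g': "bil k M' N' P' g'" by (rule bilI) (use mods in \<open>simp_all add: eq bilD[OF g]\<close>)
  note p = bil_componentwise[OF mods f g] bil_componentwise[OF mods f' g']
  show ?thesis using x mods(1,2)
  proof (induction rule: tensor_induct)
    case (pure m n)
    show ?case using y mods(3,4)
      by (induction rule: tensor_induct)
        (use pure mods in \<open>simp_all add: p(2,4) eq bilD[OF p(1)] bilD[OF p(3)] bil_zeroR[OF p(1)]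
            bil_zeroR[OF p(3)]\<close>)
  qed (use y mods in \<open>simp_all add: bilD[OF p(1)] bilD[OF p(3)] bil_zeroL[OF p(1)] bil_zeroL[OF
      p(3)]\<close>)
qed

lemma assoc_map_mult:
  fixes M N P :: "('k, 'a) kmod"
  assumes M: "module k M" "bil k M M M f" and N: "module k N" "bil k N N N g"
    and P: "module k P" "bil k P P P h"
    and x: "x \<in> carrier (tensor k (tensor k M N) P)"
        and y: "y \<in> carrier (tensor k (tensor k M N) P)"
  shows "assoc_map k M N P (componentwise k (tensor k M N) P (componentwise k M N f g) h x y) =
    componentwise k M (tensor k N P) f (componentwise k N P g h) (assoc_map k M N P x)
        (assoc_map k M N P y)"
proof -
  have MN: "module k (tensor k M N)" and NP: "module k (tensor k N P)" using M N P by simp_all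
  note a = bil_componentwise[OF M(1) N(1) M(1) N(1) M(1) N(1) M(2) N(2)]
  note b = bil_componentwise[OF N(1) P(1) N(1) P(1) N(1) P(1) N(2) P(2)]
  note c = bil_componentwise[OF MN P(1) MN P(1) MN P(1) a(1) P(2)]
  note d = bil_componentwise[OF M(1) NP M(1) NP M(1) NP M(2) b(1)]
  note s = a(2) b(2) c(2) d(2) bilD(1-3)[OF c(1)] bilD(1-3)[OF d(1)] bil_zeroL[OF c(1)] bil_zeroL[OF
      d(1)]
    bil_zeroR[OF c(1)] bil_zeroR[OF d(1)] bilD(1)[OF M(2)] bilD(1)[OF N(2)] bilD(1)[OF P(2)]
  show ?thesis using x M(1) N(1) P(1)
  proof (induction rule: tensor3_induct)
    case x: (pure m n p)
    show ?case using y M(1) N(1) P(1)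
      by (induction rule: tensor3_induct) (use x M(1) N(1) P(1) in \<open>simp_all add: s\<close>)
  qed (use y M(1) N(1) P(1) in \<open>simp_all add: s\<close>)
qed

lemma bil_scalar_mult: "bil k (scalar_algebra k) (scalar_algebra k) (scalar_algebra k)
    (mult (scalar_algebra k))"
  by (rule bilI) (auto simp: k.l_distr k.r_distr k.m_ac)

lemma lunit_map_mult:
  fixes M :: "('k, 'a) kmod"
  assumes M: "module k M" "bil k M M M f"
    and x: "x \<in> carrier (tensor k (scalar_algebra k) M)"
        and y: "y \<in> carrier (tensor k (scalar_algebra k) M)"
  shows "lunit_map k M (componentwise k (scalar_algebra k) M (mult (scalar_algebra k)) f x y) =
    f (lunit_map k M x) (lunit_map k M y)"
proof -
  note S = module_scalar_algebra
  note c = bil_componentwise[OF S M(1) S M(1) S M(1) bil_scalar_mult M(2)]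
  note s = c(2) bilD(1-3)[OF c(1)] bil_zeroL[OF c(1)] bil_zeroR[OF c(1)] bilD[OF M(2)]
    bil_zeroL[OF M(2)] bil_zeroR[OF M(2)]
  show ?thesis using x S M(1)
  proof (induction rule: tensor_induct)
    case x: (pure m n)
    show ?case using y S M(1)
      by (induction rule: tensor_induct) (use x M(1)
          in \<open>auto simp: s module.smult_assoc1 smult_lcomm\<close>)
  qed (use y M(1) in \<open>simp_all add: s\<close>)
qed

lemma runit_map_mult:
  fixes M :: "('k, 'a) kmod"
  assumes M: "module k M" "bil k M M M f"
    and x: "x \<in> carrier (tensor k M (scalar_algebra k))"
        and y: "y \<in> carrier (tensor k M (scalar_algebra k))"
  shows "runit_map k M (componentwise k M (scalar_algebra k) f (mult (scalar_algebra k)) x y) =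
    f (runit_map k M x) (runit_map k M y)"
proof -
  note S = module_scalar_algebra
  note c = bil_componentwise[OF M(1) S M(1) S M(1) S M(2) bil_scalar_mult]
  note s = c(2) bilD(1-3)[OF c(1)] bil_zeroL[OF c(1)] bil_zeroR[OF c(1)] bilD[OF M(2)]
    bil_zeroL[OF M(2)] bil_zeroR[OF M(2)]
  show ?thesis using x M(1) S
  proof (induction rule: tensor_induct)
    case x: (pure m n)
    show ?case using y M(1) S
      by (induction rule: tensor_induct) (use x M(1)
          in \<open>auto simp: s module.smult_assoc1 smult_lcomm\<close>)
  qed (use y M(1) in \<open>simp_all add: s\<close>)
qed

text \<open>With the identity of A as one of the pairs of arrows, this says that a tensor product of
  module maps is linear over A \<otimes> A. With three equal pairs it says that a tensor product of
  algebra maps is multiplicative.\<close>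

lemma tensor_map_componentwise:
  fixes f f' g g' h h' :: "('k, 'a) kmap"
  assumes f: "kmap f" "kmap f'" and g: "kmap g" "kmap g'" and h: "kmap h" "kmap h'"
    and p: "bil k (src f) (src g) (src h) p" "bil k (src f') (src g') (src h') p'"
    and q: "bil k (tgt f) (tgt g) (tgt h) q" "bil k (tgt f') (tgt g') (tgt h') q'"
    and eq: "\<And>x y. x \<in> carrier (src f) \<Longrightarrow> y \<in> carrier (src g) \<Longrightarrow> fn h (p x y) = q (fn f x) (fn g y)"
      "\<And>x y. x \<in> carrier (src f') \<Longrightarrow> y \<in> carrier (src g') \<Longrightarrow> fn h' (p' x y) = q' (fn f' x) (fn g' y)"
    and x: "x \<in> carrier (tensor k (src f) (src f'))"
        and y: "y \<in> carrier (tensor k (src g) (src g'))"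
  shows "tensor_map k h h' (componentwise k (src h) (src h') p p' x y) =
    componentwise k (tgt h) (tgt h') q q' (tensor_map k f f' x) (tensor_map k g g' y)"
proof -
  note m = kmapD(1)[OF f(1)] kmapD(1)[OF f(2)] kmapD(1)[OF g(1)] kmapD(1)[OF g(2)] kmapD(1)[OF h(1)]
      kmapD(1)[OF h(2)]
  note m' = kmapD(2)[OF f(1)] kmapD(2)[OF f(2)] kmapD(2)[OF g(1)] kmapD(2)[OF g(2)] kmapD(2)[OF
      h(1)] kmapD(2)[OF h(2)]
  note c = bil_componentwise[OF m p] and d = bil_componentwise[OF m' q]
  note s = tensor_map_simps[OF f(1) f(2)] tensor_map_simps[OF g(1) g(2)] tensor_map_simps[OF h(1)
      h(2)]
    c(2) d(2) bilD(1-3)[OF c(1)] bilD(1-3)[OF d(1)] bil_zeroL[OF c(1)] bil_zeroL[OF d(1)]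
    bil_zeroR[OF c(1)] bil_zeroR[OF d(1)] bilD(1)[OF p(1)] bilD(1)[OF p(2)] eq m m'
  show ?thesis using x m(1,2)
  proof (induction rule: tensor_induct)
    case (pure a b)
    show ?case using y m(3,4)
      by (induction rule: tensor_induct) (use pure f g h in \<open>simp_all add: s\<close>)
  qed (use y f g h in \<open>simp_all add: s\<close>)
qed

end

section \<open>Projective modules\<close>

context scalars
begin

section \<open>Finitely supported linear combinations\<close>

lemma lin_finsum:
  assumes f: "lin k M N f" and M: "module k M" and N: "module k N"
    and "finite U" "s \<in> U \<rightarrow> carrier M"
  shows "f (finsum M s U) = finsum N (\<lambda>i. f (s i)) U"
proof -
  interpret M: abelian_group M by (rule module_grp[OF M])
  interpret N: abelian_group N by (rule module_grp[OF N])
  show ?thesis using assms(4,5)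
  proof (induction U rule: finite_induct)
    case empty
    then show ?case using lin_zero[OF f M N] by simp
  next
    case (insert i U)
    then have "f (s i) \<in> carrier N" "(\<lambda>i. f (s i)) \<in> U \<rightarrow> carrier N"
      using lin_closed[OF f] by auto
    then show ?case using insert lin_add[OF f, of "s i" "finsum M s U"] by (simp add: Pi_iff)
  qed
qed

text \<open>Summing over the support of c gives a meaning to combinations indexed by an infinite
  set, here the carrier of a projective module.\<close>

definition comb :: "('k, 'u) module \<Rightarrow> 'i set \<Rightarrow> ('i \<Rightarrow> 'k) \<Rightarrow> ('i \<Rightarrow> 'u) \<Rightarrow> 'u" where
  "comb M I c s = finsum M (\<lambda>i. c i \<odot>\<^bsub>M\<^esub> s i) {i \<in> I. c i \<noteq> \<zero>\<^bsub>k\<^esub>}"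

definition finsupp :: "'i set \<Rightarrow> ('i \<Rightarrow> 'k) \<Rightarrow> bool" where
  "finsupp I c \<longleftrightarrow> c \<in> I \<rightarrow> carrier k \<and> finite {i \<in> I. c i \<noteq> \<zero>\<^bsub>k\<^esub>}"

text \<open>Two combinations may have different supports; passing to a common finite index set lets
  them be added term by term.\<close>

lemma comb_superset:
  assumes M: "module k M" and c: "finsupp I c" and s: "s \<in> I \<rightarrow> carrier M"
    and U: "finite U" "U \<subseteq> I" "{i \<in> I. c i \<noteq> \<zero>\<^bsub>k\<^esub>} \<subseteq> U"
  shows "comb M I c s = finsum M (\<lambda>i. c i \<odot>\<^bsub>M\<^esub> s i) U"
proof -
  interpret M: abelian_group M by (rule module_grp[OF M])
  have "c i \<odot>\<^bsub>M\<^esub> s i \<in> carrier M" if "i \<in> I" for i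
    using that M c s by (auto simp: finsupp_def Pi_iff)
  moreover have "c i \<odot>\<^bsub>M\<^esub> s i = \<zero>\<^bsub>M\<^esub>" if "i \<in> U - {i \<in> I. c i \<noteq> \<zero>\<^bsub>k\<^esub>}" for i
    using that M s U by (auto simp: Pi_iff)
  ultimately show ?thesis
    unfolding comb_def using U by (intro M.add.finprod_mono_neutral_cong_left) auto
qed

lemma comb_closed [simp]:
  assumes "module k M" "finsupp I c" "s \<in> I \<rightarrow> carrier M"
  shows "comb M I c s \<in> carrier M"
proof -
  interpret M: abelian_group M by (rule module_grp) fact
  show ?thesis unfolding comb_def using assms
    by (intro M.finsum_closed) (auto simp: finsupp_def Pi_iff)
qed

lemma finsupp_add:
  assumes "finsupp I c" "finsupp I d"
  shows "finsupp I (\<lambda>i. c i \<oplus>\<^bsub>k\<^esub> d i)"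
proof -
  have "{i \<in> I. c i \<oplus>\<^bsub>k\<^esub> d i \<noteq> \<zero>\<^bsub>k\<^esub>} \<subseteq> {i \<in> I. c i \<noteq> \<zero>\<^bsub>k\<^esub>} \<union> {i \<in> I. d i \<noteq> \<zero>\<^bsub>k\<^esub>}"
    by auto
  then show ?thesis using assms by (auto simp: finsupp_def Pi_iff intro: finite_subset)
qed

lemma finsupp_smult:
  assumes "finsupp I c" "r \<in> carrier k"
  shows "finsupp I (\<lambda>i. r \<otimes>\<^bsub>k\<^esub> c i)"
proof -
  have "{i \<in> I. r \<otimes>\<^bsub>k\<^esub> c i \<noteq> \<zero>\<^bsub>k\<^esub>} \<subseteq> {i \<in> I. c i \<noteq> \<zero>\<^bsub>k\<^esub>}"
    using assms by auto
  then show ?thesis using assms by (auto simp: finsupp_def Pi_iff intro: finite_subset)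
qed

lemma comb_add:
  assumes M: "module k M" and c: "finsupp I c" and d: "finsupp I d" and s: "s \<in> I \<rightarrow> carrier M"
  shows "comb M I (\<lambda>i. c i \<oplus>\<^bsub>k\<^esub> d i) s = comb M I c s \<oplus>\<^bsub>M\<^esub> comb M I d s"
proof -
  interpret M: abelian_group M by (rule module_grp[OF M])
  let ?U = "{i \<in> I. c i \<noteq> \<zero>\<^bsub>k\<^esub>} \<union> {i \<in> I. d i \<noteq> \<zero>\<^bsub>k\<^esub>}"
  have U: "finite ?U" using c d by (simp add: finsupp_def)
  have cl: "c i \<odot>\<^bsub>M\<^esub> s i \<in> carrier M" "d i \<odot>\<^bsub>M\<^esub> s i \<in> carrier M" if "i \<in> I" for i
    using that M c d s by (auto simp: finsupp_def Pi_iff)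
  have "comb M I (\<lambda>i. c i \<oplus>\<^bsub>k\<^esub> d i) s = finsum M (\<lambda>i. (c i \<oplus>\<^bsub>k\<^esub> d i) \<odot>\<^bsub>M\<^esub> s i) ?U"
    by (rule comb_superset[OF M finsupp_add[OF c d] s U]) auto
  also have "\<dots> = finsum M (\<lambda>i. c i \<odot>\<^bsub>M\<^esub> s i \<oplus>\<^bsub>M\<^esub> d i \<odot>\<^bsub>M\<^esub> s i) ?U"
    using c d s M cl
    by (intro M.finsum_cong') (auto simp: finsupp_def Pi_iff intro!: module.smult_l_distr)
  also have "\<dots> = finsum M (\<lambda>i. c i \<odot>\<^bsub>M\<^esub> s i) ?U \<oplus>\<^bsub>M\<^esub> finsum M (\<lambda>i. d i \<odot>\<^bsub>M\<^esub> s i) ?U"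
    using cl by (intro M.finsum_addf) auto
  also have "\<dots> = comb M I c s \<oplus>\<^bsub>M\<^esub> comb M I d s"
    by (subst (1 2) comb_superset[OF M _ s U]) (use c d in auto)
  finally show ?thesis .
qed

lemma comb_smult:
  assumes M: "module k M" and c: "finsupp I c" and s: "s \<in> I \<rightarrow> carrier M" and r: "r \<in> carrier k"
  shows "comb M I (\<lambda>i. r \<otimes>\<^bsub>k\<^esub> c i) s = r \<odot>\<^bsub>M\<^esub> comb M I c s"
proof -
  interpret M: abelian_group M by (rule module_grp[OF M])
  let ?U = "{i \<in> I. c i \<noteq> \<zero>\<^bsub>k\<^esub>}"
  have U: "finite ?U" using c by (simp add: finsupp_def)
  have cl: "c i \<odot>\<^bsub>M\<^esub> s i \<in> carrier M" "s i \<in> carrier M" "c i \<in> carrier k" if "i \<in> I" for i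
    using that M c s by (auto simp: finsupp_def Pi_iff)
  have "comb M I (\<lambda>i. r \<otimes>\<^bsub>k\<^esub> c i) s = finsum M (\<lambda>i. (r \<otimes>\<^bsub>k\<^esub> c i) \<odot>\<^bsub>M\<^esub> s i) ?U"
    by (rule comb_superset[OF M finsupp_smult[OF c r] s U]) (use r in auto)
  also have "\<dots> = finsum M (\<lambda>i. r \<odot>\<^bsub>M\<^esub> (c i \<odot>\<^bsub>M\<^esub> s i)) ?U"
    using r M cl by (intro M.finsum_cong') (auto intro!: module.smult_assoc1)
  also have "\<dots> = r \<odot>\<^bsub>M\<^esub> comb M I c s"
    unfolding comb_def using M U r cl by (intro module.finsum_smult_ldistr[symmetric]) auto
  finally show ?thesis .
qed

lemma comb_addR:
  assumes M: "module k M" and c: "finsupp I c" and s: "s \<in> I \<rightarrow> carrier M" and t: "t \<in> I \<rightarrow> carrier M"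
  shows "comb M I c (\<lambda>i. s i \<oplus>\<^bsub>M\<^esub> t i) = comb M I c s \<oplus>\<^bsub>M\<^esub> comb M I c t"
proof -
  interpret M: abelian_group M by (rule module_grp[OF M])
  have cl: "c i \<odot>\<^bsub>M\<^esub> s i \<in> carrier M" "c i \<odot>\<^bsub>M\<^esub> t i \<in> carrier M" if "i \<in> I" for i
    using that M c s t by (auto simp: finsupp_def Pi_iff)
  have "comb M I c (\<lambda>i. s i \<oplus>\<^bsub>M\<^esub> t i) =
      finsum M (\<lambda>i. c i \<odot>\<^bsub>M\<^esub> s i \<oplus>\<^bsub>M\<^esub> c i \<odot>\<^bsub>M\<^esub> t i) {i \<in> I. c i \<noteq> \<zero>\<^bsub>k\<^esub>}"
    unfolding comb_def using c s t M cl
    by (intro M.finsum_cong') (auto simp: finsupp_def Pi_iff intro!: module.smult_r_distr)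
  then show ?thesis unfolding comb_def using cl by (simp add: M.finsum_addf Pi_iff)
qed

lemma comb_lin:
  assumes f: "lin k M N f" and M: "module k M" and N: "module k N"
    and c: "finsupp I c" and s: "s \<in> I \<rightarrow> carrier M"
  shows "f (comb M I c s) = comb N I c (\<lambda>i. f (s i))"
proof -
  interpret N: abelian_group N by (rule module_grp[OF N])
  have cl: "c i \<in> carrier k" "s i \<in> carrier M" if "i \<in> I" for i
    using that c s by (auto simp: finsupp_def Pi_iff)
  have "f (comb M I c s) = finsum N (\<lambda>i. f (c i \<odot>\<^bsub>M\<^esub> s i)) {i \<in> I. c i \<noteq> \<zero>\<^bsub>k\<^esub>}"
    unfolding comb_def using c cl M by (intro lin_finsum[OF f M N]) (auto simp: finsupp_def Pi_iff)
  also have "\<dots> = comb N I c (\<lambda>i. f (s i))"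
    unfolding comb_def using cl f N
    by (intro N.finsum_cong') (auto simp: lin_smult[OF f] lin_closed[OF f])
  finally show ?thesis .
qed

lemma comb_cong:
  assumes "module k M" "finsupp I c" "\<And>i. i \<in> I \<Longrightarrow> c i = d i" "\<And>i. i \<in> I \<Longrightarrow> s i = t i"
      "t \<in> I \<rightarrow> carrier M"
  shows "comb M I c s = comb M I d t"
proof -
  interpret M: abelian_group M by (rule module_grp) fact
  have "finsupp I d" using assms(2,3) by (auto simp: finsupp_def Pi_iff cong: conj_cong)
  then show ?thesis unfolding comb_def using assms
    by (intro M.finsum_cong') (auto simp: finsupp_def Pi_iff)
qed

section \<open>Free modules and dual bases\<close>

definition free_module :: "'i set \<Rightarrow> ('k, 'i \<Rightarrow> 'k) module" where
  "free_module I =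
     \<lparr>carrier = {c \<in> extensional I. finsupp I c},
      mult = undefined, one = undefined,
      zero = (\<lambda>i \<in> I. \<zero>\<^bsub>k\<^esub>),
      add = (\<lambda>c d. \<lambda>i \<in> I. c i \<oplus>\<^bsub>k\<^esub> d i),
      smult = (\<lambda>r c. \<lambda>i \<in> I. r \<otimes>\<^bsub>k\<^esub> c i)\<rparr>"

lemma finsupp_restrict: "finsupp I (\<lambda>i \<in> I. c i) \<longleftrightarrow> finsupp I c"
  by (auto simp: finsupp_def Pi_iff cong: conj_cong)

lemma module_free_module: "module k (free_module I)"
proof -
  let ?F = "free_module I"
  have car: "c \<in> carrier ?F \<longleftrightarrow> c \<in> extensional I \<and> finsupp I c" for c
    by (simp add: free_module_def)
  have val: "c i \<in> carrier k" if "c \<in> carrier ?F" "i \<in> I" for c i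
    using that by (auto simp: car finsupp_def)
  have ext: "c i = undefined" if "c \<in> carrier ?F" "i \<notin> I" for c i
    using that by (auto simp: car extensional_def)
  have add: "c \<oplus>\<^bsub>?F\<^esub> d = (\<lambda>i \<in> I. c i \<oplus>\<^bsub>k\<^esub> d i)" and smult: "r \<odot>\<^bsub>?F\<^esub> c = (\<lambda>i \<in> I. r \<otimes>\<^bsub>k\<^esub> c i)"
    and zero: "\<zero>\<^bsub>?F\<^esub> = (\<lambda>i \<in> I. \<zero>\<^bsub>k\<^esub>)" for c d r
    by (simp_all add: free_module_def)
  have smult_cl: "r \<odot>\<^bsub>?F\<^esub> c \<in> carrier ?F" if "r \<in> carrier k" "c \<in> carrier ?F" for r c
    using that by (simp add: car smult finsupp_restrict finsupp_smult)
  show ?thesis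
  proof (intro moduleI cring abelian_groupI)
    fix c assume c: "c \<in> carrier ?F"
    then show "\<exists>d \<in> carrier ?F. d \<oplus>\<^bsub>?F\<^esub> c = \<zero>\<^bsub>?F\<^esub>"
      using smult_cl[OF _ c, of "\<ominus>\<^bsub>k\<^esub> \<one>\<^bsub>k\<^esub>"]
      by (intro bexI[of _ "(\<ominus>\<^bsub>k\<^esub> \<one>\<^bsub>k\<^esub>) \<odot>\<^bsub>?F\<^esub> c"])
        (auto simp: add smult zero fun_eq_iff val k.l_minus k.l_neg)
  next
    show "\<zero>\<^bsub>?F\<^esub> \<in> carrier ?F" by (simp add: car zero finsupp_restrict) (simp add: finsupp_def)
  next
    fix c d assume "c \<in> carrier ?F" "d \<in> carrier ?F"
    then show "c \<oplus>\<^bsub>?F\<^esub> d \<in> carrier ?F" by (simp add: car add finsupp_restrict finsupp_add)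
  next
    fix r c assume "r \<in> carrier k" "c \<in> carrier ?F"
    then show "r \<odot>\<^bsub>?F\<^esub> c \<in> carrier ?F" by (rule smult_cl)
  qed (auto simp: add smult zero fun_eq_iff val ext k.a_ac k.m_ac k.l_distr k.r_distr)
qed

text \<open>Serves to carry the free module, whose elements are functions, into the type
  \<open>univ\<close>, over which \<open>projective\<close> quantifies.\<close>

definition transport :: "('u \<Rightarrow> 'v) \<Rightarrow> ('k, 'u) module \<Rightarrow> ('k, 'v) module" where
  "transport e M = (let d = inv_into (carrier M) e in
     \<lparr>carrier = e ` carrier M, mult = undefined, one = undefined,
      zero = e \<zero>\<^bsub>M\<^esub>,
      add = (\<lambda>x y. e (d x \<oplus>\<^bsub>M\<^esub> d y)),
      smult = (\<lambda>r x. e (r \<odot>\<^bsub>M\<^esub> d x))\<rparr>)"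

lemma module_transport:
  assumes M: "module k M" and e: "inj_on e (carrier M)"
  shows "module k (transport e M)"
    and "lin k (transport e M) M (inv_into (carrier M) e)"
proof -
  let ?T = "transport e M"
  have car: "carrier ?T = e ` carrier M" and zero: "\<zero>\<^bsub>?T\<^esub> = e \<zero>\<^bsub>M\<^esub>"
    by (simp_all add: transport_def Let_def)
  have add: "e x \<oplus>\<^bsub>?T\<^esub> e y = e (x \<oplus>\<^bsub>M\<^esub> y)" if "x \<in> carrier M" "y \<in> carrier M" for x y
    using that e by (simp add: transport_def Let_def)
  have smult: "r \<odot>\<^bsub>?T\<^esub> e x = e (r \<odot>\<^bsub>M\<^esub> x)" if "x \<in> carrier M" for x r
    using that e by (simp add: transport_def Let_def)
  show "module k ?T"
  proof (intro moduleI cring abelian_groupI)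
    fix x assume "x \<in> carrier ?T"
    then obtain m where m: "m \<in> carrier M" "x = e m" by (auto simp: car)
    have "\<ominus>\<^bsub>M\<^esub> m \<oplus>\<^bsub>M\<^esub> m = \<zero>\<^bsub>M\<^esub>"
      using M m by (meson abelian_group.l_neg module_grp)
    then show "\<exists>y \<in> carrier ?T. y \<oplus>\<^bsub>?T\<^esub> x = \<zero>\<^bsub>?T\<^esub>"
      using m M by (intro bexI[of _ "e (\<ominus>\<^bsub>M\<^esub> m)"]) (auto simp: car add zero)
  qed (use M in \<open>auto simp: car zero add smult mod_ac module.smult_l_distr module.smult_r_distr
      module.smult_assoc1\<close>)
  show "lin k ?T M (inv_into (carrier M) e)"
    by (rule linI) (use M e in \<open>auto simp: car add smult\<close>)
qed

text \<open>The scalars themselves are the elements here, in contrast to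
  \<open>scalar_algebra\<close>, so that values of functionals can be used as coefficients without
  the constructor \<open>Scalar\<close>.\<close>

definition self_module :: "('k, 'k) module" where
  "self_module = \<lparr>carrier = carrier k, mult = mult k, one = \<one>\<^bsub>k\<^esub>, zero = \<zero>\<^bsub>k\<^esub>, add = add k,
     smult = mult k\<rparr>"

lemma self_module_simps [simp]:
  "carrier self_module = carrier k" "\<zero>\<^bsub>self_module\<^esub> = \<zero>\<^bsub>k\<^esub>" "add self_module = add k"
  "smult self_module = mult k"
  by (simp_all add: self_module_def)

text \<open>The generating family is the carrier itself, each element x with a coordinate functional
  \<phi> x. No choice of generators is involved.\<close>

definition dual_basis :: "('k, 'u) module \<Rightarrow> ('u \<Rightarrow> 'u \<Rightarrow> 'k) \<Rightarrow> bool" where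
  "dual_basis P \<phi> \<longleftrightarrow> (\<forall>x \<in> carrier P. lin k P self_module (\<phi> x)) \<and>
     (\<forall>p \<in> carrier P. finsupp (carrier P) (\<lambda>x. \<phi> x p) \<and>
        comb P (carrier P) (\<lambda>x. \<phi> x p) (\<lambda>x. x) = p)"

text \<open>The identity of P is lifted along the surjection g from the free module on the carrier
  of P. The coordinates of the lift are the functionals, and g turns the lift of p into the
  expansion of p.\<close>

lemma projective_dual_basis:
  fixes P :: "('k, 'a) kmod"
  assumes P: "projective k P"
  shows "\<exists>\<phi>. dual_basis P \<phi>"
proof -
  have mP: "module k P" using P by (simp add: projective_def)
  define X where "X = carrier P"
  \<comment> \<open>The lifting property is only given for modules in \<open>univ\<close>, so the free module on \<open>X\<close> is
    encoded there by lists of coefficients and basis elements.\<close>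
  define supp where "supp c = (SOME xs. set xs = {x \<in> X. c x \<noteq> \<zero>\<^bsub>k\<^esub>})" for c :: "('k, 'a) univ \<Rightarrow> 'k"
  define e :: "(('k, 'a) univ \<Rightarrow> 'k) \<Rightarrow> ('k, 'a) univ" where
    "e c = Tensor (map (\<lambda>x. (Scalar (c x), x)) (supp c))" for c
  let ?F = "free_module X"
  let ?d = "inv_into (carrier ?F) e"
  have supp: "set (supp c) = {x \<in> X. c x \<noteq> \<zero>\<^bsub>k\<^esub>}" if "c \<in> carrier ?F" for c
  proof -
    have "\<exists>xs. set xs = {x \<in> X. c x \<noteq> \<zero>\<^bsub>k\<^esub>}"
      using that by (intro finite_list) (simp add: free_module_def finsupp_def)
    then show ?thesis unfolding supp_def by (rule someI_ex)
  qed
  \<comment> \<open>\<open>e c\<close> lists the nonzero coefficients together with their positions,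
    so c is recovered from the set of the entries, whatever order \<open>supp\<close> has
    chosen.\<close>
  have e: "inj_on e (carrier ?F)"
  proof (rule inj_onI)
    fix c d assume cd: "c \<in> carrier ?F" "d \<in> carrier ?F" "e c = e d"
    then have "map (\<lambda>x. (Scalar (c x) :: ('k, 'a) univ, x)) (supp c) =
        map (\<lambda>x. (Scalar (d x), x)) (supp d)"
      by (simp add: e_def)
    from arg_cong[OF this, of set] have *: "(\<lambda>x. (Scalar (c x), x)) ` {x \<in> X. c x \<noteq> \<zero>\<^bsub>k\<^esub>} =
        (\<lambda>x. (Scalar (d x) :: ('k, 'a) univ, x)) ` {x \<in> X. d x \<noteq> \<zero>\<^bsub>k\<^esub>}"
      using cd by (simp add: supp)
    have "c x = d x" if "x \<in> X" for x
    proof (cases "c x = \<zero>\<^bsub>k\<^esub>")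
      case False
      then have "(Scalar (c x), x) \<in> (\<lambda>x. (Scalar (d x) :: ('k, 'a) univ, x)) ` {x \<in> X. d x \<noteq> \<zero>\<^bsub>k\<^esub>}"
        unfolding *[symmetric] using that by auto
      then show ?thesis by auto
    next
      case True
      show ?thesis
      proof (rule ccontr)
        assume "c x \<noteq> d x"
        then have "(Scalar (d x), x) \<in> (\<lambda>x. (Scalar (c x) :: ('k, 'a) univ, x)) ` {x \<in> X. c x \<noteq>
            \<zero>\<^bsub>k\<^esub>}"
          unfolding * using that True by auto
        then show False using True \<open>c x \<noteq> d x\<close> by auto
      qed
    qed
    then show "c = d"
      using cd by (intro extensionalityI[of c X]) (auto simp: free_module_def)
  qed
  have F_add: "c \<oplus>\<^bsub>?F\<^esub> d = (\<lambda>x \<in> X. c x \<oplus>\<^bsub>k\<^esub> d x)" and F_smult: "r \<odot>\<^bsub>?F\<^esub> c = (\<lambda>x \<in> X. r \<otimes>\<^bsub>k\<^esub> c x)"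
      for c d r
    by (simp_all add: free_module_def)
  let ?T = "transport e ?F"
  note T = module_transport[OF module_free_module e]
  have dfs: "finsupp X (?d u)" if "u \<in> carrier ?T" for u
    using lin_closed[OF T(2) that] by (simp add: free_module_def)
  define g where "g = (\<lambda>u \<in> carrier ?T. comb P X (?d u) (\<lambda>x. x))"
  have g_lin: "lin k ?T P g"
    unfolding g_def
  proof (rule iffD2[OF lin_restrict[OF T(1)]], rule linI)
    fix u v assume uv: "u \<in> carrier ?T" "v \<in> carrier ?T"
    have "comb P X (?d (u \<oplus>\<^bsub>?T\<^esub> v)) (\<lambda>x. x) = comb P X (\<lambda>x. ?d u x \<oplus>\<^bsub>k\<^esub> ?d v x) (\<lambda>x. x)"
      using uv dfs mP T(1)
      by (intro comb_cong) (auto simp: lin_add[OF T(2)] F_add X_def[symmetric] finsupp_restrict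
          finsupp_add)
    then show "comb P X (?d (u \<oplus>\<^bsub>?T\<^esub> v)) (\<lambda>x. x) =
        comb P X (?d u) (\<lambda>x. x) \<oplus>\<^bsub>P\<^esub> comb P X (?d v) (\<lambda>x. x)"
      using uv dfs mP by (simp add: comb_add X_def)
  next
    fix r u assume u: "u \<in> carrier ?T" "r \<in> carrier k"
    have "comb P X (?d (r \<odot>\<^bsub>?T\<^esub> u)) (\<lambda>x. x) = comb P X (\<lambda>x. r \<otimes>\<^bsub>k\<^esub> ?d u x) (\<lambda>x. x)"
      using u dfs mP T(1)
      by (intro comb_cong) (auto simp: lin_smult[OF T(2)] F_smult X_def[symmetric] finsupp_restrict
          finsupp_smult)
    then show "comb P X (?d (r \<odot>\<^bsub>?T\<^esub> u)) (\<lambda>x. x) = r \<odot>\<^bsub>P\<^esub> comb P X (?d u) (\<lambda>x. x)"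
      using u dfs mP by (simp add: comb_smult X_def)
  qed (use dfs mP in \<open>simp add: X_def\<close>)
  have surj: "g ` carrier ?T = carrier P"
  proof (intro equalityI subsetI)
    fix p assume p: "p \<in> carrier P"
    interpret P: abelian_group P by (rule module_grp[OF mP])
    \<comment> \<open>The unit vector at p; its code is a preimage of p under g.\<close>
    define c where "c = (\<lambda>x \<in> X. if x = p then \<one>\<^bsub>k\<^esub> else \<zero>\<^bsub>k\<^esub>)"
    have c: "c \<in> carrier ?F"
      unfolding c_def free_module_def
      by (auto simp: finsupp_def intro: finite_subset[of _ "{p}"])
    then have u: "e c \<in> carrier ?T" "?d (e c) = c" using e by (auto simp: transport_def Let_def)
    have "comb P X c (\<lambda>x. x) = finsum P (\<lambda>x. c x \<odot>\<^bsub>P\<^esub> x) {p}"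
      using c p mP by (intro comb_superset) (auto simp: free_module_def X_def c_def)
    also have "\<dots> = p" using p mP by (simp add: c_def X_def)
    finally have "g (e c) = p" using u by (simp add: g_def)
    then show "p \<in> g ` carrier ?T" using u by force
  qed (use lin_closed[OF g_lin] in auto)
  have "g \<in> linear_maps k ?T P" using g_lin by (simp add: linear_maps_iff g_def)
  moreover have "(\<lambda>x \<in> carrier P. x) \<in> linear_maps k P P"
    using mP by (intro linear_maps_restrict linI) auto
  ultimately have "\<exists>h \<in> linear_maps k P ?T. \<forall>x \<in> carrier P. g (h x) = (\<lambda>x \<in> carrier P. x) x"
    using P surj T(1) mP unfolding projective_def by blast
  then obtain h where h: "h \<in> linear_maps k P ?T" "\<And>x. x \<in> carrier P \<Longrightarrow> g (h x) = x"
    by auto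
  then have hl: "lin k P ?T h" by (simp add: linear_maps_iff)
  have dh: "lin k P ?F (\<lambda>p. ?d (h p))" by (rule lin_comp[OF hl T(2)])
  have dh_fs: "?d (h p) x \<in> carrier k" if "p \<in> carrier P" "x \<in> X" for p x
    using lin_closed[OF dh that(1)] that(2) by (auto simp: free_module_def finsupp_def)
  have "dual_basis P (\<lambda>x p. ?d (h p) x)"
    unfolding dual_basis_def
  proof (intro conjI ballI)
    fix x assume x: "x \<in> carrier P"
    show "lin k P self_module (\<lambda>p. ?d (h p) x)"
      using x lin_closed[OF dh] by (intro linI)
        (auto simp: lin_add[OF dh] lin_smult[OF dh] F_add F_smult X_def[symmetric] dh_fs)
  next
    fix p assume p: "p \<in> carrier P"
    show "finsupp (carrier P) (\<lambda>x. ?d (h p) x)"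
      using dfs[OF lin_closed[OF hl p]] by (simp add: X_def)
    show "comb P (carrier P) (\<lambda>x. ?d (h p) x) (\<lambda>x. x) = p"
      using h(2)[OF p] lin_closed[OF hl p] by (simp add: g_def X_def)
  qed
  then show ?thesis by blast
qed

text \<open>The usual argument through Hom(Q, X) would leave the type \<open>univ\<close>. Instead
  the lifting property of P is applied to p \<mapsto> f (p \<otimes> w) for each w in Q separately,
  and the lifts are combined with coefficients from a dual basis of Q.\<close>

lemma projective_tensor:
  fixes P Q :: "('k, 'a) kmod"
  assumes P: "projective k P" and Q: "projective k Q"
  shows "projective k (tensor k P Q)"
proof -
  have mods: "module k P" "module k Q" using P Q by (auto simp: projective_def)
  obtain \<psi> where \<psi>: "dual_basis Q \<psi>" using projective_dual_basis[OF Q] by blast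
  have fs: "finsupp (carrier Q) (\<lambda>x. \<psi> x q)" and cb: "comb Q (carrier Q) (\<lambda>x. \<psi> x q) (\<lambda>x. x) = q"
    if "q \<in> carrier Q" for q
    using \<psi> that by (auto simp: dual_basis_def)
  have \<psi>l: "lin k Q self_module (\<psi> x)" if "x \<in> carrier Q" for x
    using \<psi> that by (simp add: dual_basis_def)
  let ?T = "tensor k P Q"
  show ?thesis
    unfolding projective_def
  proof (intro conjI allI impI)
    fix X Y :: "('k, 'a) kmod" and g f
    assume X: "module k X" and Y: "module k Y" and g: "g \<in> linear_maps k X Y"
      and surj: "g ` carrier X = carrier Y" and f: "f \<in> linear_maps k ?T Y"
    have gl: "lin k X Y g" and fl: "lin k ?T Y f" using f g by (simp_all add: linear_maps_iff)
    have fw: "lin k P Y (\<lambda>p. f (pure_tensor k P Q p w))" if "w \<in> carrier Q" for w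
      by (rule linI) (use that mods in \<open>simp_all add: linD[OF fl]\<close>)
    have "\<exists>h \<in> linear_maps k P X. \<forall>p \<in> carrier P. g (h p) = f (pure_tensor k P Q p w)"
      if w: "w \<in> carrier Q" for w
    proof -
      have "(\<lambda>p \<in> carrier P. f (pure_tensor k P Q p w)) \<in> linear_maps k P Y"
        using fw[OF w] mods by (rule_tac linear_maps_restrict) auto
      then have "\<exists>h \<in> linear_maps k P X. \<forall>x \<in> carrier P.
          g (h x) = (\<lambda>p \<in> carrier P. f (pure_tensor k P Q p w)) x"
        using P X Y g surj unfolding projective_def by blast
      then show ?thesis by simp
    qed
    then obtain H where H: "\<And>w. w \<in> carrier Q \<Longrightarrow> H w \<in> linear_maps k P X"
      "\<And>w p. w \<in> carrier Q \<Longrightarrow> p \<in> carrier P \<Longrightarrow> g (H w p) = f (pure_tensor k P Q p w)"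
      by metis
    have Hl: "lin k P X (H w)" if "w \<in> carrier Q" for w using H(1)[OF that]
      by (simp add: linear_maps_iff)
    have im: "(\<lambda>w. H w p) \<in> carrier Q \<rightarrow> carrier X" if "p \<in> carrier P" for p
      using that lin_closed[OF Hl] by auto
    \<comment> \<open>The lifts \<open>H w\<close> are chosen independently for different w;
      linearity in q comes from the coefficients \<open>\<psi> w q\<close> alone.\<close>
    define \<eta> where "\<eta> p q = comb X (carrier Q) (\<lambda>w. \<psi> w q) (\<lambda>w. H w p)" for p q
    have b: "bil k P Q X \<eta>"
    proof (rule bilI)
      fix p q assume "p \<in> carrier P" "q \<in> carrier Q"
      then show "\<eta> p q \<in> carrier X" unfolding \<eta>_def using fs X im by simp
    next
      fix p p' q assume p: "p \<in> carrier P" "p' \<in> carrier P" "q \<in> carrier Q"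
      have "\<eta> (p \<oplus>\<^bsub>P\<^esub> p') q = comb X (carrier Q) (\<lambda>w. \<psi> w q) (\<lambda>w. H w p \<oplus>\<^bsub>X\<^esub> H w p')"
        unfolding \<eta>_def using p fs X lin_closed[OF Hl]
        by (intro comb_cong) (auto simp: lin_add[OF Hl])
      then show "\<eta> (p \<oplus>\<^bsub>P\<^esub> p') q = \<eta> p q \<oplus>\<^bsub>X\<^esub> \<eta> p' q"
        unfolding \<eta>_def using p X fs im by (simp add: comb_addR)
    next
      fix p q q' assume q: "p \<in> carrier P" "q \<in> carrier Q" "q' \<in> carrier Q"
      have "\<eta> p (q \<oplus>\<^bsub>Q\<^esub> q') = comb X (carrier Q) (\<lambda>w. \<psi> w q \<oplus>\<^bsub>k\<^esub> \<psi> w q') (\<lambda>w. H w p)"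
        unfolding \<eta>_def using q fs[of "q \<oplus>\<^bsub>Q\<^esub> q'"] X im mods
        by (intro comb_cong) (auto simp: lin_add[OF \<psi>l] Pi_iff)
      then show "\<eta> p (q \<oplus>\<^bsub>Q\<^esub> q') = \<eta> p q \<oplus>\<^bsub>X\<^esub> \<eta> p q'"
        unfolding \<eta>_def using q X fs im by (simp add: comb_add)
    next
      fix r p q assume p: "r \<in> carrier k" "p \<in> carrier P" "q \<in> carrier Q"
      have "lin k X X (\<lambda>x. r \<odot>\<^bsub>X\<^esub> x)"
        using X p by (intro linI)
          (auto simp: module.smult_r_distr module.smult_assoc1[symmetric] k.m_comm)
      from comb_lin[OF this X X fs im] p
      have "r \<odot>\<^bsub>X\<^esub> \<eta> p q = comb X (carrier Q) (\<lambda>w. \<psi> w q) (\<lambda>w. r \<odot>\<^bsub>X\<^esub> H w p)"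
        by (simp add: \<eta>_def)
      also have "\<dots> = \<eta> (r \<odot>\<^bsub>P\<^esub> p) q"
        unfolding \<eta>_def using p fs X im mods
        by (intro comb_cong) (auto simp: lin_smult[OF Hl] lin_closed[OF Hl] Pi_iff)
      finally show "\<eta> (r \<odot>\<^bsub>P\<^esub> p) q = r \<odot>\<^bsub>X\<^esub> \<eta> p q" by simp
      have "\<eta> p (r \<odot>\<^bsub>Q\<^esub> q) = comb X (carrier Q) (\<lambda>w. r \<otimes>\<^bsub>k\<^esub> \<psi> w q) (\<lambda>w. H w p)"
        unfolding \<eta>_def using p fs[of "r \<odot>\<^bsub>Q\<^esub> q"] X im mods
        by (intro comb_cong) (auto simp: lin_smult[OF \<psi>l] Pi_iff)
      then show "\<eta> p (r \<odot>\<^bsub>Q\<^esub> q) = r \<odot>\<^bsub>X\<^esub> \<eta> p q"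
        unfolding \<eta>_def using p X fs im by (simp add: comb_smult)
    qed
    note lift = lin_tensor_lift[OF mods X b]
    \<comment> \<open>g moves into the combination and turns \<open>H w p\<close> into f (p
      \<otimes> w). As f (p \<otimes> w) is linear in w, the coefficients collect to the expansion
      of q in the second factor.\<close>
    have g\<eta>: "g (\<eta> p q) = f (pure_tensor k P Q p q)" if pq: "p \<in> carrier P" "q \<in> carrier Q" for p q
    proof -
      have "g (\<eta> p q) = comb Y (carrier Q) (\<lambda>w. \<psi> w q) (\<lambda>w. g (H w p))"
        unfolding \<eta>_def using pq by (intro comb_lin[OF gl X Y fs im])
      also have "\<dots> = comb Y (carrier Q) (\<lambda>w. \<psi> w q) (\<lambda>w. f (pure_tensor k P Q p w))"
        using pq H(2) fs Y by (intro comb_cong) (auto simp: lin_closed[OF fl])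
      also have "\<dots> = f (pure_tensor k P Q p (comb Q (carrier Q) (\<lambda>w. \<psi> w q) (\<lambda>w. w)))"
      proof -
        have "lin k Q Y (\<lambda>w. f (pure_tensor k P Q p w))"
          by (rule linI) (use pq mods in \<open>simp_all add: linD[OF fl]\<close>)
        from comb_lin[OF this mods(2) Y fs[OF pq(2)], of "\<lambda>w. w"] show ?thesis by simp
      qed
      finally show ?thesis using cb pq by simp
    qed
    have gz: "g (tensor_lift X \<eta> z) = f z" if z: "z \<in> carrier ?T" for z
      by (rule lin_eq_on_tensor[OF lin_comp[OF lift(1) gl] fl mods Y _ z]) (simp add: lift(2) g\<eta>)
    show "\<exists>h \<in> linear_maps k ?T X. \<forall>x \<in> carrier ?T. g (h x) = f x"
      by (rule bexI[of _ "\<lambda>x \<in> carrier ?T. tensor_lift X \<eta> x"])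
        (use gz lift(1) mods in \<open>auto intro!: linear_maps_restrict\<close>)
  qed (use mods in simp)
qed

text \<open>With a dual basis of M, every tensor is a finite sum of terms x \<otimes>
  \<open>\<zeta> x z\<close>, where \<open>\<zeta> x\<close> evaluates the functional
  \<open>\<phi> x\<close> on the left factor. If all functionals send z to 0, then z = 0.\<close>

lemma tensor_separateL:
  fixes M N :: "('k, 'a) kmod"
  assumes M: "projective k M" and N: "module k N" and z: "z \<in> carrier (tensor k M N)"
    and sep: "\<And>\<phi>. lin k M self_module \<phi> \<Longrightarrow> tensor_lift N (\<lambda>m n. \<phi> m \<odot>\<^bsub>N\<^esub> n) z = \<zero>\<^bsub>N\<^esub>"
  shows "z = \<zero>\<^bsub>tensor k M N\<^esub>"
proof -
  have mM: "module k M" using M by (simp add: projective_def)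
  obtain \<phi> where \<phi>: "dual_basis M \<phi>" using projective_dual_basis[OF M] by blast
  let ?T = "tensor k M N"
  have mT: "module k ?T" using mM N by simp
  interpret T: abelian_group ?T by (rule module_grp[OF mT])
  have \<phi>l: "lin k M self_module (\<phi> x)" if "x \<in> carrier M" for x
    using \<phi> that by (simp add: dual_basis_def)
  have b: "bil k M N N (\<lambda>m n. \<phi> x m \<odot>\<^bsub>N\<^esub> n)" if "x \<in> carrier M" for x
    using \<phi>l[OF that] N
    by (intro bilI) (auto simp: lin_def module.smult_l_distr module.smult_r_distr
        module.smult_assoc1[symmetric] k.m_comm)
  define \<zeta> where "\<zeta> x = tensor_lift N (\<lambda>m n. \<phi> x m \<odot>\<^bsub>N\<^esub> n)" for x
  note \<zeta> = lin_tensor_lift[OF mM N N b, folded \<zeta>_def]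
  \<comment> \<open>The expansion is claimed for every finite index set that contains X0, so that
    two tensors can be expanded over a common index set when they are added.\<close>
  have "\<exists>X0. finite X0 \<and> X0 \<subseteq> carrier M \<and> (\<forall>X1. finite X1 \<longrightarrow> X0 \<subseteq> X1 \<longrightarrow> X1 \<subseteq> carrier M \<longrightarrow>
      z = finsum ?T (\<lambda>x. pure_tensor k M N x (\<zeta> x z)) X1)"
    using z mM N
  proof (induction rule: tensor_induct)
    case zero
    have "finsum ?T (\<lambda>x. pure_tensor k M N x (\<zeta> x \<zero>\<^bsub>?T\<^esub>)) X1 = finsum ?T (\<lambda>x. \<zero>\<^bsub>?T\<^esub>) X1"
      if "X1 \<subseteq> carrier M" for X1
      using that lin_zero[OF \<zeta>(1) mT N] mM N by (intro T.finsum_cong') auto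
    then show ?case by (intro exI[of _ "{}"]) (simp add: T.finsum_zero)
  next
    case (pure m n)
    have fs: "finsupp (carrier M) (\<lambda>x. \<phi> x m)" "comb M (carrier M) (\<lambda>x. \<phi> x m) (\<lambda>x. x) = m"
      using \<phi> pure by (auto simp: dual_basis_def)
    have "pure_tensor k M N m n = finsum ?T (\<lambda>x. pure_tensor k M N x (\<zeta> x (pure_tensor k M N m n)))
        X1"
      if X1: "finite X1" "{x \<in> carrier M. \<phi> x m \<noteq> \<zero>\<^bsub>k\<^esub>} \<subseteq> X1" "X1 \<subseteq> carrier M" for X1
    proof -
      have \<phi>m: "\<phi> x m \<in> carrier k" if "x \<in> X1" for x
        using lin_closed[OF \<phi>l, of x m] that pure X1 by auto
      have "m = finsum M (\<lambda>x. \<phi> x m \<odot>\<^bsub>M\<^esub> x) X1"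
        using comb_superset[OF mM fs(1) _ X1(1,3,2), of "\<lambda>x. x"] fs(2) by simp
      then have "pure_tensor k M N m n = pure_tensor k M N (finsum M (\<lambda>x. \<phi> x m \<odot>\<^bsub>M\<^esub> x) X1) n"
        by simp
      also have "\<dots> = finsum ?T (\<lambda>x. pure_tensor k M N (\<phi> x m \<odot>\<^bsub>M\<^esub> x) n) X1"
        using pure X1 \<phi>m mM by (intro lin_finsum[OF bil_linL[OF bil_pure_tensor[OF mM N]] mM mT])
            auto
      also have "\<dots> = finsum ?T (\<lambda>x. pure_tensor k M N x (\<zeta> x (pure_tensor k M N m n))) X1"
        using pure X1 \<phi>m mM N by (intro T.finsum_cong') (auto simp: \<zeta>(2) subset_iff)
      finally show ?thesis .
    qed
    then show ?case using fs by (intro exI[of _ "{x \<in> carrier M. \<phi> x m \<noteq> \<zero>\<^bsub>k\<^esub>}"])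
        (auto simp: finsupp_def)
  next
    case (add x y)
    then obtain X0 Y0 where
      X0: "finite X0" "X0 \<subseteq> carrier M" "\<And>X1. finite X1 \<Longrightarrow> X0 \<subseteq> X1 \<Longrightarrow> X1 \<subseteq> carrier M \<Longrightarrow>
        x = finsum ?T (\<lambda>i. pure_tensor k M N i (\<zeta> i x)) X1" and
      Y0: "finite Y0" "Y0 \<subseteq> carrier M" "\<And>X1. finite X1 \<Longrightarrow> Y0 \<subseteq> X1 \<Longrightarrow> X1 \<subseteq> carrier M \<Longrightarrow>
        y = finsum ?T (\<lambda>i. pure_tensor k M N i (\<zeta> i y)) X1"
      by blast
    have "x \<oplus>\<^bsub>?T\<^esub> y = finsum ?T (\<lambda>i. pure_tensor k M N i (\<zeta> i (x \<oplus>\<^bsub>?T\<^esub> y))) X1"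
      if X1: "finite X1" "X0 \<union> Y0 \<subseteq> X1" "X1 \<subseteq> carrier M" for X1
    proof -
      have cl: "\<zeta> i x \<in> carrier N" "\<zeta> i y \<in> carrier N" if "i \<in> X1" for i
        using that X1 add lin_closed[OF \<zeta>(1)] by auto
      have "finsum ?T (\<lambda>i. pure_tensor k M N i (\<zeta> i (x \<oplus>\<^bsub>?T\<^esub> y))) X1 =
          finsum ?T (\<lambda>i. pure_tensor k M N i (\<zeta> i x) \<oplus>\<^bsub>?T\<^esub> pure_tensor k M N i (\<zeta> i y)) X1"
        using X1 add cl mM N by (intro T.finsum_cong') (auto simp: lin_add[OF \<zeta>(1)] subset_iff)
      also have "\<dots> = finsum ?T (\<lambda>i. pure_tensor k M N i (\<zeta> i x)) X1 \<oplus>\<^bsub>?T\<^esub>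
          finsum ?T (\<lambda>i. pure_tensor k M N i (\<zeta> i y)) X1"
        using X1 cl by (intro T.finsum_addf) auto
      also have "\<dots> = x \<oplus>\<^bsub>?T\<^esub> y" using X0(3)[OF X1(1) _ X1(3)] Y0(3)[OF X1(1) _ X1(3)] X1 by simp
      finally show ?thesis by simp
    qed
    then show ?case using X0 Y0 by (intro exI[of _ "X0 \<union> Y0"]) auto
  qed
  then obtain X0 where X0: "X0 \<subseteq> carrier M" "z = finsum ?T (\<lambda>x. pure_tensor k M N x (\<zeta> x z)) X0"
    by blast
  note X0(2)
  also have "finsum ?T (\<lambda>x. pure_tensor k M N x (\<zeta> x z)) X0 = finsum ?T (\<lambda>x. \<zero>\<^bsub>?T\<^esub>) X0"
    using X0(1) sep[OF \<phi>l] mM N by (intro T.finsum_cong') (auto simp: \<zeta>_def)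
  finally show ?thesis by (simp add: T.finsum_zero)
qed

text \<open>Reduced to the previous lemma by the symmetry \<open>?s\<close> of the tensor product,
  which \<open>?s'\<close> undoes.\<close>

lemma tensor_separateR:
  fixes M N :: "('k, 'a) kmod"
  assumes M: "module k M" and N: "projective k N" and z: "z \<in> carrier (tensor k M N)"
    and sep: "\<And>\<phi>. lin k N self_module \<phi> \<Longrightarrow> tensor_lift M (\<lambda>m n. \<phi> n \<odot>\<^bsub>M\<^esub> m) z = \<zero>\<^bsub>M\<^esub>"
  shows "z = \<zero>\<^bsub>tensor k M N\<^esub>"
proof -
  have mN: "module k N" using N by (simp add: projective_def)
  note lift = lin_tensor_lift[OF M mN tensor_module[OF mN M] bil_flip[OF bil_pure_tensor[OF mN M]]]
  note lift' = lin_tensor_lift[OF mN M tensor_module[OF M mN] bil_flip[OF bil_pure_tensor[OF M mN]]]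
  let ?s = "tensor_lift (tensor k N M) (\<lambda>m n. pure_tensor k N M n m)"
  let ?s' = "tensor_lift (tensor k M N) (\<lambda>n m. pure_tensor k M N m n)"
  have "?s z = \<zero>\<^bsub>tensor k N M\<^esub>"
  proof (rule tensor_separateL[OF N M lin_closed[OF lift(1) z]])
    fix \<phi> assume \<phi>: "lin k N self_module \<phi>"
    have b: "bil k N M M (\<lambda>n m. \<phi> n \<odot>\<^bsub>M\<^esub> m)"
      using \<phi> M by (intro bilI) (auto simp: lin_def module.smult_l_distr module.smult_r_distr
          module.smult_assoc1[symmetric] k.m_comm)
    note l = lin_tensor_lift[OF mN M M b] lin_tensor_lift[OF M mN M bil_flip[OF b]]
    have "tensor_lift M (\<lambda>n m. \<phi> n \<odot>\<^bsub>M\<^esub> m) (?s z) = tensor_lift M (\<lambda>m n. \<phi> n \<odot>\<^bsub>M\<^esub> m) z"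
      by (rule lin_eq_on_tensor[OF lin_comp[OF lift(1) l(1)] l(3) M mN M _ z]) (simp add: lift(2) l)
    then show "tensor_lift M (\<lambda>n m. \<phi> n \<odot>\<^bsub>M\<^esub> m) (?s z) = \<zero>\<^bsub>M\<^esub>" using sep[OF \<phi>] by simp
  qed
  moreover have "?s' (?s z) = z"
    by (rule lin_eq_on_tensor[OF lin_comp[OF lift(1) lift'(1)] _ M mN _ _ z])
      (use M mN in \<open>simp_all add: lift(2) lift'(2) lin_def\<close>)
  ultimately show ?thesis
    using lin_zero[OF lift'(1)] M mN by simp
qed

end

section \<open>Non-degenerate idempotent modules and base change\<close>

text \<open>A module over an algebra with multiplication \<open>p\<close> is given by its action map, written as a right
  action; left modules are right modules over the opposite multiplication.\<close>

definition nd_module :: "'k ring \<Rightarrow> ('k, 'x) module \<Rightarrow> ('x \<Rightarrow> 'x \<Rightarrow> 'x) \<Rightarrow>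
    ('k, 'u) module \<Rightarrow> ('u \<Rightarrow> 'x \<Rightarrow> 'u) \<Rightarrow> bool" where
  "nd_module k A p M \<rho> \<longleftrightarrow> module k M \<and> bil k M A M \<rho> \<and>
     (\<forall>m \<in> carrier M. \<forall>a \<in> carrier A. \<forall>b \<in> carrier A. \<rho> (\<rho> m a) b = \<rho> m (p a b)) \<and>
     (\<forall>m \<in> carrier M. (\<forall>a \<in> carrier A. \<rho> m a = \<zero>\<^bsub>M\<^esub>) \<longrightarrow> m = \<zero>\<^bsub>M\<^esub>) \<and>
     carrier M = addspan M {\<rho> m a | m a. m \<in> carrier M \<and> a \<in> carrier A}"

text \<open>The operations are separate arguments, not fields of a record, so that passing to
  opposite multiplications is a permutation of arguments, as in \<open>nd_ext_op\<close>.\<close>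

definition nd_ext :: "'k ring \<Rightarrow> ('k, 'x) module \<Rightarrow> ('x \<Rightarrow> 'x \<Rightarrow> 'x) \<Rightarrow>
    ('k, 'u) module \<Rightarrow> ('u \<Rightarrow> 'u \<Rightarrow> 'u) \<Rightarrow> ('x \<Rightarrow> 'u \<Rightarrow> 'u) \<Rightarrow> ('u \<Rightarrow> 'x \<Rightarrow> 'u) \<Rightarrow> bool" where
  "nd_ext k A p R q l r \<longleftrightarrow> bil k R R R q \<and>
     (\<forall>x \<in> carrier R. \<forall>y \<in> carrier R. \<forall>z \<in> carrier R. q (q x y) z = q x (q y z)) \<and>
     nd_module k A p R r \<and> nd_module k A (\<lambda>a b. p b a) R (\<lambda>x a. l a x) \<and>
     (\<forall>x \<in> carrier R. \<forall>a \<in> carrier A. \<forall>b \<in> carrier A. r (l a x) b = l a (r x b)) \<and>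
     (\<forall>x \<in> carrier R. \<forall>y \<in> carrier R. \<forall>a \<in> carrier A.
        l a (q x y) = q (l a x) y \<and> r (q x y) a = q x (r y a) \<and> q (r x a) y = q x (l a y))"

text \<open>Base change along an extension \<open>B\<close> of \<open>A\<close>: the action of \<open>a \<in> A\<close> has to send \<open>m = \<Sum> m\<^sub>i y\<^sub>i\<close> to
  \<open>\<Sum> m\<^sub>i (y\<^sub>i a)\<close>. As the \<open>B\<close>-module \<open>M\<close> is non-degenerate, the value is determined by its
  products with the elements of \<open>B\<close>, which avoids a choice of the \<open>m\<^sub>i\<close> and \<open>y\<^sub>i\<close>.\<close>

definition base_change :: "('k, 'y) module \<Rightarrow> ('x \<Rightarrow> 'y \<Rightarrow> 'y) \<Rightarrow> ('k, 'u) module \<Rightarrow>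
    ('u \<Rightarrow> 'y \<Rightarrow> 'u) \<Rightarrow> 'u \<Rightarrow> 'x \<Rightarrow> 'u" where
  "base_change B l M \<rho> m a =
     (THE m'. m' \<in> carrier M \<and> (\<forall>y \<in> carrier B. \<rho> m' y = \<rho> m (l a y)))"

lemma nd_moduleD:
  assumes "nd_module k A p M \<rho>"
  shows "module k M" "bil k M A M \<rho>"
    and "m \<in> carrier M \<Longrightarrow> a \<in> carrier A \<Longrightarrow> b \<in> carrier A \<Longrightarrow> \<rho> (\<rho> m a) b = \<rho> m (p a b)"
    and "m \<in> carrier M \<Longrightarrow> (\<And>a. a \<in> carrier A \<Longrightarrow> \<rho> m a = \<zero>\<^bsub>M\<^esub>) \<Longrightarrow> m = \<zero>\<^bsub>M\<^esub>"
    and "carrier M = addspan M {\<rho> m a | m a. m \<in> carrier M \<and> a \<in> carrier A}"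
  using assms unfolding nd_module_def by blast+

lemma nd_extD:
  assumes "nd_ext k A p R q l r"
  shows "nd_module k A p R r" "nd_module k A (\<lambda>a b. p b a) R (\<lambda>x a. l a x)" "bil k R R R q"
    and "x \<in> carrier R \<Longrightarrow> y \<in> carrier R \<Longrightarrow> z \<in> carrier R \<Longrightarrow> q (q x y) z = q x (q y z)"
    and "x \<in> carrier R \<Longrightarrow> a \<in> carrier A \<Longrightarrow> b \<in> carrier A \<Longrightarrow> r (l a x) b = l a (r x b)"
    and "x \<in> carrier R \<Longrightarrow> y \<in> carrier R \<Longrightarrow> a \<in> carrier A \<Longrightarrow> l a (q x y) = q (l a x) y"
    and "x \<in> carrier R \<Longrightarrow> y \<in> carrier R \<Longrightarrow> a \<in> carrier A \<Longrightarrow> r (q x y) a = q x (r y a)"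
    and "x \<in> carrier R \<Longrightarrow> y \<in> carrier R \<Longrightarrow> a \<in> carrier A \<Longrightarrow> q (r x a) y = q x (l a y)"
  using assms unfolding nd_ext_def by blast+

text \<open>Exchanges the left and the right half of an extension, so that facts about left actions
  follow from those about right actions.\<close>

lemma nd_ext_op:
  assumes "nd_ext k A p R q l r"
  shows "nd_ext k A (\<lambda>a b. p b a) R (\<lambda>x y. q y x) (\<lambda>a x. r x a) (\<lambda>x a. l a x)"
  using assms unfolding nd_ext_def by (auto simp: bil_flip)

context scalars
begin

lemma nd_moduleI:
  assumes M: "module k M" and b: "bil k M A M \<rho>"
    and "\<And>m a b. m \<in> carrier M \<Longrightarrow> a \<in> carrier A \<Longrightarrow> b \<in> carrier A \<Longrightarrow> \<rho> (\<rho> m a) b = \<rho> m (p a b)"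
    and "\<And>m. m \<in> carrier M \<Longrightarrow> (\<And>a. a \<in> carrier A \<Longrightarrow> \<rho> m a = \<zero>\<^bsub>M\<^esub>) \<Longrightarrow> m = \<zero>\<^bsub>M\<^esub>"
    and "\<And>m. m \<in> carrier M \<Longrightarrow> m \<in> addspan M {\<rho> m a | m a. m \<in> carrier M \<and> a \<in> carrier A}"
  shows "nd_module k A p M \<rho>"
proof -
  have "addspan M {\<rho> m a | m a. m \<in> carrier M \<and> a \<in> carrier A} \<subseteq> carrier M"
    using addspan_closed[OF _ M] bil_closed[OF b] by blast
  then show ?thesis unfolding nd_module_def using assms by blast
qed

text \<open>Idempotence in the form used throughout: an additive property has to be checked only on
  products m a.\<close>

lemma nd_induct [consumes 2, case_names zero act add]:
  assumes nd: "nd_module k A p M \<rho>" and m: "m \<in> carrier M"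
    and zero: "Q \<zero>\<^bsub>M\<^esub>"
    and act: "\<And>m a. m \<in> carrier M \<Longrightarrow> a \<in> carrier A \<Longrightarrow> Q (\<rho> m a)"
    and add: "\<And>x y. x \<in> carrier M \<Longrightarrow> y \<in> carrier M \<Longrightarrow> Q x \<Longrightarrow> Q y \<Longrightarrow> Q (x \<oplus>\<^bsub>M\<^esub> y)"
  shows "Q m"
proof -
  let ?S = "{\<rho> m a | m a. m \<in> carrier M \<and> a \<in> carrier A}"
  have S: "?S \<subseteq> carrier M" using bil_closed[OF nd_moduleD(2)[OF nd]] by blast
  have "m \<in> addspan M ?S" using m nd_moduleD(5)[OF nd] by blast
  then have "m \<in> carrier M \<and> Q m"
  proof induction
    case zero
    then show ?case using nd_moduleD(1)[OF nd] assms(3) by simp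
  next
    case (step x y)
    then have "x \<in> carrier M" "Q x" using act S by blast+
    then show ?case using step add[of x y] nd_moduleD(1)[OF nd] by simp
  qed
  then show ?thesis ..
qed

lemma nd_eqI:
  assumes nd: "nd_module k A p M \<rho>" and m: "m \<in> carrier M" "m' \<in> carrier M"
    and eq: "\<And>a. a \<in> carrier A \<Longrightarrow> \<rho> m a = \<rho> m' a"
  shows "m = m'"
proof (rule mod_minus_eqD[OF nd_moduleD(1)[OF nd] m])
  note M = nd_moduleD(1)[OF nd] and b = nd_moduleD(2)[OF nd]
  have k1: "\<ominus>\<^bsub>k\<^esub> \<one>\<^bsub>k\<^esub> \<in> carrier k" by simp
  show "m \<oplus>\<^bsub>M\<^esub> (\<ominus>\<^bsub>k\<^esub> \<one>\<^bsub>k\<^esub>) \<odot>\<^bsub>M\<^esub> m' = \<zero>\<^bsub>M\<^esub>"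
  proof (rule nd_moduleD(4)[OF nd])
    fix a assume a: "a \<in> carrier A"
    then have c: "\<rho> m' a \<in> carrier M" using m bil_closed[OF b] by simp
    have "\<rho> (m \<oplus>\<^bsub>M\<^esub> (\<ominus>\<^bsub>k\<^esub> \<one>\<^bsub>k\<^esub>) \<odot>\<^bsub>M\<^esub> m') a = \<one>\<^bsub>k\<^esub> \<odot>\<^bsub>M\<^esub> \<rho> m' a \<oplus>\<^bsub>M\<^esub> (\<ominus>\<^bsub>k\<^esub> \<one>\<^bsub>k\<^esub>) \<odot>\<^bsub>M\<^esub> \<rho> m' a"
      using a m M c k1 by (simp add: bilD[OF b] eq)
    also have "\<dots> = (\<one>\<^bsub>k\<^esub> \<oplus>\<^bsub>k\<^esub> \<ominus>\<^bsub>k\<^esub> \<one>\<^bsub>k\<^esub>) \<odot>\<^bsub>M\<^esub> \<rho> m' a"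
      using c k1 by (intro module.smult_l_distr[OF M, symmetric]) auto
    also have "\<dots> = \<zero>\<^bsub>M\<^esub>" using c M by (simp add: k.r_neg)
    finally show "\<rho> (m \<oplus>\<^bsub>M\<^esub> (\<ominus>\<^bsub>k\<^esub> \<one>\<^bsub>k\<^esub>) \<odot>\<^bsub>M\<^esub> m') a = \<zero>\<^bsub>M\<^esub>" .
  qed (use m M k1 in simp)
qed

lemma nd_module_cong:
  assumes "nd_module k A p M \<rho>"
    and \<rho>: "\<And>m a. m \<in> carrier M \<Longrightarrow> a \<in> carrier A \<Longrightarrow> \<rho>' m a = \<rho> m a"
    and p: "\<And>a b. a \<in> carrier A \<Longrightarrow> b \<in> carrier A \<Longrightarrow> p' a b = p a b"
    and A: "module k A" "\<And>a b. a \<in> carrier A \<Longrightarrow> b \<in> carrier A \<Longrightarrow> p a b \<in> carrier A"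
  shows "nd_module k A p' M \<rho>'"
proof -
  note nd = assms(1)
  note M = nd_moduleD(1)[OF nd] and b = nd_moduleD(2)[OF nd]
  have S: "{\<rho>' m a | m a. m \<in> carrier M \<and> a \<in> carrier A} = {\<rho> m a | m a. m \<in> carrier M \<and>
      a \<in> carrier A}"
    by (rule Collect_cong) (metis \<rho>)
  show ?thesis
  proof (rule nd_moduleI[OF M])
    show "bil k M A M \<rho>'" by (rule bilI) (use M A in \<open>simp_all add: \<rho> bilD[OF b]\<close>)
    show "m = \<zero>\<^bsub>M\<^esub>" if "m \<in> carrier M" "\<And>a. a \<in> carrier A \<Longrightarrow> \<rho>' m a = \<zero>\<^bsub>M\<^esub>" for m
      using that nd_moduleD(4)[OF nd, of m] \<rho> by simp
    show "m \<in> addspan M {\<rho>' m a | m a. m \<in> carrier M \<and> a \<in> carrier A}" if "m \<in> carrier M" for m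
      using that nd_moduleD(5)[OF nd] by (subst S) (rule subst)
    show "\<rho>' (\<rho>' m a) b = \<rho>' m (p' a b)" if "m \<in> carrier M" "a \<in> carrier A" "b \<in> carrier A"
        for m a b
      using that nd_moduleD(3)[OF nd that] A(2) bil_closed[OF b] by (simp add: p \<rho>)
  qed
qed

section \<open>Base change\<close>

lemma base_change_eqI:
  assumes F: "nd_module k B q M \<rho>" and "m' \<in> carrier M"
    and "\<And>y. y \<in> carrier B \<Longrightarrow> \<rho> m' y = \<rho> m (l a y)"
  shows "base_change B l M \<rho> m a = m'"
  unfolding base_change_def
proof (rule the_equality)
  fix n assume "n \<in> carrier M \<and> (\<forall>y \<in> carrier B. \<rho> n y = \<rho> m (l a y))"
  then show "n = m'" by - (rule nd_eqI[OF F], use assms in auto)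
qed (use assms in simp)

text \<open>Why B-linear maps are A-linear after base change: the image of the old value has the
  products with B that characterise the new value.\<close>

lemma base_change_map:
  assumes F': "nd_module k B q M' \<rho>'"
    and h: "lin k M M' h" and eq: "\<And>m y. m \<in> carrier M \<Longrightarrow> y \<in> carrier B \<Longrightarrow> h (\<rho> m y) = \<rho>' (h m) y"
    and m: "m \<in> carrier M" and bc: "base_change B l M \<rho> m a \<in> carrier M"
      "\<And>y. y \<in> carrier B \<Longrightarrow> \<rho> (base_change B l M \<rho> m a) y = \<rho> m (l a y)"
      "\<And>y. y \<in> carrier B \<Longrightarrow> l a y \<in> carrier B"
  shows "h (base_change B l M \<rho> m a) = base_change B l M' \<rho>' (h m) a"
  by (rule base_change_eqI[OF F', symmetric]) (use m bc
      in \<open>simp_all add: lin_closed[OF h] eq[symmetric]\<close>)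

text \<open>The acting elements a and a' may belong to different algebras, as long as they act alike
  on B. This is how \<open>ndi_cmp\<close> passes from multipliers to elements of an
  algebra.\<close>

lemma base_change_cong:
  assumes "carrier B = carrier B'" "carrier M = carrier M'"
    and "\<And>m y. m \<in> carrier M \<Longrightarrow> y \<in> carrier B \<Longrightarrow> \<rho> m y = \<rho>' m y"
    and "\<And>y. y \<in> carrier B \<Longrightarrow> l a y = l' a' y \<and> l a y \<in> carrier B" and "m \<in> carrier M"
  shows "base_change B l M \<rho> m a = base_change B' l' M' \<rho>' m a'"
proof -
  have "m' \<in> carrier M \<and> (\<forall>y \<in> carrier B. \<rho> m' y = \<rho> m (l a y)) \<longleftrightarrow>
      m' \<in> carrier M' \<and> (\<forall>y \<in> carrier B'. \<rho>' m' y = \<rho>' m (l' a' y))" for m'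
    using assms by metis
  then show ?thesis by (simp add: base_change_def)
qed

lemma nd_ext_cong:
  assumes E: "nd_ext k A p R q l r"
    and l: "\<And>x a. x \<in> carrier R \<Longrightarrow> a \<in> carrier A \<Longrightarrow> l' a x = l a x"
    and r: "\<And>x a. x \<in> carrier R \<Longrightarrow> a \<in> carrier A \<Longrightarrow> r' x a = r x a"
    and A: "module k A" "\<And>a b. a \<in> carrier A \<Longrightarrow> b \<in> carrier A \<Longrightarrow> p a b \<in> carrier A"
  shows "nd_ext k A p R q l' r'"
proof -
  note D = nd_extD[OF E]
  have c: "l a x \<in> carrier R" "r x a \<in> carrier R" if "x \<in> carrier R" "a \<in> carrier A" for x a
    using that bil_closed[OF nd_moduleD(2)[OF D(1)]] bil_closed[OF nd_moduleD(2)[OF D(2)]] by auto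
  have qc: "q x y \<in> carrier R" if "x \<in> carrier R" "y \<in> carrier R" for x y
    using that bil_closed[OF D(3)] by auto
  show ?thesis
    unfolding nd_ext_def
    using D(3,4) nd_module_cong[OF D(1) r HOL.refl A] nd_module_cong[OF D(2) l HOL.refl A(1)] A(2)
    by (simp add: l r c qc D(5-8))
qed

lemma addspan_mono:
  assumes "S \<subseteq> T"
  shows "addspan M S \<subseteq> addspan M T"
proof
  fix x assume "x \<in> addspan M S"
  then show "x \<in> addspan M T" by induction (use assms in \<open>auto intro: addspan.intros\<close>)
qed

lemma addspan_subset:
  assumes "add M' = add M" "\<zero>\<^bsub>M'\<^esub> = \<zero>\<^bsub>M\<^esub>"
  shows "addspan M' S \<subseteq> addspan M S"
proof
  fix x assume "x \<in> addspan M' S"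
  then show "x \<in> addspan M S" by induction (use assms in \<open>auto intro: addspan.intros\<close>)
qed

lemma addspan_reduct [simp]:
  "addspan (underlying M) S = addspan M S" "addspan (algebra_tensor k P Q) S =
      addspan (tensor k P Q) S"
  by (intro equalityI addspan_subset; simp)+

lemma nd_module_reduct [simp]:
  "nd_module k A p (underlying M) \<rho> = nd_module k A p M \<rho>"
  "nd_module k A p (algebra_tensor k M N) \<rho> = nd_module k A p (tensor k M N) \<rho>"
  "nd_module k (underlying A) p P \<rho> = nd_module k A p P \<rho>"
  "nd_module k (algebra_tensor k M N) p P \<rho> = nd_module k (tensor k M N) p P \<rho>"
  by (simp_all add: nd_module_def)

lemma nd_ext_reduct [simp]:
  "nd_ext k A p (underlying M) q l r = nd_ext k A p M q l r"
  "nd_ext k A p (algebra_tensor k M N) q l r = nd_ext k A p (tensor k M N) q l r"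
  "nd_ext k (underlying A) p P q l r = nd_ext k A p P q l r"
  "nd_ext k (algebra_tensor k M N) p P q l r = nd_ext k (tensor k M N) p P q l r"
  by (simp_all add: nd_ext_def)

lemma projective_reduct [simp]:
  "projective k (underlying M) = projective k M"
  "projective k (algebra_tensor k M N) = projective k (tensor k M N)"
  by (simp_all add: projective_def)

end

text \<open>The three carrier types are independent because A may be a multiplier algebra, whose
  elements are pairs of functions on the type of B.\<close>

locale extension_module = scalars k for k :: "'k ring" +
  fixes A :: "('k, 'x) module" and p :: "'x \<Rightarrow> 'x \<Rightarrow> 'x"
    and B :: "('k, 'y) module" and q :: "'y \<Rightarrow> 'y \<Rightarrow> 'y"
    and l :: "'x \<Rightarrow> 'y \<Rightarrow> 'y" and r :: "'y \<Rightarrow> 'x \<Rightarrow> 'y"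
    and M :: "('k, 'u) module" and \<rho> :: "'u \<Rightarrow> 'y \<Rightarrow> 'u"
  assumes E: "nd_ext k A p B q l r" and F: "nd_module k B q M \<rho>"
begin

abbreviation "bc \<equiv> base_change B l M \<rho>"

lemmas nr = nd_extD(1)[OF E] and nl = nd_extD(2)[OF E]

lemma mods: "module k B" "module k M"
  using nd_moduleD(1)[OF nr] nd_moduleD(1)[OF F] .

lemma cl: "a \<in> carrier A \<Longrightarrow> y \<in> carrier B \<Longrightarrow> l a y \<in> carrier B"
  "a \<in> carrier A \<Longrightarrow> y \<in> carrier B \<Longrightarrow> r y a \<in> carrier B"
  "m \<in> carrier M \<Longrightarrow> y \<in> carrier B \<Longrightarrow> \<rho> m y \<in> carrier M"
  "y \<in> carrier B \<Longrightarrow> z \<in> carrier B \<Longrightarrow> q y z \<in> carrier B"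
  using bil_closed[OF nd_moduleD(2)[OF nl]] bil_closed[OF nd_moduleD(2)[OF nr]]
    bil_closed[OF nd_moduleD(2)[OF F]] bil_closed[OF nd_extD(3)[OF E]] by auto

text \<open>By idempotence it is enough to treat an element m y, for which m (y a) is the witness:
  (m (y a)) z = m ((y a) z) = m (y (a z)) = (m y) (a z).\<close>

lemma base_change_ex:
  assumes m: "m \<in> carrier M" and a: "a \<in> carrier A"
  shows "\<exists>m' \<in> carrier M. \<forall>y \<in> carrier B. \<rho> m' y = \<rho> m (l a y)"
  using F m
proof (induction rule: nd_induct)
  case zero
  then show ?case
    by (intro bexI[of _ "\<zero>\<^bsub>M\<^esub>"])
      (use a mods in \<open>simp_all add: cl bil_zeroL[OF nd_moduleD(2)[OF F]]\<close>)
next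
  case (act m y)
  show ?case
    by (intro bexI[of _ "\<rho> m (r y a)"])
      (use act a in \<open>simp_all add: cl nd_moduleD(3)[OF F] nd_extD(8)[OF E]\<close>)
next
  case (add m n)
  then obtain m' n' where
    "m' \<in> carrier M" "\<And>y. y \<in> carrier B \<Longrightarrow> \<rho> m' y = \<rho> m (l a y)"
    "n' \<in> carrier M" "\<And>y. y \<in> carrier B \<Longrightarrow> \<rho> n' y = \<rho> n (l a y)" by blast
  then show ?case
    by (intro bexI[of _ "m' \<oplus>\<^bsub>M\<^esub> n'"])
      (use add a mods in \<open>simp_all add: cl bilD[OF nd_moduleD(2)[OF F]]\<close>)
qed

lemma base_change:
  assumes m: "m \<in> carrier M" and a: "a \<in> carrier A"
  shows "bc m a \<in> carrier M" and "y \<in> carrier B \<Longrightarrow> \<rho> (bc m a) y = \<rho> m (l a y)"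
proof -
  obtain m' where "m' \<in> carrier M" "\<And>y. y \<in> carrier B \<Longrightarrow> \<rho> m' y = \<rho> m (l a y)"
    using base_change_ex[OF m a] by blast
  then show "bc m a \<in> carrier M" "y \<in> carrier B \<Longrightarrow> \<rho> (bc m a) y = \<rho> m (l a y)"
    using base_change_eqI[OF F, of m' m l a] by auto
qed

lemma base_change_act:
  assumes "m \<in> carrier M" "y \<in> carrier B" "a \<in> carrier A"
  shows "bc (\<rho> m y) a = \<rho> m (r y a)"
  by (rule base_change_eqI[OF F])
    (use assms in \<open>simp_all add: cl nd_moduleD(3)[OF F] nd_extD(8)[OF E]\<close>)

lemma bil_base_change: "bil k M A M bc"
proof -
  note b = bilD[OF nd_moduleD(2)[OF F]] bilD[OF nd_moduleD(2)[OF nl]]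
  show ?thesis
    by (rule bilI; (rule base_change_eqI[OF F])?)
      (use mods in \<open>simp_all add: cl base_change b\<close>)
qed

text \<open>If every m a is 0, then every m (a y) is 0, and since B = A B, non-degeneracy over B
  gives m = 0. For idempotence, M = M B and B = B A are combined with m (y a) = (m y) a.\<close>

lemma nd_base_change: "nd_module k A p M bc"
proof (rule nd_moduleI[OF mods(2) bil_base_change])
  fix m a b assume *: "m \<in> carrier M" "a \<in> carrier A" "b \<in> carrier A"
  show "bc (bc m a) b = bc m (p a b)"
    by (rule base_change_eqI[OF F, symmetric])
      (use * nd_moduleD(3)[OF nl] in \<open>simp_all add: cl base_change\<close>)
next
  fix m assume m: "m \<in> carrier M" and z: "\<And>a. a \<in> carrier A \<Longrightarrow> bc m a = \<zero>\<^bsub>M\<^esub>"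
  show "m = \<zero>\<^bsub>M\<^esub>"
  proof (rule nd_moduleD(4)[OF F m])
    fix y assume "y \<in> carrier B"
    with nl show "\<rho> m y = \<zero>\<^bsub>M\<^esub>"
    proof (induction rule: nd_induct)
      case (act y a)
      then have "\<rho> m (l a y) = \<rho> \<zero>\<^bsub>M\<^esub> y" using base_change(2)[OF m, of a y] z by simp
      then show ?case using act mods by (simp add: bil_zeroL[OF nd_moduleD(2)[OF F]])
    qed (use m mods in \<open>simp_all add: bil_zeroR[OF nd_moduleD(2)[OF F]] bilD[OF nd_moduleD(2)[OF
        F]]\<close>)
  qed
next
  let ?S = "{bc m a | m a. m \<in> carrier M \<and> a \<in> carrier A}"
  have S: "?S \<subseteq> carrier M" using base_change by blast
  fix m assume "m \<in> carrier M"
  with F show "m \<in> addspan M ?S"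
  proof (induction rule: nd_induct)
    case (act m y)
    show ?case using nr act(2)
    proof (induction rule: nd_induct)
      case zero
      then show ?case using act mods by (simp add: bil_zeroR[OF nd_moduleD(2)[OF F]] addspan.zero)
    next
      case (act y a)
      then have "\<rho> m (r y a) \<in> ?S" using base_change_act[of m y a] \<open>m \<in> carrier M\<close> cl by force
      then show ?case by (rule addspan_gen[OF mods(2) S])
    next
      case (add x y)
      then show ?case using act mods S by (simp add: bilD[OF nd_moduleD(2)[OF F]] addspan_add)
    qed
  qed (use mods S in \<open>simp_all add: addspan.zero addspan_add\<close>)
qed

text \<open>Recognises the induced action from its values on products m y. The uniqueness part of
  \<open>bar_eq\<close> rests on this.\<close>

lemma base_change_unique:
  assumes add: "\<And>m n. m \<in> carrier M \<Longrightarrow> n \<in> carrier M \<Longrightarrow> \<sigma> (m \<oplus>\<^bsub>M\<^esub> n) = \<sigma> m \<oplus>\<^bsub>M\<^esub> \<sigma> n"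
    and zero: "\<sigma> \<zero>\<^bsub>M\<^esub> = \<zero>\<^bsub>M\<^esub>"
    and act: "\<And>m y. m \<in> carrier M \<Longrightarrow> y \<in> carrier B \<Longrightarrow> \<sigma> (\<rho> m y) = \<rho> m (r y a)"
    and m: "m \<in> carrier M" and a: "a \<in> carrier A"
  shows "\<sigma> m = bc m a"
  using F m
  by (induction rule: nd_induct)
    (use a mods in \<open>simp_all add: zero act add base_change_act
      bil_zeroL[OF bil_base_change] bilD[OF bil_base_change]\<close>)

end

context scalars
begin

text \<open>This is composition of arrows of \<open>ndi_cat\<close> on the level of extensions. The
  right action is base change along B, and the left action is base change for the opposite
  multiplications.\<close>

lemma base_change_ext:
  assumes E: "nd_ext k A p B q l r" and F: "nd_ext k B q C s l' r'"
  shows "nd_ext k A p C s (\<lambda>a c. base_change B (\<lambda>a y. r y a) C (\<lambda>c y. l' y c) c a)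
      (base_change B l C r')"
proof -
  interpret R: extension_module k A p B q l r C r'
    by unfold_locales (use E nd_extD(1)[OF F] in auto)
  interpret L: extension_module k A "\<lambda>a b. p b a" B "\<lambda>x y. q y x" "\<lambda>a y. r y a"
      "\<lambda>y a. l a y" C "\<lambda>c y. l' y c"
    by unfold_locales (use nd_ext_op[OF E] nd_extD(2)[OF F] in auto)
  define L where "L a c = L.bc c a" for a c
  define R where "R = R.bc"
  note Ls = L.base_change[folded L_def] and Rs = R.base_change[folded R_def]
  note Fs = nd_extD(4-8)[OF F]
  have cs: "\<And>x y. x \<in> carrier C \<Longrightarrow> y \<in> carrier C \<Longrightarrow> s x y \<in> carrier C"
    using bil_closed[OF nd_extD(3)[OF F]] .
  note bs = bilD[OF nd_extD(3)[OF F]]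
  have LS: "L a (s x y) = s (L a x) y" if "a \<in> carrier A" "x \<in> carrier C" "y \<in> carrier C" for a x y
    by (rule nd_eqI[OF L.F]) (use that in \<open>simp_all add: Ls cs L.cl R.cl Fs\<close>)
  have RS: "R (s x y) a = s x (R y a)" if "a \<in> carrier A" "x \<in> carrier C" "y \<in> carrier C" for a x y
    by (rule nd_eqI[OF R.F]) (use that in \<open>simp_all add: Rs cs L.cl R.cl Fs\<close>)
  \<comment> \<open>Multiplication by y on the left and by z on the right turns both induced actions
    into actions of B, which commute. Non-degeneracy on the two sides gives the equality.\<close>
  have LR: "R (L a x) b = L a (R x b)" if "a \<in> carrier A" "x \<in> carrier C" "b \<in> carrier A" for a x b
  proof (rule nd_eqI[OF L.F])
    fix y assume y: "y \<in> carrier B"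
    show "l' y (R (L a x) b) = l' y (L a (R x b))"
    proof (rule nd_eqI[OF R.F])
      fix z assume z: "z \<in> carrier B"
      have "r' (l' y (R (L a x) b)) z = l' y (r' (L a x) (l b z))"
        using that y z by (simp add: Ls Rs Fs)
      also have "\<dots> = r' (l' y (L a x)) (l b z)"
        using that y z by (intro Fs(2)[symmetric]) (simp_all add: Ls R.cl)
      also have "\<dots> = r' (l' y (L a (R x b))) z"
        using that y z by (simp add: Ls Rs R.cl L.cl Fs)
      finally show "r' (l' y (R (L a x) b)) z = r' (l' y (L a (R x b))) z" .
    qed (use that y in \<open>simp_all add: Ls Rs L.cl\<close>)
  qed (use that in \<open>simp_all add: Ls Rs\<close>)
  \<comment> \<open>By idempotence x may be replaced by a product x z. There the action of a passes
    to z a, and balancedness over B moves z a to y, where it becomes z acting on a y.\<close>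
  have bal: "s (R x a) y = s x (L a y)" if a: "a \<in> carrier A" and x: "x \<in> carrier C"
      and y: "y \<in> carrier C" for a x y
    using R.F x
  proof (induction rule: nd_induct)
    case zero
    then show ?case using a y R.mods Ls
      by (simp add: R_def bil_zeroL[OF R.bil_base_change] bil_zeroL[OF nd_extD(3)[OF F]])
  next
    case (act x z)
    then show ?case using a y by (simp add: R_def R.base_change_act Fs R.cl Ls)
  next
    case (add x z)
    then show ?case using a y Ls(1)
      by (simp add: R_def bilD[OF R.bil_base_change] bs)
  qed
  have "nd_ext k A p C s L R"
    unfolding nd_ext_def
    using nd_extD(3,4)[OF F] R.nd_base_change[folded R_def] L.nd_base_change LS RS LR bal
    by (auto simp: L_def)
  then show ?thesis by (simp add: L_def[abs_def] R_def)
qed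

text \<open>The two algebras are removed one at a time. Let z be killed by A \<otimes> B, and let
  \<open>?w b z\<close> arise from z by acting with b on the right factors. A functional on N sends
  \<open>?w b z\<close> to an element of M that is killed by A, hence to 0; as N is projective,
  \<open>?w b z\<close> = 0. A functional on M sends z to an element of N whose product with b is
  the image of \<open>?w b z\<close>, hence to 0; as M is projective, z = 0. Idempotence follows
  from (m \<otimes> n) (a \<otimes> b) = m a \<otimes> n b.\<close>

lemma nd_module_tensor:
  fixes A B M N :: "('k, 'a) kmod"
  assumes A: "module k A" "bil k A A A p" and B: "module k B" "bil k B B B q"
    and M: "nd_module k A p M \<rho>" "projective k M" and N: "nd_module k B q N \<sigma>" "projective k N"
  shows "nd_module k (tensor k A B) (componentwise k A B p q) (tensor k M N) (componentwise k M N \<rho>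
      \<sigma>)"
proof -
  note mM = nd_moduleD(1)[OF M(1)] and mN = nd_moduleD(1)[OF N(1)]
  note bM = nd_moduleD(2)[OF M(1)] and bN = nd_moduleD(2)[OF N(1)]
  let ?T = "tensor k M N" and ?c = "componentwise k M N \<rho> \<sigma>"
  note c = bil_componentwise[OF mM mN A(1) B(1) mM mN bM bN]
  have mT: "module k ?T" using mM mN by simp
  show ?thesis
  proof (rule nd_moduleI[OF mT c(1)])
    fix z a b assume "z \<in> carrier ?T" "a \<in> carrier (tensor k A B)" "b \<in> carrier (tensor k A B)"
    then show "?c (?c z a) b = ?c z (componentwise k A B p q a b)"
      using componentwise_assoc[OF mM mN A(1) B(1) A(1) B(1) mM mN A(1) B(1) mM mN bM bN bM bN
          A(2) B(2) bM bN] nd_moduleD(3)[OF M(1)] nd_moduleD(3)[OF N(1)] by simp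
  next
    fix z assume z: "z \<in> carrier ?T" and null: "\<And>a. a \<in> carrier (tensor k A B) \<Longrightarrow> ?c z a = \<zero>\<^bsub>?T\<^esub>"
    have bL: "bil k M N N (\<lambda>m n. \<phi> m \<odot>\<^bsub>N\<^esub> n)" if "lin k M self_module \<phi>" for \<phi>
      using that mN by (intro bilI) (auto simp: lin_def module.smult_l_distr module.smult_r_distr
          module.smult_assoc1[symmetric] k.m_comm)
    have bR: "bil k M N M (\<lambda>m n. \<phi> n \<odot>\<^bsub>M\<^esub> m)" if "lin k N self_module \<phi>" for \<phi>
      using that mM by (intro bilI) (auto simp: lin_def module.smult_l_distr module.smult_r_distr
          module.smult_assoc1[symmetric] k.m_comm)
    let ?w = "\<lambda>b. tensor_lift ?T (\<lambda>m n. pure_tensor k M N m (\<sigma> n b))"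
    have bw: "bil k M N ?T (\<lambda>m n. pure_tensor k M N m (\<sigma> n b))" if "b \<in> carrier B" for b
      by (rule bilI) (use that mM mN in \<open>simp_all add: bilD[OF bN]\<close>)
    note w = lin_tensor_lift[OF mM mN mT bw]
    have w0: "?w b z = \<zero>\<^bsub>?T\<^esub>" if b: "b \<in> carrier B" for b
    proof (rule tensor_separateR[OF mM N(2) lin_closed[OF w(1)[OF b] z]])
      fix \<phi> assume \<phi>: "lin k N self_module \<phi>"
      note l = lin_tensor_lift[OF mM mN mM bR[OF \<phi>]]
      let ?f = "tensor_lift M (\<lambda>m n. \<phi> n \<odot>\<^bsub>M\<^esub> m)"
      show "?f (?w b z) = \<zero>\<^bsub>M\<^esub>"
      proof (rule nd_moduleD(4)[OF M(1)])
        fix a assume a: "a \<in> carrier A"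
        have "\<rho> (?f (?w b z)) a = ?f (?c z (pure_tensor k A B a b))"
        proof (rule lin_eq_on_tensor[OF _ _ mM mN mM _ z])
          show "lin k ?T M (\<lambda>z. \<rho> (?f (?w b z)) a)"
            by (rule linI) (use mT mM a in \<open>simp_all add: linD[OF l(1)] linD[OF w(1)[OF b]]
                bilD[OF bM]\<close>)
          show "lin k ?T M (\<lambda>z. ?f (?c z (pure_tensor k A B a b)))"
            by (rule linI) (use mT a b in \<open>simp_all add: linD[OF l(1)] bilD[OF c(1)]\<close>)
          fix m n assume "m \<in> carrier M" "n \<in> carrier N"
          then show "\<rho> (?f (?w b (pure_tensor k M N m n))) a =
              ?f (?c (pure_tensor k M N m n) (pure_tensor k A B a b))"
            using a b lin_closed[OF \<phi>] by (simp add: l(2) w(2) c(2) bilD[OF bM] bilD[OF bN])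
        qed
        then show "\<rho> (?f (?w b z)) a = \<zero>\<^bsub>M\<^esub>"
          using null a b lin_zero[OF l(1)] mT mM by simp
      qed (use l(1) w(1)[OF b] z in \<open>simp add: linD\<close>)
    qed
    show "z = \<zero>\<^bsub>?T\<^esub>"
    proof (rule tensor_separateL[OF M(2) mN z])
      fix \<phi> assume \<phi>: "lin k M self_module \<phi>"
      note l = lin_tensor_lift[OF mM mN mN bL[OF \<phi>]]
      let ?f = "tensor_lift N (\<lambda>m n. \<phi> m \<odot>\<^bsub>N\<^esub> n)"
      show "?f z = \<zero>\<^bsub>N\<^esub>"
      proof (rule nd_moduleD(4)[OF N(1)])
        fix b assume b: "b \<in> carrier B"
        have "\<sigma> (?f z) b = ?f (?w b z)"
        proof (rule lin_eq_on_tensor[OF _ _ mM mN mN _ z])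
          show "lin k ?T N (\<lambda>z. \<sigma> (?f z) b)"
            by (rule linI) (use mT mN b in \<open>simp_all add: linD[OF l(1)] bilD[OF bN]\<close>)
          show "lin k ?T N (\<lambda>z. ?f (?w b z))" by (rule lin_comp[OF w(1)[OF b] l(1)])
          fix m n assume "m \<in> carrier M" "n \<in> carrier N"
          then show "\<sigma> (?f (pure_tensor k M N m n)) b = ?f (?w b (pure_tensor k M N m n))"
            using b lin_closed[OF \<phi>] by (simp add: l(2) w(2) bilD[OF bN])
        qed
        then show "\<sigma> (?f z) b = \<zero>\<^bsub>N\<^esub>" using w0[OF b] lin_zero[OF l(1)] mT mN by simp
      qed (use l(1) z in \<open>simp add: linD\<close>)
    qed
  next
    let ?S = "{?c z a | z a. z \<in> carrier ?T \<and> a \<in> carrier (tensor k A B)}"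
    have S: "?S \<subseteq> carrier ?T" using bil_closed[OF c(1)] by blast
    fix z assume "z \<in> carrier ?T"
    then show "z \<in> addspan ?T ?S" using mM mN
    proof (induction rule: tensor_induct)
      case (pure m n)
      show ?case using M(1) pure(1)
      proof (induction rule: nd_induct)
        case m: (act m a)
        show ?case using N(1) pure(2)
        proof (induction rule: nd_induct)
          case (act n b)
          have "?c (pure_tensor k M N m n) (pure_tensor k A B a b) =
              pure_tensor k M N (\<rho> m a) (\<sigma> n b)"
            using m act by (simp add: c(2))
          then have "pure_tensor k M N (\<rho> m a) (\<sigma> n b) \<in> ?S"
            using m act pure_tensor_closed[of m M n N] pure_tensor_closed[of a A b B]
            by (smt (verit) mem_Collect_eq)
          then show ?case by (rule addspan_gen[OF mT S])
        qed (use m mM mN mT S in \<open>simp_all add: bilD[OF bM] addspan.zero addspan_add\<close>)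
      qed (use pure mM mN mT S in \<open>simp_all add: addspan.zero addspan_add\<close>)
    qed (use mT S in \<open>simp_all add: addspan.zero addspan_add\<close>)
  qed
qed

text \<open>The identities between product and actions are instances of
  \<open>componentwise_assoc\<close>. The left module structure is \<open>nd_module_tensor\<close>
  for the opposite multiplications, rewritten with \<open>componentwise_flip\<close>.\<close>

lemma nd_ext_tensor:
  fixes A B R S :: "('k, 'a) kmod"
  assumes A: "module k A" "bil k A A A p" and B: "module k B" "bil k B B B p'"
    and R: "nd_ext k A p R q l r" "projective k R" and S: "nd_ext k B p' S q' l' r'"
        "projective k S"
  shows "nd_ext k (tensor k A B) (componentwise k A B p p') (tensor k R S) (componentwise k R S q
      q')
    (componentwise k R S l l') (componentwise k R S r r')"
proof -
  have mR: "module k R" and mS: "module k S" using R S by (auto simp: projective_def)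
  note bq = nd_extD(3)[OF R(1)] nd_extD(3)[OF S(1)]
  note br = nd_moduleD(2)[OF nd_extD(1)[OF R(1)]] nd_moduleD(2)[OF nd_extD(1)[OF S(1)]]
  note bl' = nd_moduleD(2)[OF nd_extD(2)[OF R(1)]] nd_moduleD(2)[OF nd_extD(2)[OF S(1)]]
  note bl = bil_flip[OF bl'(1)] bil_flip[OF bl'(2)]
  note cb = bil_componentwise(1)[OF mR mS mR mS mR mS bq]
  note mm = mR mS and mA = A(1) B(1)
  note Rs = nd_extD(4-8)[OF R(1)] and Ss = nd_extD(4-8)[OF S(1)]
  have left: "nd_module k (tensor k A B) (\<lambda>a b. componentwise k A B p p' b a) (tensor k R S)
      (\<lambda>x a. componentwise k R S l l' a x)"
  proof (rule nd_module_cong[OF nd_module_tensor[OF A(1) bil_flip[OF A(2)] B(1) bil_flip[OF B(2)]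
          nd_extD(2)[OF R(1)] R(2) nd_extD(2)[OF S(1)] S(2)]])
    fix x a assume "x \<in> carrier (tensor k R S)" "a \<in> carrier (tensor k A B)"
    then show "componentwise k R S l l' a x = componentwise k R S (\<lambda>x a. l a x) (\<lambda>x a. l' a x) x a"
      using componentwise_flip[OF mA mm mm bl] by simp
  next
    fix a b assume "a \<in> carrier (tensor k A B)" "b \<in> carrier (tensor k A B)"
    then show "componentwise k A B p p' b a = componentwise k A B (\<lambda>a b. p b a) (\<lambda>a b. p' b a) a b"
      "componentwise k A B (\<lambda>a b. p b a) (\<lambda>a b. p' b a) a b \<in> carrier (tensor k A B)"
      using componentwise_flip[OF mA mA mA A(2) B(2)]
        bil_closed[OF bil_componentwise(1)[OF mA mA mA bil_flip[OF A(2)] bil_flip[OF B(2)]]]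
          by simp_all
  qed (use A B in simp)
  show ?thesis
    unfolding nd_ext_def
  proof (intro conjI ballI)
    show "nd_module k (tensor k A B) (componentwise k A B p p') (tensor k R S) (componentwise k R S
        r r')"
      by (rule nd_module_tensor[OF A B nd_extD(1)[OF R(1)] R(2) nd_extD(1)[OF S(1)] S(2)])
    fix x a b assume "x \<in> carrier (tensor k R S)" "a \<in> carrier (tensor k A B)"
        "b \<in> carrier (tensor k A B)"
    then show "componentwise k R S r r' (componentwise k R S l l' a x) b =
        componentwise k R S l l' a (componentwise k R S r r' x b)"
      by (intro componentwise_assoc[OF mA mm mA mm mm mm bl br br bl]) (simp_all add: Rs Ss)
  next
    fix x y z assume "x \<in> carrier (tensor k R S)" "y \<in> carrier (tensor k R S)"
        "z \<in> carrier (tensor k R S)"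
    then show "componentwise k R S q q' (componentwise k R S q q' x y) z =
        componentwise k R S q q' x (componentwise k R S q q' y z)"
      by (intro componentwise_assoc[OF mm mm mm mm mm mm bq bq bq bq]) (simp_all add: Rs Ss)
  next
    fix x y a assume *: "x \<in> carrier (tensor k R S)" "y \<in> carrier (tensor k R S)"
        "a \<in> carrier (tensor k A B)"
    from * show "componentwise k R S l l' a (componentwise k R S q q' x y) =
        componentwise k R S q q' (componentwise k R S l l' a x) y"
      by (intro componentwise_assoc[OF mA mm mm mm mm mm bl bq bq bl, symmetric]) (simp_all add: Rs
          Ss)
    from * show "componentwise k R S r r' (componentwise k R S q q' x y) a =
        componentwise k R S q q' x (componentwise k R S r r' y a)"
      by (intro componentwise_assoc[OF mm mm mA mm mm mm bq br br bq]) (simp_all add: Rs Ss)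
    from * show "componentwise k R S q q' (componentwise k R S r r' x a) y =
        componentwise k R S q q' x (componentwise k R S l l' a y)"
      by (intro componentwise_assoc[OF mm mA mm mm mm mm br bq bl bq]) (simp_all add: Rs Ss)
  qed (rule cb left)+
qed

text \<open>By surjectivity the products m (h b) exhaust all products m a, so non-degeneracy and
  idempotence persist. The lemma is applied to isomorphisms of algebras that are regarded as
  arrows.\<close>

lemma nd_module_hom:
  assumes nd: "nd_module k A p M \<rho>" and h: "lin k B A h" "h ` carrier B = carrier A"
    and mult: "\<And>a b. a \<in> carrier B \<Longrightarrow> b \<in> carrier B \<Longrightarrow> h (p' a b) = p (h a) (h b)"
  shows "nd_module k B p' M (\<lambda>m b. \<rho> m (h b))"
proof -
  note M = nd_moduleD(1)[OF nd] and b = nd_moduleD(2)[OF nd]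
  have c: "h a \<in> carrier A" if "a \<in> carrier B" for a using that h(2) by auto
  have S: "{\<rho> m (h a) | m a. m \<in> carrier M \<and> a \<in> carrier B} = {\<rho> m a | m a. m \<in> carrier M \<and>
      a \<in> carrier A}"
    unfolding h(2)[symmetric] by blast
  show ?thesis
  proof (rule nd_moduleI[OF M])
    show "bil k M B M (\<lambda>m b. \<rho> m (h b))"
      by (rule bilI) (simp_all add: bilD[OF b] linD[OF h(1)])
    show "m = \<zero>\<^bsub>M\<^esub>" if "m \<in> carrier M" "\<And>a. a \<in> carrier B \<Longrightarrow> \<rho> m (h a) = \<zero>\<^bsub>M\<^esub>" for m
    proof (rule nd_moduleD(4)[OF nd that(1)])
      fix a assume "a \<in> carrier A"
      then show "\<rho> m a = \<zero>\<^bsub>M\<^esub>" using that(2) h(2) by (metis imageE)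
    qed
    show "m \<in> addspan M {\<rho> m (h a) | m a. m \<in> carrier M \<and> a \<in> carrier B}" if "m \<in> carrier M" for m
      unfolding S using that nd_moduleD(5)[OF nd] by blast
  qed (simp add: nd_moduleD(3)[OF nd] c mult)
qed

lemma nd_ext_hom:
  assumes E: "nd_ext k A p R q l r" and h: "lin k B A h" "h ` carrier B = carrier A"
    and mult: "\<And>a b. a \<in> carrier B \<Longrightarrow> b \<in> carrier B \<Longrightarrow> h (p' a b) = p (h a) (h b)"
  shows "nd_ext k B p' R q (\<lambda>b. l (h b)) (\<lambda>x b. r x (h b))"
proof -
  have "nd_module k B p' R (\<lambda>x b. r x (h b))"
    by (rule nd_module_hom[OF nd_extD(1)[OF E] h]) (rule mult)
  moreover have "nd_module k B (\<lambda>a b. p' b a) R (\<lambda>x b. l (h b) x)"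
    by (rule nd_module_hom[OF nd_extD(2)[OF E] h]) (rule mult)
  ultimately show ?thesis
    unfolding nd_ext_def using nd_extD(3-8)[OF E] lin_closed[OF h(1)] by simp
qed

end

section \<open>Multiplier algebras and composition in the category of algebras\<close>

context scalars
begin

section \<open>The given definitions in terms of \<open>nd_module\<close> and
  \<open>nd_ext\<close>\<close>

lemma right_module_iff:
  assumes A: "module k A"
  shows "right_module k A M \<and> right_nondegenerate A M \<and> right_idempotent A M \<longleftrightarrow>
    nd_module k A (mult A) (base M) (act M) \<and>
    act M \<in> carrier (base M) \<rightarrow>\<^sub>E carrier A \<rightarrow>\<^sub>E carrier (base M)"
proof -
  have "finite_sums (base M) {act M m a | m a. m \<in> carrier (base M) \<and> a \<in> carrier A} =
      addspan (base M) {act M m a | m a. m \<in> carrier (base M) \<and> a \<in> carrier A}"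
    if "module k (base M)" "bil k (base M) A (base M) (act M)"
    using bil_closed[OF that(2)] by (intro finite_sums_eq_addspan that) blast
  then show ?thesis
    using bilinear_iff[OF _ A, of "base M" "base M" "act M"]
    unfolding right_module_def right_nondegenerate_def right_idempotent_def nd_module_def
    by fastforce
qed

lemma left_module_iff:
  assumes A: "module k A"
  shows "left_module k A M \<and> left_nondegenerate A M \<and> left_idempotent A M \<longleftrightarrow>
    nd_module k A (\<lambda>a b. mult A b a) (base M) (\<lambda>m a. act M a m) \<and>
    act M \<in> carrier A \<rightarrow>\<^sub>E carrier (base M) \<rightarrow>\<^sub>E carrier (base M)"
proof -
  have S: "{act M a m | a m. a \<in> carrier A \<and> m \<in> carrier (base M)} =
      {act M a m | m a. m \<in> carrier (base M) \<and> a \<in> carrier A}" by blast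
  have "finite_sums (base M) {act M a m | m a. m \<in> carrier (base M) \<and> a \<in> carrier A} =
      addspan (base M) {act M a m | m a. m \<in> carrier (base M) \<and> a \<in> carrier A}"
    if "module k (base M)" "bil k A (base M) (base M) (act M)"
    using bil_closed[OF that(2)] by (intro finite_sums_eq_addspan that) blast
  note fs = this
  have b: "bil k A (base M) (base M) (act M) \<longleftrightarrow> bil k (base M) A (base M) (\<lambda>m a. act M a m)"
    by (auto simp: bil_def)
  have assoc: "(\<forall>m \<in> carrier (base M). \<forall>a \<in> carrier A. \<forall>b \<in> carrier A.
        act M a (act M b m) = act M (a \<otimes>\<^bsub>A\<^esub> b) m) \<longleftrightarrow>
      (\<forall>m \<in> carrier (base M). \<forall>a \<in> carrier A. \<forall>b \<in> carrier A.
        act M b (act M a m) = act M (b \<otimes>\<^bsub>A\<^esub> a) m)" by blast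
  show ?thesis
  proof (cases "module k (base M) \<and> bil k A (base M) (base M) (act M)")
    case True
    then show ?thesis
      unfolding left_module_def left_nondegenerate_def left_idempotent_def nd_module_def S assoc
      using fs b bilinear_iff[OF A, of "base M" "base M" "act M"] by (simp only: simp_thms) blast
  next
    case False
    then show ?thesis
      using b bilinear_iff[OF A, of "base M" "base M" "act M"]
      by (auto simp: left_module_def nd_module_def)
  qed
qed

lemma nonunital_algebra_iff:
  "nonunital_algebra k R \<longleftrightarrow> module k R \<and> bil k R R R (mult R) \<and>
     (\<forall>a \<in> carrier R. \<forall>b \<in> carrier R. \<forall>c \<in> carrier R.
        (a \<otimes>\<^bsub>R\<^esub> b) \<otimes>\<^bsub>R\<^esub> c = a \<otimes>\<^bsub>R\<^esub> (b \<otimes>\<^bsub>R\<^esub> c))"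
  unfolding nonunital_algebra_def by (auto simp: bilinear_iff)

lemma ext_objects_iff:
  assumes A: "module k A"
  shows "R \<in> ext_objects k A \<longleftrightarrow>
    nd_ext k A (mult A) (alg R) (mult (alg R)) (lact R) (ract R) \<and>
    lact R \<in> carrier A \<rightarrow>\<^sub>E carrier (alg R) \<rightarrow>\<^sub>E carrier (alg R) \<and>
    ract R \<in> carrier (alg R) \<rightarrow>\<^sub>E carrier A \<rightarrow>\<^sub>E carrier (alg R) \<and> projective k (alg R)"
proof -
  have "R \<in> ext_objects k A \<longleftrightarrow> nonunital_algebra k (alg R) \<and>
      (left_module k A (left_part R) \<and> left_nondegenerate A (left_part R) \<and>
          left_idempotent A (left_part R)) \<and>
      (right_module k A (right_part R) \<and> right_nondegenerate A (right_part R) \<and>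
          right_idempotent A (right_part R)) \<and>
      (\<forall>x \<in> carrier (alg R). \<forall>a \<in> carrier A. \<forall>b \<in> carrier A.
        ract R (lact R a x) b = lact R a (ract R x b)) \<and>
      (\<forall>x \<in> carrier (alg R). \<forall>y \<in> carrier (alg R). \<forall>a \<in> carrier A.
        lact R a (x \<otimes>\<^bsub>alg R\<^esub> y) = lact R a x \<otimes>\<^bsub>alg R\<^esub> y \<and>
        ract R (x \<otimes>\<^bsub>alg R\<^esub> y) a = x \<otimes>\<^bsub>alg R\<^esub> ract R y a \<and>
        ract R x a \<otimes>\<^bsub>alg R\<^esub> y = x \<otimes>\<^bsub>alg R\<^esub> lact R a y) \<and> projective k (alg R)"
    unfolding ext_objects_def is_extension_def mem_Collect_eq
    by (intro iffI; elim conjE; intro conjI; assumption)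
  then show ?thesis
    unfolding left_module_iff[OF A] right_module_iff[OF A] nonunital_algebra_iff nd_ext_def
    by (simp only: left_part_def right_part_def action_module.simps nd_module_reduct
        underlying_simps)
      (intro iffI; elim conjE; intro conjI; (assumption | simp add: nd_module_def))
qed

text \<open>Viewing an algebra as an extension of itself makes the lemmas about extensions available
  for it.\<close>

definition nd_algebra :: "('k, 'u) module \<Rightarrow> bool" where
  "nd_algebra A \<longleftrightarrow> nd_ext k A (mult A) A (mult A) (mult A) (mult A)"

lemma nd_algebra_iff:
  "nonunital_algebra k A \<and> nondegenerate_algebra A \<and> idempotent_algebra A \<longleftrightarrow> nd_algebra A"
proof -
  have S: "{b \<otimes>\<^bsub>A\<^esub> a | a b. a \<in> carrier A \<and> b \<in> carrier A} = {a \<otimes>\<^bsub>A\<^esub> b | a b. a \<in> carrier A \<and>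
      b \<in> carrier A}"
    by blast
  have "finite_sums A {a \<otimes>\<^bsub>A\<^esub> b | a b. a \<in> carrier A \<and> b \<in> carrier A} =
      addspan A {a \<otimes>\<^bsub>A\<^esub> b | a b. a \<in> carrier A \<and> b \<in> carrier A}"
    if "module k A" "bil k A A A (mult A)"
    using bil_closed[OF that(2)] by (intro finite_sums_eq_addspan that) blast
  note fs = this
  have b: "bil k A A A (\<lambda>x a. mult A a x) \<longleftrightarrow> bil k A A A (mult A)" by (auto simp: bil_def)
  have assoc: "(\<forall>a \<in> carrier A. \<forall>b \<in> carrier A. \<forall>c \<in> carrier A. c \<otimes>\<^bsub>A\<^esub> (b \<otimes>\<^bsub>A\<^esub> a) =
      (c \<otimes>\<^bsub>A\<^esub> b) \<otimes>\<^bsub>A\<^esub> a)"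
    if "\<forall>a \<in> carrier A. \<forall>b \<in> carrier A. \<forall>c \<in> carrier A. (a \<otimes>\<^bsub>A\<^esub> b) \<otimes>\<^bsub>A\<^esub> c = a \<otimes>\<^bsub>A\<^esub> (b \<otimes>\<^bsub>A\<^esub> c)"
    using that by metis
  show ?thesis
  proof (cases "module k A \<and> bil k A A A (mult A)")
    case True
    then show ?thesis
      unfolding nonunital_algebra_iff nondegenerate_algebra_def idempotent_algebra_def
        nd_algebra_def nd_ext_def nd_module_def S
      using fs b assoc by (simp only: simp_thms) (intro iffI conjI; blast)
  next
    case False
    then show ?thesis by (auto simp: nonunital_algebra_iff nd_algebra_def nd_ext_def nd_module_def)
  qed
qed

lemma nd_algebraD:
  assumes "nd_algebra A"
  shows "module k A" "bil k A A A (mult A)"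
    and "a \<in> carrier A \<Longrightarrow> b \<in> carrier A \<Longrightarrow> c \<in> carrier A \<Longrightarrow> (a \<otimes>\<^bsub>A\<^esub> b) \<otimes>\<^bsub>A\<^esub> c = a \<otimes>\<^bsub>A\<^esub> (b \<otimes>\<^bsub>A\<^esub> c)"
    and "a \<in> carrier A \<Longrightarrow> b \<in> carrier A \<Longrightarrow> a \<otimes>\<^bsub>A\<^esub> b \<in> carrier A"
    and "nd_module k A (mult A) A (mult A)"
proof -
  note E = assms[unfolded nd_algebra_def]
  show "nd_module k A (mult A) A (mult A)" by (rule nd_extD(1)[OF E])
  then show "module k A" by (rule nd_moduleD(1))
  show b: "bil k A A A (mult A)" by (rule nd_extD(3)[OF E])
  show "a \<in> carrier A \<Longrightarrow> b \<in> carrier A \<Longrightarrow> a \<otimes>\<^bsub>A\<^esub> b \<in> carrier A" by (rule bil_closed[OF b])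
qed (rule nd_extD(4)[OF assms[unfolded nd_algebra_def]])

section \<open>Multiplier algebras\<close>

lemma multiplier_iff:
  "x \<in> carrier (multiplier_algebra k A) \<longleftrightarrow>
     lin k A A (fst x) \<and> fst x \<in> extensional (carrier A) \<and>
     lin k A A (snd x) \<and> snd x \<in> extensional (carrier A) \<and>
     (\<forall>a \<in> carrier A. \<forall>b \<in> carrier A. fst x (a \<otimes>\<^bsub>A\<^esub> b) = fst x a \<otimes>\<^bsub>A\<^esub> b \<and>
        snd x (a \<otimes>\<^bsub>A\<^esub> b) = a \<otimes>\<^bsub>A\<^esub> snd x b \<and> a \<otimes>\<^bsub>A\<^esub> fst x b = snd x a \<otimes>\<^bsub>A\<^esub> b)"
  by (cases x) (auto simp: multiplier_algebra_def linear_maps_iff)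

lemma multiplier_ops:
  "a \<in> carrier A \<Longrightarrow> fst (x \<otimes>\<^bsub>multiplier_algebra k A\<^esub> y) a = fst x (fst y a)"
  "a \<in> carrier A \<Longrightarrow> snd (x \<otimes>\<^bsub>multiplier_algebra k A\<^esub> y) a = snd y (snd x a)"
  "a \<in> carrier A \<Longrightarrow> fst (x \<oplus>\<^bsub>multiplier_algebra k A\<^esub> y) a = fst x a \<oplus>\<^bsub>A\<^esub> fst y a"
  "a \<in> carrier A \<Longrightarrow> snd (x \<oplus>\<^bsub>multiplier_algebra k A\<^esub> y) a = snd x a \<oplus>\<^bsub>A\<^esub> snd y a"
  "a \<in> carrier A \<Longrightarrow> fst (c \<odot>\<^bsub>multiplier_algebra k A\<^esub> x) a = c \<odot>\<^bsub>A\<^esub> fst x a"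
  "a \<in> carrier A \<Longrightarrow> snd (c \<odot>\<^bsub>multiplier_algebra k A\<^esub> x) a = c \<odot>\<^bsub>A\<^esub> snd x a"
  "a \<in> carrier A \<Longrightarrow> fst \<one>\<^bsub>multiplier_algebra k A\<^esub> a = a"
  "a \<in> carrier A \<Longrightarrow> snd \<one>\<^bsub>multiplier_algebra k A\<^esub> a = a"
  by (simp_all add: multiplier_algebra_def compose_def)

lemma multiplier_ops_ext:
  "fst (x \<otimes>\<^bsub>multiplier_algebra k A\<^esub> y) \<in> extensional (carrier A)"
  "snd (x \<otimes>\<^bsub>multiplier_algebra k A\<^esub> y) \<in> extensional (carrier A)"
  "fst (x \<oplus>\<^bsub>multiplier_algebra k A\<^esub> y) \<in> extensional (carrier A)"
  "snd (x \<oplus>\<^bsub>multiplier_algebra k A\<^esub> y) \<in> extensional (carrier A)"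
  "fst (c \<odot>\<^bsub>multiplier_algebra k A\<^esub> x) \<in> extensional (carrier A)"
  "snd (c \<odot>\<^bsub>multiplier_algebra k A\<^esub> x) \<in> extensional (carrier A)"
  "fst \<one>\<^bsub>multiplier_algebra k A\<^esub> \<in> extensional (carrier A)"
  "snd \<one>\<^bsub>multiplier_algebra k A\<^esub> \<in> extensional (carrier A)"
  by (simp_all add: multiplier_algebra_def)

lemma multiplier_eqI:
  assumes "x \<in> carrier (multiplier_algebra k A)" "y \<in> carrier (multiplier_algebra k A)"
    and "\<And>a. a \<in> carrier A \<Longrightarrow> fst x a = fst y a" "\<And>a. a \<in> carrier A \<Longrightarrow> snd x a = snd y a"
  shows "x = y"
  using assms extensionalityI[of "fst x" "carrier A" "fst y"] extensionalityI[of "snd x" "carrier A"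
      "snd y"]
  by (intro prod_eqI) (auto simp: multiplier_iff)

lemma lin_sum:
  assumes "lin k M N f" "lin k M N g" "module k N" "module k M"
  shows "lin k M N (\<lambda>x. f x \<oplus>\<^bsub>N\<^esub> g x)"
  by (rule linI) (use assms in \<open>simp_all add: linD[OF assms(1)] linD[OF assms(2)] mod_ac
      module.smult_r_distr\<close>)

lemma lin_scale:
  assumes "lin k M N f" "c \<in> carrier k" "module k N" "module k M"
  shows "lin k M N (\<lambda>x. c \<odot>\<^bsub>N\<^esub> f x)"
  by (rule linI) (use assms in \<open>simp_all add: linD[OF assms(1)] module.smult_r_distr
      module.smult_assoc1[symmetric] k.m_comm\<close>)

lemma multiplier_closed:
  assumes A: "nd_algebra A" and x: "x \<in> carrier (multiplier_algebra k A)"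
  shows "y \<in> carrier (multiplier_algebra k A) \<Longrightarrow>
      x \<oplus>\<^bsub>multiplier_algebra k A\<^esub> y \<in> carrier (multiplier_algebra k A)"
    and "y \<in> carrier (multiplier_algebra k A) \<Longrightarrow>
      x \<otimes>\<^bsub>multiplier_algebra k A\<^esub> y \<in> carrier (multiplier_algebra k A)"
    and "c \<in> carrier k \<Longrightarrow> c \<odot>\<^bsub>multiplier_algebra k A\<^esub> x \<in> carrier (multiplier_algebra k A)"
proof -
  note m = nd_algebraD(1)[OF A] and b = bilD[OF nd_algebraD(2)[OF A]] and mc = nd_algebraD(4)[OF A]
  have xl: "lin k A A (fst x)" "lin k A A (snd x)" using x by (simp_all add: multiplier_iff)
  have xc: "fst x a \<in> carrier A" "snd x a \<in> carrier A" if "a \<in> carrier A" for a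
    using that lin_closed[OF xl(1)] lin_closed[OF xl(2)] by simp_all
  {
    assume y: "y \<in> carrier (multiplier_algebra k A)"
    have yl: "lin k A A (fst y)" "lin k A A (snd y)" using y by (simp_all add: multiplier_iff)
    have yc: "fst y a \<in> carrier A" "snd y a \<in> carrier A" if "a \<in> carrier A" for a
      using that lin_closed[OF yl(1)] lin_closed[OF yl(2)] by simp_all
    have "lin k A A (fst (x \<oplus>\<^bsub>multiplier_algebra k A\<^esub> y))"
        "lin k A A (snd (x \<oplus>\<^bsub>multiplier_algebra k A\<^esub> y))"
      using lin_sum[OF xl(1) yl(1) m m] lin_sum[OF xl(2) yl(2) m m] m
      by (simp_all add: multiplier_algebra_def lin_restrict)
    then show "x \<oplus>\<^bsub>multiplier_algebra k A\<^esub> y \<in> carrier (multiplier_algebra k A)"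
      using x y xc yc by (simp add: multiplier_iff multiplier_ops multiplier_ops_ext mc b)
    have "lin k A A (fst (x \<otimes>\<^bsub>multiplier_algebra k A\<^esub> y))"
        "lin k A A (snd (x \<otimes>\<^bsub>multiplier_algebra k A\<^esub> y))"
      using lin_comp[OF yl(1) xl(1)] lin_comp[OF xl(2) yl(2)] m
      by (simp_all add: multiplier_algebra_def lin_restrict compose_def)
    then show "x \<otimes>\<^bsub>multiplier_algebra k A\<^esub> y \<in> carrier (multiplier_algebra k A)"
      using x y xc yc by (simp add: multiplier_iff multiplier_ops multiplier_ops_ext mc b)
  }
  assume c: "c \<in> carrier k"
  have "lin k A A (fst (c \<odot>\<^bsub>multiplier_algebra k A\<^esub> x))"
      "lin k A A (snd (c \<odot>\<^bsub>multiplier_algebra k A\<^esub> x))"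
    using lin_scale[OF xl(1) c m m] lin_scale[OF xl(2) c m m] m
    by (simp_all add: multiplier_algebra_def lin_restrict)
  then show "c \<odot>\<^bsub>multiplier_algebra k A\<^esub> x \<in> carrier (multiplier_algebra k A)"
    using x xc c by (simp add: multiplier_iff multiplier_ops multiplier_ops_ext mc b)
qed

lemma multiplier_ap_closed:
  assumes "x \<in> carrier (multiplier_algebra k A)" "a \<in> carrier A"
  shows "fst x a \<in> carrier A" "snd x a \<in> carrier A"
  using assms by (simp_all add: multiplier_iff lin_def)

lemma multiplier_incl_ops:
  "b \<in> carrier A \<Longrightarrow> fst (multiplier_incl A a) b = a \<otimes>\<^bsub>A\<^esub> b"
  "b \<in> carrier A \<Longrightarrow> snd (multiplier_incl A a) b = b \<otimes>\<^bsub>A\<^esub> a"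
  by (simp_all add: multiplier_incl_def)

lemma multiplier_incl_closed:
  assumes A: "nd_algebra A" and a: "a \<in> carrier A"
  shows "multiplier_incl A a \<in> carrier (multiplier_algebra k A)"
proof -
  note b = nd_algebraD(2)[OF A]
  have "lin k A A (fst (multiplier_incl A a))" "lin k A A (snd (multiplier_incl A a))"
    using bil_linL[OF b a] bil_linR[OF b a] nd_algebraD(1)[OF A]
    by (simp_all add: multiplier_incl_def lin_restrict)
  then show ?thesis using a nd_algebraD(3,4)[OF A]
    by (simp add: multiplier_iff multiplier_incl_def)
qed

text \<open>The image of A is an ideal of the multiplier algebra, which is why multiplicative maps
  on the latter can be controlled by their values on A.\<close>

lemma multiplier_incl_mult:
  assumes A: "nd_algebra A" and a: "a \<in> carrier A" and x: "x \<in> carrier (multiplier_algebra k A)"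
  shows "x \<otimes>\<^bsub>multiplier_algebra k A\<^esub> multiplier_incl A a = multiplier_incl A (fst x a)"
    and "multiplier_incl A a \<otimes>\<^bsub>multiplier_algebra k A\<^esub> x = multiplier_incl A (snd x a)"
proof -
  note c = multiplier_ap_closed[OF x a]
  note i = multiplier_incl_closed[OF A]
  show "x \<otimes>\<^bsub>multiplier_algebra k A\<^esub> multiplier_incl A a = multiplier_incl A (fst x a)"
    by (rule multiplier_eqI[OF multiplier_closed(2)[OF A x i[OF a]] i[OF c(1)]])
      (use a x multiplier_ap_closed[OF x] in \<open>simp_all add: multiplier_ops multiplier_incl_ops
          multiplier_iff\<close>)
  show "multiplier_incl A a \<otimes>\<^bsub>multiplier_algebra k A\<^esub> x = multiplier_incl A (snd x a)"
    by (rule multiplier_eqI[OF multiplier_closed(2)[OF A i[OF a] x] i[OF c(2)]])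
      (use a x multiplier_ap_closed[OF x] in \<open>simp_all add: multiplier_ops multiplier_incl_ops
          multiplier_iff\<close>)
qed

text \<open>Idempotence and non-degeneracy are inherited from A acting on itself, since the products
  with elements of A are among the values of multipliers.\<close>

lemma nd_ext_multiplier:
  assumes A: "nd_algebra A"
  shows "nd_ext k (multiplier_algebra k A) (mult (multiplier_algebra k A)) A (mult A) fst
      (\<lambda>a x. snd x a)"
proof -
  let ?M = "multiplier_algebra k A"
  note m = nd_algebraD(1)[OF A]
  note E = A[unfolded nd_algebra_def]
  note nr = nd_extD(1)[OF E] and nl = nd_extD(2)[OF E]
  note c = multiplier_ap_closed
  have l: "lin k A A (fst x)" "lin k A A (snd x)" if "x \<in> carrier ?M" for x
    using that by (auto simp: multiplier_iff)
  note i = multiplier_incl_closed[OF A]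
  have "nd_module k ?M (mult ?M) A (\<lambda>a x. snd x a)"
  proof (rule nd_moduleI[OF m])
    show "bil k A ?M A (\<lambda>a x. snd x a)"
      by (rule bilI) (simp_all add: linD[OF l(2)] multiplier_ops)
    show "a = \<zero>\<^bsub>A\<^esub>" if a: "a \<in> carrier A" and z: "\<And>x. x \<in> carrier ?M \<Longrightarrow> snd x a = \<zero>\<^bsub>A\<^esub>" for a
    proof (rule nd_moduleD(4)[OF nr a])
      fix b assume "b \<in> carrier A"
      then show "a \<otimes>\<^bsub>A\<^esub> b = \<zero>\<^bsub>A\<^esub>" using z[OF i, of b] a by (simp add: multiplier_incl_ops)
    qed
    show "a \<in> addspan A {snd x a | a x. a \<in> carrier A \<and> x \<in> carrier ?M}" if "a \<in> carrier A" for a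
    proof -
      have "{a \<otimes>\<^bsub>A\<^esub> b | a b. a \<in> carrier A \<and> b \<in> carrier A} \<subseteq> {snd x a | a x. a \<in> carrier A \<and>
          x \<in> carrier ?M}"
        using i multiplier_incl_ops(2) by (smt (verit) Collect_mono)
      from addspan_mono[OF this] show ?thesis using that nd_moduleD(5)[OF nr] by blast
    qed
  qed (simp add: multiplier_ops)
  moreover have "nd_module k ?M (\<lambda>x y. mult ?M y x) A (\<lambda>a x. fst x a)"
  proof (rule nd_moduleI[OF m])
    show "bil k A ?M A (\<lambda>a x. fst x a)"
      by (rule bilI) (simp_all add: linD[OF l(1)] multiplier_ops)
    show "a = \<zero>\<^bsub>A\<^esub>" if a: "a \<in> carrier A" and z: "\<And>x. x \<in> carrier ?M \<Longrightarrow> fst x a = \<zero>\<^bsub>A\<^esub>" for a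
    proof (rule nd_moduleD(4)[OF nl a])
      fix b assume "b \<in> carrier A"
      then show "b \<otimes>\<^bsub>A\<^esub> a = \<zero>\<^bsub>A\<^esub>" using z[OF i, of b] a by (simp add: multiplier_incl_ops)
    qed
    show "a \<in> addspan A {fst x a | a x. a \<in> carrier A \<and> x \<in> carrier ?M}" if "a \<in> carrier A" for a
    proof -
      have "{b \<otimes>\<^bsub>A\<^esub> a | a b. a \<in> carrier A \<and> b \<in> carrier A} \<subseteq> {fst x a | a x. a \<in> carrier A \<and>
          x \<in> carrier ?M}"
        using i multiplier_incl_ops(1) by (smt (verit) Collect_mono)
      from addspan_mono[OF this] show ?thesis using that nd_moduleD(5)[OF nl] by blast
    qed
  qed (simp add: multiplier_ops)
  \<comment> \<open>Tested by a product with b on the right: both sides become the left map of x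
    applied to a times y b.\<close>
  moreover have "snd y (fst x a) = fst x (snd y a)" if "x \<in> carrier ?M" "y \<in> carrier ?M"
      "a \<in> carrier A" for x y a
  proof (rule nd_eqI[OF nr])
    fix b assume b: "b \<in> carrier A"
    show "snd y (fst x a) \<otimes>\<^bsub>A\<^esub> b = fst x (snd y a) \<otimes>\<^bsub>A\<^esub> b"
      using that b c by (smt (verit) multiplier_iff)
  qed (use that in \<open>simp_all add: c\<close>)
  ultimately show ?thesis
    unfolding nd_ext_def using nd_algebraD(2,3)[OF A] by (simp add: multiplier_iff)
qed

text \<open>An algebra is an extension of its multiplier algebra, and \<^const>\<open>bar\<close> is base change along this
  extension.\<close>

lemma bar_eq:
  fixes g :: "(('k, 'u) module, 'u actions) arrow"
  assumes A: "nd_algebra (src g)"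
    and G: "nd_ext k (src g) (mult (src g)) (tgt g) (mult (tgt g)) (fst (fn g)) (snd (fn g))"
    and x: "x \<in> carrier (multiplier_algebra k (src g))"
  shows "bar k g x =
    (\<lambda>c \<in> carrier (tgt g). base_change (src g) (\<lambda>x y. snd x y) (tgt g) (\<lambda>c y. fst (fn g) y c) c x,
     \<lambda>c \<in> carrier (tgt g). base_change (src g) (\<lambda>x y. fst x y) (tgt g) (snd (fn g)) c x)"
proof -
  define A where "A = src g"
  define C where "C = tgt g"
  define l where "l = fst (fn g)"
  define r where "r = snd (fn g)"
  note A = A[folded A_def] and G = G[folded A_def C_def l_def r_def] and x = x[folded A_def]
  let ?M = "multiplier_algebra k A" and ?N = "multiplier_algebra k C"
  define L :: "'u multiplier \<Rightarrow> 'u \<Rightarrow> 'u" where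
    "L x c = base_change A (\<lambda>x y. snd x y) C (\<lambda>c y. l y c) c x" for x c
  define R :: "'u \<Rightarrow> 'u multiplier \<Rightarrow> 'u" where "R = base_change A (\<lambda>x y. fst x y) C r"
  note E = nd_ext_multiplier[OF A]
  have H: "nd_ext k ?M (mult ?M) C (mult C) L R"
    using base_change_ext[OF E G] by (simp add: L_def[abs_def] R_def)
  interpret XR: extension_module k ?M "mult ?M" A "mult A" fst "\<lambda>a x. snd x a" C r
    by unfold_locales (use E nd_extD(1)[OF G] in auto)
  interpret XL: extension_module k ?M "\<lambda>x y. mult ?M y x" A "\<lambda>x y. mult A y x" "\<lambda>x a. snd x a"
      "\<lambda>a x. fst x a" C "\<lambda>c y. l y c"
    by unfold_locales (use nd_ext_op[OF E] nd_extD(2)[OF G] in auto)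
  note Hr = nd_extD(1)[OF H] and Hl = nd_extD(2)[OF H]
  note br = bilD[OF nd_moduleD(2)[OF Hr]] and bl = bilD[OF nd_moduleD(2)[OF Hl]]
  have mC: "module k C" using nd_moduleD(1)[OF Hr] .
  define h where "h = (\<lambda>x \<in> carrier ?M. (\<lambda>c \<in> carrier C. L x c, \<lambda>c \<in> carrier C. R c x))"
  have h_closed: "h x \<in> carrier ?N" if "x \<in> carrier ?M" for x
  proof -
    have "lin k C C (L x)" "lin k C C (\<lambda>c. R c x)"
      using bil_linL[OF nd_moduleD(2)[OF Hr] that] bil_linL[OF nd_moduleD(2)[OF Hl] that]
      by simp_all
    then show ?thesis
      using that mC nd_extD(6-8)[OF H] bil_closed[OF nd_extD(3)[OF H]] br(1) bl(1)
      by (simp add: multiplier_iff h_def lin_restrict)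
  qed
  have fh: "fst (h x) c = L x c" "snd (h x) c = R c x" if "x \<in> carrier ?M" "c \<in> carrier C" for x c
    using that by (simp_all add: h_def)
  note mcl = multiplier_closed[OF A]
  have hN: "fst (h x) \<in> extensional (carrier C)" "snd (h x) \<in> extensional (carrier C)"
    if "x \<in> carrier ?M" for x
    using h_closed[OF that] by (simp_all add: multiplier_iff)
  have eqI: "u = v" if "fst u \<in> extensional (carrier C)" "snd u \<in> extensional (carrier C)"
      "fst v \<in> extensional (carrier C)" "snd v \<in> extensional (carrier C)"
      "\<And>c. c \<in> carrier C \<Longrightarrow> fst u c = fst v c" "\<And>c. c \<in> carrier C \<Longrightarrow> snd u c = snd v c"
    for u v :: "'u multiplier"
    using that extensionalityI[of "fst u" "carrier C" "fst v"] extensionalityI[of "snd u"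
        "carrier C" "snd v"]
    by (intro prod_eqI) auto
  have one: "\<one>\<^bsub>?M\<^esub> \<in> carrier ?M"
    using nd_algebraD[OF A] by (auto simp: multiplier_iff multiplier_ops multiplier_ops_ext lin_def)
  note i = multiplier_incl_closed[OF A]
  have ext_fn: "b \<in> carrier A \<Longrightarrow> tilde g b = (\<lambda>c \<in> carrier C. l b c, \<lambda>c \<in> carrier C. r c b)" for b
    by (simp add: tilde_def A_def C_def l_def r_def)
  have "h \<in> algebra_maps k ?M ?N"
    unfolding algebra_maps_def linear_maps_iff
  proof (intro CollectI conjI linI ballI)
    fix x y assume xy: "x \<in> carrier ?M" "y \<in> carrier ?M"
    show "h (x \<oplus>\<^bsub>?M\<^esub> y) = h x \<oplus>\<^bsub>?N\<^esub> h y"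
      by (rule eqI) (use xy mcl(1)[OF xy] in \<open>simp_all add: hN multiplier_ops_ext multiplier_ops fh
          bl br\<close>)
    show "h (x \<otimes>\<^bsub>?M\<^esub> y) = h x \<otimes>\<^bsub>?N\<^esub> h y"
      by (rule eqI) (use xy mcl(2)[OF xy] nd_moduleD(3)[OF Hr] nd_moduleD(3)[OF Hl] in
          \<open>simp_all add: hN multiplier_ops_ext multiplier_ops fh bl br\<close>)
  next
    fix x c assume xc: "c \<in> carrier k" "x \<in> carrier ?M"
    show "h (c \<odot>\<^bsub>?M\<^esub> x) = c \<odot>\<^bsub>?N\<^esub> h x"
      by (rule eqI) (use xc mcl(3)[OF xc(2,1)]
          in \<open>simp_all add: hN multiplier_ops_ext multiplier_ops fh bl br\<close>)
  next
    show "h \<in> extensional (carrier ?M)" by (simp add: h_def)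
  qed (rule h_closed)
  moreover have "h \<one>\<^bsub>?M\<^esub> = \<one>\<^bsub>?N\<^esub>"
  proof (rule eqI)
    fix c assume c: "c \<in> carrier C"
    have "L \<one>\<^bsub>?M\<^esub> c = c" unfolding L_def
      by (rule base_change_eqI[OF XL.F]) (use c in \<open>simp_all add: multiplier_ops\<close>)
    moreover have "R c \<one>\<^bsub>?M\<^esub> = c" unfolding R_def
      by (rule base_change_eqI[OF XR.F]) (use c in \<open>simp_all add: multiplier_ops\<close>)
    ultimately show "fst (h \<one>\<^bsub>?M\<^esub>) c = fst \<one>\<^bsub>?N\<^esub> c" "snd (h \<one>\<^bsub>?M\<^esub>) c = snd \<one>\<^bsub>?N\<^esub> c"
      using c one by (simp_all add: fh multiplier_ops)
  qed (use one in \<open>simp_all add: hN multiplier_ops_ext\<close>)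
  moreover have "h (multiplier_incl A b) = tilde g b" if b: "b \<in> carrier A" for b
  proof (rule eqI)
    fix c assume c: "c \<in> carrier C"
    have "L (multiplier_incl A b) c = l b c" unfolding L_def
      by (rule base_change_eqI[OF XL.F])
        (use b c nd_moduleD(3)[OF XL.F] XL.cl in \<open>simp_all add: multiplier_incl_ops\<close>)
    moreover have "R c (multiplier_incl A b) = r c b" unfolding R_def
      by (rule base_change_eqI[OF XR.F])
        (use b c nd_moduleD(3)[OF XR.F] XR.cl in \<open>simp_all add: multiplier_incl_ops\<close>)
    ultimately show "fst (h (multiplier_incl A b)) c = fst (tilde g b) c"
      "snd (h (multiplier_incl A b)) c = snd (tilde g b) c"
      using c b i by (simp_all add: fh ext_fn)
  qed (use b i in \<open>simp_all add: hN ext_fn\<close>)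
  \<comment> \<open>As A is an ideal, multiplicativity makes the product of \<open>h' x\<close> with
    the image of b equal to the image of x b, and similarly on the other side. This prescribes
    \<open>h' x\<close> on products with A, and \<open>base_change_unique\<close> applies.\<close>
  moreover have "h' = h" if h': "h' \<in> algebra_maps k ?M ?N" "\<And>b. b \<in> carrier A \<Longrightarrow>
      h' (multiplier_incl A b) = tilde g b" for h'
  proof (rule extensionalityI)
    show "h' \<in> extensional (carrier ?M)" "h \<in> extensional (carrier ?M)"
      using h'(1) by (auto simp: algebra_maps_def linear_maps_iff h_def)
    fix x assume x: "x \<in> carrier ?M"
    have h'x: "h' x \<in> carrier ?N" using h'(1) x lin_closed
      by (auto simp: algebra_maps_def linear_maps_iff)
    have mult: "h' (x \<otimes>\<^bsub>?M\<^esub> y) = h' x \<otimes>\<^bsub>?N\<^esub> h' y" "h' (y \<otimes>\<^bsub>?M\<^esub> x) = h' y \<otimes>\<^bsub>?N\<^esub> h' x"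
      if "y \<in> carrier ?M" for y
      using h'(1) x that by (auto simp: algebra_maps_def)
    have xcl: "fst x b \<in> carrier A" "snd x b \<in> carrier A" if "b \<in> carrier A" for b
      by (rule multiplier_ap_closed[OF x that])+
    have lins: "lin k C C (fst (h' x))" "lin k C C (snd (h' x))" using h'x
      by (simp_all add: multiplier_iff)
    show "h' x = h x"
    proof (rule multiplier_eqI[OF h'x h_closed[OF x]])
      fix c assume c: "c \<in> carrier C"
      have "fst (h' x) c = XL.bc c x"
      proof (rule XL.base_change_unique[OF _ _ _ c x])
        fix c b assume cb: "c \<in> carrier C" "b \<in> carrier A"
        have "h' x \<otimes>\<^bsub>?N\<^esub> tilde g b = tilde g (fst x b)"
          using mult(1)[OF i, of b] h'(2)[of b] h'(2)[OF xcl(1), of b] multiplier_incl_mult(1)[OF A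
              _ x, of b] cb
          by simp
        from arg_cong[OF this, of "\<lambda>u. fst u c"] show "fst (h' x) (l b c) = l (fst x b) c"
          using cb xcl by (simp add: ext_fn multiplier_ops)
      qed (use linD[OF lins(1)] lin_zero[OF lins(1) mC mC] in auto)
      then show "fst (h' x) c = fst (h x) c" using c x by (simp add: fh L_def)
      have "snd (h' x) c = XR.bc c x"
      proof (rule XR.base_change_unique[OF _ _ _ c x])
        fix c b assume cb: "c \<in> carrier C" "b \<in> carrier A"
        have "tilde g b \<otimes>\<^bsub>?N\<^esub> h' x = tilde g (snd x b)"
          using mult(2)[OF i, of b] h'(2)[of b] h'(2)[OF xcl(2), of b] multiplier_incl_mult(2)[OF A
              _ x, of b] cb
          by simp
        from arg_cong[OF this, of "\<lambda>u. snd u c"] show "snd (h' x) (r c b) = r c (snd x b)"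
          using cb xcl by (simp add: ext_fn multiplier_ops)
      qed (use linD[OF lins(2)] lin_zero[OF lins(2) mC mC] in auto)
      then show "snd (h' x) c = snd (h x) c" using c x by (simp add: fh R_def)
    qed
  qed
  ultimately have "bar k g = h"
    unfolding bar_def A_def[symmetric] C_def[symmetric] by (intro the_equality) blast+
  then show ?thesis
    using x by (simp add: h_def L_def R_def A_def C_def l_def r_def)
qed

text \<open>By \<open>bar_eq\<close> the composite is base change from the multiplier algebra,
  evaluated at \<open>tilde f b\<close>. This multiplier acts on \<open>tgt f\<close> by the actions
  in f, so the result is base change along f itself.\<close>

lemma ndi_cmp:
  fixes f g :: "('k, 'a) ndi_arrow"
  assumes F: "nd_ext k (src f) (mult (src f)) (tgt f) (mult (tgt f)) (fst (fn f)) (snd (fn f))"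
    and G: "nd_ext k (src g) (mult (src g)) (tgt g) (mult (tgt g)) (fst (fn g)) (snd (fn g))"
    and A: "nd_algebra (src g)" and eq: "src g = tgt f"
  shows "cmp (ndi_cat k) g f = \<lparr>src = src f, tgt = tgt g, fn =
    (\<lambda>b \<in> carrier (src f). \<lambda>c \<in> carrier (tgt g).
       base_change (tgt f) (\<lambda>b y. snd (fn f) y b) (tgt g) (\<lambda>c y. fst (fn g) y c) c b,
     \<lambda>c \<in> carrier (tgt g). \<lambda>b \<in> carrier (src f).
       base_change (tgt f) (fst (fn f)) (tgt g) (snd (fn g)) c b)\<rparr>"
proof -
  note bl = nd_moduleD(2)[OF nd_extD(2)[OF F]] and br = nd_moduleD(2)[OF nd_extD(1)[OF F]]
  note m = nd_moduleD(1)[OF nd_extD(1)[OF F]]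
  have t: "tilde f b \<in> carrier (multiplier_algebra k (src g))"
    and tf: "\<And>a. a \<in> carrier (tgt f) \<Longrightarrow> fst (tilde f b) a = fst (fn f) b a"
      "\<And>a. a \<in> carrier (tgt f) \<Longrightarrow> snd (tilde f b) a = snd (fn f) a b"
    if b: "b \<in> carrier (src f)" for b
  proof -
    show tf: "fst (tilde f b) a = fst (fn f) b a" "snd (tilde f b) a = snd (fn f) a b"
      if "a \<in> carrier (tgt f)" for a
      using b that by (simp_all add: tilde_def)
    have "lin k (tgt f) (tgt f) (fst (tilde f b))" "lin k (tgt f) (tgt f) (snd (tilde f b))"
      using bil_linL[OF bl b] bil_linL[OF br b] b m by (simp_all add: tilde_def lin_restrict)
    moreover have "fst (tilde f b) \<in> extensional (carrier (tgt f))"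
        "snd (tilde f b) \<in> extensional (carrier (tgt f))"
      using b by (simp_all add: tilde_def)
    ultimately show "tilde f b \<in> carrier (multiplier_algebra k (src g))"
      using b nd_extD(6-8)[OF F] bil_closed[OF nd_extD(3)[OF F]] bil_closed[OF bl] bil_closed[OF br]
      by (simp add: multiplier_iff eq tf)
  qed
  have "base_change (src g) (\<lambda>x y. snd x y) (tgt g) (\<lambda>c y. fst (fn g) y c) c (tilde f b) =
      base_change (tgt f) (\<lambda>b y. snd (fn f) y b) (tgt g) (\<lambda>c y. fst (fn g) y c) c b"
    "base_change (src g) (\<lambda>x y. fst x y) (tgt g) (snd (fn g)) c (tilde f b) =
      base_change (tgt f) (fst (fn f)) (tgt g) (snd (fn g)) c b"
    if "b \<in> carrier (src f)" "c \<in> carrier (tgt g)" for b c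
    using that bil_closed[OF bl] bil_closed[OF br]
    by (intro base_change_cong; simp add: eq tf)+
  then show ?thesis
    by (auto simp: ndi_cat_def Let_def arrow_of_tilde_def fun_eq_iff restrict_def compose_def
        bar_eq[OF A G t])
qed

end

section \<open>Tensor products of modules over a multiplier bialgebra\<close>

context scalars
begin

lemma nd_algebra_tensor:
  assumes "nd_algebra A" "projective k A" "nd_algebra B" "projective k B"
  shows "nd_algebra (algebra_tensor k A B)" "projective k (algebra_tensor k A B)"
  using nd_ext_tensor[OF nd_algebraD(1,2)[OF assms(1)] nd_algebraD(1,2)[OF assms(3)]
      assms(1)[unfolded nd_algebra_def] assms(2) assms(3)[unfolded nd_algebra_def] assms(4)]
    projective_tensor[OF assms(2,4)]
  by (simp_all add: nd_algebra_def)

lemma nd_algebra_scalar: "nd_algebra (scalar_algebra k)"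
proof -
  let ?K = "scalar_algebra k"
  have c: "mult ?K a b = mult ?K b a" "mult ?K a b \<in> carrier ?K" if "a \<in> carrier ?K"
      "b \<in> carrier ?K" for a b
    using that by (auto simp: k.m_comm)
  have nd: "nd_module k ?K (mult ?K) ?K (mult ?K)"
  proof (rule nd_moduleI[OF module_scalar_algebra bil_scalar_mult])
    fix m assume m: "m \<in> carrier ?K" "\<And>a. a \<in> carrier ?K \<Longrightarrow> m \<otimes>\<^bsub>?K\<^esub> a = \<zero>\<^bsub>?K\<^esub>"
    show "m = \<zero>\<^bsub>?K\<^esub>" using m(1) m(2)[of "Scalar \<one>\<^bsub>k\<^esub>"] by auto
  next
    let ?S = "{m \<otimes>\<^bsub>?K\<^esub> a | m a. m \<in> carrier ?K \<and> a \<in> carrier ?K}"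
    fix m assume m: "m \<in> carrier ?K"
    have S: "?S \<subseteq> carrier ?K" using c(2) by blast
    have "m = m \<otimes>\<^bsub>?K\<^esub> Scalar \<one>\<^bsub>k\<^esub>" using m by auto
    then have "m \<in> ?S" using m by (intro CollectI exI[of _ m] exI[of _ "Scalar \<one>\<^bsub>k\<^esub>"]) simp
    then show "m \<in> addspan ?K ?S" by (rule addspan_gen[OF module_scalar_algebra S])
  qed (auto simp: k.m_assoc)
  have nd': "nd_module k ?K (\<lambda>a b. mult ?K b a) ?K (\<lambda>x a. mult ?K a x)"
    by (rule nd_module_cong[OF nd _ _ module_scalar_algebra]) (auto simp: k.m_comm)
  show ?thesis
    unfolding nd_algebra_def nd_ext_def using nd nd' bil_scalar_mult by (auto simp: k.m_assoc)
qed

lemma ndi_obj_iff: "B \<in> obj (ndi_cat k) \<longleftrightarrow> nd_algebra B \<and> projective k B"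
  using nd_algebra_iff[of B] by (auto simp: ndi_cat_def Let_def)

lemma ndi_arr_iff: "f \<in> arr (ndi_cat k) \<longleftrightarrow>
    src f \<in> obj (ndi_cat k) \<and> tgt f \<in> obj (ndi_cat k) \<and> extension_of f \<in> ext_objects k (src f)"
  by (simp add: ndi_cat_def Let_def)

end

lemma extension_of_simps [simp]:
  "alg (extension_of f) = tgt f" "lact (extension_of f) = fst (fn f)" "ract (extension_of f) =
      snd (fn f)"
  by (simp_all add: extension_of_def)

lemma PiE2_eqI:
  assumes "f \<in> X \<rightarrow>\<^sub>E Y \<rightarrow>\<^sub>E Z" "g \<in> X \<rightarrow>\<^sub>E Y \<rightarrow>\<^sub>E Z'" "\<And>x y. x \<in> X \<Longrightarrow> y \<in> Y \<Longrightarrow> f x y = g x y"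
  shows "f = g"
proof (rule extensionalityI[of f X g])
  fix x assume "x \<in> X"
  then show "f x = g x" using assms by (intro extensionalityI[of "f x" Y "g x"])
      (auto simp: PiE_iff)
qed (use assms in \<open>auto simp: PiE_iff\<close>)

locale nd_alg = scalars k for k :: "'k ring" +
  fixes A :: "('k, 'a) kmod"
  assumes A: "nd_algebra A" and projA: "projective k A"
begin

lemma mA [simp]: "module k A" by (rule nd_algebraD(1)[OF A])

lemmas ext_iff = ext_objects_iff[OF mA]

text \<open>The regular extension: its left and right parts are the generators of the module
  categories.\<close>

definition reg :: "('k, ('k, 'a) univ) extension" where
  "reg = extension_of (idn (ndi_cat k) A)"

lemma reg_simps [simp]:
  "alg reg = A" "lact reg = (\<lambda>b \<in> carrier A. \<lambda>a \<in> carrier A. b \<otimes>\<^bsub>A\<^esub> a)"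
  "ract reg = (\<lambda>a \<in> carrier A. \<lambda>b \<in> carrier A. a \<otimes>\<^bsub>A\<^esub> b)"
  by (auto simp: reg_def ndi_cat_def Let_def arrow_of_tilde_def multiplier_incl_def fun_eq_iff
      restrict_def)

lemma reg_ext: "reg \<in> ext_objects k A"
proof -
  have "nd_ext k A (mult A) A (mult A) (lact reg) (ract reg)"
    by (rule nd_ext_cong[OF A[unfolded nd_algebra_def]]) (simp_all add: nd_algebraD(4)[OF A])
  then show ?thesis by (simp add: ext_iff projA nd_algebraD(4)[OF A])
qed

text \<open>D plays the role of \<Delta>, namely A \<otimes> A as an extension of A. The
  restrictions make the action extensional, as the objects of \<open>right_mod_cat\<close> have to
  be.\<close>

definition rtens :: "('k, ('k, 'a) univ) extension \<Rightarrow> ('k, ('k, 'a) univ) action_module \<Rightarrow>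
    ('k, ('k, 'a) univ) action_module \<Rightarrow> ('k, ('k, 'a) univ) action_module" where
  "rtens D M N = \<lparr>base = tensor k (base M) (base N),
     act = (\<lambda>z \<in> carrier (tensor k (base M) (base N)). \<lambda>a \<in> carrier A.
       base_change (tensor k A A) (lact D) (tensor k (base M) (base N))
         (componentwise k (base M) (base N) (act M) (act N)) z a)\<rparr>"

text \<open>The mirror image of \<open>rtens\<close> for opposite multiplications: base change uses
  the right action of D, and the componentwise action takes its arguments in reverse order.\<close>

definition ltens :: "('k, ('k, 'a) univ) extension \<Rightarrow> ('k, ('k, 'a) univ) action_module \<Rightarrow>
    ('k, ('k, 'a) univ) action_module \<Rightarrow> ('k, ('k, 'a) univ) action_module" where
  "ltens D M N = \<lparr>base = tensor k (base M) (base N),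
     act = (\<lambda>a \<in> carrier A. \<lambda>z \<in> carrier (tensor k (base M) (base N)).
       base_change (tensor k A A) (\<lambda>a y. ract D y a) (tensor k (base M) (base N))
         (\<lambda>z y. componentwise k (base M) (base N) (act M) (act N) y z) z a)\<rparr>"

definition etens :: "('k, ('k, 'a) univ) extension \<Rightarrow> ('k, ('k, 'a) univ) extension \<Rightarrow>
    ('k, ('k, 'a) univ) extension \<Rightarrow> ('k, ('k, 'a) univ) extension" where
  "etens D R S = \<lparr>alg = algebra_tensor k (alg R) (alg S),
     lact = act (ltens D (left_part R) (left_part S)),
     ract = act (rtens D (right_part R) (right_part S))\<rparr>"

lemma part_simps [simp]:
  "base (left_part R) = underlying (alg R)" "act (left_part R) = lact R"
  "base (right_part R) = underlying (alg R)" "act (right_part R) = ract R"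
  by (simp_all add: left_part_def right_part_def)

lemma tens_base [simp]:
  "base (rtens D M N) = tensor k (base M) (base N)" "base (ltens D M N) =
      tensor k (base M) (base N)"
  "alg (etens D R S) = algebra_tensor k (alg R) (alg S)"
  by (simp_all add: rtens_def ltens_def etens_def)

lemma etens_parts [simp]:
  "left_part (etens D R S) = ltens D (left_part R) (left_part S)"
  "right_part (etens D R S) = rtens D (right_part R) (right_part S)"
  by (simp_all add: left_part_def right_part_def etens_def ltens_def rtens_def)

definition robj :: "('k, ('k, 'a) univ) action_module \<Rightarrow> bool" where
  "robj M \<longleftrightarrow> nd_module k A (mult A) (base M) (act M) \<and>
     act M \<in> carrier (base M) \<rightarrow>\<^sub>E carrier A \<rightarrow>\<^sub>E carrier (base M) \<and> projective k (base M)"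

definition lobj :: "('k, ('k, 'a) univ) action_module \<Rightarrow> bool" where
  "lobj M \<longleftrightarrow> nd_module k A (\<lambda>a b. mult A b a) (base M) (\<lambda>m a. act M a m) \<and>
     act M \<in> carrier A \<rightarrow>\<^sub>E carrier (base M) \<rightarrow>\<^sub>E carrier (base M) \<and> projective k (base M)"

lemma ext_iff_parts: "R \<in> ext_objects k A \<longleftrightarrow>
    nd_ext k A (mult A) (alg R) (mult (alg R)) (lact R) (ract R) \<and> lobj (left_part R) \<and>
        robj (right_part R)"
  unfolding ext_iff lobj_def robj_def by (auto simp: nd_ext_def)

lemma robj_cat: "obj (right_mod_cat k A) = {M. robj M}"
  using right_module_iff[OF mA] by (auto simp: right_mod_cat_def Let_def robj_def)

lemma lobj_cat: "obj (left_mod_cat k A) = {M. lobj M}"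
  using left_module_iff[OF mA] by (auto simp: left_mod_cat_def Let_def lobj_def)

end

locale comult = nd_alg k A for k :: "'k ring" and A :: "('k, 'a) kmod" +
  fixes D :: "('k, ('k, 'a) univ) extension"
  assumes D: "D \<in> ext_objects k A" and algD: "alg D = algebra_tensor k A A"
begin

abbreviation "AA \<equiv> tensor k A A"
abbreviation "mAA \<equiv> componentwise k A A (mult A) (mult A)"

lemma nd_D: "nd_ext k A (mult A) AA mAA (lact D) (ract D)"
  and D_PiE: "lact D \<in> carrier A \<rightarrow>\<^sub>E carrier AA \<rightarrow>\<^sub>E carrier AA"
    "ract D \<in> carrier AA \<rightarrow>\<^sub>E carrier A \<rightarrow>\<^sub>E carrier AA"
  using D by (auto simp: ext_iff algD)

lemma D_closed: "a \<in> carrier A \<Longrightarrow> y \<in> carrier AA \<Longrightarrow> lact D a y \<in> carrier AA"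
  "a \<in> carrier A \<Longrightarrow> y \<in> carrier AA \<Longrightarrow> ract D y a \<in> carrier AA"
  using D_PiE by (auto simp: PiE_iff)

lemma rtens_module:
  assumes "robj M" "robj N"
  shows "extension_module k A (mult A) AA mAA (lact D) (ract D) (tensor k (base M) (base N))
    (componentwise k (base M) (base N) (act M) (act N))"
proof unfold_locales
  show "nd_module k AA mAA (tensor k (base M) (base N)) (componentwise k (base M) (base N) (act M)
      (act N))"
    by (rule nd_module_tensor[OF nd_algebraD(1,2)[OF A] nd_algebraD(1,2)[OF A]])
      (use assms in \<open>simp_all add: robj_def\<close>)
qed (rule nd_D)

lemma ltens_module:
  assumes "lobj M" "lobj N"
  shows "extension_module k A (\<lambda>a b. mult A b a) AA (\<lambda>x y. mAA y x) (\<lambda>a y. ract D y a)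
      (\<lambda>y a. lact D a y)
    (tensor k (base M) (base N)) (\<lambda>z y. componentwise k (base M) (base N) (act M) (act N) y z)"
proof unfold_locales
  have m: "module k (base M)" "module k (base N)" using assms
    by (auto simp: lobj_def projective_def)
  have b: "bil k A (base M) (base M) (act M)" "bil k A (base N) (base N) (act N)"
    using assms bil_flip[OF nd_moduleD(2)] unfolding lobj_def by blast+
  note mb = nd_algebraD(1,2)[OF A]
  note bf = bil_flip[OF nd_algebraD(2)[OF A]]
  show "nd_module k AA (\<lambda>x y. mAA y x) (tensor k (base M) (base N))
      (\<lambda>z y. componentwise k (base M) (base N) (act M) (act N) y z)"
  proof (rule nd_module_cong[OF nd_module_tensor[OF mb(1) bf mb(1) bf]])
    fix z y assume "z \<in> carrier (tensor k (base M) (base N))" "y \<in> carrier AA"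
    then show "componentwise k (base M) (base N) (act M) (act N) y z =
        componentwise k (base M) (base N) (\<lambda>m a. act M a m) (\<lambda>m a. act N a m) z y"
      using componentwise_flip[OF mA mA m m b] by simp
  next
    fix a b assume "a \<in> carrier AA" "b \<in> carrier AA"
    then show "mAA b a = componentwise k A A (\<lambda>a b. mult A b a) (\<lambda>a b. mult A b a) a b"
      "componentwise k A A (\<lambda>a b. mult A b a) (\<lambda>a b. mult A b a) a b \<in> carrier AA"
      using componentwise_flip[OF mA mA mA mA mA mA mb(2) mb(2)]
        bil_closed[OF bil_componentwise(1)[OF mA mA mA mA mA mA bf bf]] by simp_all
  qed (use assms in \<open>simp_all add: lobj_def\<close>)
qed (rule nd_ext_op[OF nd_D])

lemma rtens_robj:
  assumes "robj M" "robj N"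
  shows "robj (rtens D M N)"
proof -
  interpret extension_module k A "mult A" AA mAA "lact D" "ract D" "tensor k (base M) (base N)"
    "componentwise k (base M) (base N) (act M) (act N)" by (rule rtens_module[OF assms])
  have "nd_module k A (mult A) (tensor k (base M) (base N)) (act (rtens D M N))"
    by (rule nd_module_cong[OF nd_base_change]) (simp_all add: rtens_def nd_algebraD(4)[OF A])
  moreover have "act (rtens D M N) \<in> carrier (tensor k (base M) (base N)) \<rightarrow>\<^sub>E carrier A \<rightarrow>\<^sub>E carrier
      (tensor k (base M) (base N))"
    using base_change(1) by (simp add: rtens_def)
  ultimately show ?thesis using assms by (simp add: robj_def projective_tensor)
qed

lemma ltens_lobj:
  assumes "lobj M" "lobj N"
  shows "lobj (ltens D M N)"
proof -
  interpret extension_module k A "\<lambda>a b. mult A b a" AA "\<lambda>x y. mAA y x" "\<lambda>a y. ract D y a"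
      "\<lambda>y a. lact D a y"
    "tensor k (base M) (base N)" "\<lambda>z y. componentwise k (base M) (base N) (act M) (act N) y z"
    by (rule ltens_module[OF assms])
  have "nd_module k A (\<lambda>a b. mult A b a) (tensor k (base M) (base N)) (\<lambda>z a. act (ltens D M N) a z)"
    by (rule nd_module_cong[OF nd_base_change]) (simp_all add: ltens_def nd_algebraD(4)[OF A])
  moreover have "act (ltens D M N) \<in> carrier A \<rightarrow>\<^sub>E carrier (tensor k (base M) (base N)) \<rightarrow>\<^sub>E carrier
      (tensor k (base M) (base N))"
    using base_change(1) by (simp add: ltens_def)
  ultimately show ?thesis using assms by (simp add: lobj_def projective_tensor)
qed

lemma etens_ext:
  assumes R: "R \<in> ext_objects k A" and S: "S \<in> ext_objects k A"
  shows "etens D R S \<in> ext_objects k A"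
proof -
  note mb = nd_algebraD(1,2)[OF A]
  have T: "nd_ext k AA mAA (tensor k (alg R) (alg S)) (componentwise k (alg R) (alg S)
      (mult (alg R)) (mult (alg S)))
      (componentwise k (alg R) (alg S) (lact R) (lact S)) (componentwise k (alg R) (alg S) (ract R)
          (ract S))"
    by (rule nd_ext_tensor[OF mb mb]) (use R S in \<open>simp_all add: ext_iff\<close>)
  have "nd_ext k A (mult A) (tensor k (alg R) (alg S)) (componentwise k (alg R) (alg S)
      (mult (alg R)) (mult (alg S)))
      (lact (etens D R S)) (ract (etens D R S))"
    by (rule nd_ext_cong[OF base_change_ext[OF nd_D T]])
      (simp_all add: etens_def ltens_def rtens_def nd_algebraD(4)[OF A])
  then show ?thesis
    using R S ltens_lobj rtens_robj by (simp add: ext_iff_parts)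
qed

text \<open>A \<otimes> A acts on itself by its product, and y (a z) = (y a) z holds in the
  extension D, so base change returns the actions of D. Hence D can be read off from the tensor
  product of extensions that it defines.\<close>

lemma etens_reg: "etens D reg reg = D"
proof -
  have r: "robj (right_part reg)" and l: "lobj (left_part reg)" using reg_ext
    by (simp_all add: ext_iff_parts)
  have e: "etens D reg reg \<in> ext_objects k A" by (rule etens_ext[OF reg_ext reg_ext])
  interpret R: extension_module k A "mult A" AA mAA "lact D"
      "ract D" AA "componentwise k A A (ract reg) (ract reg)"
    using rtens_module[OF r r] by simp
  interpret L: extension_module k A "\<lambda>a b. mult A b a" AA "\<lambda>x y. mAA y x" "\<lambda>a y. ract D y a"
      "\<lambda>y a. lact D a y"
    AA "\<lambda>z y. componentwise k A A (lact reg) (lact reg) y z"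
    using ltens_module[OF l l] by simp
  have c: "componentwise k A A (\<lambda>b \<in> carrier A. \<lambda>a \<in> carrier A. b \<otimes>\<^bsub>A\<^esub> a) (\<lambda>b \<in> carrier A. \<lambda>a \<in>
      carrier A. b \<otimes>\<^bsub>A\<^esub> a) x y = mAA x y"
    if "x \<in> carrier AA" "y \<in> carrier AA" for x y
    by (rule componentwise_cong[OF mA mA mA mA mA mA nd_algebraD(2)[OF A] nd_algebraD(2)[OF A] _ _
        that]) simp_all
  have "ract (etens D reg reg) = ract D"
  proof (rule PiE2_eqI)
    fix y a assume *: "y \<in> carrier AA" "a \<in> carrier A"
    have "R.bc y a = ract D y a"
      by (rule base_change_eqI[OF R.F]) (use * nd_extD(8)[OF nd_D] in \<open>simp_all add: D_closed c\<close>)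
    then show "ract (etens D reg reg) y a = ract D y a" using * by (simp add: etens_def rtens_def)
  qed (use e D in \<open>auto simp: ext_iff algD\<close>)
  moreover have "lact (etens D reg reg) = lact D"
  proof (rule PiE2_eqI)
    fix a y assume *: "a \<in> carrier A" "y \<in> carrier AA"
    have "L.bc y a = lact D a y"
      by (rule base_change_eqI[OF L.F]) (use * nd_extD(8)[OF nd_D] in \<open>simp_all add: D_closed c\<close>)
    then show "lact (etens D reg reg) a y = lact D a y" using * by (simp add: etens_def ltens_def)
  qed (use e D in \<open>auto simp: ext_iff algD\<close>)
  ultimately show ?thesis using algD by (simp add: etens_def)
qed

end

section \<open>The comonoid axioms as linearity of the constraint maps\<close>

context nd_alg
begin

text \<open>Multiplicativity is kept apart: the constraint maps are multiplicative for the tensor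
  product algebras whatever the actions of A are.\<close>

definition amap :: "('k, ('k, 'a) univ) extension \<Rightarrow> ('k, ('k, 'a) univ) extension \<Rightarrow>
    (('k, 'a) univ \<Rightarrow> ('k, 'a) univ) \<Rightarrow> bool" where
  "amap R S h \<longleftrightarrow> (\<forall>a \<in> carrier A. \<forall>x \<in> carrier (alg R).
     h (lact R a x) = lact S a (h x) \<and> h (ract R x a) = ract S (h x) a)"

text \<open>Composition with an isomorphism of algebras transports the actions: a acts on c by h (a
  (h' c)) and h ((h' c) a). Equality with g therefore says that h commutes with the actions.\<close>

lemma ndi_cmp_iso:
  fixes B C :: "('k, 'a) kmod"
  assumes f: "src f = A" "tgt f = B" "extension_of f \<in> ext_objects k A"
    and g: "src g = A" "tgt g = C" "extension_of g \<in> ext_objects k A"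
    and B: "nd_algebra B" and C: "nd_algebra C" and h: "lin k B C h"
    and mult: "\<And>x y. x \<in> carrier B \<Longrightarrow> y \<in> carrier B \<Longrightarrow> h (x \<otimes>\<^bsub>B\<^esub> y) = h x \<otimes>\<^bsub>C\<^esub> h y"
    and h': "\<And>x. x \<in> carrier C \<Longrightarrow> h' x \<in> carrier B" "\<And>x. x \<in> carrier C \<Longrightarrow> h (h' x) = x"
      "\<And>x. x \<in> carrier B \<Longrightarrow> h' (h x) = x"
  shows "cmp (ndi_cat k) (arrow_of_map B C h) f = g \<longleftrightarrow> amap (extension_of f) (extension_of g) h"
proof -
  define l where "l = fst (fn f)"
  define r where "r = snd (fn f)"
  let ?h = "arrow_of_map B C h"
  have F: "nd_ext k A (mult A) B (mult B) l r" using f by (simp add: ext_iff l_def r_def)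
  have hc: "\<And>x. x \<in> carrier B \<Longrightarrow> h x \<in> carrier C" by (rule lin_closed[OF h])
  have lc: "l a x \<in> carrier B" "r x a \<in> carrier B" if "a \<in> carrier A" "x \<in> carrier B" for a x
    using that bil_closed[OF nd_moduleD(2)[OF nd_extD(1)[OF F]]] bil_closed[OF nd_moduleD(2)[OF
        nd_extD(2)[OF F]]]
    by simp_all
  have "h ` carrier B = carrier C"
  proof (intro equalityI subsetI)
    fix x assume "x \<in> carrier C"
    then show "x \<in> h ` carrier B" using h'(1,2) by (intro image_eqI[of _ _ "h' x"]) simp_all
  qed (use hc in auto)
  then have hom: "nd_ext k B (mult B) C (mult C) (\<lambda>b. mult C (h b)) (\<lambda>c b. mult C c (h b))"
    by - (rule nd_ext_hom[OF C[unfolded nd_algebra_def] h], simp_all add: mult)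
  have hfn: "src ?h = B" "tgt ?h = C"
    "\<And>b c. b \<in> carrier B \<Longrightarrow> c \<in> carrier C \<Longrightarrow> fst (fn ?h) b c = h b \<otimes>\<^bsub>C\<^esub> c"
    "\<And>b c. b \<in> carrier B \<Longrightarrow> c \<in> carrier C \<Longrightarrow> snd (fn ?h) c b = c \<otimes>\<^bsub>C\<^esub> h b"
    by (simp_all add: arrow_of_map_def arrow_of_tilde_def compose_def multiplier_incl_def)
  have G: "nd_ext k B (mult B) C (mult C) (fst (fn ?h)) (snd (fn ?h))"
    by (rule nd_ext_cong[OF hom]) (simp_all add: hfn nd_algebraD[OF B])
  have L: "base_change B (\<lambda>b y. r y b) C (\<lambda>c y. fst (fn ?h) y c) c a = h (l a (h' c))"
    if "a \<in> carrier A" "c \<in> carrier C" for a c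
  proof (rule base_change_eqI[OF nd_extD(2)[OF G]])
    fix y assume y: "y \<in> carrier B"
    have "h y \<otimes>\<^bsub>C\<^esub> h (l a (h' c)) = h (y \<otimes>\<^bsub>B\<^esub> l a (h' c))" using that y by (simp add: mult lc h')
    also have "\<dots> = h (r y a) \<otimes>\<^bsub>C\<^esub> c" using that y
      by (simp add: nd_extD(8)[OF F, symmetric] mult lc h')
    finally show "fst (fn ?h) y (h (l a (h' c))) = fst (fn ?h) (r y a) c"
      using that y by (simp add: hfn hc lc h')
  qed (use that in \<open>simp add: hc lc h'\<close>)
  have R: "base_change B l C (snd (fn ?h)) c a = h (r (h' c) a)"
    if "a \<in> carrier A" "c \<in> carrier C" for a c
  proof (rule base_change_eqI[OF nd_extD(1)[OF G]])
    fix y assume y: "y \<in> carrier B"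
    have "h (r (h' c) a) \<otimes>\<^bsub>C\<^esub> h y = h (r (h' c) a \<otimes>\<^bsub>B\<^esub> y)" using that y by (simp add: mult lc h')
    also have "\<dots> = c \<otimes>\<^bsub>C\<^esub> h (l a y)" using that y by (simp add: nd_extD(8)[OF F] mult lc h')
    finally show "snd (fn ?h) (h (r (h' c) a)) y = snd (fn ?h) c (l a y)"
      using that y by (simp add: hfn hc lc h')
  qed (use that in \<open>simp add: hc lc h'\<close>)
  have cmp: "cmp (ndi_cat k) ?h f = \<lparr>src = A, tgt = C, fn =
      (\<lambda>a \<in> carrier A. \<lambda>c \<in> carrier C. h (l a (h' c)), \<lambda>c \<in> carrier C. \<lambda>a \<in> carrier A. h
          (r (h' c) a))\<rparr>"
    using ndi_cmp[of f ?h] F G B f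
    by (auto simp: hfn l_def[symmetric] r_def[symmetric] fun_eq_iff restrict_def L R)
  have gP: "fst (fn g) \<in> carrier A \<rightarrow>\<^sub>E carrier C \<rightarrow>\<^sub>E carrier C"
      "snd (fn g) \<in> carrier C \<rightarrow>\<^sub>E carrier A \<rightarrow>\<^sub>E carrier C"
    using g by (simp_all add: ext_iff)
  show ?thesis
  proof
    assume "cmp (ndi_cat k) ?h f = g"
    then have "fst (fn g) = (\<lambda>a \<in> carrier A. \<lambda>c \<in> carrier C. h (l a (h' c)))"
      "snd (fn g) = (\<lambda>c \<in> carrier C. \<lambda>a \<in> carrier A. h (r (h' c) a))" using cmp by auto
    then show "amap (extension_of f) (extension_of g) h"
      by (simp add: amap_def f hc h' l_def r_def)
  next
    assume am: "amap (extension_of f) (extension_of g) h"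
    have "fst (fn g) = (\<lambda>a \<in> carrier A. \<lambda>c \<in> carrier C. h (l a (h' c)))"
      by (rule PiE2_eqI[OF gP(1), where Z' = "carrier C"])
        (use am in \<open>auto simp: amap_def f h' l_def[symmetric] hc lc\<close>)
    moreover have "snd (fn g) = (\<lambda>c \<in> carrier C. \<lambda>a \<in> carrier A. h (r (h' c) a))"
      by (rule PiE2_eqI[OF gP(2), where Z' = "carrier C"])
        (use am in \<open>auto simp: amap_def f h' r_def[symmetric] hc lc\<close>)
    ultimately show "cmp (ndi_cat k) ?h f = g"
      using cmp g by (cases g) (auto intro: prod_eqI)
  qed
qed

end

context comult
begin

text \<open>Links the comonoid axioms to tensor products of extensions: composing \<Delta> with f
  \<otimes> g is base change of the componentwise extension along D, which is how
  \<open>etens D\<close> is defined.\<close>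

lemma ndi_cmp_tensor:
  assumes \<Delta>: "src \<Delta> = A" "extension_of \<Delta> = D"
    and f: "src f = A" "extension_of f \<in> ext_objects k A"
    and g: "src g = A" "extension_of g \<in> ext_objects k A"
  shows "cmp (ndi_cat k) (ndi_tensor_arrow k f g) \<Delta> =
    \<lparr>src = A, tgt = algebra_tensor k (tgt f) (tgt g),
     fn = (lact (etens D (extension_of f) (extension_of g)), ract (etens D (extension_of f)
         (extension_of g)))\<rparr>"
proof -
  let ?t = "ndi_tensor_arrow k f g"
  let ?R = "tgt f" and ?S = "tgt g"
  let ?T = "tensor k ?R ?S"
  have fe: "nd_ext k A (mult A) ?R (mult ?R) (fst (fn f)) (snd (fn f))" "projective k ?R"
    and ge: "nd_ext k A (mult A) ?S (mult ?S) (fst (fn g)) (snd (fn g))" "projective k ?S"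
    using f g by (simp_all add: ext_iff)
  have \<Delta>D: "tgt \<Delta> = algebra_tensor k A A" "fst (fn \<Delta>) = lact D" "snd (fn \<Delta>) = ract D"
    using \<Delta>(2) algD by (auto simp: extension_of_def)
  note mb = nd_algebraD(1,2)[OF A]
  have st: "src ?t = algebra_tensor k A A" "tgt ?t = algebra_tensor k ?R ?S"
    and t_fn: "\<And>y z. y \<in> carrier AA \<Longrightarrow> z \<in> carrier ?T \<Longrightarrow> fst (fn ?t) y z =
        componentwise k ?R ?S (fst (fn f)) (fst (fn g)) y z"
    "\<And>y z. y \<in> carrier AA \<Longrightarrow> z \<in> carrier ?T \<Longrightarrow> snd (fn ?t) z y =
        componentwise k ?R ?S (snd (fn f)) (snd (fn g)) z y"
    by (simp_all add: ndi_tensor_arrow_def Let_def f g)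
  have mAAc: "mAA x y \<in> carrier AA" if "x \<in> carrier AA" "y \<in> carrier AA" for x y
    using that nd_algebraD(4)[OF nd_algebra_tensor(1)[OF A projA A projA]] by simp
  have T: "nd_ext k AA mAA ?T (componentwise k ?R ?S (mult ?R) (mult ?S)) (fst (fn ?t))
      (snd (fn ?t))"
    by (rule nd_ext_cong[OF nd_ext_tensor[OF mb mb fe ge]]) (simp_all add: t_fn mAAc)
  have "cmp (ndi_cat k) ?t \<Delta> = \<lparr>src = A, tgt = algebra_tensor k ?R ?S, fn =
    (\<lambda>b \<in> carrier A. \<lambda>c \<in> carrier ?T. base_change (algebra_tensor k A A) (\<lambda>b y. ract D y b)
       (algebra_tensor k ?R ?S) (\<lambda>c y. fst (fn ?t) y c) c b,
     \<lambda>c \<in> carrier ?T. \<lambda>b \<in> carrier A. base_change (algebra_tensor k A A) (lact D)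
       (algebra_tensor k ?R ?S) (snd (fn ?t)) c b)\<rparr>"
    using ndi_cmp[of \<Delta> ?t] nd_D T nd_algebra_tensor(1)[OF A projA A projA]
    by (simp add: st \<Delta>D \<Delta>(1))
  moreover have "base_change (algebra_tensor k A A) (\<lambda>b y. ract D y b) (algebra_tensor k ?R ?S)
      (\<lambda>c y. fst (fn ?t) y c) c b =
      base_change AA (\<lambda>b y. ract D y b) ?T (\<lambda>c y. componentwise k ?R ?S (fst (fn f)) (fst (fn g)) y
          c) c b"
    "base_change (algebra_tensor k A A) (lact D) (algebra_tensor k ?R ?S) (snd (fn ?t)) c b =
      base_change AA (lact D) ?T (componentwise k ?R ?S (snd (fn f)) (snd (fn g))) c b"
    if "b \<in> carrier A" "c \<in> carrier ?T" for b c
    by (rule base_change_cong; use that in \<open>simp add: t_fn D_closed\<close>)+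
  ultimately show ?thesis
    by (auto simp: etens_def ltens_def rtens_def fun_eq_iff restrict_def)
qed

end

context nd_alg
begin

lemma comult_nd:
  assumes "D \<in> ext_objects k A" "alg D = algebra_tensor k A A"
  shows "comult k A D"
  using assms by unfold_locales

lemma idn_src [simp]: "src (idn (ndi_cat k) A) = A" "tgt (idn (ndi_cat k) A) = A"
  by (simp_all add: ndi_cat_def Let_def arrow_of_tilde_def)

text \<open>By \<open>ndi_cmp_tensor\<close> the composites in the axioms are tensor products of the
  extensions given by \<Delta>, \<epsilon> and the identity. By \<open>ndi_cmp_iso\<close>
  composition with a constraint turns each axiom into the linearity of that constraint.\<close>

lemma comonoid_iff:
  "comonoid (ndi_cat k) (ndi_tensor k) A \<Delta> \<epsilon> \<longleftrightarrow>
     src \<Delta> = A \<and> tgt \<Delta> = algebra_tensor k A A \<and> src \<epsilon> = A \<and> tgt \<epsilon> = scalar_algebra k \<and>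
     extension_of \<Delta> \<in> ext_objects k A \<and> extension_of \<epsilon> \<in> ext_objects k A \<and>
     amap (etens (extension_of \<Delta>) (extension_of \<Delta>) reg) (etens (extension_of \<Delta>) reg
         (extension_of \<Delta>))
       (assoc_map k A A A) \<and>
     amap (etens (extension_of \<Delta>) (extension_of \<epsilon>) reg) reg (lunit_map k A) \<and>
     amap (etens (extension_of \<Delta>) reg (extension_of \<epsilon>)) reg (runit_map k A)"
proof -
  let ?D = "extension_of \<Delta>" and ?U = "extension_of \<epsilon>" and ?I = "idn (ndi_cat k) A"
  let ?K = "scalar_algebra k :: ('k, 'a) kmod"
  note AAn = nd_algebra_tensor[OF A projA A projA]
  have basic: "A \<in> obj (ndi_cat k) \<and> in_hom (ndi_cat k) \<Delta> A (algebra_tensor k A A) \<and>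
      in_hom (ndi_cat k) \<epsilon> A ?K \<longleftrightarrow>
      src \<Delta> = A \<and> tgt \<Delta> = algebra_tensor k A A \<and> src \<epsilon> = A \<and> tgt \<epsilon> = ?K \<and> ?D \<in> ext_objects k A \<and>
          ?U \<in> ext_objects k A"
  proof -
    have "A \<in> obj (ndi_cat k)" "algebra_tensor k A A \<in> obj (ndi_cat k)"
      using A projA AAn by (simp_all only: ndi_obj_iff simp_thms)
    moreover have "?K \<in> obj (ndi_cat k)" if "tgt \<epsilon> = ?K" "?U \<in> ext_objects k A"
    proof -
      \<comment> \<open>That k is an object of \<open>ndi_cat\<close> is read off from \<epsilon>,
        since projectivity is part of \<open>ext_objects\<close>.\<close>
      have "projective k (tgt \<epsilon>)" using that(2) unfolding ext_iff extension_of_simps by blast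
      then show ?thesis using that(1) by (simp add: nd_algebra_scalar ndi_obj_iff)
    qed
    ultimately show ?thesis unfolding in_hom_def ndi_arr_iff by metis
  qed
  have "cmp (ndi_cat k) (asc (ndi_tensor k) A A A) (cmp (ndi_cat k) (tar (ndi_tensor k) \<Delta> ?I) \<Delta>) =
        cmp (ndi_cat k) (tar (ndi_tensor k) ?I \<Delta>) \<Delta> \<longleftrightarrow> amap (etens ?D ?D reg) (etens ?D reg ?D)
            (assoc_map k A A A)"
    and "cmp (ndi_cat k) (lun (ndi_tensor k) A) (cmp (ndi_cat k) (tar (ndi_tensor k) \<epsilon> ?I) \<Delta>) = ?I \<longleftrightarrow>
      amap (etens ?D ?U reg) reg (lunit_map k A)"
    and "cmp (ndi_cat k) (run (ndi_tensor k) A) (cmp (ndi_cat k) (tar (ndi_tensor k) ?I \<epsilon>) \<Delta>) = ?I \<longleftrightarrow>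
      amap (etens ?D reg ?U) reg (runit_map k A)"
    if s: "src \<Delta> = A" "src \<epsilon> = A" and t: "tgt \<Delta> = algebra_tensor k A A" "tgt \<epsilon> = ?K"
      and D: "?D \<in> ext_objects k A" and U: "?U \<in> ext_objects k A"
  proof -
    interpret comult k A ?D by (rule comult_nd) (simp_all add: D t)
    have projK: "projective k ?K" using U by (simp add: ext_iff t)
    have I: "src ?I = A" "extension_of ?I \<in> ext_objects k A" "extension_of ?I = reg"
      using reg_ext by (simp_all add: reg_def[symmetric])
    have arrow: "extension_of \<lparr>src = A, tgt = B, fn = (lact E, ract E)\<rparr> = E" if "alg E = B" for E B
      using that by (simp add: extension_of_def)
    note c = ndi_cmp_tensor[OF s(1) HOL.refl]
    have e: "cmp (ndi_cat k) (ndi_tensor_arrow k f g) \<Delta> = \<lparr>src = A, tgt =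
        alg (etens ?D (extension_of f) (extension_of g)),
        fn = (lact (etens ?D (extension_of f) (extension_of g)), ract (etens ?D (extension_of f)
            (extension_of g)))\<rparr>"
      if "src f = A" "extension_of f \<in> ext_objects k A" "src g = A"
          "extension_of g \<in> ext_objects k A" for f g
      using c[OF that] by simp
    note mb = nd_algebraD(1,2)[OF A]
    note nt = nd_algebra_tensor[OF AAn A projA] nd_algebra_tensor[OF A projA AAn]
      nd_algebra_tensor[OF nd_algebra_scalar projK A projA] nd_algebra_tensor[OF A projA
          nd_algebra_scalar projK]
    show "cmp (ndi_cat k) (asc (ndi_tensor k) A A A) (cmp (ndi_cat k) (tar (ndi_tensor k) \<Delta> ?I) \<Delta>) =
        cmp (ndi_cat k) (tar (ndi_tensor k) ?I \<Delta>) \<Delta> \<longleftrightarrow> amap (etens ?D ?D reg) (etens ?D reg ?D)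
            (assoc_map k A A A)"
      unfolding ndi_tensor_def monoidal_data.simps e[OF s(1) D I(1,2)] e[OF I(1,2) s(1) D] I(3)
    proof (subst ndi_cmp_iso[where h' = "assoc_inv A A A"])
      fix x y assume "x \<in> carrier (algebra_tensor k (algebra_tensor k A A) A)"
          "y \<in> carrier (algebra_tensor k (algebra_tensor k A A) A)"
      then show "assoc_map k A A A (x \<otimes>\<^bsub>algebra_tensor k (algebra_tensor k A A) A\<^esub> y) =
          assoc_map k A A A x \<otimes>\<^bsub>algebra_tensor k A (algebra_tensor k A A)\<^esub> assoc_map k A A A y"
        using assoc_map_mult[OF mb mb mb] by simp
    qed (simp_all add: t arrow etens_ext D reg_ext nt assoc_map_lin)
    show "cmp (ndi_cat k) (lun (ndi_tensor k) A) (cmp (ndi_cat k) (tar (ndi_tensor k) \<epsilon> ?I) \<Delta>) =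
        ?I \<longleftrightarrow>
        amap (etens ?D ?U reg) reg (lunit_map k A)"
      unfolding ndi_tensor_def monoidal_data.simps e[OF s(2) U I(1,2)] I(3)
    proof (subst ndi_cmp_iso[where h' = "lunit_inv A"])
      fix x y assume "x \<in> carrier (algebra_tensor k ?K A)" "y \<in> carrier (algebra_tensor k ?K A)"
      then show "lunit_map k A (x \<otimes>\<^bsub>algebra_tensor k ?K A\<^esub> y) =
          lunit_map k A x \<otimes>\<^bsub>A\<^esub> lunit_map k A y"
        using lunit_map_mult[OF mb] by simp
    qed (simp_all add: t arrow etens_ext U reg_ext I nt A lunit_map_lin lin_closed[OF
        lunit_map_lin(3)])
    show "cmp (ndi_cat k) (run (ndi_tensor k) A) (cmp (ndi_cat k) (tar (ndi_tensor k) ?I \<epsilon>) \<Delta>) =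
        ?I \<longleftrightarrow>
        amap (etens ?D reg ?U) reg (runit_map k A)"
      unfolding ndi_tensor_def monoidal_data.simps e[OF I(1,2) s(2) U] I(3)
    proof (subst ndi_cmp_iso[where h' = "runit_inv A"])
      fix x y assume "x \<in> carrier (algebra_tensor k A ?K)" "y \<in> carrier (algebra_tensor k A ?K)"
      then show "runit_map k A (x \<otimes>\<^bsub>algebra_tensor k A ?K\<^esub> y) =
          runit_map k A x \<otimes>\<^bsub>A\<^esub> runit_map k A y"
        using runit_map_mult[OF mb] by simp
    qed (simp_all add: t arrow etens_ext U reg_ext I nt A runit_map_lin lin_closed[OF
        runit_map_lin(3)])
  qed
  then show ?thesis
    using basic unfolding comonoid_def by (simp add: ndi_tensor_def) blast
qed

end

section \<open>Concrete monoidal categories over modules\<close>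

lemma forget_arrow_simps [simp]:
  "src (forget_arrow V f) = V (src f)" "tgt (forget_arrow V f) = V (tgt f)" "fn (forget_arrow V f) =
      fn f"
  by (simp_all add: forget_arrow_def)

lemma forget_arrow_comp: "forget_arrow U (forget_arrow V f) = forget_arrow (\<lambda>X. U (V X)) f"
  by (simp add: forget_arrow_def)

lemma forget_arrow_ident [simp]: "forget_arrow (\<lambda>X. X) f = f"
  by (simp add: forget_arrow_def)

lemma arrow_eqI: "src f = src g \<Longrightarrow> tgt f = tgt g \<Longrightarrow> fn f = fn g \<Longrightarrow> f = (g :: ('o, 'f) arrow)"
  by simp

text \<open>The content of strictness over \<open>mod_tensor\<close> in explicit formulas. Only the
  tensor product of objects and the unit object remain free, and their underlying modules are
  prescribed.\<close>

definition over_mod :: "'k ring \<Rightarrow> ('o, ('k, 'a) univ \<Rightarrow> ('k, 'a) univ) precategory \<Rightarrow> ('o \<Rightarrow> ('k,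
    'a) kmod) \<Rightarrow>
    ('o, ('k, 'a) univ \<Rightarrow> ('k, 'a) univ) monoidal_data \<Rightarrow> bool" where
  "over_mod k C U T \<longleftrightarrow>
     (\<forall>X \<in> obj C. \<forall>Y \<in> obj C. U (tob T X Y) = tensor k (U X) (U Y)) \<and>
     U (unit_ob T) = underlying (scalar_algebra k) \<and>
     (\<forall>f \<in> arr C. \<forall>g \<in> arr C. tar T f g =
        \<lparr>src = tob T (src f) (src g), tgt = tob T (tgt f) (tgt g),
         fn = tensor_map k (forget_arrow U f) (forget_arrow U g)\<rparr>) \<and>
     (\<forall>X \<in> obj C. \<forall>Y \<in> obj C. \<forall>Z \<in> obj C. asc T X Y Z =
        \<lparr>src = tob T (tob T X Y) Z, tgt = tob T X (tob T Y Z), fn =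
            assoc_map k (U X) (U Y) (U Z)\<rparr>) \<and>
     (\<forall>X \<in> obj C. lun T X = \<lparr>src = tob T (unit_ob T) X, tgt = X, fn = lunit_map k (U X)\<rparr>) \<and>
     (\<forall>X \<in> obj C. run T X = \<lparr>src = tob T X (unit_ob T), tgt = X, fn = runit_map k (U X)\<rparr>)"

lemma over_modD:
  assumes "over_mod k C U T"
  shows "X \<in> obj C \<Longrightarrow> Y \<in> obj C \<Longrightarrow> U (tob T X Y) = tensor k (U X) (U Y)"
    and "U (unit_ob T) = underlying (scalar_algebra k)"
    and "f \<in> arr C \<Longrightarrow> g \<in> arr C \<Longrightarrow> tar T f g =
        \<lparr>src = tob T (src f) (src g), tgt = tob T (tgt f) (tgt g),
         fn = tensor_map k (forget_arrow U f) (forget_arrow U g)\<rparr>"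
    and "X \<in> obj C \<Longrightarrow> Y \<in> obj C \<Longrightarrow> Z \<in> obj C \<Longrightarrow> asc T X Y Z =
        \<lparr>src = tob T (tob T X Y) Z, tgt = tob T X (tob T Y Z), fn = assoc_map k (U X) (U Y) (U Z)\<rparr>"
    and "X \<in> obj C \<Longrightarrow> lun T X = \<lparr>src = tob T (unit_ob T) X, tgt = X, fn = lunit_map k (U X)\<rparr>"
    and "X \<in> obj C \<Longrightarrow> run T X = \<lparr>src = tob T X (unit_ob T), tgt = X, fn = runit_map k (U X)\<rparr>"
  using assms unfolding over_mod_def by blast+

text \<open>Modules with additional structure, P being the condition that singles out the arrows
  among the linear maps; k-modules, A-modules and extensions are the instances. \<open>P_inv\<close>
  makes bijective arrows isomorphisms.\<close>

locale concrete = scalars k for k :: "'k ring" +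
  fixes C :: "('o, ('k, 'a) univ \<Rightarrow> ('k, 'a) univ) precategory" and U :: "'o \<Rightarrow> ('k, 'a) kmod"
    and P :: "'o \<Rightarrow> 'o \<Rightarrow> (('k, 'a) univ \<Rightarrow> ('k, 'a) univ) \<Rightarrow> bool"
  assumes arr_iff: "f \<in> arr C \<longleftrightarrow> src f \<in> obj C \<and> tgt f \<in> obj C \<and>
      fn f \<in> linear_maps k (U (src f)) (U (tgt f)) \<and> P (src f) (tgt f) (fn f)"
    and idn_eq: "idn C X = \<lparr>src = X, tgt = X, fn = (\<lambda>x \<in> carrier (U X). x)\<rparr>"
    and cmp_eq: "cmp C g f = \<lparr>src = src f, tgt = tgt g, fn =
        compose (carrier (U (src f))) (fn g) (fn f)\<rparr>"
    and U_module: "X \<in> obj C \<Longrightarrow> module k (U X)"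
    and P_idn: "X \<in> obj C \<Longrightarrow> P X X (\<lambda>x \<in> carrier (U X). x)"
    and P_cmp: "X \<in> obj C \<Longrightarrow> Y \<in> obj C \<Longrightarrow> Z \<in> obj C \<Longrightarrow> \<phi> \<in> linear_maps k (U X) (U Y) \<Longrightarrow>
      \<psi> \<in> linear_maps k (U Y) (U Z) \<Longrightarrow> P X Y \<phi> \<Longrightarrow> P Y Z \<psi> \<Longrightarrow> P X Z (compose (carrier (U X)) \<psi> \<phi>)"
    and P_inv: "X \<in> obj C \<Longrightarrow> Y \<in> obj C \<Longrightarrow> \<phi> \<in> linear_maps k (U X) (U Y) \<Longrightarrow>
      \<psi> \<in> linear_maps k (U Y) (U X) \<Longrightarrow> P X Y \<phi> \<Longrightarrow> (\<And>x. x \<in> carrier (U X) \<Longrightarrow> \<psi> (\<phi> x) = x) \<Longrightarrow>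
      (\<And>y. y \<in> carrier (U Y) \<Longrightarrow> \<phi> (\<psi> y) = y) \<Longrightarrow> P Y X \<psi>"
begin

lemma in_hom_iff: "in_hom C f X Y \<longleftrightarrow> src f = X \<and> tgt f = Y \<and> X \<in> obj C \<and> Y \<in> obj C \<and>
    fn f \<in> linear_maps k (U X) (U Y) \<and> P X Y (fn f)"
  unfolding in_hom_def arr_iff by auto

lemma in_hom_cmp: "in_hom C f X Y \<Longrightarrow> in_hom C g Y Z \<Longrightarrow> in_hom C (cmp C g f) X Z"
proof -
  assume f: "in_hom C f X Y" and g: "in_hom C g Y Z"
  have "lin k (U X) (U Z) (\<lambda>x. fn g (fn f x))"
    using f g by (auto simp: in_hom_iff linear_maps_iff intro: lin_comp)
  then have "compose (carrier (U X)) (fn g) (fn f) \<in> linear_maps k (U X) (U Z)"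
    using f U_module[of X] linear_maps_restrict by (auto simp: in_hom_iff compose_def)
  then show ?thesis using f g P_cmp by (auto simp: in_hom_iff cmp_eq)
qed

lemma in_hom_idn: "X \<in> obj C \<Longrightarrow> in_hom C (idn C X) X X"
  using P_idn U_module[of X] by (auto simp: in_hom_iff idn_eq intro!: linear_maps_restrict linI)

text \<open>Faithfulness of the forgetful functor: equations of arrows reduce to equations of
  functions on k-modules.\<close>

lemma arr_eqI:
  assumes "in_hom C f X Y" "in_hom C g X Y" "\<And>x. x \<in> carrier (U X) \<Longrightarrow> fn f x = fn g x"
  shows "f = g"
  using assms by (intro arrow_eqI extensionalityI[of "fn f" "carrier (U X)" "fn g"])
    (auto simp: in_hom_iff linear_maps_iff)

lemma fn_closed: "in_hom C f X Y \<Longrightarrow> x \<in> carrier (U X) \<Longrightarrow> fn f x \<in> carrier (U Y)"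
  by (auto simp: in_hom_iff linear_maps_iff lin_def)

lemma fn_idn: "x \<in> carrier (U X) \<Longrightarrow> fn (idn C X) x = x"
  by (simp add: idn_eq)

lemma fn_cmp: "in_hom C f X Y \<Longrightarrow> x \<in> carrier (U X) \<Longrightarrow> fn (cmp C g f) x = fn g (fn f x)"
  by (simp add: cmp_eq in_hom_iff compose_def)

lemma category: "category C"
proof
  fix f X Y assume f: "in_hom C f X Y"
  then have XY: "X \<in> obj C" "Y \<in> obj C" by (simp_all add: in_hom_iff)
  show "cmp C f (idn C X) = f"
    by (rule arr_eqI[OF in_hom_cmp[OF in_hom_idn f] f]) (simp_all add: XY fn_cmp[OF in_hom_idn]
        fn_idn)
  show "cmp C (idn C Y) f = f"
    by (rule arr_eqI[OF in_hom_cmp[OF f in_hom_idn] f]) (simp_all add: XY fn_cmp[OF f] fn_idn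
        fn_closed[OF f])
next
  fix f g h W X Y Z assume f: "in_hom C f W X" and g: "in_hom C g X Y" and h: "in_hom C h Y Z"
  show "cmp C h (cmp C g f) = cmp C (cmp C h g) f"
    by (rule arr_eqI[OF in_hom_cmp[OF in_hom_cmp[OF f g] h] in_hom_cmp[OF f in_hom_cmp[OF g h]]])
      (simp add: fn_cmp[OF f] fn_cmp[OF g] fn_cmp[OF in_hom_cmp[OF f g]] fn_closed[OF f])
qed (auto simp: arr_iff in_hom_idn intro: in_hom_cmp)

lemma kmap_forget: "in_hom C f X Y \<Longrightarrow> kmap (forget_arrow U f)"
  using U_module[of X] U_module[of Y] unfolding kmap_def by (simp add: in_hom_iff linear_maps_iff)

end

text \<open>The conditions on P say that tensor products of arrows and the constraint maps are
  arrows of C. They are what depends on the category; the equations of a monoidal category come from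
  k-modules.\<close>

locale concrete_tensor = concrete k C U P for k :: "'k ring"
  and C :: "('o, ('k, 'a) univ \<Rightarrow> ('k, 'a) univ) precategory" and U :: "'o \<Rightarrow> ('k, 'a) kmod"
  and P :: "'o \<Rightarrow> 'o \<Rightarrow> (('k, 'a) univ \<Rightarrow> ('k, 'a) univ) \<Rightarrow> bool" +
  fixes T :: "('o, ('k, 'a) univ \<Rightarrow> ('k, 'a) univ) monoidal_data"
  assumes over: "over_mod k C U T"
    and T_obj: "X \<in> obj C \<Longrightarrow> Y \<in> obj C \<Longrightarrow> tob T X Y \<in> obj C" and T_unit: "unit_ob T \<in> obj C"
    and P_tar: "in_hom C f X X' \<Longrightarrow> in_hom C g Y Y' \<Longrightarrow>
      P (tob T X Y) (tob T X' Y') (tensor_map k (forget_arrow U f) (forget_arrow U g))"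
    and P_asc: "X \<in> obj C \<Longrightarrow> Y \<in> obj C \<Longrightarrow> Z \<in> obj C \<Longrightarrow>
      P (tob T (tob T X Y) Z) (tob T X (tob T Y Z)) (assoc_map k (U X) (U Y) (U Z))"
    and P_lun: "X \<in> obj C \<Longrightarrow> P (tob T (unit_ob T) X) X (lunit_map k (U X))"
    and P_run: "X \<in> obj C \<Longrightarrow> P (tob T X (unit_ob T)) X (runit_map k (U X))"
begin

lemmas ov = over_modD[OF over]

lemma tar_in_hom:
  assumes f: "in_hom C f X X'" and g: "in_hom C g Y Y'"
  shows "in_hom C (tar T f g) (tob T X Y) (tob T X' Y')"
    and "fn (tar T f g) = tensor_map k (forget_arrow U f) (forget_arrow U g)"
proof -
  have fg: "f \<in> arr C" "g \<in> arr C" using f g by (simp_all add: in_hom_def)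
  show "fn (tar T f g) = tensor_map k (forget_arrow U f) (forget_arrow U g)" using ov(3)[OF fg]
    by simp
  note l = tensor_map_lin(1)[OF kmap_forget[OF f] kmap_forget[OF g]]
  have "tensor_map k (forget_arrow U f) (forget_arrow U g) \<in> extensional (carrier (tensor k
      (U (src f)) (U (src g))))"
    by (simp add: tensor_map_def)
  then show "in_hom C (tar T f g) (tob T X Y) (tob T X' Y')"
    using f g ov(3)[OF fg] T_obj P_tar[OF f g] l by (simp add: in_hom_iff linear_maps_iff ov(1))
qed

lemma asc_in_hom:
  assumes "X \<in> obj C" "Y \<in> obj C" "Z \<in> obj C"
  shows "in_hom C (asc T X Y Z) (tob T (tob T X Y) Z) (tob T X (tob T Y Z))"
    and "fn (asc T X Y Z) = assoc_map k (U X) (U Y) (U Z)"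
proof -
  have "assoc_map k (U X) (U Y) (U Z) \<in> extensional (carrier (tensor k (tensor k (U X) (U Y))
      (U Z)))"
    by (simp add: assoc_map_def)
  then show "in_hom C (asc T X Y Z) (tob T (tob T X Y) Z) (tob T X (tob T Y Z))"
    "fn (asc T X Y Z) = assoc_map k (U X) (U Y) (U Z)"
    using assms assoc_map_lin(1)[OF U_module U_module U_module, OF assms] P_asc
    by (simp_all add: ov(4) in_hom_iff T_obj linear_maps_iff ov(1))
qed

lemma unit_in_hom:
  assumes X: "X \<in> obj C"
  shows "in_hom C (lun T X) (tob T (unit_ob T) X) X" "fn (lun T X) = lunit_map k (U X)"
    and "in_hom C (run T X) (tob T X (unit_ob T)) X" "fn (run T X) = runit_map k (U X)"
proof -
  have "lunit_map k (U X) \<in> extensional (carrier (tensor k (scalar_algebra k) (U X)))"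
    "runit_map k (U X) \<in> extensional (carrier (tensor k (U X) (scalar_algebra k)))"
    by (simp_all add: lunit_map_def runit_map_def)
  then show "in_hom C (lun T X) (tob T (unit_ob T) X) X" "fn (lun T X) = lunit_map k (U X)"
    "in_hom C (run T X) (tob T X (unit_ob T)) X" "fn (run T X) = runit_map k (U X)"
    using X lunit_map_lin(1)[OF U_module[OF X]] runit_map_lin(1)[OF U_module[OF X]] P_lun P_run
    by (simp_all add: ov(5,6) in_hom_iff T_obj T_unit linear_maps_iff ov(1,2))
qed

lemma iso_inI:
  assumes f: "in_hom C f X Y" and g: "g \<in> linear_maps k (U Y) (U X)"
    and inv: "\<And>x. x \<in> carrier (U X) \<Longrightarrow> g (fn f x) = x" "\<And>y. y \<in> carrier (U Y) \<Longrightarrow> fn f (g y) = y"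
  shows "iso_in C f X Y"
proof -
  let ?g = "\<lparr>src = Y, tgt = X, fn = g\<rparr>"
  have fs: "X \<in> obj C" "Y \<in> obj C" "fn f \<in> linear_maps k (U X) (U Y)" "P X Y (fn f)"
    using f by (simp_all add: in_hom_iff)
  have g': "in_hom C ?g Y X"
    using P_inv[OF fs(1-3) g fs(4) inv] fs g by (simp add: in_hom_iff)
  have "cmp C ?g f = idn C X"
    by (rule arr_eqI[OF in_hom_cmp[OF f g'] in_hom_idn]) (simp_all add: fs fn_cmp[OF f] fn_idn inv)
  moreover have "cmp C f ?g = idn C Y"
    by (rule arr_eqI[OF in_hom_cmp[OF g' f] in_hom_idn]) (simp_all add: fs fn_cmp[OF g'] fn_idn inv)
  ultimately show ?thesis using f g' by (auto simp: iso_in_def)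
qed

text \<open>Every equation required is turned by \<open>arr_eqI\<close> into the corresponding
  equation for k-modules, which was proved on pure tensors. The inverses of the constraints are
  arrows by \<open>P_inv\<close>.\<close>

lemma monoidal_category: "monoidal_category C T"
proof (intro monoidal_category.intro category monoidal_category_axioms.intro)
  fix f X X' g Y Y' assume f: "in_hom C f X X'" and g: "in_hom C g Y Y'"
  show "in_hom C (tar T f g) (tob T X Y) (tob T X' Y')" by (rule tar_in_hom[OF f g])
next
  fix X Y assume X: "X \<in> obj C" and Y: "Y \<in> obj C"
  note t = tar_in_hom[OF in_hom_idn[OF X] in_hom_idn[OF Y]]
  have s: "src (idn C X) = X" "tgt (idn C X) = X" for X by (simp_all add: idn_eq)
  show "tar T (idn C X) (idn C Y) = idn C (tob T X Y)"
  proof (rule arr_eqI[OF t(1) in_hom_idn[OF T_obj[OF X Y]]])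
    fix x assume x: "x \<in> carrier (U (tob T X Y))"
    have "tensor_map k (forget_arrow U (idn C X)) (forget_arrow U (idn C Y)) x = x"
      by (rule tensor_map_ident[OF kmap_forget[OF in_hom_idn[OF X]] kmap_forget[OF in_hom_idn[OF
          Y]]])
        (use x in \<open>simp_all add: s fn_idn ov(1) X Y\<close>)
    then show "fn (tar T (idn C X) (idn C Y)) x = fn (idn C (tob T X Y)) x"
      using x by (simp add: t fn_idn)
  qed
next
  fix f X X' f' X'' g Y Y' g' Y''
  assume f: "in_hom C f X X'" "in_hom C f' X' X''" and g: "in_hom C g Y Y'" "in_hom C g' Y' Y''"
  note ff = in_hom_cmp[OF f] and gg = in_hom_cmp[OF g]
  show "tar T (cmp C f' f) (cmp C g' g) = cmp C (tar T f' g') (tar T f g)"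
  proof (rule arr_eqI[OF tar_in_hom(1)[OF ff gg] in_hom_cmp[OF tar_in_hom(1)[OF f(1) g(1)]
      tar_in_hom(1)[OF f(2) g(2)]]])
    fix x assume x: "x \<in> carrier (U (tob T X Y))"
    note s = f[unfolded in_hom_iff] g[unfolded in_hom_iff] ff[unfolded in_hom_iff] gg[unfolded
        in_hom_iff]
    have "tensor_map k (forget_arrow U (cmp C f' f)) (forget_arrow U (cmp C g' g)) x =
        tensor_map k (forget_arrow U f') (forget_arrow U g') (tensor_map k (forget_arrow U f)
            (forget_arrow U g) x)"
      by (rule tensor_map_comp[OF kmap_forget[OF f(1)] kmap_forget[OF f(2)] kmap_forget[OF ff]
            kmap_forget[OF g(1)] kmap_forget[OF g(2)] kmap_forget[OF gg]])
        (use x s in \<open>simp_all add: fn_cmp[OF f(1)] fn_cmp[OF g(1)] ov(1)\<close>)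
    then show "fn (tar T (cmp C f' f) (cmp C g' g)) x = fn (cmp C (tar T f' g') (tar T f g)) x"
      using x by (simp add: tar_in_hom(2)[OF ff gg] fn_cmp[OF tar_in_hom(1)[OF f(1) g(1)]]
          tar_in_hom(2)[OF f(1) g(1)] tar_in_hom(2)[OF f(2) g(2)])
  qed
next
  fix X Y Z assume o: "X \<in> obj C" "Y \<in> obj C" "Z \<in> obj C"
  note m = o[THEN U_module]
  have "assoc_inv (U X) (U Y) (U Z) \<in> linear_maps k (tensor k (U X) (tensor k (U Y) (U Z)))
      (tensor k (tensor k (U X) (U Y)) (U Z))"
    using assoc_inv_lin(1)[OF m] by (simp add: linear_maps_iff assoc_inv_def)
  then show "iso_in C (asc T X Y Z) (tob T (tob T X Y) Z) (tob T X (tob T Y Z))"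
  proof (intro iso_inI[OF asc_in_hom(1)[OF o]])
    fix x assume "x \<in> carrier (U (tob T (tob T X Y) Z))"
    then have x: "x \<in> carrier (tensor k (tensor k (U X) (U Y)) (U Z))" by (simp add: ov(1) o T_obj)
    show "assoc_inv (U X) (U Y) (U Z) (fn (asc T X Y Z) x) = x"
      unfolding asc_in_hom(2)[OF o] by (rule assoc_inv_left[OF m x])
  next
    fix x assume "x \<in> carrier (U (tob T X (tob T Y Z)))"
    then have x: "x \<in> carrier (tensor k (U X) (tensor k (U Y) (U Z)))" by (simp add: ov(1) o T_obj)
    show "fn (asc T X Y Z) (assoc_inv (U X) (U Y) (U Z) x) = x"
      unfolding asc_in_hom(2)[OF o] by (rule assoc_inv_right[OF m x])
  qed (use o in \<open>simp add: ov(1) T_obj\<close>)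
next
  fix f X X' g Y Y' h Z Z' assume f: "in_hom C f X X'" and g: "in_hom C g Y Y'"
      and h: "in_hom C h Z Z'"
  then have o: "X \<in> obj C" "Y \<in> obj C" "Z \<in> obj C" and o': "X' \<in> obj C" "Y' \<in> obj C" "Z' \<in> obj C"
    by (simp_all add: in_hom_iff)
  note fg = tar_in_hom[OF f g] and gh = tar_in_hom[OF g h]
  note l = tar_in_hom[OF fg(1) h] and r = tar_in_hom[OF f gh(1)]
  show "cmp C (asc T X' Y' Z') (tar T (tar T f g) h) = cmp C (tar T f (tar T g h)) (asc T X Y Z)"
  proof (rule arr_eqI[OF in_hom_cmp[OF l(1) asc_in_hom(1)[OF o']] in_hom_cmp[OF asc_in_hom(1)[OF o]
      r(1)]])
    fix x assume x: "x \<in> carrier (U (tob T (tob T X Y) Z))"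
    note s = f[unfolded in_hom_iff] g[unfolded in_hom_iff] h[unfolded in_hom_iff] fg(1)[unfolded
        in_hom_iff] gh(1)[unfolded in_hom_iff]
    have "assoc_map k (U X') (U Y') (U Z') (tensor_map k (forget_arrow U (tar T f g))
        (forget_arrow U h) x) =
        tensor_map k (forget_arrow U f) (forget_arrow U (tar T g h)) (assoc_map k (U X) (U Y)
            (U Z) x)"
      using assoc_natural[OF kmap_forget[OF f] kmap_forget[OF g] kmap_forget[OF h] kmap_forget[OF
          fg(1)] kmap_forget[OF gh(1)]]
        x s by (simp add: ov(1) fg(2) gh(2))
    then show "fn (cmp C (asc T X' Y' Z') (tar T (tar T f g) h)) x =
        fn (cmp C (tar T f (tar T g h)) (asc T X Y Z)) x"
      using x by (simp add: fn_cmp[OF l(1)] fn_cmp[OF asc_in_hom(1)[OF o]] l(2) r(2)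
          asc_in_hom(2)[OF o] asc_in_hom(2)[OF o'])
  qed
next
  fix X assume X: "X \<in> obj C"
  note m = U_module[OF X]
  have "lunit_inv (U X) \<in> linear_maps k (U X) (tensor k (scalar_algebra k) (U X))"
    "runit_inv (U X) \<in> linear_maps k (U X) (tensor k (U X) (scalar_algebra k))"
    using lunit_map_lin(3)[OF m] runit_map_lin(3)[OF m]
    by (simp_all add: linear_maps_iff lunit_inv_def runit_inv_def)
  then show "iso_in C (lun T X) (tob T (unit_ob T) X) X"
      "iso_in C (run T X) (tob T X (unit_ob T)) X"
    by (intro iso_inI[OF unit_in_hom(1)[OF X], where g = "lunit_inv (U X)"]
          iso_inI[OF unit_in_hom(3)[OF X], where g = "runit_inv (U X)"];
        simp add: X unit_in_hom(2,4)[OF X] ov(1,2) T_unit m)+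
next
  fix f X Y assume f: "in_hom C f X Y"
  then have o: "X \<in> obj C" "Y \<in> obj C" by (simp_all add: in_hom_iff)
  note e = in_hom_idn[OF T_unit]
  have s: "src f = X" "tgt f = Y" using f by (simp_all add: in_hom_iff)
  have es: "U (src (idn C (unit_ob T))) = underlying (scalar_algebra k)"
      "U (tgt (idn C (unit_ob T))) = underlying (scalar_algebra k)"
    "x \<in> Scalar ` carrier k \<Longrightarrow> fn (idn C (unit_ob T)) x = x" for x
    by (simp_all add: idn_eq ov(2))
  note l = tar_in_hom[OF e f] and r = tar_in_hom[OF f e]
  show "cmp C (lun T Y) (tar T (idn C (unit_ob T)) f) = cmp C f (lun T X)"
  proof (rule arr_eqI[OF in_hom_cmp[OF l(1) unit_in_hom(1)[OF o(2)]] in_hom_cmp[OF unit_in_hom(1)[OF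
      o(1)] f]])
    fix x assume x: "x \<in> carrier (U (tob T (unit_ob T) X))"
    have "lunit_map k (U Y) (tensor_map k (forget_arrow U (idn C (unit_ob T))) (forget_arrow U f) x)
        = fn f (lunit_map k (U X) x)"
      using lunit_natural[OF kmap_forget[OF f] kmap_forget[OF e]] x s es
      by (simp add: ov(1,2) o T_unit)
    then show "fn (cmp C (lun T Y) (tar T (idn C (unit_ob T)) f)) x = fn (cmp C f (lun T X)) x"
      using x by (simp add: fn_cmp[OF l(1)] fn_cmp[OF unit_in_hom(1)[OF o(1)]] l(2)
          unit_in_hom(2)[OF o(1)] unit_in_hom(2)[OF o(2)])
  qed
  show "cmp C (run T Y) (tar T f (idn C (unit_ob T))) = cmp C f (run T X)"
  proof (rule arr_eqI[OF in_hom_cmp[OF r(1) unit_in_hom(3)[OF o(2)]] in_hom_cmp[OF unit_in_hom(3)[OF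
      o(1)] f]])
    fix x assume x: "x \<in> carrier (U (tob T X (unit_ob T)))"
    have "runit_map k (U Y) (tensor_map k (forget_arrow U f) (forget_arrow U (idn C (unit_ob T))) x)
        = fn f (runit_map k (U X) x)"
      using runit_natural[OF kmap_forget[OF f] kmap_forget[OF e]] x s es
      by (simp add: ov(1,2) o T_unit)
    then show "fn (cmp C (run T Y) (tar T f (idn C (unit_ob T)))) x = fn (cmp C f (run T X)) x"
      using x by (simp add: fn_cmp[OF r(1)] fn_cmp[OF unit_in_hom(3)[OF o(1)]] r(2)
          unit_in_hom(4)[OF o(1)] unit_in_hom(4)[OF o(2)])
  qed
next
  fix W X Y Z assume o: "W \<in> obj C" "X \<in> obj C" "Y \<in> obj C" "Z \<in> obj C"
  note m = o[THEN U_module]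
  note i = in_hom_idn[OF o(1)] in_hom_idn[OF o(4)]
  note a1 = asc_in_hom[OF T_obj[OF o(1,2)] o(3,4)] and a2 = asc_in_hom[OF o(1,2) T_obj[OF o(3,4)]]
  note b1 = asc_in_hom[OF o(1-3)] and b2 = asc_in_hom[OF o(1) T_obj[OF o(2,3)] o(4)] and b3 =
      asc_in_hom[OF o(2-4)]
  note t1 = tar_in_hom[OF b1(1) i(2)] and t2 = tar_in_hom[OF i(1) b3(1)]
  have ids: "src (idn C X) = X" "tgt (idn C X) = X" for X by (simp_all add: idn_eq)
  show "cmp C (asc T W X (tob T Y Z)) (asc T (tob T W X) Y Z) =
      cmp C (tar T (idn C W) (asc T X Y Z)) (cmp C (asc T W (tob T X Y) Z) (tar T (asc T W X Y)
          (idn C Z)))"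
  proof (rule arr_eqI[OF in_hom_cmp[OF a1(1) a2(1)] in_hom_cmp[OF in_hom_cmp[OF t1(1) b2(1)]
      t2(1)]])
    fix x assume x: "x \<in> carrier (U (tob T (tob T (tob T W X) Y) Z))"
    note s = b1(1)[unfolded in_hom_iff] b3(1)[unfolded in_hom_iff]
    have "assoc_map k (U W) (U X) (tensor k (U Y) (U Z)) (assoc_map k (tensor k (U W) (U X)) (U Y)
        (U Z) x) =
        tensor_map k (forget_arrow U (idn C W)) (forget_arrow U (asc T X Y Z))
          (assoc_map k (U W) (tensor k (U X) (U Y)) (U Z) (tensor_map k (forget_arrow U
              (asc T W X Y)) (forget_arrow U (idn C Z)) x))"
      by (rule tensor_pentagon[OF m kmap_forget[OF i(1)] _ _ _ kmap_forget[OF i(2)] _ _ _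
          kmap_forget[OF b3(1)] _ _ _ kmap_forget[OF b1(1)]])
        (use x s in \<open>simp_all add: ids fn_idn ov(1) T_obj o b1(2) b3(2)\<close>)
    then show "fn (cmp C (asc T W X (tob T Y Z)) (asc T (tob T W X) Y Z)) x =
        fn (cmp C (tar T (idn C W) (asc T X Y Z)) (cmp C (asc T W (tob T X Y) Z)
            (tar T (asc T W X Y) (idn C Z)))) x"
      using x by (simp add: fn_cmp[OF a1(1)] fn_cmp[OF in_hom_cmp[OF t1(1) b2(1)]] fn_cmp[OF t1(1)]
          a1(2) a2(2) b2(2) t1(2) t2(2) ov(1) o)
  qed
next
  fix X Y assume o: "X \<in> obj C" "Y \<in> obj C"
  note m = o[THEN U_module]
  note i = in_hom_idn[OF o(1)] in_hom_idn[OF o(2)]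
  note a = asc_in_hom[OF o(1) T_unit o(2)] and u1 = unit_in_hom[OF o(1)] and u2 =
      unit_in_hom[OF o(2)]
  note t1 = tar_in_hom[OF i(1) u2(1)] and t2 = tar_in_hom[OF u1(3) i(2)]
  have ids: "src (idn C X) = X" "tgt (idn C X) = X" for X by (simp_all add: idn_eq)
  show "cmp C (tar T (idn C X) (lun T Y)) (asc T X (unit_ob T) Y) = tar T (run T X) (idn C Y)"
  proof (rule arr_eqI[OF in_hom_cmp[OF a(1) t1(1)] t2(1)])
    fix x assume x: "x \<in> carrier (U (tob T (tob T X (unit_ob T)) Y))"
    note s = u1(3)[unfolded in_hom_iff] u2(1)[unfolded in_hom_iff]
    have "tensor_map k (forget_arrow U (idn C X)) (forget_arrow U (lun T Y)) (assoc_map k (U X)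
        (scalar_algebra k) (U Y) x) =
        tensor_map k (forget_arrow U (run T X)) (forget_arrow U (idn C Y)) x"
      by (rule tensor_triangle[OF m kmap_forget[OF i(1)] _ _ _ kmap_forget[OF i(2)] _ _ _
          kmap_forget[OF u2(1)] _ _ _ kmap_forget[OF u1(3)]])
        (use x s in \<open>simp_all add: ids fn_idn ov(1,2) T_obj T_unit o u1(4) u2(2)\<close>)
    then show "fn (cmp C (tar T (idn C X) (lun T Y)) (asc T X (unit_ob T) Y)) x =
        fn (tar T (run T X) (idn C Y)) x"
      using x by (simp add: fn_cmp[OF a(1)] a(2) t1(2) t2(2) ov(2))
  qed
qed (simp_all add: T_obj T_unit)

end

text \<open>Both structures obey the formulas of \<open>over_mod\<close>, so strictness on arrows
  and constraints follows from strictness on objects, given by \<open>tob\<close> and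
  \<open>unit\<close>.\<close>

lemma concrete_strict:
  assumes C: "concrete_tensor k C U P T" and C': "concrete_tensor k C' U' P' T'"
    and V: "\<And>X. X \<in> obj C \<Longrightarrow> V X \<in> obj C'" "\<And>X. X \<in> obj C \<Longrightarrow> U' (V X) = U X"
    and P: "\<And>X Y f. X \<in> obj C \<Longrightarrow> Y \<in> obj C \<Longrightarrow> f \<in> linear_maps k (U X) (U Y) \<Longrightarrow> P X Y f \<Longrightarrow>
        P' (V X) (V Y) f"
    and tob: "\<And>X Y. X \<in> obj C \<Longrightarrow> Y \<in> obj C \<Longrightarrow> V (tob T X Y) = tob T' (V X) (V Y)"
    and unit: "V (unit_ob T) = unit_ob T'"
  shows "strict_monoidal_functor C T C' T' V (forget_arrow V)"
proof -
  interpret C: concrete_tensor k C U P T by (rule C)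
  interpret C': concrete_tensor k C' U' P' T' by (rule C')
  have hom: "in_hom C' (forget_arrow V f) (V X) (V Y)" if "in_hom C f X Y" for f X Y
    using that P V by (auto simp: C.in_hom_iff C'.in_hom_iff)
  have arr: "forget_arrow V f \<in> arr C'" if "f \<in> arr C" for f
    using hom[of f "src f" "tgt f"] that by (simp add: in_hom_def)
  have tar: "forget_arrow U' (forget_arrow V f) = forget_arrow U f" if "f \<in> arr C" for f
    using that V by (simp add: forget_arrow_def C.arr_iff)
  show ?thesis
  proof (intro strict_monoidal_functor.intro cat_functor.intro cat_functor_axioms.intro
      strict_monoidal_functor_axioms.intro
      C.category C'.category C.monoidal_category C'.monoidal_category)
    fix f X Y g Z assume "in_hom C f X Y" "in_hom C g Y Z"
    then show "forget_arrow V (cmp C g f) = cmp C' (forget_arrow V g) (forget_arrow V f)"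
      using V by (simp add: C.cmp_eq C'.cmp_eq C.in_hom_iff forget_arrow_def)
  next
    fix f g assume fg: "f \<in> arr C" "g \<in> arr C"
    then show "forget_arrow V (tar T f g) = tar T' (forget_arrow V f) (forget_arrow V g)"
      using arr tob by (simp add: C.ov(3) C'.ov(3) tar) (simp add: forget_arrow_def C.arr_iff)
  qed (use hom V tob unit C.T_obj C.T_unit in
      \<open>simp_all add: C.idn_eq C'.idn_eq forget_arrow_def C.ov C'.ov\<close>)
qed

text \<open>Strictness fixes the functions of the structure maps. Their sources and targets cannot
  be recovered through V and come from the axioms of the monoidal category T.\<close>

lemma over_mod_strict:
  assumes F: "strict_monoidal_functor C T C' T' V (forget_arrow V)" and over: "over_mod k C' U' T'"
  shows "over_mod k C (\<lambda>X. U' (V X)) T"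
proof -
  interpret strict_monoidal_functor C T C' T' V "forget_arrow V" by (rule F)
  note ov = over_modD[OF over]
  have arr: "forget_arrow V f \<in> arr C'" if "f \<in> arr C" for f
    using Fa_hom[of f "src f" "tgt f"] that by (simp add: in_hom_def)
  have fnF: "fn f = fn f'" if "forget_arrow V f = f'" for f f'
    using that by auto
  show ?thesis
    unfolding over_mod_def
  proof (intro conjI ballI)
    fix f g assume fg: "f \<in> arr C" "g \<in> arr C"
    show "tar T f g = \<lparr>src = tob T (src f) (src g), tgt = tob T (tgt f) (tgt g),
        fn = tensor_map k (forget_arrow (\<lambda>X. U' (V X)) f) (forget_arrow (\<lambda>X. U' (V X)) g)\<rparr>"
      using source.tar_hom[of f "src f" "tgt f" g "src g" "tgt g"] fnF[OF strict_tar[OF fg]] fg arr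
      by (intro arrow_eqI) (auto simp: in_hom_def ov(3) forget_arrow_comp)
  next
    fix X Y Z assume o: "X \<in> obj C" "Y \<in> obj C" "Z \<in> obj C"
    show "asc T X Y Z = \<lparr>src = tob T (tob T X Y) Z, tgt = tob T X (tob T Y Z),
        fn = assoc_map k (U' (V X)) (U' (V Y)) (U' (V Z))\<rparr>"
      using source.asc_iso[OF o] fnF[OF strict_asc[OF o]] o Fo_obj
      by (intro arrow_eqI) (auto simp: in_hom_def iso_in_def ov(4))
  next
    fix X assume o: "X \<in> obj C"
    show "lun T X = \<lparr>src = tob T (unit_ob T) X, tgt = X, fn = lunit_map k (U' (V X))\<rparr>"
      using source.lun_iso[OF o] fnF[OF strict_lun[OF o]] o Fo_obj
      by (intro arrow_eqI) (auto simp: in_hom_def iso_in_def ov(5))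
    show "run T X = \<lparr>src = tob T X (unit_ob T), tgt = X, fn = runit_map k (U' (V X))\<rparr>"
      using source.run_iso[OF o] fnF[OF strict_run[OF o]] o Fo_obj
      by (intro arrow_eqI) (auto simp: in_hom_def iso_in_def ov(6))
  qed (simp_all add: strict_tob strict_unit ov(1,2) Fo_obj)
qed

text \<open>Inside of C the formulas of \<open>over_mod\<close> decide; outside of it both
  structures have the value \<open>undefined\<close> by the convention of
  \<open>monoidal_structures\<close>.\<close>

lemma over_mod_unique:
  assumes T: "T \<in> monoidal_structures C" and T': "T' \<in> monoidal_structures C"
    and over: "over_mod k C U T" "over_mod k C U T'"
    and tob: "\<And>X Y. X \<in> obj C \<Longrightarrow> Y \<in> obj C \<Longrightarrow> tob T X Y = tob T' X Y" and unit: "unit_ob T =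
        unit_ob T'"
  shows "T = (T' :: ('o, ('k, 'a) univ \<Rightarrow> ('k, 'a) univ) monoidal_data)"
proof -
  interpret T: monoidal_category C T using T by (simp add: monoidal_structures_def)
  note ov = over_modD[OF over(1)] and ov' = over_modD[OF over(2)]
  note U = T[unfolded monoidal_structures_def mem_Collect_eq] and U' =
      T'[unfolded monoidal_structures_def mem_Collect_eq]
  have t: "tob T X Y = tob T' X Y" for X Y using tob U U' by metis
  show ?thesis
  proof (rule monoidal_data.equality)
    show "tar T = tar T'"
    proof (intro ext)
      fix f g show "tar T f g = tar T' f g"
        using ov(3)[of f g] ov'(3)[of f g] t U U' by (cases "f \<in> arr C \<and> g \<in> arr C") simp_all
    qed
    show "asc T = asc T'"
    proof (intro ext)
      fix X Y Z show "asc T X Y Z = asc T' X Y Z"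
        using ov(4)[of X Y Z] ov'(4)[of X Y Z] t U U' by (cases "X \<in> obj C \<and> Y \<in> obj C \<and>
            Z \<in> obj C") simp_all
    qed
    show "lun T = lun T'"
    proof (intro ext)
      fix X show "lun T X = lun T' X"
        using ov(5)[of X] ov'(5)[of X] t unit U U' by (cases "X \<in> obj C") simp_all
    qed
    show "run T = run T'"
    proof (intro ext)
      fix X show "run T X = run T' X"
        using ov(6)[of X] ov'(6)[of X] t unit U U' by (cases "X \<in> obj C") simp_all
    qed
  qed (use t unit in \<open>auto simp: fun_eq_iff\<close>)
qed

text \<open>The case distinctions produce the values \<open>undefined\<close> that
  \<open>monoidal_structures\<close> prescribes outside of C.\<close>

definition lift_tensor :: "'k ring \<Rightarrow> ('o, ('k, 'a) univ \<Rightarrow> ('k, 'a) univ) precategory \<Rightarrow> ('o \<Rightarrow> ('k,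
    'a) kmod) \<Rightarrow>
    ('o \<Rightarrow> 'o \<Rightarrow> 'o) \<Rightarrow> 'o \<Rightarrow> ('o, ('k, 'a) univ \<Rightarrow> ('k, 'a) univ) monoidal_data" where
  "lift_tensor k C U t u =
     \<lparr>tob = (\<lambda>X Y. if X \<in> obj C \<and> Y \<in> obj C then t X Y else undefined),
      tar = (\<lambda>f g. if f \<in> arr C \<and> g \<in> arr C
        then \<lparr>src = t (src f) (src g), tgt = t (tgt f) (tgt g),
              fn = tensor_map k (forget_arrow U f) (forget_arrow U g)\<rparr> else undefined),
      unit_ob = u,
      asc = (\<lambda>X Y Z. if X \<in> obj C \<and> Y \<in> obj C \<and> Z \<in> obj C
        then \<lparr>src = t (t X Y) Z, tgt = t X (t Y Z), fn =
            assoc_map k (U X) (U Y) (U Z)\<rparr> else undefined),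
      lun = (\<lambda>X. if X \<in> obj C then \<lparr>src = t u X, tgt = X, fn = lunit_map k (U X)\<rparr> else undefined),
      run = (\<lambda>X. if X \<in> obj C then \<lparr>src = t X u, tgt = X, fn = runit_map k (U X)\<rparr> else undefined)\<rparr>"

lemma (in concrete) concrete_tensor_lift:
  assumes t: "\<And>X Y. X \<in> obj C \<Longrightarrow> Y \<in> obj C \<Longrightarrow> t X Y \<in> obj C \<and> U (t X Y) = tensor k (U X) (U Y)"
    and u: "u \<in> obj C" "U u = underlying (scalar_algebra k)"
    and tar: "\<And>f g X X' Y Y'. in_hom C f X X' \<Longrightarrow> in_hom C g Y Y' \<Longrightarrow>
      P (t X Y) (t X' Y') (tensor_map k (forget_arrow U f) (forget_arrow U g))"
    and asc: "\<And>X Y Z. X \<in> obj C \<Longrightarrow> Y \<in> obj C \<Longrightarrow> Z \<in> obj C \<Longrightarrow>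
      P (t (t X Y) Z) (t X (t Y Z)) (assoc_map k (U X) (U Y) (U Z))"
    and un: "\<And>X. X \<in> obj C \<Longrightarrow> P (t u X) X (lunit_map k (U X))"
      "\<And>X. X \<in> obj C \<Longrightarrow> P (t X u) X (runit_map k (U X))"
  shows "concrete_tensor k C U P (lift_tensor k C U t u)"
proof unfold_locales
  show "over_mod k C U (lift_tensor k C U t u)"
    using t u by (simp add: over_mod_def lift_tensor_def arr_iff)
  fix f X X' g Y Y' assume fg: "in_hom C f X X'" "in_hom C g Y Y'"
  then have "X \<in> obj C" "X' \<in> obj C" "Y \<in> obj C" "Y' \<in> obj C" by (simp_all add: in_hom_iff)
  then show "P (tob (lift_tensor k C U t u) X Y) (tob (lift_tensor k C U t u) X' Y')
      (tensor_map k (forget_arrow U f) (forget_arrow U g))"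
    using tar[OF fg] by (simp add: lift_tensor_def)
qed (use t u in \<open>simp_all add: lift_tensor_def asc un\<close>)

lemma lift_tensor_structure:
  assumes "concrete_tensor k C U P (lift_tensor k C U t u)"
  shows "lift_tensor k C U t u \<in> monoidal_structures C"
  using concrete_tensor.monoidal_category[OF assms]
  by (auto simp: monoidal_structures_def lift_tensor_def)

lemma concrete_mod_cat:
  assumes "cring k"
  shows "concrete_tensor k (mod_cat k) (\<lambda>M. M) (\<lambda>_ _ _. True) (mod_tensor k)"
proof -
  interpret scalars k by (rule scalars.intro) fact
  show ?thesis
  proof (intro concrete_tensor.intro concrete.intro concrete_axioms.intro
      concrete_tensor_axioms.intro scalars_axioms)
    show "over_mod k (mod_cat k) (\<lambda>M. M) (mod_tensor k)"
      unfolding over_mod_def by (simp add: mod_cat_def mod_tensor_def)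
  qed (simp_all add: mod_cat_def mod_tensor_def)
qed

section \<open>Categories generated by one object\<close>

text \<open>This locale serves to treat right and left \<open>A\<close>-modules at once: \<open>a X b\<close> is the action of \<open>b \<in> A\<close>
  on \<open>X\<close>, and the generator \<open>G\<close> is \<open>A\<close> itself, with the arrows \<open>c \<mapsto> x c\<close>.\<close>

locale generated = scalars k for k :: "'k ring" +
  fixes C :: "('o, ('k, 'a) univ \<Rightarrow> ('k, 'a) univ) precategory" and U :: "'o \<Rightarrow> ('k, 'a) kmod"
    and B :: "'b set" and a :: "'o \<Rightarrow> 'b \<Rightarrow> ('k, 'a) univ \<Rightarrow> ('k, 'a) univ" and G :: 'o
  assumes arr_C: "f \<in> arr C \<longleftrightarrow> src f \<in> obj C \<and> tgt f \<in> obj C \<and>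
      fn f \<in> linear_maps k (U (src f)) (U (tgt f)) \<and>
      (\<forall>b \<in> B. \<forall>x \<in> carrier (U (src f)). fn f (a (src f) b x) = a (tgt f) b (fn f x))"
    and idn_C: "idn C X = \<lparr>src = X, tgt = X, fn = (\<lambda>x \<in> carrier (U X). x)\<rparr>"
    and cmp_C: "cmp C g f = \<lparr>src = src f, tgt = tgt g, fn =
        compose (carrier (U (src f))) (fn g) (fn f)\<rparr>"
    and mod_C: "X \<in> obj C \<Longrightarrow> module k (U X)"
    and a_closed: "X \<in> obj C \<Longrightarrow> b \<in> B \<Longrightarrow> x \<in> carrier (U X) \<Longrightarrow> a X b x \<in> carrier (U X)"
    and a_add: "X \<in> obj C \<Longrightarrow> b \<in> B \<Longrightarrow> x \<in> carrier (U X) \<Longrightarrow> y \<in> carrier (U X) \<Longrightarrow>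
      a X b (x \<oplus>\<^bsub>U X\<^esub> y) = a X b x \<oplus>\<^bsub>U X\<^esub> a X b y"
    and a_zero: "X \<in> obj C \<Longrightarrow> b \<in> B \<Longrightarrow> a X b \<zero>\<^bsub>U X\<^esub> = \<zero>\<^bsub>U X\<^esub>"
    and G: "G \<in> obj C"
    and gen: "\<And>X x Q. X \<in> obj C \<Longrightarrow> x \<in> carrier (U X) \<Longrightarrow> Q \<zero>\<^bsub>U X\<^esub> \<Longrightarrow>
      (\<And>f g. in_hom C f G X \<Longrightarrow> g \<in> carrier (U G) \<Longrightarrow> Q (fn f g)) \<Longrightarrow>
      (\<And>x y. x \<in> carrier (U X) \<Longrightarrow> y \<in> carrier (U X) \<Longrightarrow> Q x \<Longrightarrow> Q y \<Longrightarrow> Q (x \<oplus>\<^bsub>U X\<^esub> y)) \<Longrightarrow> Q x"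
begin

definition preserves :: "'o \<Rightarrow> 'o \<Rightarrow> (('k, 'a) univ \<Rightarrow> ('k, 'a) univ) \<Rightarrow> bool" where
  "preserves X Y \<phi> \<longleftrightarrow> (\<forall>b \<in> B. \<forall>x \<in> carrier (U X). \<phi> (a X b x) = a Y b (\<phi> x))"

sublocale concrete k C U preserves
proof (rule concrete.intro[OF scalars_axioms], rule concrete_axioms.intro)
  fix X Y Z \<phi> \<psi> assume *: "X \<in> obj C" "Y \<in> obj C" "Z \<in> obj C" "\<phi> \<in> linear_maps k (U X) (U Y)"
    "\<psi> \<in> linear_maps k (U Y) (U Z)" "preserves X Y \<phi>" "preserves Y Z \<psi>"
  then show "preserves X Z (compose (carrier (U X)) \<psi> \<phi>)"
    by (simp add: preserves_def compose_def a_closed linear_maps_iff lin_def)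
next
  fix X Y \<phi> \<psi> assume *: "X \<in> obj C" "Y \<in> obj C" "\<phi> \<in> linear_maps k (U X) (U Y)"
    "\<psi> \<in> linear_maps k (U Y) (U X)" "preserves X Y \<phi>" "\<And>x. x \<in> carrier (U X) \<Longrightarrow> \<psi> (\<phi> x) = x"
    "\<And>y. y \<in> carrier (U Y) \<Longrightarrow> \<phi> (\<psi> y) = y"
  show "preserves Y X \<psi>"
    unfolding preserves_def
  proof (intro ballI)
    fix b y assume b: "b \<in> B" and y: "y \<in> carrier (U Y)"
    have c: "\<psi> y \<in> carrier (U X)" using *(4) y by (simp add: linear_maps_iff lin_def)
    have "\<psi> (a Y b y) = \<psi> (a Y b (\<phi> (\<psi> y)))" using * y by simp
    also have "\<dots> = \<psi> (\<phi> (a X b (\<psi> y)))" using *(5) b c by (simp add: preserves_def)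
    also have "\<dots> = a X b (\<psi> y)" using * b c by (simp add: a_closed)
    finally show "\<psi> (a Y b y) = a X b (\<psi> y)" .
  qed
qed (simp_all add: arr_C idn_C cmp_C mod_C preserves_def a_closed)

end

text \<open>\<open>t_arr\<close> expresses that tensor products of arrows are arrows. Base change
  along D and an arbitrary strict structure both satisfy it, so
  \<open>generated_tensor_unique\<close> can compare them.\<close>

locale generated_tensor = generated k C U B a G for k :: "'k ring"
  and C :: "('o, ('k, 'a) univ \<Rightarrow> ('k, 'a) univ) precategory" and U :: "'o \<Rightarrow> ('k, 'a) kmod"
  and B :: "'b set" and a :: "'o \<Rightarrow> 'b \<Rightarrow> ('k, 'a) univ \<Rightarrow> ('k, 'a) univ" and G :: 'o +
  fixes t :: "'o \<Rightarrow> 'o \<Rightarrow> 'o"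
  assumes t_obj: "X \<in> obj C \<Longrightarrow> Y \<in> obj C \<Longrightarrow> t X Y \<in> obj C"
    and t_base: "X \<in> obj C \<Longrightarrow> Y \<in> obj C \<Longrightarrow> U (t X Y) = tensor k (U X) (U Y)"
    and t_arr: "in_hom C f X X' \<Longrightarrow> in_hom C g Y Y' \<Longrightarrow> b \<in> B \<Longrightarrow> z \<in> carrier (tensor k (U X) (U Y)) \<Longrightarrow>
      tensor_map k (forget_arrow U f) (forget_arrow U g) (a (t X Y) b z) =
      a (t X' Y') b (tensor_map k (forget_arrow U f) (forget_arrow U g) z)"
begin

definition tmap :: "('o, ('k, 'a) univ \<Rightarrow> ('k, 'a) univ) arrow \<Rightarrow> ('o, ('k, 'a) univ \<Rightarrow> ('k, 'a) univ)
    arrow \<Rightarrow>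
    ('o, ('k, 'a) univ \<Rightarrow> ('k, 'a) univ) arrow" where
  "tmap f g = \<lparr>src = t (src f) (src g), tgt = t (tgt f) (tgt g),
     fn = tensor_map k (forget_arrow U f) (forget_arrow U g)\<rparr>"

lemma tmap_hom:
  assumes f: "in_hom C f X X'" and g: "in_hom C g Y Y'"
  shows "in_hom C (tmap f g) (t X Y) (t X' Y')"
proof -
  note l = tensor_map_lin(1)[OF kmap_forget[OF f] kmap_forget[OF g]]
  have "tensor_map k (forget_arrow U f) (forget_arrow U g) \<in> extensional (carrier (tensor k
      (U (src f)) (U (src g))))"
    by (simp add: tensor_map_def)
  then show ?thesis
    using f g l t_arr[OF f g] by (simp add: in_hom_iff tmap_def t_obj t_base linear_maps_iff
        preserves_def)
qed

lemma tmap_pure: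
  assumes f: "in_hom C f X X'" and g: "in_hom C g Y Y'" and "x \<in> carrier (U X)" "y \<in> carrier (U Y)"
  shows "fn (tmap f g) (pure_tensor k (U X) (U Y) x y) =
      pure_tensor k (U X') (U Y') (fn f x) (fn g y)"
  using tensor_map_simps(1)[OF kmap_forget[OF f] kmap_forget[OF g]] assms
  by (simp add: tmap_def in_hom_iff)

lemma hom_a: "in_hom C f X Y \<Longrightarrow> b \<in> B \<Longrightarrow> x \<in> carrier (U X) \<Longrightarrow> fn f (a X b x) = a Y b (fn f x)"
  by (simp add: in_hom_iff preserves_def)

text \<open>A pure tensor of values f u, g v and h s is the image of a pure tensor over G under a
  tensor product of f, g and h, which commutes with the actions. Naturality of the associativity map
  carries the claim over from G.\<close>

lemma assoc_preserves:
  assumes base: "preserves (t (t G G) G) (t G (t G G)) (assoc_map k (U G) (U G) (U G))"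
    and X: "X \<in> obj C" and Y: "Y \<in> obj C" and Z: "Z \<in> obj C"
  shows "preserves (t (t X Y) Z) (t X (t Y Z)) (assoc_map k (U X) (U Y) (U Z))"
  unfolding preserves_def
proof (intro ballI)
  let ?S = "t (t X Y) Z" and ?T = "t X (t Y Z)" and ?f = "assoc_map k (U X) (U Y) (U Z)"
  note o = X Y Z and m = mod_C[OF X] mod_C[OF Y] mod_C[OF Z] and mG = mod_C[OF G]
  have U: "U ?S = tensor k (tensor k (U X) (U Y)) (U Z)"
      "U ?T = tensor k (U X) (tensor k (U Y) (U Z))"
    by (simp_all add: o t_obj t_base)
  have ST: "?S \<in> obj C" "?T \<in> obj C" by (simp_all add: o t_obj)
  fix b z assume b: "b \<in> B" and z: "z \<in> carrier (U ?S)"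
  define P where "P z \<longleftrightarrow> ?f (a ?S b z) = a ?T b (?f z)" for z
  note as = a_closed[OF ST(1) b, unfolded U] a_closed[OF ST(2) b, unfolded U]
    a_add[OF ST(1) b, unfolded U] a_add[OF ST(2) b, unfolded U] a_zero[OF ST(1) b,
        unfolded U] a_zero[OF ST(2) b, unfolded U]
  have P0: "P \<zero>\<^bsub>tensor k (tensor k (U X) (U Y)) (U Z)\<^esub>" using m by (simp add: P_def as)
  have Padd: "P (v \<oplus>\<^bsub>tensor k (tensor k (U X) (U Y)) (U Z)\<^esub> w)" if "P v" "P w"
    "v \<in> carrier (tensor k (tensor k (U X) (U Y)) (U Z))"
        "w \<in> carrier (tensor k (tensor k (U X) (U Y)) (U Z))" for v w
    using that m by (simp add: P_def as)
  have "P z" using z[unfolded U] m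
  proof (induction rule: tensor3_induct)
    case (pure x y w)
    let ?p = "\<lambda>x y w. pure_tensor k (tensor k (U X) (U Y)) (U Z) (pure_tensor k (U X) (U Y) x y) w"
    have base': "P (?p (fn f u) (fn g v) (fn h s))"
      if f: "in_hom C f G X" and g: "in_hom C g G Y" and h: "in_hom C h G Z"
        and uvs: "u \<in> carrier (U G)" "v \<in> carrier (U G)" "s \<in> carrier (U G)" for f g h u v s
    proof -
      note fg = tmap_hom[OF f g] and gh = tmap_hom[OF g h]
      note l = tmap_hom[OF fg h] and r = tmap_hom[OF f gh]
      have srcs: "src f = G" "tgt f = X" "src g = G" "tgt g = Y" "src h = G" "tgt h = Z"
        using f g h by (simp_all add: in_hom_iff)
      have nat: "?f (fn (tmap (tmap f g) h) c) = fn (tmap f (tmap g h)) (assoc_map k (U G) (U G)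
          (U G) c)"
        if "c \<in> carrier (tensor k (tensor k (U G) (U G)) (U G))" for c
        using assoc_natural[OF kmap_forget[OF f] kmap_forget[OF g] kmap_forget[OF h] kmap_forget[OF
            fg] kmap_forget[OF gh]] that
        by (simp add: tmap_def srcs t_base G o)
      let ?c = "pure_tensor k (tensor k (U G) (U G)) (U G) (pure_tensor k (U G) (U G) u v) s"
      have c: "?c \<in> carrier (U (t (t G G) G))" using uvs by (simp add: t_base t_obj G)
      have e: "?p (fn f u) (fn g v) (fn h s) = fn (tmap (tmap f g) h) ?c"
        using tmap_pure[OF fg h, of "pure_tensor k (U G) (U G) u v" s] tmap_pure[OF f g uvs(1,2)]
            uvs
        by (simp add: t_base G o)
      have ac: "a (t (t G G) G) b ?c \<in> carrier (tensor k (tensor k (U G) (U G)) (U G))"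
        using a_closed[OF _ b c] by (simp add: t_base t_obj G)
      have as: "assoc_map k (U G) (U G) (U G) ?c \<in> carrier (U (t G (t G G)))"
        using c mG by (simp add: t_base t_obj G)
      show ?thesis
        unfolding P_def e hom_a[OF l b c, symmetric] nat[OF ac] nat[OF c[simplified t_base t_obj G]]
        using base b c hom_a[OF r b as] by (simp add: preserves_def)
    qed
    \<comment> \<open>The rule \<open>gen\<close> is applied to one factor at a time, from the last
      to the first.\<close>
    have "P (?p (fn f u) (fn g v) w)" if f: "in_hom C f G X" "u \<in> carrier (U G)"
        and g: "in_hom C g G Y" "v \<in> carrier (U G)" for f g u v
      by (rule gen[OF Z pure(3)])
        (use base'[OF f(1) g(1) _ f(2) g(2)] fn_closed[OF f] fn_closed[OF g] m P0 Padd
            in \<open>simp_all\<close>)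
    then have "P (?p (fn f u) y w)" if f: "in_hom C f G X" "u \<in> carrier (U G)" for f u
      by (rule_tac gen[OF Y pure(2)])
        (use f fn_closed[OF f] pure(3) m P0 Padd in \<open>simp_all\<close>)
    then show "P (?p x y w)"
      by (rule_tac gen[OF X pure(1)]) (use pure m P0 Padd in \<open>simp_all\<close>)
  qed (use P0 Padd in auto)
  then show "?f (a ?S b z) = a ?T b (?f z)" by (simp add: P_def)
qed

text \<open>The argument of \<open>assoc_preserves\<close> with the identity of u on the scalar
  factor.\<close>

lemma unit_preserves:
  assumes u: "u \<in> obj C" "U u = underlying (scalar_algebra k)" and X: "X \<in> obj C"
  shows "preserves (t u G) G (lunit_map k (U G)) \<Longrightarrow> preserves (t u X) X (lunit_map k (U X))"
    and "preserves (t G u) G (runit_map k (U G)) \<Longrightarrow> preserves (t X u) X (runit_map k (U X))"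
proof -
  note m = mod_C[OF X] and mG = mod_C[OF G]
  have U: "U (t u X) = tensor k (scalar_algebra k) (U X)" "U (t X u) =
      tensor k (U X) (scalar_algebra k)"
    "U (t u G) = tensor k (scalar_algebra k) (U G)" "U (t G u) = tensor k (U G) (scalar_algebra k)"
    by (simp_all add: X u G t_base)
  have o: "t u X \<in> obj C" "t X u \<in> obj C" "t u G \<in> obj C" "t G u \<in> obj C"
    by (simp_all add: t_obj u X G)
  let ?I = "idn C u"
  have I: "in_hom C ?I u u" by (rule in_hom_idn[OF u(1)])
  have es: "U (src ?I) = underlying (scalar_algebra k)" "U (tgt ?I) = underlying (scalar_algebra k)"
    "x \<in> Scalar ` carrier k \<Longrightarrow> fn ?I x = x" for x by (simp_all add: idn_eq u)
  {
    fix b assume b: "b \<in> B"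
    note as = a_closed[OF o(1) b, unfolded U] a_closed[OF X b] a_closed[OF o(2) b, unfolded U]
      a_add[OF o(1) b, unfolded U] a_add[OF X b] a_add[OF o(2) b, unfolded U]
      a_zero[OF o(1) b, unfolded U] a_zero[OF X b] a_zero[OF o(2) b, unfolded U]
    {
      assume base: "preserves (t u G) G (lunit_map k (U G))"
      define P where "P z \<longleftrightarrow> lunit_map k (U X) (a (t u X) b z) = a X b (lunit_map k (U X) z)" for z
      have P0: "P \<zero>\<^bsub>tensor k (scalar_algebra k) (U X)\<^esub>" using m by (simp add: P_def as)
      have Padd: "P (v \<oplus>\<^bsub>tensor k (scalar_algebra k) (U X)\<^esub> w)" if "P v" "P w"
        "v \<in> carrier (tensor k (scalar_algebra k) (U X))"
            "w \<in> carrier (tensor k (scalar_algebra k) (U X))" for v w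
        using that m by (simp add: P_def as)
      have "P z" if "z \<in> carrier (tensor k (scalar_algebra k) (U X))" for z
        using that module_scalar_algebra m
      proof (induction rule: tensor_induct)
        case (pure r x)
        have "P (pure_tensor k (scalar_algebra k) (U X) r (fn f s))" if f: "in_hom C f G X"
            and s: "s \<in> carrier (U G)" for f s
        proof -
          note l = tmap_hom[OF I f]
          have srcs: "src f = G" "tgt f = X" "src ?I = u" "tgt ?I = u" using f
            by (simp_all add: in_hom_iff idn_eq)
          have nat: "lunit_map k (U X) (fn (tmap ?I f) c) = fn f (lunit_map k (U G) c)"
            if "c \<in> carrier (tensor k (scalar_algebra k) (U G))" for c
            using lunit_natural[OF kmap_forget[OF f] kmap_forget[OF I]] that es
            by (simp add: tmap_def srcs)
          let ?c = "pure_tensor k (scalar_algebra k) (U G) r s"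
          have c: "?c \<in> carrier (tensor k (scalar_algebra k) (U G))" using pure s by simp
          have e: "pure_tensor k (scalar_algebra k) (U X) r (fn f s) = fn (tmap ?I f) ?c"
            using tmap_pure[OF I f, of r s] pure s es by (simp add: u)
          have ac: "a (t u G) b ?c \<in> carrier (tensor k (scalar_algebra k) (U G))"
            using a_closed[OF o(3) b] c by (simp add: U)
          have h: "fn (tmap ?I f) (a (t u G) b ?c) = a (t u X) b (fn (tmap ?I f) ?c)"
            by (rule hom_a[OF l b]) (simp add: U c)
          show ?thesis
            unfolding P_def e h[symmetric] nat[OF ac] nat[OF c]
            using base b c hom_a[OF f b, of "lunit_map k (U G) ?c"] mG
            by (simp add: preserves_def U)
        qed
        then show ?case
          by (rule_tac gen[OF X pure(2)]) (use pure m P0 Padd in \<open>simp_all\<close>)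
      qed (use P0 Padd in auto)
      note this[unfolded P_def]
    }
    note L = this
    {
      assume base: "preserves (t G u) G (runit_map k (U G))"
      define P where "P z \<longleftrightarrow> runit_map k (U X) (a (t X u) b z) = a X b (runit_map k (U X) z)" for z
      have P0: "P \<zero>\<^bsub>tensor k (U X) (scalar_algebra k)\<^esub>" using m by (simp add: P_def as)
      have Padd: "P (v \<oplus>\<^bsub>tensor k (U X) (scalar_algebra k)\<^esub> w)" if "P v" "P w"
        "v \<in> carrier (tensor k (U X) (scalar_algebra k))"
            "w \<in> carrier (tensor k (U X) (scalar_algebra k))" for v w
        using that m by (simp add: P_def as)
      have "P z" if "z \<in> carrier (tensor k (U X) (scalar_algebra k))" for z
        using that m module_scalar_algebra
      proof (induction rule: tensor_induct)
        case (pure x r)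
        have "P (pure_tensor k (U X) (scalar_algebra k) (fn f s) r)" if f: "in_hom C f G X"
            and s: "s \<in> carrier (U G)" for f s
        proof -
          note l = tmap_hom[OF f I]
          have srcs: "src f = G" "tgt f = X" "src ?I = u" "tgt ?I = u" using f
            by (simp_all add: in_hom_iff idn_eq)
          have nat: "runit_map k (U X) (fn (tmap f ?I) c) = fn f (runit_map k (U G) c)"
            if "c \<in> carrier (tensor k (U G) (scalar_algebra k))" for c
            using runit_natural[OF kmap_forget[OF f] kmap_forget[OF I]] that es
            by (simp add: tmap_def srcs)
          let ?c = "pure_tensor k (U G) (scalar_algebra k) s r"
          have c: "?c \<in> carrier (tensor k (U G) (scalar_algebra k))" using pure s by simp
          have e: "pure_tensor k (U X) (scalar_algebra k) (fn f s) r = fn (tmap f ?I) ?c"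
            using tmap_pure[OF f I, of s r] pure s es by (simp add: u)
          have ac: "a (t G u) b ?c \<in> carrier (tensor k (U G) (scalar_algebra k))"
            using a_closed[OF o(4) b] c by (simp add: U)
          have h: "fn (tmap f ?I) (a (t G u) b ?c) = a (t X u) b (fn (tmap f ?I) ?c)"
            by (rule hom_a[OF l b]) (simp add: U c)
          show ?thesis
            unfolding P_def e h[symmetric] nat[OF ac] nat[OF c]
            using base b c hom_a[OF f b, of "runit_map k (U G) ?c"] mG
            by (simp add: preserves_def U)
        qed
        then show ?case
          by (rule_tac gen[OF X pure(1)]) (use pure m P0 Padd in \<open>simp_all\<close>)
      qed (use P0 Padd in auto)
      note this[unfolded P_def]
    }
    note L this
  }
  then show "preserves (t u G) G (lunit_map k (U G)) \<Longrightarrow> preserves (t u X) X (lunit_map k (U X))"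
    and "preserves (t G u) G (runit_map k (U G)) \<Longrightarrow> preserves (t X u) X (runit_map k (U X))"
    unfolding preserves_def U by blast+
qed

end

text \<open>The underlying modules and the maps f \<otimes> g are the same for t and t'. On a tensor
  f u \<otimes> g v both actions are images of the actions on G \<otimes> G, where they
  agree.\<close>

lemma generated_tensor_unique:
  assumes t: "generated_tensor k C U B a G t" and t': "generated_tensor k C U B a G t'"
    and eq: "\<And>b z. b \<in> B \<Longrightarrow> z \<in> carrier (tensor k (U G) (U G)) \<Longrightarrow> a (t G G) b z = a (t' G G) b z"
    and X: "X \<in> obj C" and Y: "Y \<in> obj C" and b: "b \<in> B" and z: "z \<in> carrier (tensor k (U X) (U Y))"
  shows "a (t X Y) b z = a (t' X Y) b z"
proof -
  interpret t: generated_tensor k C U B a G t by (rule t)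
  interpret t': generated_tensor k C U B a G t' by (rule t')
  note m = t.mod_C[OF X] t.mod_C[OF Y]
  have U: "U (t X Y) = tensor k (U X) (U Y)" "U (t' X Y) = tensor k (U X) (U Y)"
    by (simp_all add: X Y t.t_base t'.t_base)
  have o: "t X Y \<in> obj C" "t' X Y \<in> obj C" by (simp_all add: X Y t.t_obj t'.t_obj)
  define P where "P z \<longleftrightarrow> a (t X Y) b z = a (t' X Y) b z" for z
  have P0: "P \<zero>\<^bsub>tensor k (U X) (U Y)\<^esub>"
    using t.a_zero[OF o(1) b] t.a_zero[OF o(2) b] by (simp add: P_def U)
  have Padd: "P (v \<oplus>\<^bsub>tensor k (U X) (U Y)\<^esub> w)" if "P v" "P w"
    "v \<in> carrier (tensor k (U X) (U Y))" "w \<in> carrier (tensor k (U X) (U Y))" for v w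
    using that t.a_add[OF o(1) b] t.a_add[OF o(2) b] by (simp add: P_def U)
  have "P z" using z m
  proof (induction rule: t.tensor_induct)
    case (pure x y)
    have base: "P (pure_tensor k (U X) (U Y) (fn f u) (fn g v))"
      if f: "in_hom C f G X" and g: "in_hom C g G Y" and uv: "u \<in> carrier (U G)" "v \<in> carrier (U G)"
          for f g u v
    proof -
      let ?c = "pure_tensor k (U G) (U G) u v"
      have c: "?c \<in> carrier (tensor k (U G) (U G))" using uv by simp
      have e: "pure_tensor k (U X) (U Y) (fn f u) (fn g v) =
          tensor_map k (forget_arrow U f) (forget_arrow U g) ?c"
        using t.tmap_pure[OF f g uv] by (simp add: t.tmap_def)
      show ?thesis unfolding P_def e t.t_arr[OF f g b c, symmetric] t'.t_arr[OF f g b c, symmetric]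
        by (simp add: eq[OF b c])
    qed
    have "P (pure_tensor k (U X) (U Y) (fn f u) y)" if f: "in_hom C f G X" "u \<in> carrier (U G)"
        for f u
      by (rule t.gen[OF Y pure(2)]) (use base[OF f(1) _ f(2)] t.fn_closed[OF f] m P0 Padd
          in \<open>simp_all\<close>)
    then show ?case
      by (rule_tac t.gen[OF X pure(1)]) (use pure m P0 Padd in \<open>simp_all\<close>)
  qed (use P0 Padd in auto)
  then show ?thesis by (simp add: P_def)
qed

section \<open>The correspondence\<close>

context nd_alg
begin

lemma reg_parts: "robj (right_part reg)" "lobj (left_part reg)"
  using reg_ext by (simp_all add: ext_iff_parts)

lemma robjD:
  assumes "robj M"
  shows "module k (base M)" "nd_module k A (mult A) (base M) (act M)"
      "bil k (base M) A (base M) (act M)"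
  using assms nd_moduleD(1,2)[of k A "mult A" "base M" "act M"] by (simp_all add: robj_def)

lemma lobjD:
  assumes "lobj M"
  shows "module k (base M)" "nd_module k A (\<lambda>a b. mult A b a) (base M) (\<lambda>m a. act M a m)"
    "bil k A (base M) (base M) (act M)"
  using assms nd_moduleD(1,2)[of k A "\<lambda>a b. mult A b a" "base M" "\<lambda>m a. act M a m"]
    bil_flip[of k "base M" A "base M" "\<lambda>m a. act M a m"] by (simp_all add: lobj_def)

sublocale R: generated k "right_mod_cat k A" base "carrier A" "\<lambda>M b m. act M m b" "right_part reg"
proof (rule generated.intro[OF scalars_axioms], rule generated_axioms.intro, goal_cases)
  case (1 f)
  show ?case by (auto simp: right_mod_cat_def Let_def)
next
  \<comment> \<open>Goal 9 is \<open>gen\<close>, and goal 7 below is \<open>a_zero\<close>. A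
    product m c is the value at c of the arrow from A to X defined by m.\<close>
  case (9 X x Q)
  have X: "robj X" using 9(1) by (simp add: robj_cat)
  note nd = robjD(2)[OF X] and b = robjD(3)[OF X]
  show ?case using nd 9(2)
  proof (induction rule: nd_induct)
    case (act m c)
    define f where "f = \<lparr>src = right_part reg, tgt = X, fn = (\<lambda>c \<in> carrier A. act X m c)\<rparr>"
    have "fn f \<in> linear_maps k A (base X)"
      unfolding f_def using bil_linR[OF b act(1)] by (auto intro!: linear_maps_restrict)
    then have "in_hom (right_mod_cat k A) f (right_part reg) X"
      using X reg_parts act(1) nd_moduleD(3)[OF nd] nd_algebraD(4)[OF A] robj_cat
      by (auto simp: in_hom_def right_mod_cat_def Let_def f_def)
    from 9(4)[OF this, of c] show ?case using act by (simp add: f_def)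
  qed (use 9(3,5) in auto)
next
  case (7 X b)
  then show ?case using robjD[of X] bil_zeroL[of "base X" A "base X" "act X" b]
    by (simp add: robj_cat)
qed (use robjD reg_parts in \<open>simp_all add: right_mod_cat_def[THEN arg_cong[where f = idn]]
    right_mod_cat_def[THEN arg_cong[where f = cmp]] Let_def robj_cat bilD[OF robjD(3)]\<close>)

sublocale L: generated k "left_mod_cat k A" base "carrier A" act "left_part reg"
proof (rule generated.intro[OF scalars_axioms], rule generated_axioms.intro, goal_cases)
  case (1 f)
  show ?case by (auto simp: left_mod_cat_def Let_def)
next
  case (9 X x Q)
  have X: "lobj X" using 9(1) by (simp add: lobj_cat)
  note nd = lobjD(2)[OF X] and b = lobjD(3)[OF X]
  show ?case using nd 9(2)
  proof (induction rule: nd_induct)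
    case (act m c)
    define f where "f = \<lparr>src = left_part reg, tgt = X, fn = (\<lambda>c \<in> carrier A. act X c m)\<rparr>"
    have "fn f \<in> linear_maps k A (base X)"
      unfolding f_def using bil_linL[OF b act(1)] by (auto intro!: linear_maps_restrict)
    then have "in_hom (left_mod_cat k A) f (left_part reg) X"
      using X reg_parts act(1) nd_moduleD(3)[OF nd] nd_algebraD(4)[OF A] lobj_cat
      by (auto simp: in_hom_def left_mod_cat_def Let_def f_def)
    from 9(4)[OF this, of c] show ?case using act by (simp add: f_def)
  qed (use 9(3,5) in auto)
next
  case (7 X b)
  then show ?case using lobjD[of X] bil_zeroR[of A "base X" "base X" "act X" b]
    by (simp add: lobj_cat)
qed (use lobjD reg_parts in \<open>simp_all add: left_mod_cat_def[THEN arg_cong[where f = idn]]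
    left_mod_cat_def[THEN arg_cong[where f = cmp]] Let_def lobj_cat bilD[OF lobjD(3)]\<close>)

text \<open>Splitting the condition into a multiplicative part and two module parts lets the results
  on left and right modules be used for extensions.\<close>

definition ext_preserves :: "('k, ('k, 'a) univ) extension \<Rightarrow> ('k, ('k, 'a) univ) extension \<Rightarrow>
    (('k, 'a) univ \<Rightarrow> ('k, 'a) univ) \<Rightarrow> bool" where
  "ext_preserves R S \<phi> \<longleftrightarrow>
     (\<forall>x \<in> carrier (alg R). \<forall>y \<in> carrier (alg R). \<phi> (x \<otimes>\<^bsub>alg R\<^esub> y) = \<phi> x \<otimes>\<^bsub>alg S\<^esub> \<phi> y) \<and>
     L.preserves (left_part R) (left_part S) \<phi> \<and> R.preserves (right_part R) (right_part S) \<phi>"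

abbreviation ebase :: "('k, ('k, 'a) univ) extension \<Rightarrow> ('k, 'a) kmod" where
  "ebase R \<equiv> underlying (alg R)"

lemma ext_obj_parts:
  assumes "R \<in> ext_objects k A"
  shows "left_part R \<in> obj (left_mod_cat k A)" "right_part R \<in> obj (right_mod_cat k A)"
    "module k (alg R)" "bil k (alg R) (alg R) (alg R) (mult (alg R))"
  using assms nd_moduleD(1)[OF nd_extD(1)] nd_extD(3)
  unfolding ext_iff_parts lobj_cat robj_cat by blast+

lemma ext_obj [simp]: "obj (ext_cat k A) = ext_objects k A"
  by (simp add: ext_cat_def)

sublocale E: concrete k "ext_cat k A" ebase ext_preserves
proof (rule concrete.intro[OF scalars_axioms], rule concrete_axioms.intro, goal_cases)
  case (1 f)
  show ?case
    by (auto simp: ext_cat_def algebra_maps_def ext_preserves_def L.preserves_def R.preserves_def)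
next
  \<comment> \<open>Goals 5, 6 and 7 are \<open>P_idn\<close>, \<open>P_cmp\<close> and
    \<open>P_inv\<close>.\<close>
  case (5 X)
  then show ?case
    using ext_obj_parts[of X] L.P_idn[of "left_part X"] R.P_idn[of "right_part X"]
    by (auto simp: ext_preserves_def bil_closed)
next
  case (6 X Y Z \<phi> \<psi>)
  then have "\<phi> x \<in> carrier (alg Y)" if "x \<in> carrier (alg X)" for x
    using that by (auto simp: linear_maps_iff lin_def)
  then show ?case
    using 6 ext_obj_parts[of X] ext_obj_parts[of Y] ext_obj_parts[of Z]
      L.P_cmp[of "left_part X" "left_part Y" "left_part Z" \<phi> \<psi>]
      R.P_cmp[of "right_part X" "right_part Y" "right_part Z" \<phi> \<psi>]
    by (simp add: ext_preserves_def compose_def bil_closed)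
next
  case (7 X Y \<phi> \<psi>)
  have c: "\<psi> y \<in> carrier (alg X)" if "y \<in> carrier (alg Y)" for y
    using 7(4) that by (auto simp: linear_maps_iff lin_def)
  have "\<psi> (x \<otimes>\<^bsub>alg Y\<^esub> y) = \<psi> x \<otimes>\<^bsub>alg X\<^esub> \<psi> y" if "x \<in> carrier (alg Y)" "y \<in> carrier (alg Y)" for x y
  proof -
    have "\<psi> (x \<otimes>\<^bsub>alg Y\<^esub> y) = \<psi> (\<phi> (\<psi> x) \<otimes>\<^bsub>alg Y\<^esub> \<phi> (\<psi> y))" using 7(7) that by simp
    also have "\<dots> = \<psi> (\<phi> (\<psi> x \<otimes>\<^bsub>alg X\<^esub> \<psi> y))" using 7(5) c that by (simp add: ext_preserves_def)
    also have "\<dots> = \<psi> x \<otimes>\<^bsub>alg X\<^esub> \<psi> y"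
      using 7(1,6) c that bil_closed[OF ext_obj_parts(4)] by simp
    finally show ?thesis .
  qed
  then show ?case
    using 7 ext_obj_parts[of X] ext_obj_parts[of Y]
      L.P_inv[of "left_part X" "left_part Y" \<phi> \<psi>] R.P_inv[of "right_part X" "right_part Y" \<phi> \<psi>]
    by (simp add: ext_preserves_def)
qed (use ext_obj_parts in \<open>simp_all add: ext_cat_def\<close>)

lemma ext_hom_parts:
  assumes "in_hom (ext_cat k A) f X Y"
  shows "in_hom (left_mod_cat k A) (forget_arrow left_part f) (left_part X) (left_part Y)"
    and "in_hom (right_mod_cat k A) (forget_arrow right_part f) (right_part X) (right_part Y)"
  using assms ext_obj_parts[of X] ext_obj_parts[of Y]
  by (auto simp: E.in_hom_iff L.in_hom_iff R.in_hom_iff ext_preserves_def)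

lemma amap_iff: "amap R S h \<longleftrightarrow>
    L.preserves (left_part R) (left_part S) h \<and> R.preserves (right_part R) (right_part S) h"
  by (auto simp: amap_def L.preserves_def R.preserves_def)

end

section \<open>From a comultiplication and a counit to monoidal structures\<close>

context comult
begin

text \<open>Serves as the arrow on the acting algebra in
  \<open>tensor_map_componentwise\<close>.\<close>

lemma kmap_ident: "kmap \<lparr>src = A, tgt = A, fn = (\<lambda>x. x)\<rparr>"
  unfolding kmap_def by (simp add: lin_def)

lemma tensor_map_idA: "y \<in> carrier AA \<Longrightarrow>
    tensor_map k \<lparr>src = A, tgt = A, fn = (\<lambda>x. x)\<rparr> \<lparr>src = A, tgt = A, fn = (\<lambda>x. x)\<rparr> y = y"
  using tensor_map_ident[OF kmap_ident kmap_ident] by simp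

text \<open>A tensor product of A-linear maps is linear over A \<otimes> A by
  \<open>tensor_map_componentwise\<close>, and \<open>base_change_map\<close> makes it linear for
  the induced actions of A.\<close>

sublocale R: generated_tensor k "right_mod_cat k A" base "carrier A" "\<lambda>M b m. act M m b"
    "right_part reg" "rtens D"
proof (rule generated_tensor.intro[OF R.generated_axioms], rule generated_tensor_axioms.intro)
  fix f X X' g Y Y' b z
  assume f: "in_hom (right_mod_cat k A) f X X'" and g: "in_hom (right_mod_cat k A) g Y Y'"
    and b: "b \<in> carrier A" and z: "z \<in> carrier (tensor k (base X) (base Y))"
  have o: "robj X" "robj X'" "robj Y" "robj Y'" and fs: "src f = X" "tgt f = X'" "src g = Y"
      "tgt g = Y'"
    using f g by (simp_all add: R.in_hom_iff robj_cat)
  interpret S: extension_module k A "mult A" AA mAA "lact D" "ract D" "tensor k (base X) (base Y)"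
    "componentwise k (base X) (base Y) (act X) (act Y)" by (rule rtens_module[OF o(1,3)])
  interpret S': extension_module k A "mult A" AA mAA "lact D" "ract D"
      "tensor k (base X') (base Y')"
    "componentwise k (base X') (base Y') (act X') (act Y')" by (rule rtens_module[OF o(2,4)])
  note kf = R.kmap_forget[OF f] R.kmap_forget[OF g]
  let ?h = "tensor_map k (forget_arrow base f) (forget_arrow base g)"
  note l = tensor_map_lin(1)[OF kf, simplified fs forget_arrow_simps]
  have "?h (componentwise k (base X) (base Y) (act X) (act Y) z y) =
      componentwise k (base X') (base Y') (act X') (act Y') (?h z) y"
    if "z \<in> carrier (tensor k (base X) (base Y))" "y \<in> carrier AA" for z y
    using tensor_map_componentwise[OF kf kmap_ident kmap_ident kf, of "act X" "act Y" "act X'"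
        "act Y'" z y] that
      f[unfolded R.in_hom_iff R.preserves_def] g[unfolded R.in_hom_iff R.preserves_def] o
    by (simp add: fs robjD(3) tensor_map_idA)
  from base_change_map[OF S'.F l this z S.base_change[OF z b] S.cl(1)[OF b]]
  show "?h (act (rtens D X Y) z b) = act (rtens D X' Y') (?h z) b"
    using z b lin_closed[OF l z] by (simp add: rtens_def)
qed (use rtens_robj in \<open>simp_all add: robj_cat\<close>)

sublocale L: generated_tensor k "left_mod_cat k A" base "carrier A" act "left_part reg" "ltens D"
proof (rule generated_tensor.intro[OF L.generated_axioms], rule generated_tensor_axioms.intro)
  fix f X X' g Y Y' b z
  assume f: "in_hom (left_mod_cat k A) f X X'" and g: "in_hom (left_mod_cat k A) g Y Y'"
    and b: "b \<in> carrier A" and z: "z \<in> carrier (tensor k (base X) (base Y))"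
  have o: "lobj X" "lobj X'" "lobj Y" "lobj Y'" and fs: "src f = X" "tgt f = X'" "src g = Y"
      "tgt g = Y'"
    using f g by (simp_all add: L.in_hom_iff lobj_cat)
  interpret S: extension_module k A "\<lambda>a b. mult A b a" AA "\<lambda>x y. mAA y x" "\<lambda>a y. ract D y a"
      "\<lambda>y a. lact D a y"
    "tensor k (base X) (base Y)" "\<lambda>z y. componentwise k (base X) (base Y) (act X) (act Y) y z"
    by (rule ltens_module[OF o(1,3)])
  interpret S': extension_module k A "\<lambda>a b. mult A b a" AA "\<lambda>x y. mAA y x" "\<lambda>a y. ract D y a"
      "\<lambda>y a. lact D a y"
    "tensor k (base X') (base Y')" "\<lambda>z y. componentwise k (base X') (base Y') (act X') (act Y') y z"
    by (rule ltens_module[OF o(2,4)])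
  note kf = L.kmap_forget[OF f] L.kmap_forget[OF g]
  let ?h = "tensor_map k (forget_arrow base f) (forget_arrow base g)"
  note l = tensor_map_lin(1)[OF kf, simplified fs forget_arrow_simps]
  have "?h (componentwise k (base X) (base Y) (act X) (act Y) y z) =
      componentwise k (base X') (base Y') (act X') (act Y') y (?h z)"
    if "z \<in> carrier (tensor k (base X) (base Y))" "y \<in> carrier AA" for z y
    using tensor_map_componentwise[OF kmap_ident kmap_ident kf kf, of "act X" "act Y" "act X'"
        "act Y'" y z] that
      f[unfolded L.in_hom_iff L.preserves_def] g[unfolded L.in_hom_iff L.preserves_def] o
    by (simp add: fs lobjD(3) tensor_map_idA)
  from base_change_map[OF S'.F l this z S.base_change[OF z b] S.cl(1)[OF b]]
  show "?h (act (ltens D X Y) b z) = act (ltens D X' Y') b (?h z)"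
    using z b lin_closed[OF l z] by (simp add: ltens_def)
qed (use ltens_lobj in \<open>simp_all add: lobj_cat\<close>)

end

text \<open>The comonoid axioms in the form of \<open>comonoid_iff\<close>, with the extensions D
  and E in place of \<Delta> and \<epsilon>.\<close>

locale bialgebra_ext = comult k A D for k :: "'k ring" and A :: "('k, 'a) kmod" and D +
  fixes E :: "('k, ('k, 'a) univ) extension"
  assumes E: "E \<in> ext_objects k A" and algE: "alg E = scalar_algebra k"
    and coassoc: "amap (etens D D reg) (etens D reg D) (assoc_map k A A A)"
    and counit: "amap (etens D E reg) reg (lunit_map k A)"
        "amap (etens D reg E) reg (runit_map k A)"
begin

lemma D_parts: "rtens D (right_part reg) (right_part reg) = right_part D"
    "ltens D (left_part reg) (left_part reg) = left_part D"
  using etens_parts[of D reg reg] by (simp_all add: etens_reg)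

lemma coassoc_parts:
  "R.preserves (rtens D (right_part D) (right_part reg)) (rtens D (right_part reg) (right_part D))
      (assoc_map k A A A)"
  "L.preserves (ltens D (left_part D) (left_part reg)) (ltens D (left_part reg) (left_part D))
      (assoc_map k A A A)"
  using coassoc by (simp_all add: amap_iff)

lemma counit_parts:
  "R.preserves (rtens D (right_part E) (right_part reg)) (right_part reg) (lunit_map k A)"
  "L.preserves (ltens D (left_part E) (left_part reg)) (left_part reg) (lunit_map k A)"
  "R.preserves (rtens D (right_part reg) (right_part E)) (right_part reg) (runit_map k A)"
  "L.preserves (ltens D (left_part reg) (left_part E)) (left_part reg) (runit_map k A)"
  using counit by (simp_all add: amap_iff)

lemma E_base: "base (right_part E) = underlying (scalar_algebra k)" "base (left_part E) =
    underlying (scalar_algebra k)"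
  by (simp_all add: algE)

abbreviation "TR \<equiv> lift_tensor k (right_mod_cat k A) base (rtens D) (right_part E)"
abbreviation "TL \<equiv> lift_tensor k (left_mod_cat k A) base (ltens D) (left_part E)"
abbreviation "TE \<equiv> lift_tensor k (ext_cat k A) ebase (etens D) E"

text \<open>The axioms speak of the generator only, where tensoring \<open>reg\<close> with itself
  gives D by \<open>D_parts\<close>. \<open>assoc_preserves\<close> and
  \<open>unit_preserves\<close> extend them to all right modules.\<close>

lemma concrete_TR: "concrete_tensor k (right_mod_cat k A) base R.preserves TR"
proof (rule R.concrete_tensor_lift)
  fix f X X' g Y Y' assume f: "in_hom (right_mod_cat k A) f X X'"
      and g: "in_hom (right_mod_cat k A) g Y Y'"
  then show "R.preserves (rtens D X Y) (rtens D X' Y') (tensor_map k (forget_arrow base f)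
      (forget_arrow base g))"
    using R.t_arr[OF f g] by (simp add: R.preserves_def)
qed (use R.t_obj ext_obj_parts[OF E] E_base R.assoc_preserves R.unit_preserves[OF
    ext_obj_parts(2)[OF E] E_base(1)]
  coassoc_parts counit_parts in \<open>simp_all add: D_parts\<close>)

lemma concrete_TL: "concrete_tensor k (left_mod_cat k A) base L.preserves TL"
proof (rule L.concrete_tensor_lift)
  fix f X X' g Y Y' assume f: "in_hom (left_mod_cat k A) f X X'"
      and g: "in_hom (left_mod_cat k A) g Y Y'"
  then show "L.preserves (ltens D X Y) (ltens D X' Y') (tensor_map k (forget_arrow base f)
      (forget_arrow base g))"
    using L.t_arr[OF f g] by (simp add: L.preserves_def)
qed (use L.t_obj ext_obj_parts[OF E] E_base L.assoc_preserves L.unit_preserves[OF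
    ext_obj_parts(1)[OF E] E_base(2)]
  coassoc_parts counit_parts in \<open>simp_all add: D_parts\<close>)

text \<open>Linearity on both sides is inherited from the two module categories. Multiplicativity is
  the additional point and comes from the componentwise products on the tensor product
  algebras.\<close>

lemma concrete_TE: "concrete_tensor k (ext_cat k A) ebase ext_preserves TE"
proof (rule E.concrete_tensor_lift, unfold ext_obj)
  fix X Y assume "X \<in> ext_objects k A" "Y \<in> ext_objects k A"
  then show "etens D X Y \<in> ext_objects k A \<and> ebase (etens D X Y) = tensor k (ebase X) (ebase Y)"
    using etens_ext by simp
next
  fix f X X' g Y Y' assume f: "in_hom (ext_cat k A) f X X'" and g: "in_hom (ext_cat k A) g Y Y'"
  note fl = ext_hom_parts[OF f] and gl = ext_hom_parts[OF g]
  let ?h = "tensor_map k (forget_arrow ebase f) (forget_arrow ebase g)"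
  have fs: "src f = X" "tgt f = X'" "src g = Y" "tgt g = Y'" using f g
    by (simp_all add: E.in_hom_iff)
  have o: "X \<in> ext_objects k A" "X' \<in> ext_objects k A" "Y \<in> ext_objects k A" "Y' \<in> ext_objects k A"
    using f g by (simp_all add: E.in_hom_iff)
  note kf = E.kmap_forget[OF f] E.kmap_forget[OF g]
  have "?h (x \<otimes>\<^bsub>alg (etens D X Y)\<^esub> y) = ?h x \<otimes>\<^bsub>alg (etens D X' Y')\<^esub> ?h y"
    if "x \<in> carrier (alg (etens D X Y))" "y \<in> carrier (alg (etens D X Y))" for x y
    using tensor_map_componentwise[OF kf kf kf, of "mult (alg X)" "mult (alg Y)" "mult (alg X')"
        "mult (alg Y')" x y] that
      o f[unfolded E.in_hom_iff ext_preserves_def] g[unfolded E.in_hom_iff ext_preserves_def]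
    by (simp add: fs ext_obj_parts(4))
  moreover have "L.preserves (left_part (etens D X Y)) (left_part (etens D X' Y')) ?h"
    using L.t_arr[OF fl(1) gl(1)] by (simp add: L.preserves_def forget_arrow_comp)
  moreover have "R.preserves (right_part (etens D X Y)) (right_part (etens D X' Y')) ?h"
    using R.t_arr[OF fl(2) gl(2)] by (simp add: R.preserves_def forget_arrow_comp)
  ultimately show "ext_preserves (etens D X Y) (etens D X' Y') ?h" by (simp add: ext_preserves_def)
next
  fix X Y Z assume o: "X \<in> ext_objects k A" "Y \<in> ext_objects k A" "Z \<in> ext_objects k A"
  note p = ext_obj_parts[OF o(1)] ext_obj_parts[OF o(2)] ext_obj_parts[OF o(3)]
  show "ext_preserves (etens D (etens D X Y) Z) (etens D X (etens D Y Z)) (assoc_map k (ebase X)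
      (ebase Y) (ebase Z))"
    using assoc_map_mult[OF p(3,4) p(7,8) p(11,12)]
      R.assoc_preserves[OF _ p(2,6,10)] L.assoc_preserves[OF _ p(1,5,9)] coassoc_parts
    by (simp add: ext_preserves_def D_parts)
next
  fix X assume o: "X \<in> ext_objects k A"
  note p = ext_obj_parts[OF o] and e = ext_obj_parts[OF E]
  show "ext_preserves (etens D E X) X (lunit_map k (ebase X))"
    using lunit_map_mult[OF p(3,4)] R.unit_preserves(1)[OF e(2) E_base(1) p(2)]
        L.unit_preserves(1)[OF e(1) E_base(2) p(1)]
      counit_parts by (simp add: ext_preserves_def algE)
  show "ext_preserves (etens D X E) X (runit_map k (ebase X))"
    using runit_map_mult[OF p(3,4)] R.unit_preserves(2)[OF e(2) E_base(1) p(2)]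
        L.unit_preserves(2)[OF e(1) E_base(2) p(1)]
      counit_parts by (simp add: ext_preserves_def algE)
qed (simp_all add: E algE)

lemma lift_structures: "(TR, TL, TE) \<in> strict_monoidal_structures k A"
proof -
  note M = concrete_mod_cat[OF cring]
  have "strict_monoidal_functor (ext_cat k A) TE (left_mod_cat k A) TL left_part
      (forget_arrow left_part)"
    by (rule concrete_strict[OF concrete_TE concrete_TL])
      (use ext_obj_parts in \<open>simp_all add: lift_tensor_def ext_preserves_def\<close>)
  moreover have "strict_monoidal_functor (ext_cat k A) TE (right_mod_cat k A) TR right_part
      (forget_arrow right_part)"
    by (rule concrete_strict[OF concrete_TE concrete_TR])
      (use ext_obj_parts in \<open>simp_all add: lift_tensor_def ext_preserves_def\<close>)
  moreover have "strict_monoidal_functor (left_mod_cat k A) TL (mod_cat k) (mod_tensor k) base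
      (forget_arrow base)"
    by (rule concrete_strict[OF concrete_TL M])
      (use L.mod_C in \<open>simp_all add: lift_tensor_def mod_cat_def mod_tensor_def E_base algE\<close>)
  moreover have "strict_monoidal_functor (right_mod_cat k A) TR (mod_cat k) (mod_tensor k) base
      (forget_arrow base)"
    by (rule concrete_strict[OF concrete_TR M])
      (use R.mod_C in \<open>simp_all add: lift_tensor_def mod_cat_def mod_tensor_def E_base algE\<close>)
  ultimately show ?thesis
    using lift_tensor_structure[OF concrete_TR] lift_tensor_structure[OF concrete_TL]
        lift_tensor_structure[OF concrete_TE]
    unfolding strict_monoidal_structures_def by (simp add: lift_tensor_def algE)
qed

end

section \<open>The two assignments are mutually inverse\<close>

context nd_alg
begin

definition structures_of :: "('k, 'a) ndi_arrow \<times> ('k, 'a) ndi_arrow \<Rightarrow>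
    ('k, 'a) action_tensor \<times> ('k, 'a) action_tensor \<times> ('k, 'a) ext_tensor" where
  "structures_of x = (let D = extension_of (fst x); E = extension_of (snd x) in
     (lift_tensor k (right_mod_cat k A) base (rtens D) (right_part E),
      lift_tensor k (left_mod_cat k A) base (ltens D) (left_part E),
      lift_tensor k (ext_cat k A) ebase (etens D) E))"

text \<open>An extension record does not mention the algebra that acts; supplying A as source
  inverts \<open>extension_of\<close> on arrows that start at A.\<close>

definition arrow_of_ext :: "('k, ('k, 'a) univ) extension \<Rightarrow> ('k, 'a) ndi_arrow" where
  "arrow_of_ext D = \<lparr>src = A, tgt = alg D, fn = (lact D, ract D)\<rparr>"

definition comonoid_of :: "('k, 'a) action_tensor \<times> ('k, 'a) action_tensor \<times> ('k, 'a) ext_tensor \<Rightarrow>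
    ('k, 'a) ndi_arrow \<times> ('k, 'a) ndi_arrow" where
  "comonoid_of x = (arrow_of_ext (tob (snd (snd x)) reg reg), arrow_of_ext (unit_ob (snd (snd x))))"

lemma arrow_of_ext [simp]: "extension_of (arrow_of_ext D) = D" "src (arrow_of_ext D) = A"
    "tgt (arrow_of_ext D) = alg D"
  "src f = A \<Longrightarrow> arrow_of_ext (extension_of f) = f"
  by (simp_all add: arrow_of_ext_def extension_of_def)

lemma bialgebra_ext_iff: "bialgebra_ext k A D E \<longleftrightarrow>
    D \<in> ext_objects k A \<and> alg D = algebra_tensor k A A \<and> E \<in> ext_objects k A \<and> alg E =
        scalar_algebra k \<and>
    amap (etens D D reg) (etens D reg D) (assoc_map k A A A) \<and>
    amap (etens D E reg) reg (lunit_map k A) \<and> amap (etens D reg E) reg (runit_map k A)"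
  using nd_alg_axioms
  by (auto simp: bialgebra_ext_def bialgebra_ext_axioms_def comult_def comult_axioms_def)

lemma bialgebra_structures_iff: "(\<Delta>, \<epsilon>) \<in> multiplier_bialgebra_structures k A \<longleftrightarrow>
    src \<Delta> = A \<and> src \<epsilon> = A \<and> bialgebra_ext k A (extension_of \<Delta>) (extension_of \<epsilon>)"
  unfolding multiplier_bialgebra_structures_def bialgebra_ext_iff by (auto simp: comonoid_iff)

text \<open>\<open>etens_reg\<close> recovers \<Delta> from the tensor product of \<open>reg\<close>
  with itself, and \<epsilon> is given by the unit object.\<close>

lemma structures_of_mem:
  assumes "x \<in> multiplier_bialgebra_structures k A"
  shows "structures_of x \<in> strict_monoidal_structures k A" "comonoid_of (structures_of x) = x"
    "\<And>TR TL TE. structures_of x = (TR, TL, TE) \<Longrightarrow>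
      tob TE reg reg = extension_of (fst x) \<and> unit_ob TE = extension_of (snd x)"
proof -
  obtain \<Delta> \<epsilon> where x: "x = (\<Delta>, \<epsilon>)" by (cases x)
  then have s: "src \<Delta> = A" "src \<epsilon> = A" and b: "bialgebra_ext k A (extension_of \<Delta>) (extension_of \<epsilon>)"
    using assms by (simp_all add: bialgebra_structures_iff)
  interpret bialgebra_ext k A "extension_of \<Delta>" "extension_of \<epsilon>" by (rule b)
  show "structures_of x \<in> strict_monoidal_structures k A"
    using lift_structures by (simp add: structures_of_def Let_def x)
  show "comonoid_of (structures_of x) = x"
    using reg_ext s by (simp add: structures_of_def Let_def x comonoid_of_def lift_tensor_def
        etens_reg)
  show "structures_of x = (TR, TL, TE) \<Longrightarrow>
      tob TE reg reg = extension_of (fst x) \<and> unit_ob TE = extension_of (snd x)" for TR TL TE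
    using reg_ext by (auto simp: structures_of_def Let_def x lift_tensor_def etens_reg)
qed

lemma action_eqI:
  assumes "base M = base (N :: ('k, 'u) action_module)" "act M = act N"
  shows "M = N"
  using assms by simp

text \<open>D and E are the extensions A \<otimes> A and k of the given structure. The tensor
  product built from D agrees with the given one at the generator by strictness, hence everywhere by
  \<open>generated_tensor_unique\<close>. The comonoid axioms hold because the constraints at
  \<open>reg\<close> are arrows of extensions.\<close>

lemma comonoid_of_mem:
  assumes "x \<in> strict_monoidal_structures k A"
  shows "comonoid_of x \<in> multiplier_bialgebra_structures k A" "structures_of (comonoid_of x) = x"
proof -
  obtain T\<^sub>R T\<^sub>L T\<^sub>E where x: "x = (T\<^sub>R, T\<^sub>L, T\<^sub>E)" by (cases x)
  have ms: "T\<^sub>R \<in> monoidal_structures (right_mod_cat k A)"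
      "T\<^sub>L \<in> monoidal_structures (left_mod_cat k A)"
      "T\<^sub>E \<in> monoidal_structures (ext_cat k A)"
    and EL: "strict_monoidal_functor (ext_cat k A) T\<^sub>E (left_mod_cat k A) T\<^sub>L left_part
        (forget_arrow left_part)"
    and ER: "strict_monoidal_functor (ext_cat k A) T\<^sub>E (right_mod_cat k A) T\<^sub>R right_part
        (forget_arrow right_part)"
    and LM: "strict_monoidal_functor (left_mod_cat k A) T\<^sub>L (mod_cat k) (mod_tensor k) base
        (forget_arrow base)"
    and RM: "strict_monoidal_functor (right_mod_cat k A) T\<^sub>R (mod_cat k) (mod_tensor k) base
        (forget_arrow base)"
    and algT: "\<And>R S. R \<in> ext_objects k A \<Longrightarrow> S \<in> ext_objects k A \<Longrightarrow>
      alg (tob T\<^sub>E R S) = algebra_tensor k (alg R) (alg S)"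
    and algU: "alg (unit_ob T\<^sub>E) = scalar_algebra k"
    using assms by (auto simp: strict_monoidal_structures_def x)
  interpret EL: strict_monoidal_functor "ext_cat k A" T\<^sub>E "left_mod_cat k A" T\<^sub>L left_part
      "forget_arrow left_part" by (rule EL)
  interpret ER: strict_monoidal_functor "ext_cat k A" T\<^sub>E "right_mod_cat k A" T\<^sub>R right_part
      "forget_arrow right_part" by (rule ER)
  have om: "over_mod k (mod_cat k) (\<lambda>M. M) (mod_tensor k)"
    using concrete_tensor.over[OF concrete_mod_cat[OF cring]] .
  have oR: "over_mod k (right_mod_cat k A) base T\<^sub>R" by (rule over_mod_strict[OF RM om])
  have oL: "over_mod k (left_mod_cat k A) base T\<^sub>L" by (rule over_mod_strict[OF LM om])
  have oE: "over_mod k (ext_cat k A) ebase T\<^sub>E" using over_mod_strict[OF EL oL] by simp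
  define D where "D = tob T\<^sub>E reg reg"
  define E where "E = unit_ob T\<^sub>E"
  have D: "D \<in> ext_objects k A" "alg D = algebra_tensor k A A"
    using EL.source.tob_obj[of reg reg] reg_ext algT[OF reg_ext reg_ext] by (simp_all add: D_def)
  have E: "E \<in> ext_objects k A" "alg E = scalar_algebra k"
    using EL.source.unit_obj algU by (simp_all add: E_def)
  interpret comult k A D by (rule comult_nd[OF D])
  have partsD: "right_part D = tob T\<^sub>R (right_part reg) (right_part reg)" "left_part D =
      tob T\<^sub>L (left_part reg) (left_part reg)"
    using ER.strict_tob[of reg reg] EL.strict_tob[of reg reg] reg_ext by (simp_all add: D_def)
  have partsE: "right_part E = unit_ob T\<^sub>R" "left_part E = unit_ob T\<^sub>L"
    using ER.strict_unit EL.strict_unit by (simp_all add: E_def)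
  note ovR = over_modD[OF oR] and ovL = over_modD[OF oL] and ovE = over_modD[OF oE]
  have gR: "generated_tensor k (right_mod_cat k A) base (carrier A) (\<lambda>M b m. act M m b)
      (right_part reg) (tob T\<^sub>R)"
  proof (rule generated_tensor.intro[OF R.generated_axioms], rule generated_tensor_axioms.intro)
    fix f X X' g Y Y' b z
    assume f: "in_hom (right_mod_cat k A) f X X'" and g: "in_hom (right_mod_cat k A) g Y Y'"
      and b: "b \<in> carrier A" and z: "z \<in> carrier (tensor k (base X) (base Y))"
    have fg: "X \<in> obj (right_mod_cat k A)" "Y \<in> obj (right_mod_cat k A)"
        "f \<in> arr (right_mod_cat k A)" "g \<in> arr (right_mod_cat k A)"
      using f g by (simp_all add: R.in_hom_iff) (simp_all add: in_hom_def R.arr_iff)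
    show "tensor_map k (forget_arrow base f) (forget_arrow base g) (act (tob T\<^sub>R X Y) z b) =
        act (tob T\<^sub>R X' Y') (tensor_map k (forget_arrow base f) (forget_arrow base g) z) b"
      using ER.target.tar_hom[OF f g] b z ovR(1)[OF fg(1,2)] ovR(3)[OF fg(3,4)]
      by (simp add: R.in_hom_iff R.preserves_def)
  qed (simp_all add: ER.target.tob_obj ovR(1))
  have gL: "generated_tensor k (left_mod_cat k A) base (carrier A) act (left_part reg) (tob T\<^sub>L)"
  proof (rule generated_tensor.intro[OF L.generated_axioms], rule generated_tensor_axioms.intro)
    fix f X X' g Y Y' b z
    assume f: "in_hom (left_mod_cat k A) f X X'" and g: "in_hom (left_mod_cat k A) g Y Y'"
      and b: "b \<in> carrier A" and z: "z \<in> carrier (tensor k (base X) (base Y))"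
    have fg: "X \<in> obj (left_mod_cat k A)" "Y \<in> obj (left_mod_cat k A)" "f \<in> arr (left_mod_cat k A)"
        "g \<in> arr (left_mod_cat k A)"
      using f g by (simp_all add: L.in_hom_iff) (simp_all add: in_hom_def L.arr_iff)
    show "tensor_map k (forget_arrow base f) (forget_arrow base g) (act (tob T\<^sub>L X Y) b z) =
        act (tob T\<^sub>L X' Y') b (tensor_map k (forget_arrow base f) (forget_arrow base g) z)"
      using EL.target.tar_hom[OF f g] b z ovL(1)[OF fg(1,2)] ovL(3)[OF fg(3,4)]
      by (simp add: L.in_hom_iff L.preserves_def)
  qed (simp_all add: EL.target.tob_obj ovL(1))
  have regD: "rtens D (right_part reg) (right_part reg) = right_part D"
      "ltens D (left_part reg) (left_part reg) = left_part D"
    using etens_parts[of D reg reg] by (simp_all add: etens_reg)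
  have tR: "tob T\<^sub>R M N = rtens D M N" if "robj M" "robj N" for M N
  proof (rule action_eqI)
    have o: "M \<in> obj (right_mod_cat k A)" "N \<in> obj (right_mod_cat k A)" using that
      by (simp_all add: robj_cat)
    show b: "base (tob T\<^sub>R M N) = base (rtens D M N)" using ovR(1)[OF o] by simp
    have "robj (tob T\<^sub>R M N)" "robj (rtens D M N)"
      using ER.target.tob_obj[OF o] rtens_robj[OF that] by (simp_all add: robj_cat)
    then show "act (tob T\<^sub>R M N) = act (rtens D M N)"
      using generated_tensor_unique[OF gR R.generated_tensor_axioms _ o] b
      by (intro PiE2_eqI[of _ "carrier (tensor k (base M) (base N))" "carrier A"
          "carrier (tensor k (base M) (base N))"])
        (auto simp: robj_def regD partsD)
  qed
  have tL: "tob T\<^sub>L M N = ltens D M N" if "lobj M" "lobj N" for M N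
  proof (rule action_eqI)
    have o: "M \<in> obj (left_mod_cat k A)" "N \<in> obj (left_mod_cat k A)" using that
      by (simp_all add: lobj_cat)
    show b: "base (tob T\<^sub>L M N) = base (ltens D M N)" using ovL(1)[OF o] by simp
    have "lobj (tob T\<^sub>L M N)" "lobj (ltens D M N)"
      using EL.target.tob_obj[OF o] ltens_lobj[OF that] by (simp_all add: lobj_cat)
    then show "act (tob T\<^sub>L M N) = act (ltens D M N)"
      using generated_tensor_unique[OF gL L.generated_tensor_axioms _ o] b
      by (intro PiE2_eqI[of _ "carrier A" "carrier (tensor k (base M) (base N))"
          "carrier (tensor k (base M) (base N))"])
        (auto simp: lobj_def regD partsD)
  qed
  \<comment> \<open>The functors to modules determine the two actions but forget the product, which
    \<open>algT\<close> supplies.\<close>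
  have tE: "tob T\<^sub>E X Y = etens D X Y" if o: "X \<in> ext_objects k A" "Y \<in> ext_objects k A" for X Y
  proof -
    have "left_part (tob T\<^sub>E X Y) = left_part (etens D X Y)" "right_part (tob T\<^sub>E X Y) =
        right_part (etens D X Y)"
      using EL.strict_tob[of X Y] ER.strict_tob[of X Y] o tR tL by (simp_all add: ext_iff_parts)
    then show ?thesis
      using algT[OF o] by (metis part_simps(2,4) tens_base(3) extension.equality old.unit.exhaust)
  qed
  have "bialgebra_ext k A D E"
    unfolding bialgebra_ext_iff
  proof (intro conjI D E)
    have r: "tob T\<^sub>E reg reg = D" by (simp add: D_def)
    have "in_hom (ext_cat k A) (asc T\<^sub>E reg reg reg) (tob T\<^sub>E (tob T\<^sub>E reg reg) reg) (tob T\<^sub>E reg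
        (tob T\<^sub>E reg reg))"
      using EL.source.asc_iso[of reg reg reg] reg_ext by (simp add: iso_in_def)
    then show "amap (etens D D reg) (etens D reg D) (assoc_map k A A A)"
      using ovE(4)[of reg reg reg] reg_ext D
      by (simp add: r tE E.in_hom_iff ext_preserves_def amap_iff)
    have "in_hom (ext_cat k A) (lun T\<^sub>E reg) (tob T\<^sub>E E reg) reg"
        "in_hom (ext_cat k A) (run T\<^sub>E reg) (tob T\<^sub>E reg E) reg"
      using EL.source.lun_iso[of reg] EL.source.run_iso[of reg] reg_ext
      by (simp_all add: iso_in_def E_def)
    then show "amap (etens D E reg) reg (lunit_map k A)" "amap (etens D reg E) reg (runit_map k A)"
      using ovE(5,6)[of reg] reg_ext E by (simp_all add: tE E.in_hom_iff ext_preserves_def amap_iff)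
  qed (rule algD)
  then interpret bialgebra_ext k A D E .
  have c: "comonoid_of x = (arrow_of_ext D, arrow_of_ext E)"
    by (simp add: comonoid_of_def x D_def E_def)
  show "comonoid_of x \<in> multiplier_bialgebra_structures k A"
    unfolding c bialgebra_structures_iff using bialgebra_ext_axioms \<open>bialgebra_ext k A D E\<close> by simp
  note lift = lift_tensor_structure[OF concrete_TR] lift_tensor_structure[OF concrete_TL]
      lift_tensor_structure[OF concrete_TE]
  have "T\<^sub>R = lift_tensor k (right_mod_cat k A) base (rtens D) (right_part E)"
    by (rule over_mod_unique[OF ms(1) lift(1) oR concrete_tensor.over[OF concrete_TR]])
      (simp_all add: lift_tensor_def tR robj_cat partsE)
  moreover have "T\<^sub>L = lift_tensor k (left_mod_cat k A) base (ltens D) (left_part E)"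
    by (rule over_mod_unique[OF ms(2) lift(2) oL concrete_tensor.over[OF concrete_TL]])
      (simp_all add: lift_tensor_def tL lobj_cat partsE)
  moreover have "T\<^sub>E = lift_tensor k (ext_cat k A) ebase (etens D) E"
    by (rule over_mod_unique[OF ms(3) lift(3) oE concrete_tensor.over[OF concrete_TE]])
      (simp_all add: lift_tensor_def tE E_def)
  ultimately show "structures_of (comonoid_of x) = x"
    unfolding c structures_of_def Let_def fst_conv snd_conv arrow_of_ext(1) unfolding x by simp
qed

end

theorem theorem2p9:
  fixes k :: "'k ring" and A :: "('k, 'a) kmod"
  assumes "cring k"
    and "nonunital_algebra k A"
    and "nondegenerate_algebra A"
    and "idempotent_algebra A"
    and "projective k A"
  shows "\<exists>\<Phi>. bij_betw \<Phi> (multiplier_bialgebra_structures k A) (strict_monoidal_structures k A) \<and>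
    (\<forall>(\<Delta>, \<epsilon>) \<in> multiplier_bialgebra_structures k A. \<forall>T\<^sub>R T\<^sub>L T\<^sub>E.
       \<Phi> (\<Delta>, \<epsilon>) = (T\<^sub>R, T\<^sub>L, T\<^sub>E) \<longrightarrow>
       (let A' = extension_of (idn (ndi_cat k) A)
        in tob T\<^sub>E A' A' = extension_of \<Delta> \<and> unit_ob T\<^sub>E = extension_of \<epsilon>))"
proof -
  interpret scalars k by (rule scalars.intro) fact
  interpret nd_alg k A
    by (rule nd_alg.intro[OF scalars_axioms], rule nd_alg_axioms.intro) (use assms nd_algebra_iff
        in auto)
  have "bij_betw structures_of (multiplier_bialgebra_structures k A) (strict_monoidal_structures k
      A)"
    by (rule bij_betw_byWitness[where f' = comonoid_of])
      (use structures_of_mem comonoid_of_mem in auto)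
  moreover have "\<forall>(\<Delta>, \<epsilon>) \<in> multiplier_bialgebra_structures k A. \<forall>T\<^sub>R T\<^sub>L T\<^sub>E.
       structures_of (\<Delta>, \<epsilon>) = (T\<^sub>R, T\<^sub>L, T\<^sub>E) \<longrightarrow>
       (let A' = extension_of (idn (ndi_cat k) A)
        in tob T\<^sub>E A' A' = extension_of \<Delta> \<and> unit_ob T\<^sub>E = extension_of \<epsilon>)"
    using structures_of_mem(3) by (fastforce simp: reg_def[symmetric] Let_def)
  ultimately show ?thesis by blast
qed

end
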